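(* Let $H$ be a quasi-Hopf algebra over a field $k$ with bijective antipode, and let $R:{}_H\mathcal M\to{}^H_H\mathcal{YD}$ be the right adjoint of the (strict monoidal) forgetful functor $F:{}^H_H\mathcal{YD}\to{}_H\mathcal M$ described in the context, with its induced monoidal structure $R^{(0)}:k\to R(k)$, $R^{(2)}_{X,Y}:R(X)\otimes R(Y)\to R(X\otimes Y)$. Then $R^{(0)}$ is determined by $R^{(0)}(1)=\beta\otimes1$, and $R^{(2)}$ is given by $$R^{(2)}_{X,Y}\bigl((a\otimes x)\otimes(b\otimes y)\bigr)=\phi_1\overline\phi_{1(1)}q^R_{1(1)}\overline\phi'_{1(1,1)}\,a\,S\bigl(q^R_2\overline\phi'_{1(2)}\bigr)\overline\phi'_2\phi'_1\,b\,S\bigl(\overline\phi_3\overline\phi'_{3(2)}\phi'_3\bigr)\otimes\phi_2\overline\phi_{1(2)}q^R_{1(2)}\overline\phi'_{1(1,2)}x\otimes\phi_3\overline\phi_2\overline\phi'_{3(1)}\phi'_2y$$ for $X,Y\in{}_H\mathcal M$, $a,b\in H$, $x\in X$, $y\in Y$.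
   Context: Conventions. $k$ is a field, $\otimes=\otimes_k$. For a $k$-algebra $A$, $x\in A^{\otimes n}$ is written $x=x_1\otimes\cdots\otimes x_n$ (summation understood), $x^{-1}=\overline x_1\otimes\cdots\otimes\overline x_n$ if invertible; primes denote independent copies. In the claim $\phi,\phi'$ are two independent copies of $\phi$ and $\overline\phi,\overline\phi'$ two independent copies of $\phi^{-1}$. A quasi-Hopf algebra is $(H,\Delta,\epsilon,\phi,S,\alpha,\beta)$ with $H$ a $k$-algebra, algebra maps $\Delta:H\to H\otimes H$ ($\Delta(h)=h_{(1)}\otimes h_{(2)}$), $\epsilon:H\to k$, an invertible $\phi\in H^{\otimes3}$, an anti-algebra map $S$ and $\alpha,\beta\in H$ such that for all $h$: $h_{(1)}\otimes\Delta(h_{(2)})=\phi(\Delta(h_{(1)})\otimes h_{(2)})\phi^{-1}$; $\epsilon(h_{(1)})h_{(2)}=h=h_{(1)}\epsilon(h_{(2)})$; $(\mathrm{id}\otimes\mathrm{id}\otimes\Delta)(\phi)(\Delta\otimes\mathrm{id}\otimes\mathrm{id})(\phi)=(1\otimes\phi)(\mathrm{id}\otimes\Delta\otimes\mathrm{id})(\phi)(\phi\otimes1)$; $(\mathrm{id}\otimes\epsilon\otimes\mathrm{id})(\phi)=1\otimes1$; $S(h_{(1)})\alpha h_{(2)}=\epsilon(h)\alpha$, $h_{(1)}\beta S(h_{(2)})=\epsilon(h)\beta$; $\phi_1\beta S(\phi_2)\alpha\phi_3=1=S(\overline\phi_1)\alpha\overline\phi_2\beta S(\overline\phi_3)$;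 and (standing) $\epsilon(\alpha)=\epsilon(\beta)=1$. $\overline S=S^{-1}$. $\Delta(h_{(1)})\otimes h_{(2)}=h_{(1,1)}\otimes h_{(1,2)}\otimes h_{(2)}$; $\Delta^{\mathrm{cop}}(h)=h_{(2)}\otimes h_{(1)}$. ${}_H\mathcal M$ is monoidal: $h(v\otimes w)=h_{(1)}v\otimes h_{(2)}w$, unit $k$ via $\epsilon$, associator $(x\otimes y)\otimes z\mapsto\phi_1x\otimes(\phi_2y\otimes\phi_3z)$. Elements: $p^R=\overline\phi_1\otimes\overline\phi_2\beta S(\overline\phi_3)$, $q^R=\phi_1\otimes\overline S(\alpha\phi_3)\phi_2$; $\mathbf a=S(\overline\phi_1\phi_2)\alpha\overline\phi_2\phi_{3(1)}\otimes S(\phi_1)\alpha\overline\phi_3\phi_{3(2)}$; $\mathbf f=(S\otimes S)(\Delta^{\mathrm{cop}}(p^R_1))\cdot\mathbf a\cdot\Delta(p^R_2)$ (invertible); $\chi=(\phi\otimes1)(\Delta\otimes\mathrm{id}\otimes\mathrm{id})(\phi^{-1})$; $\omega=(1\otimes1\otimes1\otimes\overline{\mathbf f}_2\otimes\overline{\mathbf f}_1)(\mathrm{id}\otimes\Delta\otimes S\otimes S)(\chi)(\phi\otimes1\otimes1)\in H^{\otimes5}$. Yetter-Drinfeld modules. An object $V$ of ${}^H_H\mathcal{YD}$ is a left $H$-module with a second kind coaction $\delta^{2nd}_V(v)=v_{[-1]}\otimes v_{[0]}\in H\otimes V$ satisfying $v_{[-1]}\otimes v_{[0][-1]}\otimes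 v_{[0][0]}=\omega_1(v_{[-1]})_{(1)}\omega_5\otimes\omega_2(v_{[-1]})_{(2)}\omega_4\otimes\omega_3v_{[0]}$, $\epsilon(v_{[-1]})v_{[0]}=v$, $\delta^{2nd}_V(hv)=h_{(1,1)}v_{[-1]}S(h_{(2)})\otimes h_{(1,2)}v_{[0]}$. Equivalently, it has a first kind coaction $\delta^{1st}_V(v)=v_{\langle-1\rangle}\otimes v_{\langle0\rangle}$ making $V\otimes X\to X\otimes V$, $v\otimes x\mapsto v_{\langle-1\rangle}x\otimes v_{\langle0\rangle}$ a half-braiding on ${}_H\mathcal M$ (so ${}^H_H\mathcal{YD}$ is identified with the Drinfeld center); the two are related by $\delta^{2nd}_V(v)=(p^R_1v)_{\langle-1\rangle}p^R_2\otimes(p^R_1v)_{\langle0\rangle}$ and $\delta^{1st}_V(v)=q^R_{1(1)}v_{[-1]}S(q^R_2)\otimes q^R_{1(2)}v_{[0]}$. Morphisms are linear maps preserving action and coaction. The monoidal structure of ${}^H_H\mathcal{YD}$ is that of ${}_H\mathcal M$ with $\delta^{1st}_k(1)=1\otimes1$ and $\delta^{1st}_{V\otimes W}(v\otimes w)=\phi_1(\overline\phi_1\phi'_1v)_{\langle-1\rangle}\overline\phi_2(\phi'_2w)_{\langle-1\rangle}\phi'_3\otimes\phi_2(\overline\phi_1\phi'_1v)_{\langle0\rangle}\otimes\phi_3\overline\phi_3(\phi'_2w)_{\langle0\rangle}$. The functor $R$: $R(V)=H\otimes V$ with $h\triangleright(a\otimes v)=h_{(1,1)}aS(h_{(2)})\otimes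 h_{(1,2)}v$ and $\delta^{2nd}(a\otimes v)=\omega_1a_{(1)}\omega_5\otimes(\omega_2a_{(2)}\omega_4\otimes\omega_3v)$; on morphisms $R(g)=\mathrm{id}_H\otimes g$. It is right adjoint to $F$ with unit $\eta_M(m)=m_{[-1]}\otimes m_{[0]}$ and counit $\varepsilon_V(a\otimes v)=\epsilon(a)v$. Its monoidal structure is $R^{(0)}=\eta_k$, $R^{(2)}_{X,Y}=R(\varepsilon_X\otimes\varepsilon_Y)\circ\eta_{R(X)\otimes R(Y)}$. *)

theory Defs
  imports "HOL-Algebra.Module"
begin

section \<open>Tensor products of vector spaces\<close>

text \<open>
  \<open>V \<otimes>\<^sub>K W\<close> is presented by generators and relations. A formal sum
  \<open>v\<^sub>1 \<otimes> w\<^sub>1 + \<dots> + v\<^sub>n \<otimes> w\<^sub>n\<close> is the list \<open>[(v\<^sub>1, w\<^sub>1), \<dots>, (v\<^sub>n, w\<^sub>n)]\<close>; the relation below is the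
  congruence (with respect to concatenation) generated by commutativity and bilinearity, and a
  tensor is an equivalence class of formal sums.
\<close>

inductive tensor_rel ::
  "('k, 'r) ring_scheme \<Rightarrow> ('k, 'v, 'm) module_scheme \<Rightarrow> ('k, 'w, 'n) module_scheme \<Rightarrow>
     ('v \<times> 'w) list \<Rightarrow> ('v \<times> 'w) list \<Rightarrow> bool"
  for K V W where
  refl: "set xs \<subseteq> carrier V \<times> carrier W \<Longrightarrow> tensor_rel K V W xs xs"
| sym: "tensor_rel K V W xs ys \<Longrightarrow> tensor_rel K V W ys xs"
| trans: "tensor_rel K V W xs ys \<Longrightarrow> tensor_rel K V W ys zs \<Longrightarrow> tensor_rel K V W xs zs"
| append: "tensor_rel K V W xs ys \<Longrightarrow> tensor_rel K V W xs' ys' \<Longrightarrow>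
    tensor_rel K V W (xs @ xs') (ys @ ys')"
| swap: "p \<in> carrier V \<times> carrier W \<Longrightarrow> q \<in> carrier V \<times> carrier W \<Longrightarrow>
    tensor_rel K V W [p, q] [q, p]"
| zero: "w \<in> carrier W \<Longrightarrow> tensor_rel K V W [(\<zero>\<^bsub>V\<^esub>, w)] []"
| add_left: "v \<in> carrier V \<Longrightarrow> v' \<in> carrier V \<Longrightarrow> w \<in> carrier W \<Longrightarrow>
    tensor_rel K V W [(v \<oplus>\<^bsub>V\<^esub> v', w)] [(v, w), (v', w)]"
| add_right: "v \<in> carrier V \<Longrightarrow> w \<in> carrier W \<Longrightarrow> w' \<in> carrier W \<Longrightarrow>
    tensor_rel K V W [(v, w \<oplus>\<^bsub>W\<^esub> w')] [(v, w), (v, w')]"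
| scale: "c \<in> carrier K \<Longrightarrow> v \<in> carrier V \<Longrightarrow> w \<in> carrier W \<Longrightarrow>
    tensor_rel K V W [(c \<odot>\<^bsub>V\<^esub> v, w)] [(v, c \<odot>\<^bsub>W\<^esub> w)]"

type_synonym ('v, 'w) tens = "('v \<times> 'w) list set"

definition tens ::
  "('k, 'r) ring_scheme \<Rightarrow> ('k, 'v, 'm) module_scheme \<Rightarrow> ('k, 'w, 'n) module_scheme \<Rightarrow>
     ('v \<times> 'w) list \<Rightarrow> ('v, 'w) tens"
  where "tens K V W xs = {ys. tensor_rel K V W xs ys}"

abbreviation pure ::
  "('k, 'r) ring_scheme \<Rightarrow> ('k, 'v, 'm) module_scheme \<Rightarrow> ('k, 'w, 'n) module_scheme \<Rightarrow>
     'v \<Rightarrow> 'w \<Rightarrow> ('v, 'w) tens"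
  where "pure K V W v w \<equiv> tens K V W [(v, w)]"

text \<open>
  Sweedler notation: \<open>terms t\<close> is a chosen expression of \<open>t\<close> as a finite sum \<open>\<Sum> t\<^sub>1 \<otimes> t\<^sub>2\<close>, so that
  a Sweedler sum is a list comprehension over \<open>(t\<^sub>1, t\<^sub>2) \<leftarrow> terms t\<close>, interpreted in a vector
  space by \<^term>\<open>tens\<close> or by \<open>lsum\<close>. For summands that are multilinear in the components
  the result does not depend on the choice. Higher tensors are nested to the right,
  \<open>t\<^sub>1 \<otimes> (t\<^sub>2 \<otimes> (t\<^sub>3 \<otimes> \<dots>))\<close>.
\<close>

definition "terms" :: "('v, 'w) tens \<Rightarrow> ('v \<times> 'w) list"
  where "terms t = (SOME xs. xs \<in> t)"

definition terms3 :: "('u, ('v, 'w) tens) tens \<Rightarrow> ('u \<times> 'v \<times> 'w) list"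
  where "terms3 t = [(a, b, c). (a, t') \<leftarrow> terms t, (b, c) \<leftarrow> terms t']"

definition terms4 :: "('u, ('v, ('w, 'x) tens) tens) tens \<Rightarrow> ('u \<times> 'v \<times> 'w \<times> 'x) list"
  where "terms4 t = [(a, b, c, d). (a, t') \<leftarrow> terms t, (b, c, d) \<leftarrow> terms3 t']"

definition terms5 ::
  "('u, ('v, ('w, ('x, 'y) tens) tens) tens) tens \<Rightarrow> ('u \<times> 'v \<times> 'w \<times> 'x \<times> 'y) list"
  where "terms5 t = [(a, b, c, d, e). (a, t') \<leftarrow> terms t, (b, c, d, e) \<leftarrow> terms4 t']"

definition lsum :: "('a, 'm) ring_scheme \<Rightarrow> 'a list \<Rightarrow> 'a"
  where "lsum V xs = foldr (\<lambda>x y. x \<oplus>\<^bsub>V\<^esub> y) xs \<zero>\<^bsub>V\<^esub>"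

text \<open>
  The fields \<^const>\<open>mult\<close> and \<^const>\<open>one\<close> give the tensor product algebra; they are only
  meaningful when both factors are algebras.
\<close>

definition tensor ::
  "('k, 'r) ring_scheme \<Rightarrow> ('k, 'v, 'm) module_scheme \<Rightarrow> ('k, 'w, 'n) module_scheme \<Rightarrow>
     ('k, ('v, 'w) tens) module"
  where "tensor K V W =
    \<lparr>carrier = {tens K V W xs | xs. set xs \<subseteq> carrier V \<times> carrier W},
     mult = (\<lambda>s t. tens K V W [(v \<otimes>\<^bsub>V\<^esub> v', w \<otimes>\<^bsub>W\<^esub> w'). (v, w) \<leftarrow> terms s, (v', w') \<leftarrow> terms t]),
     one = pure K V W \<one>\<^bsub>V\<^esub> \<one>\<^bsub>W\<^esub>,
     zero = tens K V W [],
     add = (\<lambda>s t. tens K V W (terms s @ terms t)),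
     smult = (\<lambda>c t. tens K V W [(c \<odot>\<^bsub>V\<^esub> v, w). (v, w) \<leftarrow> terms t])\<rparr>"

text \<open>\<open>tmap K V W f g\<close> is \<open>f \<otimes> g\<close> with codomain \<open>V \<otimes> W\<close>.\<close>

definition tmap ::
  "('k, 'r) ring_scheme \<Rightarrow> ('k, 'v, 'm) module_scheme \<Rightarrow> ('k, 'w, 'n) module_scheme \<Rightarrow>
     ('a \<Rightarrow> 'v) \<Rightarrow> ('b \<Rightarrow> 'w) \<Rightarrow> ('a, 'b) tens \<Rightarrow> ('v, 'w) tens"
  where "tmap K V W f g t = tens K V W [(f a, g b). (a, b) \<leftarrow> terms t]"


section \<open>Linear maps, algebras, and modules over an algebra\<close>

definition linear_map ::
  "('k, 'r) ring_scheme \<Rightarrow> ('k, 'v, 'm) module_scheme \<Rightarrow> ('k, 'w, 'n) module_scheme \<Rightarrow>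
     ('v \<Rightarrow> 'w) \<Rightarrow> bool"
  where "linear_map K V W f \<longleftrightarrow>
    f \<in> carrier V \<rightarrow> carrier W \<and>
    (\<forall>u\<in>carrier V. \<forall>v\<in>carrier V. f (u \<oplus>\<^bsub>V\<^esub> v) = f u \<oplus>\<^bsub>W\<^esub> f v) \<and>
    (\<forall>c\<in>carrier K. \<forall>v\<in>carrier V. f (c \<odot>\<^bsub>V\<^esub> v) = c \<odot>\<^bsub>W\<^esub> f v)"

text \<open>Unlike \<^locale>\<open>algebra\<close>, multiplication in \<open>A\<close> is not assumed commutative.\<close>

locale k_algebra = field K + module K A + ring A
  for K (structure) and A (structure) +
  assumes smult_mult_left:
      "\<lbrakk>c \<in> carrier K; x \<in> carrier A; y \<in> carrier A\<rbrakk> \<Longrightarrow>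
        (c \<odot>\<^bsub>A\<^esub> x) \<otimes>\<^bsub>A\<^esub> y = c \<odot>\<^bsub>A\<^esub> (x \<otimes>\<^bsub>A\<^esub> y)"
    and smult_mult_right:
      "\<lbrakk>c \<in> carrier K; x \<in> carrier A; y \<in> carrier A\<rbrakk> \<Longrightarrow>
        x \<otimes>\<^bsub>A\<^esub> (c \<odot>\<^bsub>A\<^esub> y) = c \<odot>\<^bsub>A\<^esub> (x \<otimes>\<^bsub>A\<^esub> y)"

definition algebra_map ::
  "('k, 'r) ring_scheme \<Rightarrow> ('k, 'a, 'm) module_scheme \<Rightarrow> ('k, 'b, 'n) module_scheme \<Rightarrow>
     ('a \<Rightarrow> 'b) \<Rightarrow> bool"
  where "algebra_map K A B f \<longleftrightarrow>
    linear_map K A B f \<and> f \<one>\<^bsub>A\<^esub> = \<one>\<^bsub>B\<^esub> \<and>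
    (\<forall>x\<in>carrier A. \<forall>y\<in>carrier A. f (x \<otimes>\<^bsub>A\<^esub> y) = f x \<otimes>\<^bsub>B\<^esub> f y)"

definition anti_algebra_map ::
  "('k, 'r) ring_scheme \<Rightarrow> ('k, 'a, 'm) module_scheme \<Rightarrow> ('k, 'b, 'n) module_scheme \<Rightarrow>
     ('a \<Rightarrow> 'b) \<Rightarrow> bool"
  where "anti_algebra_map K A B f \<longleftrightarrow>
    linear_map K A B f \<and> f \<one>\<^bsub>A\<^esub> = \<one>\<^bsub>B\<^esub> \<and>
    (\<forall>x\<in>carrier A. \<forall>y\<in>carrier A. f (x \<otimes>\<^bsub>A\<^esub> y) = f y \<otimes>\<^bsub>B\<^esub> f x)"

definition base_field :: "'k ring \<Rightarrow> ('k, 'k) module"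
  where "base_field K = ring.extend K (module.fields (mult K))"

text \<open>In a left module over an algebra the fields \<^const>\<open>mult\<close> and \<^const>\<open>one\<close> play no role.\<close>

record ('k, 'h, 'v) hmodule = "('k, 'v) module" +
  act :: "'h \<Rightarrow> 'v \<Rightarrow> 'v" (infixr \<open>\<rhd>\<index>\<close> 69)

locale hmodule = module K V
  for K (structure) and H (structure) and V (structure) +
  assumes act_closed: "\<lbrakk>h \<in> carrier H; v \<in> carrier V\<rbrakk> \<Longrightarrow> h \<rhd>\<^bsub>V\<^esub> v \<in> carrier V"
    and act_add_left: "\<lbrakk>g \<in> carrier H; h \<in> carrier H; v \<in> carrier V\<rbrakk> \<Longrightarrow>
      (g \<oplus>\<^bsub>H\<^esub> h) \<rhd>\<^bsub>V\<^esub> v = (g \<rhd>\<^bsub>V\<^esub> v) \<oplus>\<^bsub>V\<^esub> (h \<rhd>\<^bsub>V\<^esub> v)"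
    and act_add_right: "\<lbrakk>h \<in> carrier H; u \<in> carrier V; v \<in> carrier V\<rbrakk> \<Longrightarrow>
      h \<rhd>\<^bsub>V\<^esub> (u \<oplus>\<^bsub>V\<^esub> v) = (h \<rhd>\<^bsub>V\<^esub> u) \<oplus>\<^bsub>V\<^esub> (h \<rhd>\<^bsub>V\<^esub> v)"
    and act_smult_left: "\<lbrakk>c \<in> carrier K; h \<in> carrier H; v \<in> carrier V\<rbrakk> \<Longrightarrow>
      (c \<odot>\<^bsub>H\<^esub> h) \<rhd>\<^bsub>V\<^esub> v = c \<odot>\<^bsub>V\<^esub> (h \<rhd>\<^bsub>V\<^esub> v)"
    and act_smult_right: "\<lbrakk>c \<in> carrier K; h \<in> carrier H; v \<in> carrier V\<rbrakk> \<Longrightarrow>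
      h \<rhd>\<^bsub>V\<^esub> (c \<odot>\<^bsub>V\<^esub> v) = c \<odot>\<^bsub>V\<^esub> (h \<rhd>\<^bsub>V\<^esub> v)"
    and act_mult: "\<lbrakk>g \<in> carrier H; h \<in> carrier H; v \<in> carrier V\<rbrakk> \<Longrightarrow>
      (g \<otimes>\<^bsub>H\<^esub> h) \<rhd>\<^bsub>V\<^esub> v = g \<rhd>\<^bsub>V\<^esub> (h \<rhd>\<^bsub>V\<^esub> v)"
    and act_one: "v \<in> carrier V \<Longrightarrow> \<one>\<^bsub>H\<^esub> \<rhd>\<^bsub>V\<^esub> v = v"


section \<open>Quasi-Hopf algebras\<close>

record ('k, 'h) quasi_hopf = "('k, 'h) module" +
  comult :: "'h \<Rightarrow> ('h, 'h) tens"
  counit :: "'h \<Rightarrow> 'k"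
  associator :: "('h, ('h, 'h) tens) tens"
  antipode :: "'h \<Rightarrow> 'h"
  alpha :: 'h
  beta :: 'h

locale quasi_hopf_sig =
  fixes K :: "'k ring" and H :: "('k, 'h) quasi_hopf"
begin

abbreviation Hmult :: "'h \<Rightarrow> 'h \<Rightarrow> 'h" (infixl \<open>\<cdot>\<close> 70) where "x \<cdot> y \<equiv> x \<otimes>\<^bsub>H\<^esub> y"
abbreviation Delta (\<open>\<Delta>\<close>) where "\<Delta> \<equiv> comult H"
abbreviation eps (\<open>\<epsilon>\<close>) where "\<epsilon> \<equiv> counit H"
abbreviation phi (\<open>\<phi>\<close>) where "\<phi> \<equiv> associator H"
abbreviation S where "S \<equiv> antipode H"
abbreviation al (\<open>\<alpha>\<close>) where "\<alpha> \<equiv> alpha H"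
abbreviation be (\<open>\<beta>\<close>) where "\<beta> \<equiv> beta H"

abbreviation H2 where "H2 \<equiv> tensor K H H"
abbreviation H3 where "H3 \<equiv> tensor K H H2"
abbreviation H4 where "H4 \<equiv> tensor K H H3"
abbreviation H5 where "H5 \<equiv> tensor K H H4"

text \<open>Elements of \<open>H\<^sup>\<otimes>\<^sup>n\<close> given by a formal sum of \<open>n\<close>-tuples.\<close>

abbreviation tens2 where "tens2 xs \<equiv> tens K H H xs"
abbreviation tens3 where "tens3 xs \<equiv> tens K H H2 [(a, tens2 [(b, c)]). (a, b, c) \<leftarrow> xs]"
abbreviation tens4 where "tens4 xs \<equiv> tens K H H3 [(a, tens3 [(b, c, d)]). (a, b, c, d) \<leftarrow> xs]"
abbreviation tens5 where "tens5 xs \<equiv> tens K H H4 [(a, tens4 [(b, c, d, e)]). (a, b, c, d, e) \<leftarrow> xs]"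

definition phi_inv (\<open>\<phi>inv\<close>) where "\<phi>inv = inv\<^bsub>H3\<^esub> \<phi>"

definition S_inv :: "'h \<Rightarrow> 'h" where "S_inv = inv_into (carrier H) S"

end

locale quasi_hopf = quasi_hopf_sig K H + k_algebra K H for K H +
  assumes comult: "algebra_map K H H2 \<Delta>"
    and counit: "algebra_map K H (base_field K) \<epsilon>"
    and associator: "\<phi> \<in> Units H3"
    and antipode: "anti_algebra_map K H H S"
    and alpha_closed: "\<alpha> \<in> carrier H"
    and beta_closed: "\<beta> \<in> carrier H"
    and quasi_coassoc: "h \<in> carrier H \<Longrightarrow>
      tens3 [(h1, h21, h22). (h1, h2) \<leftarrow> terms (\<Delta> h), (h21, h22) \<leftarrow> terms (\<Delta> h2)] =
      \<phi> \<otimes>\<^bsub>H3\<^esub>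
      tens3 [(h11, h12, h2). (h1, h2) \<leftarrow> terms (\<Delta> h), (h11, h12) \<leftarrow> terms (\<Delta> h1)] \<otimes>\<^bsub>H3\<^esub>
      \<phi>inv"
    and counit_left: "h \<in> carrier H \<Longrightarrow>
      lsum H [\<epsilon> h1 \<odot>\<^bsub>H\<^esub> h2. (h1, h2) \<leftarrow> terms (\<Delta> h)] = h"
    and counit_right: "h \<in> carrier H \<Longrightarrow>
      lsum H [\<epsilon> h2 \<odot>\<^bsub>H\<^esub> h1. (h1, h2) \<leftarrow> terms (\<Delta> h)] = h"
    and pentagon:
      "tens4 [(a, b, c1, c2). (a, b, c) \<leftarrow> terms3 \<phi>, (c1, c2) \<leftarrow> terms (\<Delta> c)] \<otimes>\<^bsub>H4\<^esub>
       tens4 [(a1, a2, b, c). (a, b, c) \<leftarrow> terms3 \<phi>, (a1, a2) \<leftarrow> terms (\<Delta> a)] =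
       tens4 [(\<one>\<^bsub>H\<^esub>, a, b, c). (a, b, c) \<leftarrow> terms3 \<phi>] \<otimes>\<^bsub>H4\<^esub>
       tens4 [(a, b1, b2, c). (a, b, c) \<leftarrow> terms3 \<phi>, (b1, b2) \<leftarrow> terms (\<Delta> b)] \<otimes>\<^bsub>H4\<^esub>
       tens4 [(a, b, c, \<one>\<^bsub>H\<^esub>). (a, b, c) \<leftarrow> terms3 \<phi>]"
    and counit_associator: "tens2 [(a, \<epsilon> b \<odot>\<^bsub>H\<^esub> c). (a, b, c) \<leftarrow> terms3 \<phi>] = \<one>\<^bsub>H2\<^esub>"
    and antipode_alpha: "h \<in> carrier H \<Longrightarrow>
      lsum H [S h1 \<cdot> \<alpha> \<cdot> h2. (h1, h2) \<leftarrow> terms (\<Delta> h)] = \<epsilon> h \<odot>\<^bsub>H\<^esub> \<alpha>"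
    and antipode_beta: "h \<in> carrier H \<Longrightarrow>
      lsum H [h1 \<cdot> \<beta> \<cdot> S h2. (h1, h2) \<leftarrow> terms (\<Delta> h)] = \<epsilon> h \<odot>\<^bsub>H\<^esub> \<beta>"
    and antipode_phi:
      "lsum H [a \<cdot> \<beta> \<cdot> S b \<cdot> \<alpha> \<cdot> c. (a, b, c) \<leftarrow> terms3 \<phi>] = \<one>\<^bsub>H\<^esub>"
    and antipode_phi_inv:
      "lsum H [S a \<cdot> \<alpha> \<cdot> b \<cdot> \<beta> \<cdot> S c. (a, b, c) \<leftarrow> terms3 \<phi>inv] = \<one>\<^bsub>H\<^esub>"
    and counit_alpha: "\<epsilon> \<alpha> = \<one>\<^bsub>K\<^esub>"
    and counit_beta: "\<epsilon> \<beta> = \<one>\<^bsub>K\<^esub>"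

context quasi_hopf_sig
begin

subsection \<open>Distinguished elements\<close>

definition pR :: "('h, 'h) tens"
  where "pR = tens2 [(g1, g2 \<cdot> \<beta> \<cdot> S g3). (g1, g2, g3) \<leftarrow> terms3 \<phi>inv]"

definition qR :: "('h, 'h) tens"
  where "qR = tens2 [(f1, S_inv (\<alpha> \<cdot> f3) \<cdot> f2). (f1, f2, f3) \<leftarrow> terms3 \<phi>]"

definition twist_a :: "('h, 'h) tens"
  where "twist_a =
    tens2 [(S (g1 \<cdot> f2) \<cdot> \<alpha> \<cdot> g2 \<cdot> f31, S f1 \<cdot> \<alpha> \<cdot> g3 \<cdot> f32).
      (f1, f2, f3) \<leftarrow> terms3 \<phi>, (g1, g2, g3) \<leftarrow> terms3 \<phi>inv, (f31, f32) \<leftarrow> terms (\<Delta> f3)]"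

definition twist_f :: "('h, 'h) tens"
  where "twist_f =
    lsum H2 [tens2 [(S h2, S h1). (h1, h2) \<leftarrow> terms (\<Delta> p1)] \<otimes>\<^bsub>H2\<^esub> twist_a \<otimes>\<^bsub>H2\<^esub> \<Delta> p2.
      (p1, p2) \<leftarrow> terms pR]"

definition chi :: "('h, ('h, ('h, 'h) tens) tens) tens"
  where "chi =
    tens4 [(a, b, c, \<one>\<^bsub>H\<^esub>). (a, b, c) \<leftarrow> terms3 \<phi>] \<otimes>\<^bsub>H4\<^esub>
    tens4 [(a1, a2, b, c). (a, b, c) \<leftarrow> terms3 \<phi>inv, (a1, a2) \<leftarrow> terms (\<Delta> a)]"

definition omega :: "('h, ('h, ('h, ('h, 'h) tens) tens) tens) tens"
  where "omega =
    tens5 [(\<one>\<^bsub>H\<^esub>, \<one>\<^bsub>H\<^esub>, \<one>\<^bsub>H\<^esub>, f2, f1). (f1, f2) \<leftarrow> terms (inv\<^bsub>H2\<^esub> twist_f)] \<otimes>\<^bsub>H5\<^esub>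
    tens5 [(a, b1, b2, S c, S d). (a, b, c, d) \<leftarrow> terms4 chi, (b1, b2) \<leftarrow> terms (\<Delta> b)] \<otimes>\<^bsub>H5\<^esub>
    tens5 [(a, b, c, \<one>\<^bsub>H\<^esub>, \<one>\<^bsub>H\<^esub>). (a, b, c) \<leftarrow> terms3 \<phi>]"

subsection \<open>The monoidal category of left modules\<close>

definition hm_tensor ::
  "('k, 'h, 'v, 'm) hmodule_scheme \<Rightarrow> ('k, 'h, 'w, 'n) hmodule_scheme \<Rightarrow>
     ('k, 'h, ('v, 'w) tens) hmodule"
  where "hm_tensor V W = module.extend (tensor K V W) (hmodule.fields
    (\<lambda>h t. tens K V W
      [(h1 \<rhd>\<^bsub>V\<^esub> v, h2 \<rhd>\<^bsub>W\<^esub> w). (h1, h2) \<leftarrow> terms (\<Delta> h), (v, w) \<leftarrow> terms t]))"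

definition hm_unit :: "('k, 'h, 'k) hmodule"
  where "hm_unit = module.extend (base_field K) (hmodule.fields (\<lambda>h c. \<epsilon> h \<otimes>\<^bsub>K\<^esub> c))"

end


section \<open>Yetter-Drinfeld modules\<close>

text \<open>\<open>coact2\<close> is the coaction of the second kind. The forgetful functor to left modules is the
  record coercion, i.e. ignoring this field.\<close>

record ('k, 'h, 'v) yd_module = "('k, 'h, 'v) hmodule" +
  coact2 :: "'v \<Rightarrow> ('h, 'v) tens"

context quasi_hopf_sig
begin

definition yetter_drinfeld :: "('k, 'h, 'v) yd_module \<Rightarrow> bool"
  where "yetter_drinfeld V \<longleftrightarrow>
    hmodule K H V \<and>
    linear_map K V (tensor K H V) (coact2 V) \<and>
    (\<forall>v\<in>carrier V.
      tens K H (tensor K H V) [(m, coact2 V v0). (m, v0) \<leftarrow> terms (coact2 V v)] =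
      tens K H (tensor K H V)
        [(o1 \<cdot> m1 \<cdot> o5, pure K H V (o2 \<cdot> m2 \<cdot> o4) (o3 \<rhd>\<^bsub>V\<^esub> v0)).
          (o1, o2, o3, o4, o5) \<leftarrow> terms5 omega,
          (m, v0) \<leftarrow> terms (coact2 V v), (m1, m2) \<leftarrow> terms (\<Delta> m)]) \<and>
    (\<forall>v\<in>carrier V. lsum V [\<epsilon> m \<odot>\<^bsub>V\<^esub> v0. (m, v0) \<leftarrow> terms (coact2 V v)] = v) \<and>
    (\<forall>h\<in>carrier H. \<forall>v\<in>carrier V.
      coact2 V (h \<rhd>\<^bsub>V\<^esub> v) =
      tens K H V [(h11 \<cdot> m \<cdot> S h2, h12 \<rhd>\<^bsub>V\<^esub> v0).
        (h1, h2) \<leftarrow> terms (\<Delta> h), (h11, h12) \<leftarrow> terms (\<Delta> h1), (m, v0) \<leftarrow> terms (coact2 V v)])"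

text \<open>Passage between the two kinds of coactions.\<close>

definition coact1 :: "('k, 'h, 'v) yd_module \<Rightarrow> 'v \<Rightarrow> ('h, 'v) tens"
  where "coact1 V v =
    tens K H V [(q11 \<cdot> m \<cdot> S q2, q12 \<rhd>\<^bsub>V\<^esub> v0).
      (q1, q2) \<leftarrow> terms qR, (q11, q12) \<leftarrow> terms (\<Delta> q1), (m, v0) \<leftarrow> terms (coact2 V v)]"

definition coact2_of_coact1 ::
  "('k, 'h, 'v) hmodule \<Rightarrow> ('v \<Rightarrow> ('h, 'v) tens) \<Rightarrow> 'v \<Rightarrow> ('h, 'v) tens"
  where "coact2_of_coact1 V \<delta> v =
    tens K H V [(m \<cdot> p2, v0). (p1, p2) \<leftarrow> terms pR, (m, v0) \<leftarrow> terms (\<delta> (p1 \<rhd>\<^bsub>V\<^esub> v))]"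

definition yd_of_coact1 ::
  "('k, 'h, 'v) hmodule \<Rightarrow> ('v \<Rightarrow> ('h, 'v) tens) \<Rightarrow> ('k, 'h, 'v) yd_module"
  where "yd_of_coact1 V \<delta> = hmodule.extend V (yd_module.fields (coact2_of_coact1 V \<delta>))"

definition yd_unit :: "('k, 'h, 'k) yd_module"
  where "yd_unit = yd_of_coact1 hm_unit (\<lambda>c. pure K H hm_unit \<one>\<^bsub>H\<^esub> c)"

definition tensor_coact1 ::
  "('k, 'h, 'v) yd_module \<Rightarrow> ('k, 'h, 'w) yd_module \<Rightarrow> ('v, 'w) tens \<Rightarrow> ('h, ('v, 'w) tens) tens"
  where "tensor_coact1 V W t =
    tens K H (tensor K V W)
      [(f1 \<cdot> m \<cdot> g2 \<cdot> n \<cdot> f3', pure K V W (f2 \<rhd>\<^bsub>V\<^esub> v0) (f3 \<cdot> g3 \<rhd>\<^bsub>W\<^esub> w0)).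
        (v, w) \<leftarrow> terms t,
        (f1, f2, f3) \<leftarrow> terms3 \<phi>, (g1, g2, g3) \<leftarrow> terms3 \<phi>inv, (f1', f2', f3') \<leftarrow> terms3 \<phi>,
        (m, v0) \<leftarrow> terms (coact1 V (g1 \<cdot> f1' \<rhd>\<^bsub>V\<^esub> v)),
        (n, w0) \<leftarrow> terms (coact1 W (f2' \<rhd>\<^bsub>W\<^esub> w))]"

definition yd_tensor ::
  "('k, 'h, 'v) yd_module \<Rightarrow> ('k, 'h, 'w) yd_module \<Rightarrow> ('k, 'h, ('v, 'w) tens) yd_module"
  where "yd_tensor V W = yd_of_coact1 (hm_tensor V W) (tensor_coact1 V W)"


section \<open>The right adjoint of the forgetful functor\<close>

definition R_obj :: "('k, 'h, 'v, 'm) hmodule_scheme \<Rightarrow> ('k, 'h, ('h, 'v) tens) yd_module"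
  where "R_obj V = hmodule.extend
    (module.extend (tensor K H V) (hmodule.fields
      (\<lambda>h t. tens K H V [(h11 \<cdot> a \<cdot> S h2, h12 \<rhd>\<^bsub>V\<^esub> v).
        (h1, h2) \<leftarrow> terms (\<Delta> h), (h11, h12) \<leftarrow> terms (\<Delta> h1), (a, v) \<leftarrow> terms t])))
    (yd_module.fields
      (\<lambda>t. tens K H (tensor K H V) [(o1 \<cdot> a1 \<cdot> o5, pure K H V (o2 \<cdot> a2 \<cdot> o4) (o3 \<rhd>\<^bsub>V\<^esub> v)).
        (o1, o2, o3, o4, o5) \<leftarrow> terms5 omega,
        (a, v) \<leftarrow> terms t, (a1, a2) \<leftarrow> terms (\<Delta> a)]))"

text \<open>\<open>R_map W g\<close> is the image under \<open>R\<close> of a morphism \<open>g\<close> with codomain \<open>W\<close>.\<close>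

definition R_map ::
  "('k, 'h, 'w, 'm) hmodule_scheme \<Rightarrow> ('v \<Rightarrow> 'w) \<Rightarrow> ('h, 'v) tens \<Rightarrow> ('h, 'w) tens"
  where "R_map W g = tmap K H W (\<lambda>a. a) g"

definition adj_unit :: "('k, 'h, 'v) yd_module \<Rightarrow> 'v \<Rightarrow> ('h, 'v) tens"
  where "adj_unit M = coact2 M"

definition adj_counit :: "('k, 'h, 'v, 'm) hmodule_scheme \<Rightarrow> ('h, 'v) tens \<Rightarrow> 'v"
  where "adj_counit V t = lsum V [\<epsilon> a \<odot>\<^bsub>V\<^esub> v. (a, v) \<leftarrow> terms t]"

definition R0 :: "'k \<Rightarrow> ('h, 'k) tens"
  where "R0 = adj_unit yd_unit"

definition R2 ::
  "('k, 'h, 'v) hmodule \<Rightarrow> ('k, 'h, 'w) hmodule \<Rightarrow>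
     (('h, 'v) tens, ('h, 'w) tens) tens \<Rightarrow> ('h, ('v, 'w) tens) tens"
  where "R2 X Y =
    R_map (hm_tensor X Y) (tmap K X Y (adj_counit X) (adj_counit Y)) \<circ>
    adj_unit (yd_tensor (R_obj X) (R_obj Y))"

end

end

(*
The counit eps_X of the adjunction splits the second kind coaction of R(X): applying eps_X to its
second leg gives back the element, because omega becomes 1 when the counit is applied to its second
and fourth legs. For this the twist f must be invertible, which is Drinfeld's comparison of two
antipode structures for the algebra map Delta : H -> H (x) H, namely Delta S and (S (x) S) Delta^cop,
with their respective copies of alpha and beta. Since eps_X is H-linear, the first kind coaction of
R(X) followed by eps_X becomes an explicit sum in Delta and phi without omega. Substituted into the
definition of R2 this leaves a sum over six copies of phi and its inverse. It becomes the formula in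
two steps, one for the associators around b and one for those around a: the pentagon rewrites them
until one is a coproduct on two neighbouring legs that an antipode axiom contracts.
*)

theory Submission
  imports Defs
begin

section \<open>Finite sums and Sweedler sums\<close>

text \<open>Tensors are classes of formal sums and \<open>terms\<close> picks a representative, so
  Sweedler sums cannot be rewritten term by term: each manipulation has to pass through
  multilinearity. Moreover every tensor power has its own type, which would multiply the lemmas on
  coproducts and units by the number of legs. Both obstacles are met by testing: an element of a
  tensor power of \<open>H\<close> is replaced by the functional that sums a multilinear function,
  with values in a fixed space \<open>Z\<close>, over its words. All powers then share one type and
  one product \<open>star\<close>; coproduct, unit and counit on leg \<open>i\<close> become
  operators \<open>D i\<close>, \<open>U i\<close>, \<open>E i\<close>. The axioms reach this
  setting by evaluating both sides. The antipode axioms are not identities in this algebra. They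
  enter as properties of test functions (\<open>lcol\<close>, \<open>rcol\<close>): a coproduct at
  the left or right end of a product is absorbed by the function. Hence each use of the pentagon
  aims to bring some \<open>D i\<close> to the end where it is absorbed. The twist is treated with
  \<open>Z\<close> equal to \<open>H \<otimes> H\<close>, the formula for \<open>R2\<close> with
  \<open>Z\<close> equal to \<open>H \<otimes> (X \<otimes> Y)\<close>.\<close>

context abelian_monoid
begin

lemma lsum_Nil [simp]: "lsum G [] = \<zero>"
  by (simp add: lsum_def)

lemma lsum_Cons [simp]: "lsum G (x # xs) = x \<oplus> lsum G xs"
  by (simp add: lsum_def)

lemma lsum_closed: "set xs \<subseteq> carrier G \<Longrightarrow> lsum G xs \<in> carrier G"
  by (induction xs) auto

lemma lsum_map_closed: "(\<And>x. x \<in> set xs \<Longrightarrow> f x \<in> carrier G) \<Longrightarrow> lsum G (map f xs) \<in> carrier G"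
  by (rule lsum_closed) auto

lemma lsum_append:
  "set xs \<subseteq> carrier G \<Longrightarrow> set ys \<subseteq> carrier G \<Longrightarrow> lsum G (xs @ ys) = lsum G xs \<oplus> lsum G ys"
  by (induction xs) (auto simp: a_assoc lsum_closed)

lemma lsum_concat:
  "(\<And>x. x \<in> set xs \<Longrightarrow> set (g x) \<subseteq> carrier G) \<Longrightarrow>
    lsum G (concat (map g xs)) = lsum G (map (\<lambda>x. lsum G (g x)) xs)"
proof (induction xs)
  case (Cons a xs)
  then have "set (g a) \<subseteq> carrier G" "set (concat (map g xs)) \<subseteq> carrier G" by auto
  with Cons show ?case by (simp add: lsum_append)
qed simp

lemma lsum_add:
  "(\<And>x. x \<in> set xs \<Longrightarrow> f x \<in> carrier G) \<Longrightarrow> (\<And>x. x \<in> set xs \<Longrightarrow> g x \<in> carrier G) \<Longrightarrow>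
    lsum G (map (\<lambda>x. f x \<oplus> g x) xs) = lsum G (map f xs) \<oplus> lsum G (map g xs)"
  by (induction xs) (auto simp: a_ac lsum_map_closed)

lemma lsum_zero: "lsum G (map (\<lambda>_. \<zero>) xs) = \<zero>"
  by (induction xs) auto

lemma lsum_swap:
  "(\<And>x y. x \<in> set xs \<Longrightarrow> y \<in> set ys \<Longrightarrow> f x y \<in> carrier G) \<Longrightarrow>
    lsum G (map (\<lambda>x. lsum G (map (f x) ys)) xs) = lsum G (map (\<lambda>y. lsum G (map (\<lambda>x. f x y) xs)) ys)"
proof (induction xs)
  case Nil
  then show ?case by (simp add: lsum_zero)
next
  case (Cons a xs)
  then show ?case by (simp add: lsum_add lsum_map_closed)
qed

end

lemma linear_mapI:
  assumes "\<And>v. v \<in> carrier V \<Longrightarrow> f v \<in> carrier W"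
    and "\<And>u v. u \<in> carrier V \<Longrightarrow> v \<in> carrier V \<Longrightarrow> f (u \<oplus>\<^bsub>V\<^esub> v) = f u \<oplus>\<^bsub>W\<^esub> f v"
    and "\<And>c v. c \<in> carrier K \<Longrightarrow> v \<in> carrier V \<Longrightarrow> f (c \<odot>\<^bsub>V\<^esub> v) = c \<odot>\<^bsub>W\<^esub> f v"
  shows "linear_map K V W f"
  using assms by (auto simp: linear_map_def)

lemma linear_map_closed: "linear_map K V W f \<Longrightarrow> v \<in> carrier V \<Longrightarrow> f v \<in> carrier W"
  by (auto simp: linear_map_def)

lemma linear_map_add: "linear_map K V W f \<Longrightarrow> u \<in> carrier V \<Longrightarrow> v \<in> carrier V \<Longrightarrow>
    f (u \<oplus>\<^bsub>V\<^esub> v) = f u \<oplus>\<^bsub>W\<^esub> f v"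
  by (auto simp: linear_map_def)

lemma linear_map_smult: "linear_map K V W f \<Longrightarrow> c \<in> carrier K \<Longrightarrow> v \<in> carrier V \<Longrightarrow>
    f (c \<odot>\<^bsub>V\<^esub> v) = c \<odot>\<^bsub>W\<^esub> f v"
  by (auto simp: linear_map_def)

lemma linear_map_cong:
  assumes "linear_map K V W f" "module K V" "\<And>v. v \<in> carrier V \<Longrightarrow> g v = f v"
  shows "linear_map K V W g"
proof -
  interpret V: module K V by fact
  show ?thesis using assms(1,3) by (auto simp: linear_map_def)
qed

lemma linear_map_comp:
  "linear_map K U V f \<Longrightarrow> linear_map K V W g \<Longrightarrow> linear_map K U W (\<lambda>x. g (f x))"
  by (auto simp: linear_map_def Pi_iff)

lemma linear_map_id: "linear_map K V V (\<lambda>x. x)"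
  by (auto simp: linear_map_def)

lemma linear_map_zero:
  assumes "linear_map K V W f" "module K V" "module K W"
  shows "f \<zero>\<^bsub>V\<^esub> = \<zero>\<^bsub>W\<^esub>"
proof -
  interpret V: module K V by fact
  interpret W: module K W by fact
  have "f (\<zero>\<^bsub>K\<^esub> \<odot>\<^bsub>V\<^esub> \<zero>\<^bsub>V\<^esub>) = \<zero>\<^bsub>K\<^esub> \<odot>\<^bsub>W\<^esub> f \<zero>\<^bsub>V\<^esub>"
    by (rule linear_map_smult[OF assms(1)]) auto
  then show ?thesis
    using linear_map_closed[OF assms(1) V.zero_closed] by simp
qed

lemma linear_map_lsum:
  assumes "linear_map K V W f" "module K V" "module K W" "\<And>x. x \<in> set xs \<Longrightarrow> g x \<in> carrier V"
  shows "f (lsum V (map g xs)) = lsum W (map (\<lambda>x. f (g x)) xs)"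
proof -
  interpret V: module K V by fact
  interpret W: module K W by fact
  show ?thesis using assms(4)
    by (induction xs)
      (simp_all add: linear_map_zero[OF assms(1-3)] linear_map_add[OF assms(1)] V.lsum_map_closed)
qed

lemma linear_map_sum:
  assumes "module K V" "module K W" "\<And>x. x \<in> set xs \<Longrightarrow> linear_map K V W (f x)"
  shows "linear_map K V W (\<lambda>v. lsum W (map (\<lambda>x. f x v) xs))"
proof -
  interpret V: module K V by fact
  interpret W: module K W by fact
  have cl: "f x v \<in> carrier W" if "x \<in> set xs" "v \<in> carrier V" for x v
    using assms(3) that linear_map_closed by metis
  have ad: "f x (u \<oplus>\<^bsub>V\<^esub> v) = f x u \<oplus>\<^bsub>W\<^esub> f x v" if "x \<in> set xs" "u \<in> carrier V" "v \<in> carrier V" for x u v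
    by (rule linear_map_add[OF assms(3)[OF that(1)] that(2,3)])
  have sc: "f x (c \<odot>\<^bsub>V\<^esub> v) = c \<odot>\<^bsub>W\<^esub> f x v" if "x \<in> set xs" "c \<in> carrier K" "v \<in> carrier V" for x c v
    by (rule linear_map_smult[OF assms(3)[OF that(1)] that(2,3)])
  show ?thesis
  proof (rule linear_mapI)
    fix v assume "v \<in> carrier V"
    then show "lsum W (map (\<lambda>x. f x v) xs) \<in> carrier W" by (intro W.lsum_map_closed cl)
  next
    fix u v assume "u \<in> carrier V" "v \<in> carrier V"
    then have "map (\<lambda>x. f x (u \<oplus>\<^bsub>V\<^esub> v)) xs = map (\<lambda>x. f x u \<oplus>\<^bsub>W\<^esub> f x v) xs"
      by (intro map_cong[OF HOL.refl] ad)
    then show "lsum W (map (\<lambda>x. f x (u \<oplus>\<^bsub>V\<^esub> v)) xs) =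
        lsum W (map (\<lambda>x. f x u) xs) \<oplus>\<^bsub>W\<^esub> lsum W (map (\<lambda>x. f x v) xs)"
      using cl \<open>u \<in> carrier V\<close> \<open>v \<in> carrier V\<close> by (simp add: W.lsum_add del: map_eq_conv)
  next
    fix c v assume cv: "c \<in> carrier K" "v \<in> carrier V"
    then have "map (\<lambda>x. f x (c \<odot>\<^bsub>V\<^esub> v)) xs = map (\<lambda>x. c \<odot>\<^bsub>W\<^esub> f x v) xs"
      by (intro map_cong[OF HOL.refl] sc)
    moreover have "linear_map K W W (\<lambda>w. c \<odot>\<^bsub>W\<^esub> w)"
      using cv by (intro linear_mapI) (auto simp: W.smult_r_distr W.smult_assoc1[symmetric] V.R.m_comm)
    ultimately show "lsum W (map (\<lambda>x. f x (c \<odot>\<^bsub>V\<^esub> v)) xs) = c \<odot>\<^bsub>W\<^esub> lsum W (map (\<lambda>x. f x v) xs)"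
      using linear_map_lsum[OF _ assms(2,2), where g="\<lambda>x. f x v" and xs=xs] cl cv by (simp del: map_eq_conv)
  qed
qed

lemma linear_map_scale:
  assumes "module K V" "module K W" "linear_map K V W f" "c \<in> carrier K"
  shows "linear_map K V W (\<lambda>v. c \<odot>\<^bsub>W\<^esub> f v)"
proof -
  interpret V: module K V by fact
  interpret W: module K W by fact
  show ?thesis
    using assms(3,4)
    by (intro linear_mapI)
      (auto simp: linear_map_closed linear_map_add linear_map_smult W.smult_r_distr
        W.smult_assoc1[symmetric] V.R.m_comm)
qed

text \<open>Sweedler sum over the chosen expression of \<open>t\<close>. For arbitrary
  \<open>B\<close> it depends on that choice; for bilinear \<open>B\<close> the choice drops out by
  \<open>sw_tens\<close>, and \<open>sw\<close> is then the map on the tensor product induced by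
  \<open>B\<close>.\<close>

definition sw :: "('z, 'm) ring_scheme \<Rightarrow> ('v, 'w) tens \<Rightarrow> ('v \<Rightarrow> 'w \<Rightarrow> 'z) \<Rightarrow> 'z"
  where "sw Z t B = lsum Z (map (\<lambda>(a, b). B a b) (terms t))"

definition bilin ::
  "('k, 'r) ring_scheme \<Rightarrow> ('k, 'v, 'm) module_scheme \<Rightarrow> ('k, 'w, 'n) module_scheme \<Rightarrow>
     ('k, 'z, 'p) module_scheme \<Rightarrow> ('v \<Rightarrow> 'w \<Rightarrow> 'z) \<Rightarrow> bool"
  where "bilin K V W Z B \<longleftrightarrow>
    (\<forall>w\<in>carrier W. linear_map K V Z (\<lambda>v. B v w)) \<and> (\<forall>v\<in>carrier V. linear_map K W Z (B v))"

lemma bilinI: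
  assumes "\<And>w. w \<in> carrier W \<Longrightarrow> linear_map K V Z (\<lambda>v. B v w)"
    and "\<And>v. v \<in> carrier V \<Longrightarrow> linear_map K W Z (B v)"
  shows "bilin K V W Z B"
  using assms by (auto simp: bilin_def)

lemma bilin_left: "bilin K V W Z B \<Longrightarrow> w \<in> carrier W \<Longrightarrow> linear_map K V Z (\<lambda>v. B v w)"
  by (auto simp: bilin_def)

lemma bilin_right: "bilin K V W Z B \<Longrightarrow> v \<in> carrier V \<Longrightarrow> linear_map K W Z (B v)"
  by (auto simp: bilin_def)

lemma bilin_closed: "bilin K V W Z B \<Longrightarrow> v \<in> carrier V \<Longrightarrow> w \<in> carrier W \<Longrightarrow> B v w \<in> carrier Z"
  using bilin_left linear_map_closed by metis


section \<open>The tensor product as a vector space\<close>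

lemma tensor_rel_carrier:
  assumes "module K V" "module K W" "tensor_rel K V W xs ys"
  shows "set xs \<subseteq> carrier V \<times> carrier W \<and> set ys \<subseteq> carrier V \<times> carrier W"
proof -
  interpret V: module K V by fact
  interpret W: module K W by fact
  show ?thesis using assms(3) by induction auto
qed

text \<open>The well-definedness half of the universal property: every generator of
  \<open>tensor_rel\<close> is a law satisfied by bilinear maps, and concatenation of formal sums
  becomes addition in \<open>Z\<close>.\<close>

lemma tensor_rel_sum:
  assumes "module K V" "module K W" "module K Z" "bilin K V W Z B" "tensor_rel K V W xs ys"
  shows "lsum Z (map (\<lambda>(a, b). B a b) xs) = lsum Z (map (\<lambda>(a, b). B a b) ys)"
proof -
  interpret V: module K V by fact
  interpret W: module K W by fact
  interpret Z: module K Z by fact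
  note cl = bilin_closed[OF assms(4)]
  have *: "(\<lambda>(a, b). B a b) x \<in> carrier Z" if "x \<in> carrier V \<times> carrier W" for x
    using that cl by auto
  show ?thesis using assms(5)
  proof induction
    case (append xs ys xs' ys')
    note c = tensor_rel_carrier[OF assms(1,2) append.hyps(1)]
      tensor_rel_carrier[OF assms(1,2) append.hyps(2)]
    have "(\<lambda>(a, b). B a b) ` set zs \<subseteq> carrier Z" if "set zs \<subseteq> carrier V \<times> carrier W" for zs
      using * that by blast
    then show ?case using append.IH c by (simp add: Z.lsum_append)
  next
    case (swap p q)
    then show ?case by (auto simp: cl Z.a_comm)
  next
    case (zero w)
    then show ?case
      using linear_map_zero[OF bilin_left[OF assms(4)] assms(1,3)] by simp
  next
    case (add_left v v' w)
    then show ?case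
      using linear_map_add[OF bilin_left[OF assms(4)], of w v v'] by (simp add: cl)
  next
    case (add_right v w w')
    then show ?case
      using linear_map_add[OF bilin_right[OF assms(4)], of v w w'] by (simp add: cl)
  next
    case (scale c v w)
    then show ?case
      using linear_map_smult[OF bilin_left[OF assms(4)], of w c v]
        linear_map_smult[OF bilin_right[OF assms(4)], of v c w] by (simp add: cl)
  qed simp_all
qed

lemma tens_eqI: "tensor_rel K V W xs ys \<Longrightarrow> tens K V W xs = tens K V W ys"
  by (auto simp: tens_def intro: tensor_rel.trans tensor_rel.sym)

lemma tensor_rel_terms:
  assumes "set xs \<subseteq> carrier V \<times> carrier W"
  shows "tensor_rel K V W xs (terms (tens K V W xs))"
proof -
  have "xs \<in> tens K V W xs" using assms by (auto simp: tens_def intro: tensor_rel.refl)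
  then have "terms (tens K V W xs) \<in> tens K V W xs" unfolding terms_def by (rule someI)
  then show ?thesis by (simp add: tens_def)
qed

lemma carrier_tensorE:
  assumes "t \<in> carrier (tensor K V W)"
  obtains xs where "t = tens K V W xs" "set xs \<subseteq> carrier V \<times> carrier W"
  using assms by (auto simp: tensor_def)

lemma tens_closed: "set xs \<subseteq> carrier V \<times> carrier W \<Longrightarrow> tens K V W xs \<in> carrier (tensor K V W)"
  by (auto simp: tensor_def)

lemma pure_closed: "v \<in> carrier V \<Longrightarrow> w \<in> carrier W \<Longrightarrow> pure K V W v w \<in> carrier (tensor K V W)"
  by (auto intro: tens_closed)

context
  fixes K :: "('k, 'r) ring_scheme" and V :: "('k, 'v, 'm) module_scheme"
    and W :: "('k, 'w, 'n) module_scheme"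
  assumes V: "module K V" and W: "module K W"
begin

interpretation V: module K V by (fact V)
interpretation W: module K W by (fact W)

lemma terms_carrier:
  assumes "t \<in> carrier (tensor K V W)" shows "set (terms t) \<subseteq> carrier V \<times> carrier W"
proof -
  obtain xs where xs: "t = tens K V W xs" "set xs \<subseteq> carrier V \<times> carrier W"
    using assms by (rule carrier_tensorE)
  then show ?thesis using tensor_rel_carrier[OF V W tensor_rel_terms[OF xs(2)]] by simp
qed

lemma terms_carrier':
  assumes "t \<in> carrier (tensor K V W)" "(a, b) \<in> set (terms t)"
  shows "a \<in> carrier V" "b \<in> carrier W"
  using terms_carrier assms by auto

lemma tens_terms:
  assumes "t \<in> carrier (tensor K V W)" shows "tens K V W (terms t) = t"
  using assms
  by (metis carrier_tensorE tensor_rel_terms tens_eqI)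

text \<open>Consequently a Sweedler sum may be computed from any presentation, in particular from
  the one by which a tensor was defined, instead of from \<open>terms\<close>.\<close>

lemma sw_tens:
  assumes "module K Z" "bilin K V W Z B" "set xs \<subseteq> carrier V \<times> carrier W"
  shows "sw Z (tens K V W xs) B = lsum Z (map (\<lambda>(a, b). B a b) xs)"
  unfolding sw_def using tensor_rel_sum[OF V W assms(1,2) tensor_rel_terms[OF assms(3)]] by simp

lemma sw_pure:
  assumes "module K Z" "bilin K V W Z B" "v \<in> carrier V" "w \<in> carrier W"
  shows "sw Z (pure K V W v w) B = B v w"
proof -
  interpret Z: module K Z by fact
  show ?thesis using sw_tens[OF assms(1,2), of "[(v, w)]"] assms bilin_closed[OF assms(2)] by simp
qed

lemma tensor_add_tens:
  assumes "set xs \<subseteq> carrier V \<times> carrier W" "set ys \<subseteq> carrier V \<times> carrier W"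
  shows "tens K V W xs \<oplus>\<^bsub>tensor K V W\<^esub> tens K V W ys = tens K V W (xs @ ys)"
  unfolding tensor_def ring.simps
  by (rule tens_eqI[OF tensor_rel.append[OF tensor_rel_terms[OF assms(1), THEN tensor_rel.sym]
        tensor_rel_terms[OF assms(2), THEN tensor_rel.sym]]])

lemma tensor_rel_scale_map:
  assumes "c \<in> carrier K" "tensor_rel K V W xs ys"
  shows "tensor_rel K V W (map (\<lambda>(v, w). (c \<odot>\<^bsub>V\<^esub> v, w)) xs) (map (\<lambda>(v, w). (c \<odot>\<^bsub>V\<^esub> v, w)) ys)"
  using assms(2)
proof induction
  case (refl xs)
  then show ?case using assms(1) by (intro tensor_rel.refl) auto
next
  case (sym xs ys) show ?case by (rule tensor_rel.sym[OF sym.IH])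
next
  case (trans xs ys zs) show ?case by (rule tensor_rel.trans[OF trans.IH])
next
  case (append xs ys xs' ys') show ?case unfolding map_append by (rule tensor_rel.append[OF append.IH])
next
  case (swap p q)
  then show ?case using assms(1) by (auto intro!: tensor_rel.swap)
next
  case (zero w)
  then show ?case using assms(1) by (auto simp: V.smult_r_null intro: tensor_rel.zero)
next
  case (add_left v v' w)
  then show ?case using assms(1) by (auto simp: V.smult_r_distr intro: tensor_rel.add_left)
next
  case (add_right v w w')
  then show ?case using assms(1) by (auto intro!: tensor_rel.add_right)
next
  case (scale d v w)
  then show ?case using assms(1) tensor_rel.scale[of d K "c \<odot>\<^bsub>V\<^esub> v" V w W]
    by (simp add: V.smult_assoc1[symmetric] V.R.m_comm)
qed

lemma tensor_smult_tens:
  assumes "c \<in> carrier K" "set xs \<subseteq> carrier V \<times> carrier W"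
  shows "c \<odot>\<^bsub>tensor K V W\<^esub> tens K V W xs = tens K V W (map (\<lambda>(v, w). (c \<odot>\<^bsub>V\<^esub> v, w)) xs)"
proof -
  have "c \<odot>\<^bsub>tensor K V W\<^esub> tens K V W xs =
      tens K V W (map (\<lambda>(v, w). (c \<odot>\<^bsub>V\<^esub> v, w)) (terms (tens K V W xs)))"
    by (simp add: tensor_def)
  also have "\<dots> = tens K V W (map (\<lambda>(v, w). (c \<odot>\<^bsub>V\<^esub> v, w)) xs)"
    by (rule tens_eqI[OF tensor_rel.sym[OF tensor_rel_scale_map[OF assms(1) tensor_rel_terms[OF assms(2)]]]])
  finally show ?thesis .
qed

lemma tensor_zero: "\<zero>\<^bsub>tensor K V W\<^esub> = tens K V W []"
  by (simp add: tensor_def)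

text \<open>The generator \<open>swap\<close> exchanges two single entries; whole lists are
  exchanged by moving one entry at a time past the other list.\<close>

lemma tens_commute:
  assumes "set xs \<subseteq> carrier V \<times> carrier W" "set ys \<subseteq> carrier V \<times> carrier W"
  shows "tensor_rel K V W (xs @ ys) (ys @ xs)"
proof -
  have one: "tensor_rel K V W (x # ys) (ys @ [x])"
    if "x \<in> carrier V \<times> carrier W" "set ys \<subseteq> carrier V \<times> carrier W" for x ys
    using that(2)
  proof (induction ys)
    case Nil then show ?case using that by (auto intro: tensor_rel.refl)
  next
    case (Cons y ys)
    have "tensor_rel K V W ([x, y] @ ys) ([y, x] @ ys)"
      using Cons that by (intro tensor_rel.append tensor_rel.swap tensor_rel.refl) auto
    moreover have "tensor_rel K V W ([y] @ (x # ys)) ([y] @ (ys @ [x]))"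
      using Cons that by (intro tensor_rel.append tensor_rel.refl) auto
    ultimately show ?case by (auto intro: tensor_rel.trans)
  qed
  show ?thesis using assms(1)
  proof (induction xs)
    case Nil then show ?case using assms by (auto intro: tensor_rel.refl)
  next
    case (Cons x xs)
    have "tensor_rel K V W ([x] @ (xs @ ys)) ([x] @ (ys @ xs))"
      using Cons by (intro tensor_rel.append[OF tensor_rel.refl]) auto
    moreover have "tensor_rel K V W ((x # ys) @ xs) ((ys @ [x]) @ xs)"
      using Cons assms by (intro tensor_rel.append[OF one tensor_rel.refl]) auto
    ultimately show ?case by (auto intro: tensor_rel.trans)
  qed
qed

text \<open>Scalars act on the left factor entry by entry, so \<open>add_left\<close> produces the
  two families interleaved. Induction with \<open>tens_commute\<close> sorts them into two
  blocks.\<close>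

lemma tensor_rel_scale_both:
  assumes "set xs \<subseteq> carrier V \<times> carrier W" "a \<in> carrier K" "b \<in> carrier K"
  shows "tensor_rel K V W (map (\<lambda>(v, w). ((a \<oplus>\<^bsub>K\<^esub> b) \<odot>\<^bsub>V\<^esub> v, w)) xs)
    (map (\<lambda>(v, w). (a \<odot>\<^bsub>V\<^esub> v, w)) xs @ map (\<lambda>(v, w). (b \<odot>\<^bsub>V\<^esub> v, w)) xs)"
  using assms(1)
proof (induction xs)
  case Nil then show ?case by (auto intro: tensor_rel.refl)
next
  case (Cons x xs)
  obtain v w where x: "x = (v, w)" "v \<in> carrier V" "w \<in> carrier W" using Cons by auto
  let ?A = "map (\<lambda>(v, w). (a \<odot>\<^bsub>V\<^esub> v, w)) xs" and ?B = "map (\<lambda>(v, w). (b \<odot>\<^bsub>V\<^esub> v, w)) xs"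
  have c: "set ?A \<subseteq> carrier V \<times> carrier W" "set ?B \<subseteq> carrier V \<times> carrier W"
    using Cons assms by auto
  have "tensor_rel K V W ([((a \<oplus>\<^bsub>K\<^esub> b) \<odot>\<^bsub>V\<^esub> v, w)] @ map (\<lambda>(v, w). ((a \<oplus>\<^bsub>K\<^esub> b) \<odot>\<^bsub>V\<^esub> v, w)) xs)
      ([(a \<odot>\<^bsub>V\<^esub> v, w), (b \<odot>\<^bsub>V\<^esub> v, w)] @ (?A @ ?B))"
    using Cons x assms by (intro tensor_rel.append) (auto simp: V.smult_l_distr intro!: tensor_rel.add_left)
  moreover have "tensor_rel K V W ([(a \<odot>\<^bsub>V\<^esub> v, w)] @ (([(b \<odot>\<^bsub>V\<^esub> v, w)] @ ?A) @ ?B))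
      ([(a \<odot>\<^bsub>V\<^esub> v, w)] @ ((?A @ [(b \<odot>\<^bsub>V\<^esub> v, w)]) @ ?B))"
    using c x assms by (intro tensor_rel.append tens_commute tensor_rel.refl) auto
  ultimately show ?case using x by (auto intro: tensor_rel.trans)
qed

text \<open>The relations mention no negatives. Negating the left entries works because opposite
  entries merge by \<open>add_left\<close> into one with left factor zero, which the generator
  \<open>zero\<close> deletes.\<close>

lemma tensor_minus:
  assumes "set xs \<subseteq> carrier V \<times> carrier W"
  shows "tensor_rel K V W (map (\<lambda>(v, w). (\<ominus>\<^bsub>V\<^esub> v, w)) xs @ xs) []"
  using assms
proof (induction xs)
  case Nil then show ?case by (auto intro: tensor_rel.refl)
next
  case (Cons x xs)
  obtain v w where x: "x = (v, w)" "v \<in> carrier V" "w \<in> carrier W" using Cons by auto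
  let ?A = "map (\<lambda>(v, w). (\<ominus>\<^bsub>V\<^esub> v, w)) xs"
  have c: "set ?A \<subseteq> carrier V \<times> carrier W" "set xs \<subseteq> carrier V \<times> carrier W" using Cons by auto
  have "tensor_rel K V W ([(\<ominus>\<^bsub>V\<^esub> v, w)] @ ((?A @ [(v, w)]) @ xs)) ([(\<ominus>\<^bsub>V\<^esub> v, w)] @ (([(v, w)] @ ?A) @ xs))"
    using c x by (intro tensor_rel.append tens_commute tensor_rel.refl) auto
  moreover have "tensor_rel K V W ([(\<ominus>\<^bsub>V\<^esub> v, w), (v, w)] @ (?A @ xs)) ([] @ [])"
  proof (rule tensor_rel.append)
    have "tensor_rel K V W [(\<ominus>\<^bsub>V\<^esub> v \<oplus>\<^bsub>V\<^esub> v, w)] [(\<ominus>\<^bsub>V\<^esub> v, w), (v, w)]"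
      using x by (intro tensor_rel.add_left) auto
    moreover have "tensor_rel K V W [(\<ominus>\<^bsub>V\<^esub> v \<oplus>\<^bsub>V\<^esub> v, w)] []"
      using x by (auto simp: V.l_neg intro: tensor_rel.zero)
    ultimately show "tensor_rel K V W [(\<ominus>\<^bsub>V\<^esub> v, w), (v, w)] []"
      by (blast intro: tensor_rel.sym tensor_rel.trans)
    show "tensor_rel K V W (?A @ xs) []" using Cons by simp
  qed
  ultimately show ?case using x by (auto intro: tensor_rel.trans)
qed

lemma tensor_abelian_group: "abelian_group (tensor K V W)"
proof (rule abelian_groupI)
  fix x y assume "x \<in> carrier (tensor K V W)" "y \<in> carrier (tensor K V W)"
  then show "x \<oplus>\<^bsub>tensor K V W\<^esub> y \<in> carrier (tensor K V W)"
    by (elim carrier_tensorE) (auto simp: tensor_add_tens intro!: tens_closed)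
next
  show "\<zero>\<^bsub>tensor K V W\<^esub> \<in> carrier (tensor K V W)" by (auto simp: tensor_zero intro: tens_closed)
next
  fix x y z assume "x \<in> carrier (tensor K V W)" "y \<in> carrier (tensor K V W)" "z \<in> carrier (tensor K V W)"
  then show "x \<oplus>\<^bsub>tensor K V W\<^esub> y \<oplus>\<^bsub>tensor K V W\<^esub> z = x \<oplus>\<^bsub>tensor K V W\<^esub> (y \<oplus>\<^bsub>tensor K V W\<^esub> z)"
    by (elim carrier_tensorE) (auto simp: tensor_add_tens)
next
  fix x y assume "x \<in> carrier (tensor K V W)" "y \<in> carrier (tensor K V W)"
  then show "x \<oplus>\<^bsub>tensor K V W\<^esub> y = y \<oplus>\<^bsub>tensor K V W\<^esub> x"
    by (elim carrier_tensorE) (simp add: tensor_add_tens tens_eqI[OF tens_commute])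
next
  fix x assume "x \<in> carrier (tensor K V W)"
  then show "\<zero>\<^bsub>tensor K V W\<^esub> \<oplus>\<^bsub>tensor K V W\<^esub> x = x"
    by (elim carrier_tensorE) (simp add: tensor_zero tensor_add_tens)
next
  fix x assume "x \<in> carrier (tensor K V W)"
  then obtain xs where xs: "x = tens K V W xs" "set xs \<subseteq> carrier V \<times> carrier W" by (rule carrier_tensorE)
  have c: "set (map (\<lambda>(v, w). (\<ominus>\<^bsub>V\<^esub> v, w)) xs) \<subseteq> carrier V \<times> carrier W" using xs by auto
  have "tens K V W (map (\<lambda>(v, w). (\<ominus>\<^bsub>V\<^esub> v, w)) xs) \<oplus>\<^bsub>tensor K V W\<^esub> x = \<zero>\<^bsub>tensor K V W\<^esub>"
    unfolding xs(1) tensor_zero tensor_add_tens[OF c xs(2)] by (rule tens_eqI[OF tensor_minus[OF xs(2)]])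
  then show "\<exists>y\<in>carrier (tensor K V W). y \<oplus>\<^bsub>tensor K V W\<^esub> x = \<zero>\<^bsub>tensor K V W\<^esub>"
    using tens_closed[OF c] by blast
qed

lemma map_scale_carrier:
  "c \<in> carrier K \<Longrightarrow> set xs \<subseteq> carrier V \<times> carrier W \<Longrightarrow>
    set (map (\<lambda>(v, w). (c \<odot>\<^bsub>V\<^esub> v, w)) xs) \<subseteq> carrier V \<times> carrier W"
  by auto

lemma tensor_module: "module K (tensor K V W)"
proof (rule moduleI[OF V.is_cring tensor_abelian_group])
  fix a x assume "a \<in> carrier K" "x \<in> carrier (tensor K V W)"
  then show "a \<odot>\<^bsub>tensor K V W\<^esub> x \<in> carrier (tensor K V W)"
    by (elim carrier_tensorE) (simp only: tensor_smult_tens tens_closed map_scale_carrier)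
next
  fix a b x assume "a \<in> carrier K" "b \<in> carrier K" "x \<in> carrier (tensor K V W)"
  then show "(a \<oplus>\<^bsub>K\<^esub> b) \<odot>\<^bsub>tensor K V W\<^esub> x = a \<odot>\<^bsub>tensor K V W\<^esub> x \<oplus>\<^bsub>tensor K V W\<^esub> b \<odot>\<^bsub>tensor K V W\<^esub> x"
    by (elim carrier_tensorE)
      (simp only: tensor_smult_tens tensor_add_tens V.R.add.m_closed map_scale_carrier
        tens_eqI[OF tensor_rel_scale_both])
next
  fix a x y assume "a \<in> carrier K" "x \<in> carrier (tensor K V W)" "y \<in> carrier (tensor K V W)"
  then show "a \<odot>\<^bsub>tensor K V W\<^esub> (x \<oplus>\<^bsub>tensor K V W\<^esub> y) = a \<odot>\<^bsub>tensor K V W\<^esub> x \<oplus>\<^bsub>tensor K V W\<^esub> a \<odot>\<^bsub>tensor K V W\<^esub> y"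
    by (elim carrier_tensorE)
      (simp only: tensor_smult_tens tensor_add_tens map_scale_carrier set_append Un_subset_iff map_append)
next
  fix a b x assume ab: "a \<in> carrier K" "b \<in> carrier K" and "x \<in> carrier (tensor K V W)"
  then obtain xs where xs: "x = tens K V W xs" "set xs \<subseteq> carrier V \<times> carrier W" by (auto elim: carrier_tensorE)
  have "map (\<lambda>(v, w). ((a \<otimes>\<^bsub>K\<^esub> b) \<odot>\<^bsub>V\<^esub> v, w)) xs =
      map (\<lambda>(v, w). (a \<odot>\<^bsub>V\<^esub> v, w)) (map (\<lambda>(v, w). (b \<odot>\<^bsub>V\<^esub> v, w)) xs)"
    using ab xs(2) by (auto simp: V.smult_assoc1)
  then show "(a \<otimes>\<^bsub>K\<^esub> b) \<odot>\<^bsub>tensor K V W\<^esub> x = a \<odot>\<^bsub>tensor K V W\<^esub> (b \<odot>\<^bsub>tensor K V W\<^esub> x)"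
    using ab xs by (simp only: tensor_smult_tens map_scale_carrier V.R.m_closed)
next
  fix x assume "x \<in> carrier (tensor K V W)"
  then obtain xs where xs: "x = tens K V W xs" "set xs \<subseteq> carrier V \<times> carrier W" by (rule carrier_tensorE)
  have "map (\<lambda>(v, w). (\<one>\<^bsub>K\<^esub> \<odot>\<^bsub>V\<^esub> v, w)) xs = map id xs" using xs(2) by (intro map_cong) auto
  then show "\<one>\<^bsub>K\<^esub> \<odot>\<^bsub>tensor K V W\<^esub> x = x"
    using xs by (simp only: tensor_smult_tens V.R.one_closed list.map_id)
qed

interpretation T: module K "tensor K V W" by (rule tensor_module)

lemma bilin_pure: "bilin K V W (tensor K V W) (pure K V W)"
proof (rule bilinI; rule linear_mapI)
  fix u v w assume "u \<in> carrier V" "v \<in> carrier V" "w \<in> carrier W"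
  then show "pure K V W (u \<oplus>\<^bsub>V\<^esub> v) w = pure K V W u w \<oplus>\<^bsub>tensor K V W\<^esub> pure K V W v w"
    by (simp add: tensor_add_tens tens_eqI[OF tensor_rel.add_left])
next
  fix u v w assume "v \<in> carrier V" "u \<in> carrier W" "w \<in> carrier W"
  then show "pure K V W v (u \<oplus>\<^bsub>W\<^esub> w) = pure K V W v u \<oplus>\<^bsub>tensor K V W\<^esub> pure K V W v w"
    by (simp add: tensor_add_tens tens_eqI[OF tensor_rel.add_right])
next
  fix c v w assume "c \<in> carrier K" "v \<in> carrier V" "w \<in> carrier W"
  then show "pure K V W (c \<odot>\<^bsub>V\<^esub> v) w = c \<odot>\<^bsub>tensor K V W\<^esub> pure K V W v w"
    by (simp add: tensor_smult_tens)
next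
  fix c v w assume "c \<in> carrier K" "v \<in> carrier V" "w \<in> carrier W"
  then show "pure K V W v (c \<odot>\<^bsub>W\<^esub> w) = c \<odot>\<^bsub>tensor K V W\<^esub> pure K V W v w"
    by (simp add: tensor_smult_tens tens_eqI[OF tensor_rel.scale, symmetric])
qed (auto intro: pure_closed)

lemma tens_sum:
  assumes "set xs \<subseteq> carrier V \<times> carrier W"
  shows "tens K V W xs = lsum (tensor K V W) (map (\<lambda>(a, b). pure K V W a b) xs)"
  using assms
proof (induction xs)
  case Nil then show ?case by (simp add: tensor_zero)
next
  case (Cons x xs)
  then have "tens K V W ([x] @ xs) = tens K V W [x] \<oplus>\<^bsub>tensor K V W\<^esub> tens K V W xs"
    by (subst tensor_add_tens) auto
  then show ?case using Cons by auto
qed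

lemma tens_concat:
  assumes "\<And>x. x \<in> set xs \<Longrightarrow> set (g x) \<subseteq> carrier V \<times> carrier W"
  shows "tens K V W (concat (map g xs)) = lsum (tensor K V W) (map (\<lambda>x. tens K V W (g x)) xs)"
proof -
  have "set (concat (map g xs)) \<subseteq> carrier V \<times> carrier W" using assms by auto
  then have "tens K V W (concat (map g xs)) =
      lsum (tensor K V W) (concat (map (\<lambda>x. map (\<lambda>(a, b). pure K V W a b) (g x)) xs))"
    by (simp add: tens_sum map_concat comp_def)
  also have "\<dots> = lsum (tensor K V W) (map (\<lambda>x. lsum (tensor K V W) (map (\<lambda>(a, b). pure K V W a b) (g x))) xs)"
    using assms by (intro T.lsum_concat) (fastforce intro!: pure_closed)
  also have "\<dots> = lsum (tensor K V W) (map (\<lambda>x. tens K V W (g x)) xs)"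
    using assms tens_sum by (metis (mono_tags, lifting) map_cong)
  finally show ?thesis .
qed

lemma sw_pure_id:
  assumes "t \<in> carrier (tensor K V W)" shows "sw (tensor K V W) t (pure K V W) = t"
  unfolding sw_def using tens_sum[OF terms_carrier[OF assms]] tens_terms[OF assms] by simp

lemma sw_closed:
  assumes "module K Z" "t \<in> carrier (tensor K V W)"
    "\<And>a b. a \<in> carrier V \<Longrightarrow> b \<in> carrier W \<Longrightarrow> B a b \<in> carrier Z"
  shows "sw Z t B \<in> carrier Z"
proof -
  interpret Z: module K Z by fact
  show ?thesis unfolding sw_def
    using assms(3) terms_carrier'[OF assms(2)] by (intro Z.lsum_map_closed) auto
qed

lemma linear_map_sw:
  assumes "module K Z" "bilin K V W Z B"
  shows "linear_map K (tensor K V W) Z (\<lambda>t. sw Z t B)"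
proof -
  interpret Z: module K Z by fact
  note cl = bilin_closed[OF assms(2)]
  have cl': "(\<lambda>(a, b). B a b) ` set xs \<subseteq> carrier Z" if "set xs \<subseteq> carrier V \<times> carrier W" for xs
    using cl that by auto
  show ?thesis
  proof (rule linear_mapI)
    fix t assume "t \<in> carrier (tensor K V W)"
    then show "sw Z t B \<in> carrier Z" by (rule sw_closed[OF assms(1) _ cl])
  next
    fix s t assume "s \<in> carrier (tensor K V W)" "t \<in> carrier (tensor K V W)"
    then show "sw Z (s \<oplus>\<^bsub>tensor K V W\<^esub> t) B = sw Z s B \<oplus>\<^bsub>Z\<^esub> sw Z t B"
      using cl' by (elim carrier_tensorE) (simp add: tensor_add_tens sw_tens[OF assms] Z.lsum_append)
  next
    fix c t assume c: "c \<in> carrier K" and "t \<in> carrier (tensor K V W)"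
    then obtain xs where xs: "t = tens K V W xs" "set xs \<subseteq> carrier V \<times> carrier W" by (auto elim: carrier_tensorE)
    have "sw Z (c \<odot>\<^bsub>tensor K V W\<^esub> t) B =
        lsum Z (map (\<lambda>(a, b). B a b) (map (\<lambda>(v, w). (c \<odot>\<^bsub>V\<^esub> v, w)) xs))"
      using c xs by (simp only: tensor_smult_tens sw_tens[OF assms] map_scale_carrier)
    also have "map (\<lambda>(a, b). B a b) (map (\<lambda>(v, w). (c \<odot>\<^bsub>V\<^esub> v, w)) xs) = map (\<lambda>x. c \<odot>\<^bsub>Z\<^esub> (case x of (a, b) \<Rightarrow> B a
        b)) xs"
      using xs(2) c linear_map_smult[OF bilin_left[OF assms(2)]] by (auto; blast)
    also have "lsum Z \<dots> = c \<odot>\<^bsub>Z\<^esub> lsum Z (map (\<lambda>(a, b). B a b) xs)"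
      using linear_map_lsum[OF linear_map_scale[OF assms(1,1) linear_map_id c] assms(1,1),
          of xs "\<lambda>(a, b). B a b"] cl' xs(2) by (simp add: image_subset_iff)
    finally show "sw Z (c \<odot>\<^bsub>tensor K V W\<^esub> t) B = c \<odot>\<^bsub>Z\<^esub> sw Z t B"
      using xs by (simp add: sw_tens[OF assms])
  qed
qed

lemma linear_map_apply_sw:
  assumes "module K Y" "module K Z" "linear_map K Y Z f" "t \<in> carrier (tensor K V W)"
    "\<And>a b. a \<in> carrier V \<Longrightarrow> b \<in> carrier W \<Longrightarrow> B a b \<in> carrier Y"
  shows "f (sw Y t B) = sw Z t (\<lambda>a b. f (B a b))"
  unfolding sw_def
  using linear_map_lsum[OF assms(3,1,2), of "terms t" "\<lambda>(a, b). B a b"] assms(5) terms_carrier'[OF assms(4)]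
  by (auto simp: split_def)

text \<open>Every tensor is the sum of its pure terms by \<open>sw_pure_id\<close>, and linear maps
  commute with that sum. Identities on tensor products are reduced to pure tensors in this
  way.\<close>

lemma tensor_ext:
  assumes "module K Z" "linear_map K (tensor K V W) Z f" "linear_map K (tensor K V W) Z g"
    "\<And>a b. a \<in> carrier V \<Longrightarrow> b \<in> carrier W \<Longrightarrow> f (pure K V W a b) = g (pure K V W a b)"
    "t \<in> carrier (tensor K V W)"
  shows "f t = g t"
proof -
  have "h t = sw Z t (\<lambda>a b. h (pure K V W a b))" if "linear_map K (tensor K V W) Z h" for h
    using linear_map_apply_sw[OF tensor_module assms(1) that assms(5), of "pure K V W"]
    by (simp add: sw_pure_id[OF assms(5)] pure_closed)
  moreover have "sw Z t (\<lambda>a b. f (pure K V W a b)) = sw Z t (\<lambda>a b. g (pure K V W a b))"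
    unfolding sw_def using assms(4) terms_carrier'[OF assms(5)]
    by (intro arg_cong[where f="lsum Z"] map_cong) auto
  ultimately show ?thesis using assms(2,3) by metis
qed

lemma sw_cong:
  assumes "t \<in> carrier (tensor K V W)"
    "\<And>a b. a \<in> carrier V \<Longrightarrow> b \<in> carrier W \<Longrightarrow> B a b = C a b"
  shows "sw Z t B = sw Z t C"
  unfolding sw_def using assms(2) terms_carrier'[OF assms(1)]
  by (intro arg_cong[where f="lsum Z"] map_cong) auto

lemma linear_map_sw_param:
  assumes "module K U" "module K Z" "t \<in> carrier (tensor K V W)"
    "\<And>a b. a \<in> carrier V \<Longrightarrow> b \<in> carrier W \<Longrightarrow> linear_map K U Z (\<lambda>u. B u a b)"
  shows "linear_map K U Z (\<lambda>u. sw Z t (B u))"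
proof -
  have "linear_map K U Z (\<lambda>u. lsum Z (map (\<lambda>x. case x of (a, b) \<Rightarrow> B u a b) (terms t)))"
    using assms(4) terms_carrier'[OF assms(3)] by (intro linear_map_sum[OF assms(1,2)]) auto
  then show ?thesis by (simp add: sw_def)
qed

end

text \<open>With \<open>s\<close> and \<open>t\<close> fixed, both sums run over fixed lists and the
  claim is the exchange of two finite sums. A sum over a tensor that depends on a leg of
  \<open>s\<close>, such as its coproduct, has to stay inside.\<close>

lemma sw_swap:
  assumes "module K V" "module K W" "module K V'" "module K W'" "module K Z"
    "s \<in> carrier (tensor K V W)" "t \<in> carrier (tensor K V' W')"
    "\<And>a b c d. a \<in> carrier V \<Longrightarrow> b \<in> carrier W \<Longrightarrow> c \<in> carrier V' \<Longrightarrow> d \<in> carrier W' \<Longrightarrow> B a b c d \<in> carrier Z"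
  shows "sw Z s (\<lambda>a b. sw Z t (B a b)) = sw Z t (\<lambda>c d. sw Z s (\<lambda>a b. B a b c d))"
proof -
  interpret Z: module K Z by fact
  have "lsum Z (map (\<lambda>x. lsum Z (map (\<lambda>y. case x of (a, b) \<Rightarrow> case y of (c, d) \<Rightarrow> B a b c d) (terms t))) (terms s))
    = lsum Z (map (\<lambda>y. lsum Z (map (\<lambda>x. case x of (a, b) \<Rightarrow> case y of (c, d) \<Rightarrow> B a b c d) (terms s))) (terms t))"
    using assms(8) terms_carrier'[OF assms(1,2,6)] terms_carrier'[OF assms(3,4,7)]
    by (intro Z.lsum_swap) (auto split: prod.splits)
  then show ?thesis by (simp add: sw_def split_def)
qed

section \<open>Multilinear expressions and tensor products of algebras\<close>

context
  fixes K :: "('k, 'r) ring_scheme" and V :: "('k, 'v, 'm) module_scheme"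
    and W :: "('k, 'w, 'n) module_scheme"
  assumes V: "module K V" and W: "module K W"
begin

lemma lin_pure_left:
  "linear_map K U V f \<Longrightarrow> w \<in> carrier W \<Longrightarrow> linear_map K U (tensor K V W) (\<lambda>u. pure K V W (f u) w)"
  by (rule linear_map_comp[OF _ bilin_left[OF bilin_pure[OF V W]]])

lemma lin_pure_right:
  "linear_map K U W f \<Longrightarrow> v \<in> carrier V \<Longrightarrow> linear_map K U (tensor K V W) (\<lambda>u. pure K V W v (f u))"
  by (rule linear_map_comp[OF _ bilin_right[OF bilin_pure[OF V W]]])

lemma lin_sw:
  "module K Z \<Longrightarrow> linear_map K U (tensor K V W) f \<Longrightarrow> bilin K V W Z B \<Longrightarrow> linear_map K U Z (\<lambda>u. sw Z (f u) B)"
  by (rule linear_map_comp[OF _ linear_map_sw[OF V W]])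

end

lemma lin_smult_left:
  assumes "module K Z" "linear_map K U (base_field K) f" "z \<in> carrier Z"
  shows "linear_map K U Z (\<lambda>u. f u \<odot>\<^bsub>Z\<^esub> z)"
proof -
  interpret Z: module K Z by fact
  show ?thesis
    using assms by (auto simp: linear_map_def base_field_def ring.defs module.defs Z.smult_l_distr
        Z.smult_assoc1 Pi_iff)
qed

lemma base_field_simps [simp]:
  "carrier (base_field K) = carrier K" "mult (base_field K) = mult K" "one (base_field K) = one K"
  "add (base_field K) = add K" "zero (base_field K) = zero K" "smult (base_field K) = mult K"
  by (simp_all add: base_field_def ring.defs module.defs)

lemma base_field_module:
  fixes K :: "'k ring"
  assumes "cring K" shows "module K (base_field K)"
proof -
  interpret K: cring K by fact
  have "abelian_group (base_field K)"
    by (rule abelian_groupI) (auto simp: K.a_ac intro: K.l_neg K.a_inv_closed)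
  then show ?thesis
    by (rule moduleI[OF assms]) (auto simp: K.l_distr K.r_distr K.m_assoc)
qed

lemma linear_map_scalar_mult:
  fixes K :: "'k ring"
  assumes "cring K" "linear_map K U (base_field K) f" "c \<in> carrier K"
  shows "linear_map K U (base_field K) (\<lambda>u. c \<otimes>\<^bsub>K\<^esub> f u)"
proof -
  interpret K: cring K by fact
  show ?thesis using assms by (auto simp: linear_map_def Pi_iff K.r_distr K.m_lcomm)
qed

context k_algebra
begin

lemma module_self: "module K A" by (rule module_axioms)

lemma lin_mult_left: "linear_map K U A f \<Longrightarrow> c \<in> carrier A \<Longrightarrow> linear_map K U A (\<lambda>u. f u \<otimes>\<^bsub>A\<^esub> c)"
  by (auto simp: linear_map_def Pi_iff smult_mult_left l_distr)

lemma lin_mult_right: "linear_map K U A f \<Longrightarrow> c \<in> carrier A \<Longrightarrow> linear_map K U A (\<lambda>u. c \<otimes>\<^bsub>A\<^esub> f u)"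
  by (auto simp: linear_map_def Pi_iff smult_mult_right r_distr)

end

lemma algebra_map_linear: "algebra_map K A B f \<Longrightarrow> linear_map K A B f"
  by (simp add: algebra_map_def)

lemma anti_algebra_map_linear: "anti_algebra_map K A B f \<Longrightarrow> linear_map K A B f"
  by (simp add: anti_algebra_map_def)

locale tensor_algebra = A: k_algebra K A + B: k_algebra K B
  for K :: "('k, 'r) ring_scheme" and A :: "('k, 'a, 'm) module_scheme"
    and B :: "('k, 'b, 'n) module_scheme"
begin

abbreviation "T \<equiv> tensor K A B"
abbreviation pr where "pr \<equiv> pure K A B"

lemmas mods = A.module_self B.module_self
lemmas T_module = tensor_module[OF mods]

interpretation T: module K T by (rule T_module)

lemma bilin_pure_mult:
  assumes "v \<in> carrier A" "w \<in> carrier B"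
  shows "bilin K A B T (\<lambda>v' w'. pr (v \<otimes>\<^bsub>A\<^esub> v') (w \<otimes>\<^bsub>B\<^esub> w'))"
  using assms
  by (intro bilinI lin_pure_left lin_pure_right mods A.lin_mult_right B.lin_mult_right linear_map_id) auto

lemma bilin_pure_mult':
  assumes "v \<in> carrier A" "w \<in> carrier B"
  shows "bilin K A B T (\<lambda>v' w'. pr (v' \<otimes>\<^bsub>A\<^esub> v) (w' \<otimes>\<^bsub>B\<^esub> w))"
  using assms
  by (intro bilinI lin_pure_left lin_pure_right mods A.lin_mult_left B.lin_mult_left linear_map_id) auto

lemma mult_sw:
  assumes "s \<in> carrier T" "t \<in> carrier T"
  shows "s \<otimes>\<^bsub>T\<^esub> t = sw T s (\<lambda>v w. sw T t (\<lambda>v' w'. pr (v \<otimes>\<^bsub>A\<^esub> v') (w \<otimes>\<^bsub>B\<^esub> w')))"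
proof -
  note c = terms_carrier'[OF mods assms(1)] terms_carrier'[OF mods assms(2)]
  have in_C: "set [(v \<otimes>\<^bsub>A\<^esub> v', w \<otimes>\<^bsub>B\<^esub> w'). (v', w') \<leftarrow> terms t] \<subseteq> carrier A \<times> carrier B"
    if "(v, w) \<in> set (terms s)" for v w
    using c that by auto
  have "s \<otimes>\<^bsub>T\<^esub> t = tens K A B (concat (map (\<lambda>(v, w). [(v \<otimes>\<^bsub>A\<^esub> v', w \<otimes>\<^bsub>B\<^esub> w'). (v', w') \<leftarrow> terms t]) (terms s)))"
    by (simp add: tensor_def)
  also have "\<dots> = lsum T (map (\<lambda>(v, w). tens K A B [(v \<otimes>\<^bsub>A\<^esub> v', w \<otimes>\<^bsub>B\<^esub> w'). (v', w') \<leftarrow> terms t]) (terms s))"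
    using in_C by (subst tens_concat[OF mods]) (auto simp: split_def)
  also have "\<dots> = lsum T (map (\<lambda>(v, w). sw T t (\<lambda>v' w'. pr (v \<otimes>\<^bsub>A\<^esub> v') (w \<otimes>\<^bsub>B\<^esub> w'))) (terms s))"
  proof (intro arg_cong[where f="lsum T"] map_cong HOL.refl)
    fix x assume x: "x \<in> set (terms s)"
    obtain v w where vw: "x = (v, w)" by fastforce
    have "tens K A B [(v \<otimes>\<^bsub>A\<^esub> v', w \<otimes>\<^bsub>B\<^esub> w'). (v', w') \<leftarrow> terms t] = sw T t (\<lambda>v' w'. pr (v \<otimes>\<^bsub>A\<^esub> v') (w \<otimes>\<^bsub>B\<^esub> w'))"
      using in_C x vw by (subst tens_sum[OF mods]) (auto simp: sw_def split_def comp_def concat_map_singleton)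
    then show "(case x of (v, w) \<Rightarrow> tens K A B [(v \<otimes>\<^bsub>A\<^esub> v', w \<otimes>\<^bsub>B\<^esub> w'). (v', w') \<leftarrow> terms t]) =
        (case x of (v, w) \<Rightarrow> sw T t (\<lambda>v' w'. pr (v \<otimes>\<^bsub>A\<^esub> v') (w \<otimes>\<^bsub>B\<^esub> w')))"
      by (simp add: vw)
  qed
  finally show ?thesis by (simp add: sw_def)
qed

lemma bilin_sw_mult:
  assumes "t \<in> carrier T"
  shows "bilin K A B T (\<lambda>v w. sw T t (\<lambda>v' w'. pr (v \<otimes>\<^bsub>A\<^esub> v') (w \<otimes>\<^bsub>B\<^esub> w')))"
  using assms
  by (intro bilinI linear_map_sw_param[OF mods] mods T_module bilin_left[OF bilin_pure_mult']
      bilin_right[OF bilin_pure_mult'])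

lemma mult_closed: "s \<in> carrier T \<Longrightarrow> t \<in> carrier T \<Longrightarrow> s \<otimes>\<^bsub>T\<^esub> t \<in> carrier T"
  by (simp add: mult_sw) (intro sw_closed[OF mods] T_module pure_closed A.m_closed B.m_closed)

lemma mult_linear_left: "t \<in> carrier T \<Longrightarrow> linear_map K T T (\<lambda>s. s \<otimes>\<^bsub>T\<^esub> t)"
  by (rule linear_map_cong[OF linear_map_sw[OF mods T_module bilin_sw_mult] T_module mult_sw])

lemma mult_linear_right: "s \<in> carrier T \<Longrightarrow> linear_map K T T (\<lambda>t. s \<otimes>\<^bsub>T\<^esub> t)"
  by (rule linear_map_cong[OF linear_map_sw_param[OF mods T_module T_module] T_module mult_sw])
    (auto intro: linear_map_sw[OF mods T_module bilin_pure_mult])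

lemma mult_pure:
  assumes "a \<in> carrier A" "b \<in> carrier B" "c \<in> carrier A" "d \<in> carrier B"
  shows "pr a b \<otimes>\<^bsub>T\<^esub> pr c d = pr (a \<otimes>\<^bsub>A\<^esub> c) (b \<otimes>\<^bsub>B\<^esub> d)"
  using assms
  by (simp add: mult_sw pure_closed sw_pure[OF mods T_module bilin_sw_mult] sw_pure[OF mods T_module bilin_pure_mult])

lemma one_pure: "\<one>\<^bsub>T\<^esub> = pr \<one>\<^bsub>A\<^esub> \<one>\<^bsub>B\<^esub>"
  by (simp add: tensor_def)

text \<open>Both sides are linear in each argument, so the arguments are reduced to pure tensors one
  after the other, the last one first.\<close>

lemma T_assoc:
  assumes "x \<in> carrier T" "y \<in> carrier T" "z \<in> carrier T"
  shows "x \<otimes>\<^bsub>T\<^esub> y \<otimes>\<^bsub>T\<^esub> z = x \<otimes>\<^bsub>T\<^esub> (y \<otimes>\<^bsub>T\<^esub> z)"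
proof -
  note lr = linear_map_comp[OF mult_linear_left mult_linear_left]
    linear_map_comp[OF mult_linear_right mult_linear_left]
    linear_map_comp[OF mult_linear_left mult_linear_right]
    linear_map_comp[OF mult_linear_right mult_linear_right]
  note ext = tensor_ext[OF mods T_module]
  have 1: "pr a b \<otimes>\<^bsub>T\<^esub> pr c d \<otimes>\<^bsub>T\<^esub> z = pr a b \<otimes>\<^bsub>T\<^esub> (pr c d \<otimes>\<^bsub>T\<^esub> z)"
    if "a \<in> carrier A" "b \<in> carrier B" "c \<in> carrier A" "d \<in> carrier B" for a b c d
    using that assms(3)
    by (intro ext[where f="\<lambda>z. pr a b \<otimes>\<^bsub>T\<^esub> pr c d \<otimes>\<^bsub>T\<^esub> z" and t=z] mult_linear_right lr)
      (auto simp: mult_pure A.m_assoc B.m_assoc intro!: mult_closed pure_closed)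
  have 2: "pr a b \<otimes>\<^bsub>T\<^esub> y \<otimes>\<^bsub>T\<^esub> z = pr a b \<otimes>\<^bsub>T\<^esub> (y \<otimes>\<^bsub>T\<^esub> z)"
    if "a \<in> carrier A" "b \<in> carrier B" for a b
    using that assms(2,3) 1
    by (intro ext[where f="\<lambda>y. pr a b \<otimes>\<^bsub>T\<^esub> y \<otimes>\<^bsub>T\<^esub> z" and t=y] lr) (auto intro!: pure_closed)
  show ?thesis
    using assms 2
    by (intro ext[where f="\<lambda>x. x \<otimes>\<^bsub>T\<^esub> y \<otimes>\<^bsub>T\<^esub> z" and t=x] lr mult_linear_left) (auto intro!: mult_closed)
qed

lemma T_one_closed: "\<one>\<^bsub>T\<^esub> \<in> carrier T"
  by (auto simp: one_pure intro: pure_closed)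

lemma T_one:
  assumes "x \<in> carrier T" shows "\<one>\<^bsub>T\<^esub> \<otimes>\<^bsub>T\<^esub> x = x" "x \<otimes>\<^bsub>T\<^esub> \<one>\<^bsub>T\<^esub> = x"
proof -
  note o = T_one_closed
  show "\<one>\<^bsub>T\<^esub> \<otimes>\<^bsub>T\<^esub> x = x"
    using o by (rule tensor_ext[OF mods T_module mult_linear_right linear_map_id _ assms])
      (simp_all add: one_pure mult_pure)
  show "x \<otimes>\<^bsub>T\<^esub> \<one>\<^bsub>T\<^esub> = x"
    using o by (rule tensor_ext[OF mods T_module mult_linear_left linear_map_id _ assms])
      (simp_all add: one_pure mult_pure)
qed

lemma tensor_k_algebra: "k_algebra K T"
proof -
  have "ring T"
  proof (rule ringI)
    show "abelian_group T" by (rule tensor_abelian_group[OF mods])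
    show "Group.monoid T"
      by (rule Group.monoidI) (simp_all add: mult_closed T_assoc T_one T_one_closed)
  next
    fix x y z assume "x \<in> carrier T" "y \<in> carrier T" "z \<in> carrier T"
    then show "(x \<oplus>\<^bsub>T\<^esub> y) \<otimes>\<^bsub>T\<^esub> z = x \<otimes>\<^bsub>T\<^esub> z \<oplus>\<^bsub>T\<^esub> y \<otimes>\<^bsub>T\<^esub> z" "z \<otimes>\<^bsub>T\<^esub> (x \<oplus>\<^bsub>T\<^esub> y) = z \<otimes>\<^bsub>T\<^esub> x \<oplus>\<^bsub>T\<^esub> z \<otimes>\<^bsub>T\<^esub> y"
      by (simp_all add: linear_map_add[OF mult_linear_left] linear_map_add[OF mult_linear_right])
  qed
  then show ?thesis
    using T_module A.field_axioms
    by (simp add: k_algebra_def k_algebra_axioms_def linear_map_smult[OF mult_linear_left]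
        linear_map_smult[OF mult_linear_right])
qed

text \<open>Combined with multiplicativity of \<Delta> this is the Sweedler rule for the coproduct
  of a product: one sum becomes two independent ones. The lists behind the two sides are unrelated;
  bilinearity of \<open>C\<close> makes the values agree.\<close>

lemma sw_mult:
  assumes Z: "module K Z" and B: "bilin K A B Z C" and st: "s \<in> carrier T" "t \<in> carrier T"
  shows "sw Z (s \<otimes>\<^bsub>T\<^esub> t) C = sw Z s (\<lambda>a b. sw Z t (\<lambda>c d. C (a \<otimes>\<^bsub>A\<^esub> c) (b \<otimes>\<^bsub>B\<^esub> d)))"
proof -
  note sB = linear_map_sw[OF mods Z B]
  have "sw Z (s \<otimes>\<^bsub>T\<^esub> t) C = sw Z s (\<lambda>a b. sw Z (sw T t (\<lambda>c d. pr (a \<otimes>\<^bsub>A\<^esub> c) (b \<otimes>\<^bsub>B\<^esub> d))) C)"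
    unfolding mult_sw[OF st] using st(2)
    by (intro linear_map_apply_sw[OF mods T_module Z sB st(1)] sw_closed[OF mods T_module] pure_closed) auto
  also have "\<dots> = sw Z s (\<lambda>a b. sw Z t (\<lambda>c d. sw Z (pr (a \<otimes>\<^bsub>A\<^esub> c) (b \<otimes>\<^bsub>B\<^esub> d)) C))"
    using st(2)
    by (intro sw_cong[OF mods st(1)] linear_map_apply_sw[OF mods T_module Z sB st(2)] pure_closed) auto
  also have "\<dots> = sw Z s (\<lambda>a b. sw Z t (\<lambda>c d. C (a \<otimes>\<^bsub>A\<^esub> c) (b \<otimes>\<^bsub>B\<^esub> d)))"
    by (intro sw_cong[OF mods st(1)] sw_cong[OF mods st(2)] sw_pure[OF mods Z B]) auto
  finally show ?thesis .
qed

end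

section \<open>Words and multilinear functions\<close>

abbreviation (in quasi_hopf_sig) carrier_H (\<open>\<H>\<close>) where "\<H> \<equiv> carrier H"

abbreviation (in quasi_hopf_sig) one_H (\<open>\<one>\<^sub>H\<close>) where "\<one>\<^sub>H \<equiv> \<one>\<^bsub>H\<^esub>"

context quasi_hopf
begin

sublocale H2: tensor_algebra K H H
  by (simp add: tensor_algebra_def k_algebra_axioms)

sublocale H3: tensor_algebra K H H2
  by (simp add: tensor_algebra_def k_algebra_axioms H2.tensor_k_algebra)

sublocale H4: tensor_algebra K H H3
  by (simp add: tensor_algebra_def k_algebra_axioms H3.tensor_k_algebra)

sublocale H5: tensor_algebra K H H4
  by (simp add: tensor_algebra_def k_algebra_axioms H4.tensor_k_algebra)

lemmas mH [simp] = module_self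
lemmas mH2 [simp] = H2.T_module
lemmas mH3 [simp] = H3.T_module
lemmas mH4 [simp] = H4.T_module

lemma mK [simp]: "module K (base_field K)"
  by (rule base_field_module) (rule is_cring)

lemma Delta_lin: "linear_map K H H2 \<Delta>"
  using comult by (rule algebra_map_linear)

lemma Delta_closed [simp]: "h \<in> \<H> \<Longrightarrow> \<Delta> h \<in> carrier H2"
  by (rule linear_map_closed[OF Delta_lin])

lemma Delta_mult: "g \<in> \<H> \<Longrightarrow> h \<in> \<H> \<Longrightarrow> \<Delta> (g \<cdot> h) = \<Delta> g \<otimes>\<^bsub>H2\<^esub> \<Delta> h"
  using comult by (simp add: algebra_map_def)

lemma Delta_one: "\<Delta> \<one>\<^sub>H = pure K H H \<one>\<^sub>H \<one>\<^sub>H"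
  using comult by (simp add: algebra_map_def H2.one_pure)

lemma eps_lin: "linear_map K H (base_field K) \<epsilon>"
  using counit by (rule algebra_map_linear)

lemma eps_closed [simp]: "h \<in> \<H> \<Longrightarrow> \<epsilon> h \<in> carrier K"
  using linear_map_closed[OF eps_lin] by simp

lemma eps_mult: "g \<in> \<H> \<Longrightarrow> h \<in> \<H> \<Longrightarrow> \<epsilon> (g \<cdot> h) = \<epsilon> g \<otimes>\<^bsub>K\<^esub> \<epsilon> h"
  using counit by (simp add: algebra_map_def)

lemma eps_one [simp]: "\<epsilon> \<one>\<^sub>H = \<one>\<^bsub>K\<^esub>"
  using counit by (simp add: algebra_map_def)

lemma S_lin: "linear_map K H H S"
  using antipode by (rule anti_algebra_map_linear)

lemma S_closed [simp]: "h \<in> \<H> \<Longrightarrow> S h \<in> \<H>"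
  by (rule linear_map_closed[OF S_lin])

lemma S_mult: "g \<in> \<H> \<Longrightarrow> h \<in> \<H> \<Longrightarrow> S (g \<cdot> h) = S h \<cdot> S g"
  using antipode by (simp add: anti_algebra_map_def)

lemma S_one [simp]: "S \<one>\<^sub>H = \<one>\<^sub>H"
  using antipode by (simp add: anti_algebra_map_def)

declare alpha_closed [simp] beta_closed [simp]

text \<open>
  A word \<open>x\<close>, equal to \<open>1\<close> from some index on, stands for \<open>x 0 \<otimes> x 1 \<otimes>
      \<dots>\<close>. This identifies
  \<open>H\<^sup>\<otimes>\<^sup>n\<close> with its image under \<open>- \<otimes> 1\<close> and puts all tensor powers into one type.
\<close>

definition W :: "(nat \<Rightarrow> 'b) set"
  where "W = {x. (\<forall>i. x i \<in> \<H>) \<and> (\<exists>n. \<forall>i\<ge>n. x i = \<one>\<^sub>H)}"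

definition unit_word :: "nat \<Rightarrow> 'b"
  where "unit_word = (\<lambda>_. \<one>\<^sub>H)"

definition wmul :: "(nat \<Rightarrow> 'b) \<Rightarrow> (nat \<Rightarrow> 'b) \<Rightarrow> nat \<Rightarrow> 'b"
  where "wmul x y = (\<lambda>i. x i \<cdot> y i)"

definition ins :: "nat \<Rightarrow> (nat \<Rightarrow> 'b) \<Rightarrow> nat \<Rightarrow> 'b"
  where "ins i x = (\<lambda>j. if j < i then x j else if j = i then \<one>\<^sub>H else x (j - 1))"

text \<open>The old letter at \<open>i\<close> is overwritten; it enters only through
  \<open>a\<close> and \<open>b\<close>, which run over its coproduct in the applications.\<close>

definition spl :: "nat \<Rightarrow> (nat \<Rightarrow> 'b) \<Rightarrow> 'b \<Rightarrow> 'b \<Rightarrow> nat \<Rightarrow> 'b"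
  where "spl i x a b = (ins (Suc i) x)(i := a, Suc i := b)"

definition epsw :: "nat \<Rightarrow> (nat \<Rightarrow> 'b) \<Rightarrow> nat \<Rightarrow> 'b"
  where "epsw i x = x(i := \<epsilon> (x i) \<odot>\<^bsub>H\<^esub> \<one>\<^sub>H)"

lemma W_closed [simp]: "x \<in> W \<Longrightarrow> x i \<in> \<H>"
  by (auto simp: W_def)

lemma WI: "(\<And>i. x i \<in> \<H>) \<Longrightarrow> (\<And>i. i \<ge> n \<Longrightarrow> x i = \<one>\<^sub>H) \<Longrightarrow> x \<in> W"
  unfolding W_def by blast

lemma WE:
  assumes "x \<in> W" obtains n where "\<And>i. i \<ge> n \<Longrightarrow> x i = \<one>\<^sub>H"
  using assms unfolding W_def by blast

lemma W_upd [simp]: "x \<in> W \<Longrightarrow> a \<in> \<H> \<Longrightarrow> x(i := a) \<in> W"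
  by (rule WE[of x], assumption) (rule_tac n="max n (Suc i)" in WI; simp)

lemma W_unit [simp]: "unit_word \<in> W"
  by (rule WI[where n=0]) (simp_all add: unit_word_def)

lemma W_wmul [simp]: "x \<in> W \<Longrightarrow> y \<in> W \<Longrightarrow> wmul x y \<in> W"
  by (rule WE[of x], assumption, rule WE[of y], assumption) (rule_tac n="max n na" in WI; simp add: wmul_def)

lemma W_ins [simp]: "x \<in> W \<Longrightarrow> ins i x \<in> W"
  by (rule WE[of x], assumption) (rule_tac n="Suc (max n i)" in WI; simp add: ins_def)

lemma W_spl [simp]: "x \<in> W \<Longrightarrow> a \<in> \<H> \<Longrightarrow> b \<in> \<H> \<Longrightarrow> spl i x a b \<in> W"
  by (simp add: spl_def)

lemma W_epsw [simp]: "x \<in> W \<Longrightarrow> epsw i x \<in> W"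
  by (simp add: epsw_def)

lemma wmul_assoc: "x \<in> W \<Longrightarrow> y \<in> W \<Longrightarrow> z \<in> W \<Longrightarrow> wmul (wmul x y) z = wmul x (wmul y z)"
  by (simp add: wmul_def m_assoc)

lemma wmul_unit [simp]: "x \<in> W \<Longrightarrow> wmul x unit_word = x" "x \<in> W \<Longrightarrow> wmul unit_word x = x"
  by (simp_all add: wmul_def unit_word_def)

lemma ins_unit [simp]: "ins i unit_word = unit_word"
  by (auto simp: ins_def unit_word_def)

lemma ins_upd: "ins i (x(j := a)) = (ins i x)((if j < i then j else Suc j) := a)"
  by (auto simp: ins_def fun_eq_iff)

lemma ins_wmul: "ins i (wmul x y) = wmul (ins i x) (ins i y)"
  by (auto simp: ins_def wmul_def fun_eq_iff)

lemma spl_upd: "j \<noteq> i \<Longrightarrow> spl i (x(j := c)) a b = (spl i x a b)((if j < i then j else Suc j) := c)"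
  by (auto simp: spl_def ins_def fun_eq_iff)

lemma spl_upd_same: "spl i (x(i := c)) a b = spl i x a b"
  by (auto simp: spl_def ins_def fun_eq_iff)

lemma spl_left: "spl i x a b = (spl i x \<one>\<^sub>H b)(i := a)"
  by (auto simp: spl_def)

lemma spl_right: "spl i x a b = (spl i x a \<one>\<^sub>H)(Suc i := b)"
  by (auto simp: spl_def)

lemma spl_wmul: "spl i (wmul x y) (a \<cdot> c) (b \<cdot> d) = wmul (spl i x a b) (spl i y c d)"
  by (auto simp: spl_def ins_def wmul_def fun_eq_iff)

end

locale quasi_hopf_val = quasi_hopf K H + Z: module K Z
  for K :: "'k ring" and H :: "('k, 'h) quasi_hopf" and Z :: "('k, 'z, 'm) module_scheme"
begin

lemma mZ [simp]: "module K Z" by (rule Z.module_axioms)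

text \<open>Linearity is demanded in every one of the infinitely many letters, so that the same test
  functions serve all tensor powers and survive insertion and splitting of slots.\<close>

definition mlin :: "((nat \<Rightarrow> 'h) \<Rightarrow> 'z) \<Rightarrow> bool"
  where "mlin f \<longleftrightarrow> (\<forall>x\<in>W. \<forall>i. linear_map K H Z (\<lambda>a. f (x(i := a))))"

lemma mlinI: "(\<And>x i. x \<in> W \<Longrightarrow> linear_map K H Z (\<lambda>a. f (x(i := a)))) \<Longrightarrow> mlin f"
  by (simp add: mlin_def)

lemma mlinD: "mlin f \<Longrightarrow> x \<in> W \<Longrightarrow> linear_map K H Z (\<lambda>a. f (x(i := a)))"
  by (simp add: mlin_def)

lemma mlin_closed: "mlin f \<Longrightarrow> x \<in> W \<Longrightarrow> f x \<in> carrier Z"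
  using linear_map_closed[OF mlinD[of f x 0], of "x 0"] by simp

lemma mlin_cong: "(\<And>x. x \<in> W \<Longrightarrow> f x = g x) \<Longrightarrow> mlin f \<Longrightarrow> mlin g"
proof (rule mlinI)
  fix x i assume fg: "\<And>x. x \<in> W \<Longrightarrow> f x = g x" and f: "mlin f" and x: "x \<in> W"
  show "linear_map K H Z (\<lambda>a. g (x(i := a)))"
    by (rule linear_map_cong[OF mlinD[OF f x, of i] mH]) (simp add: fg x)
qed

lemma mlin_lin: "mlin f \<Longrightarrow> x \<in> W \<Longrightarrow> linear_map K U H g \<Longrightarrow> linear_map K U Z (\<lambda>a. f (x(i := g a)))"
  by (rule linear_map_comp[OF _ mlinD])

lemma mlin_ins: "mlin f \<Longrightarrow> mlin (\<lambda>x. f (ins i x))"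
  by (rule mlinI) (simp add: ins_upd mlinD)

lemma mlin_epsw:
  assumes f: "mlin f" shows "mlin (\<lambda>x. f (epsw i x))"
proof (rule mlinI)
  fix x j assume x: "x \<in> W"
  have e: "linear_map K H H (\<lambda>a. \<epsilon> a \<odot>\<^bsub>H\<^esub> \<one>\<^sub>H)"
    by (rule lin_smult_left[OF mH eps_lin]) simp
  show "linear_map K H Z (\<lambda>a. f (epsw i (x(j := a))))"
  proof (cases "j = i")
    case True
    then show ?thesis using mlin_lin[OF f x e, of i] by (simp add: epsw_def)
  next
    case False
    then have "epsw i (x(j := a)) = (epsw i x)(j := a)" for a by (auto simp: epsw_def)
    then show ?thesis using mlinD[OF f, of "epsw i x" j] x by simp
  qed
qed

lemma mlin_wmul_right: "mlin f \<Longrightarrow> x \<in> W \<Longrightarrow> mlin (\<lambda>y. f (wmul x y))"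
proof (rule mlinI)
  fix y i assume f: "mlin f" and x: "x \<in> W" and y: "y \<in> W"
  have "wmul x (y(i := a)) = (wmul x y)(i := x i \<cdot> a)" for a by (auto simp: wmul_def)
  then show "linear_map K H Z (\<lambda>a. f (wmul x (y(i := a))))"
    using mlin_lin[OF f _ lin_mult_right[OF linear_map_id], of "wmul x y"] x y by simp
qed

lemma mlin_wmul_left: "mlin f \<Longrightarrow> y \<in> W \<Longrightarrow> mlin (\<lambda>x. f (wmul x y))"
proof (rule mlinI)
  fix x i assume f: "mlin f" and y: "y \<in> W" and x: "x \<in> W"
  have "wmul (x(i := a)) y = (wmul x y)(i := a \<cdot> y i)" for a by (auto simp: wmul_def)
  then show "linear_map K H Z (\<lambda>a. f (wmul (x(i := a)) y))"
    using mlin_lin[OF f _ lin_mult_left[OF linear_map_id], of "wmul x y"] x y by simp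
qed

lemma bilin_spl:
  assumes "mlin f" "x \<in> W" shows "bilin K H H Z (\<lambda>a b. f (spl i x a b))"
proof (rule bilinI)
  fix b assume "b \<in> \<H>"
  then show "linear_map K H Z (\<lambda>a. f (spl i x a b))"
    using assms mlinD[of f "spl i x \<one>\<^sub>H b" i] by (simp add: spl_left[of i x _ b, symmetric])
next
  fix a assume "a \<in> \<H>"
  then show "linear_map K H Z (\<lambda>b. f (spl i x a b))"
    using assms mlinD[of f "spl i x a \<one>\<^sub>H" "Suc i"] by (simp add: spl_right[of i x a, symmetric])
qed

text \<open>In slot \<open>i\<close> linearity comes from \<Delta> followed by the induced map of a
  bilinear one; the other slots are merely renumbered by the split.\<close>

lemma mlin_spl:
  assumes f: "mlin f" shows "mlin (\<lambda>x. sw Z (\<Delta> (x i)) (\<lambda>a b. f (spl i x a b)))"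
proof (rule mlinI)
  fix x j assume x: "x \<in> W"
  show "linear_map K H Z (\<lambda>c. sw Z (\<Delta> ((x(j := c)) i)) (\<lambda>a b. f (spl i (x(j := c)) a b)))"
  proof (cases "j = i")
    case True
    then show ?thesis
      using linear_map_comp[OF Delta_lin linear_map_sw[OF mH mH mZ bilin_spl[OF f x]]]
      by (simp add: spl_upd_same)
  next
    case False
    have "linear_map K H Z (\<lambda>c. sw Z (\<Delta> (x i)) (\<lambda>a b. f ((spl i x a b)((if j < i then j else Suc j) := c))))"
      using x by (intro linear_map_sw_param[OF mH mH mH mZ] mlinD[OF f]) auto
    then show ?thesis using False by (simp add: spl_upd)
  qed
qed

end

section \<open>Formal tensors as functionals\<close>

context quasi_hopf_val
begin

text \<open>
  A tensor over \<open>H\<close> is represented by the functional \<open>f \<mapsto> \<Sum> f(x)\<close> on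
      multilinear functions of words,
  which does not depend on how the tensor is written as a sum of words \<open>x\<close>. The junk value for other
  functions makes functionals equal as soon as they agree on multilinear ones.
\<close>

definition sem :: "(nat \<Rightarrow> 'h) list \<Rightarrow> ((nat \<Rightarrow> 'h) \<Rightarrow> 'z) \<Rightarrow> 'z"
  where "sem xs = (\<lambda>f. if mlin f then lsum Z (map f xs) else undefined)"

text \<open>Functionals given by finite sums of words; finiteness is what makes two of them
  interchangeable (\<open>M_fubini\<close>).\<close>

definition M :: "(((nat \<Rightarrow> 'h) \<Rightarrow> 'z) \<Rightarrow> 'z) set"
  where "M = {sem xs | xs. set xs \<subseteq> W}"

definition sgl :: "(nat \<Rightarrow> 'h) \<Rightarrow> ((nat \<Rightarrow> 'h) \<Rightarrow> 'z) \<Rightarrow> 'z"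
  where "sgl x = (\<lambda>f. if mlin f then f x else undefined)"

text \<open>Kleisli extension of a map on words, with \<open>sgl\<close> as unit. Coproduct, unit,
  counit and product are all of this form, so their properties reduce to single words.\<close>

definition bnd :: "(((nat \<Rightarrow> 'h) \<Rightarrow> 'z) \<Rightarrow> 'z) \<Rightarrow> ((nat \<Rightarrow> 'h) \<Rightarrow> ((nat \<Rightarrow> 'h) \<Rightarrow> 'z) \<Rightarrow> 'z) \<Rightarrow> ((nat \<Rightarrow> 'h) \<Rightarrow> 'z) \<Rightarrow> 'z"
  where "bnd t k = (\<lambda>f. if mlin f then t (\<lambda>x. k x f) else undefined)"

text \<open>The second condition ensures that in \<open>bnd t k\<close> the functional
  \<open>t\<close> is applied to a multilinear function; otherwise its value would be junk.\<close>

definition kern :: "((nat \<Rightarrow> 'h) \<Rightarrow> ((nat \<Rightarrow> 'h) \<Rightarrow> 'z) \<Rightarrow> 'z) \<Rightarrow> bool"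
  where "kern k \<longleftrightarrow> (\<forall>x\<in>W. k x \<in> M) \<and> (\<forall>f. mlin f \<longrightarrow> mlin (\<lambda>x. k x f))"

lemma ME:
  assumes "t \<in> M"
  obtains xs where "set xs \<subseteq> W" "\<And>f. t f = (if mlin f then lsum Z (map f xs) else undefined)"
  using assms by (auto simp: M_def sem_def)

lemma semM: "set xs \<subseteq> W \<Longrightarrow> sem xs \<in> M"
  by (auto simp: M_def)

lemma M_cong: "t \<in> M \<Longrightarrow> (\<And>x. x \<in> W \<Longrightarrow> f x = g x) \<Longrightarrow> t f = t g"
proof (erule ME)
  fix xs assume fg: "\<And>x. x \<in> W \<Longrightarrow> f x = g x" and xs: "set xs \<subseteq> W"
    "\<And>f. t f = (if mlin f then lsum Z (map f xs) else undefined)"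
  have "map f xs = map g xs" using fg xs(1) by auto
  moreover have "mlin f = mlin g" using mlin_cong[of f g] mlin_cong[of g f] fg by metis
  ultimately show "t f = t g" by (simp only: xs(2))
qed

lemma M_closed: "t \<in> M \<Longrightarrow> mlin f \<Longrightarrow> t f \<in> carrier Z"
proof (erule ME)
  fix xs assume "mlin f" and xs: "set xs \<subseteq> W"
    "\<And>f. t f = (if mlin f then lsum Z (map f xs) else undefined)"
  then show "t f \<in> carrier Z" using xs(1) by (auto simp: xs(2) intro!: Z.lsum_map_closed mlin_closed)
qed

lemma M_ext: "s \<in> M \<Longrightarrow> t \<in> M \<Longrightarrow> (\<And>f. mlin f \<Longrightarrow> s f = t f) \<Longrightarrow> s = t"
  by (elim ME) (auto simp: fun_eq_iff)

lemma sgl_M [simp]: "x \<in> W \<Longrightarrow> sgl x \<in> M"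
proof -
  assume x: "x \<in> W"
  have "sgl x = sem [x]" using mlin_closed[OF _ x] by (auto simp: sgl_def sem_def fun_eq_iff)
  then show ?thesis using semM[of "[x]"] x by simp
qed

lemma sgl_eval [simp]: "mlin f \<Longrightarrow> sgl x f = f x"
  by (simp add: sgl_def)

lemma bnd_eval: "mlin f \<Longrightarrow> bnd t k f = t (\<lambda>x. k x f)"
  by (simp add: bnd_def)

lemma kernD: "kern k \<Longrightarrow> x \<in> W \<Longrightarrow> k x \<in> M" "kern k \<Longrightarrow> mlin f \<Longrightarrow> mlin (\<lambda>x. k x f)"
  by (auto simp: kern_def)

lemma bnd_M: "t \<in> M \<Longrightarrow> kern k \<Longrightarrow> bnd t k \<in> M"
proof (erule ME)
  fix xs assume k: "kern k" and xs: "set xs \<subseteq> W"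
    "\<And>f. t f = (if mlin f then lsum Z (map f xs) else undefined)"
  \<comment> \<open>A list is chosen for every word; concatenating the choices along a list for
    \<open>t\<close> presents the composite.\<close>
  have "\<forall>x\<in>W. \<exists>ys. set ys \<subseteq> W \<and> k x = sem ys"
    using k unfolding kern_def M_def by blast
  then obtain ks where ks: "\<And>x. x \<in> W \<Longrightarrow> set (ks x) \<subseteq> W" "\<And>x. x \<in> W \<Longrightarrow> k x = sem (ks x)"
    by metis
  have "bnd t k = sem (concat (map ks xs))"
  proof
    fix f
    show "bnd t k f = sem (concat (map ks xs)) f"
    proof (cases "mlin f")
      case True
      have "bnd t k f = lsum Z (map (\<lambda>x. k x f) xs)"
        using True kernD(2)[OF k True] by (simp add: bnd_eval xs(2))
      also have "map (\<lambda>x. k x f) xs = map (\<lambda>x. lsum Z (map f (ks x))) xs"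
        using True ks(2) xs(1) by (auto simp: sem_def)
      also have "lsum Z \<dots> = lsum Z (concat (map (\<lambda>x. map f (ks x)) xs))"
        using xs(1) ks(1) mlin_closed[OF True] by (intro Z.lsum_concat[symmetric]) auto
      finally show ?thesis using True by (simp add: sem_def map_concat comp_def)
    qed (simp add: bnd_def sem_def)
  qed
  moreover have "set (concat (map ks xs)) \<subseteq> W" using xs(1) ks(1) by auto
  ultimately show "bnd t k \<in> M" using semM by metis
qed

text \<open>Summing out one of two multilinear variables leaves a function multilinear in the other;
  this keeps iterated evaluations away from the junk value.\<close>

lemma M_param:
  assumes t: "t \<in> M" and g: "\<And>x. x \<in> W \<Longrightarrow> mlin (g x)" "\<And>y. y \<in> W \<Longrightarrow> mlin (\<lambda>x. g x y)"
  shows "mlin (\<lambda>x. t (g x))"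
proof (rule ME[OF t])
  fix xs assume xs: "set xs \<subseteq> W" "\<And>f. t f = (if mlin f then lsum Z (map f xs) else undefined)"
  show "mlin (\<lambda>x. t (g x))"
  proof (rule mlinI)
    fix x i assume x: "x \<in> W"
    have "linear_map K H Z (\<lambda>a. lsum Z (map (\<lambda>y. g (x(i := a)) y) xs))"
      using x xs(1) by (intro linear_map_sum[OF mH mZ] mlinD[OF g(2)]) auto
    then show "linear_map K H Z (\<lambda>a. t (g (x(i := a))))"
      by (rule linear_map_cong[OF _ mH]) (use x g(1) in \<open>simp add: xs(2)\<close>)
  qed
qed

text \<open>Both functionals are finite sums over words, so two finite sums are exchanged; the
  multilinearity assumptions guarantee that neither side meets the junk value.\<close>

lemma M_fubini:
  assumes s: "s \<in> M" and t: "t \<in> M"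
    and g: "\<And>x. x \<in> W \<Longrightarrow> mlin (g x)" "\<And>y. y \<in> W \<Longrightarrow> mlin (\<lambda>x. g x y)"
  shows "s (\<lambda>x. t (g x)) = t (\<lambda>y. s (\<lambda>x. g x y))"
proof -
  obtain xs where xs: "set xs \<subseteq> W" "\<And>f. s f = (if mlin f then lsum Z (map f xs) else undefined)"
    using ME[OF s] by metis
  obtain ys where ys: "set ys \<subseteq> W" "\<And>f. t f = (if mlin f then lsum Z (map f ys) else undefined)"
    using ME[OF t] by metis
  have "s (\<lambda>x. t (g x)) = lsum Z (map (\<lambda>x. t (g x)) xs)"
    using M_param[OF t g] by (simp add: xs(2))
  also have "\<dots> = lsum Z (map (\<lambda>x. lsum Z (map (g x) ys)) xs)"
    using g(1) xs(1) by (intro arg_cong[where f="lsum Z"] map_cong) (auto simp: ys(2))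
  also have "\<dots> = lsum Z (map (\<lambda>y. lsum Z (map (\<lambda>x. g x y) xs)) ys)"
    using xs(1) ys(1) g(1) mlin_closed by (intro Z.lsum_swap) blast
  also have "\<dots> = lsum Z (map (\<lambda>y. s (\<lambda>x. g x y)) ys)"
    using g(2) ys(1) by (intro arg_cong[where f="lsum Z"] map_cong) (auto simp: xs(2))
  also have "\<dots> = t (\<lambda>y. s (\<lambda>x. g x y))"
    using M_param[OF s g(2) g(1)] by (simp add: ys(2))
  finally show ?thesis .
qed

definition star :: "(((nat \<Rightarrow> 'h) \<Rightarrow> 'z) \<Rightarrow> 'z) \<Rightarrow> (((nat \<Rightarrow> 'h) \<Rightarrow> 'z) \<Rightarrow> 'z) \<Rightarrow> ((nat \<Rightarrow> 'h) \<Rightarrow> 'z) \<Rightarrow> 'z"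
    (infixl \<open>\<star>\<close> 70)
  where "s \<star> t = bnd s (\<lambda>x. bnd t (\<lambda>y. sgl (wmul x y)))"

definition one_M :: "((nat \<Rightarrow> 'h) \<Rightarrow> 'z) \<Rightarrow> 'z" where "one_M = sgl unit_word"

text \<open>
  \<open>D i\<close>, \<open>U i\<close> and \<open>E i\<close> apply the comultiplication, the unit and the
      counit at slot \<open>i\<close>, counted from \<open>0\<close>.
  \<open>E i\<close> does not delete the slot but fills it with a multiple of \<open>1\<close>, so that later
      slots keep their numbers.
\<close>

definition D :: "nat \<Rightarrow> (((nat \<Rightarrow> 'h) \<Rightarrow> 'z) \<Rightarrow> 'z) \<Rightarrow> ((nat \<Rightarrow> 'h) \<Rightarrow> 'z) \<Rightarrow> 'z"
  where "D i t = bnd t (\<lambda>x f. if mlin f then sw Z (\<Delta> (x i)) (\<lambda>a b. f (spl i x a b)) else undefined)"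

definition U :: "nat \<Rightarrow> (((nat \<Rightarrow> 'h) \<Rightarrow> 'z) \<Rightarrow> 'z) \<Rightarrow> ((nat \<Rightarrow> 'h) \<Rightarrow> 'z) \<Rightarrow> 'z"
  where "U i t = bnd t (\<lambda>x. sgl (ins i x))"

definition E :: "nat \<Rightarrow> (((nat \<Rightarrow> 'h) \<Rightarrow> 'z) \<Rightarrow> 'z) \<Rightarrow> ((nat \<Rightarrow> 'h) \<Rightarrow> 'z) \<Rightarrow> 'z"
  where "E i t = bnd t (\<lambda>x. sgl (epsw i x))"

lemma one_M [simp]: "one_M \<in> M"
  by (simp add: one_M_def)

lemma one_eval: "mlin f \<Longrightarrow> one_M f = f unit_word"
  by (simp add: one_M_def)

lemma kern_sgl: "(\<And>x. x \<in> W \<Longrightarrow> r x \<in> W) \<Longrightarrow> (\<And>f. mlin f \<Longrightarrow> mlin (\<lambda>x. f (r x))) \<Longrightarrow> kern (\<lambda>x. sgl (r x))"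
  by (simp add: kern_def)

lemma kern_wmul: "x \<in> W \<Longrightarrow> kern (\<lambda>y. sgl (wmul x y))"
  by (rule kern_sgl) (auto intro: mlin_wmul_right)

lemma mlin_star: "t \<in> M \<Longrightarrow> mlin f \<Longrightarrow> mlin (\<lambda>x. t (\<lambda>y. f (wmul x y)))"
  by (rule M_param[OF _ mlin_wmul_right mlin_wmul_left])

lemma kern_star: "t \<in> M \<Longrightarrow> kern (\<lambda>x. bnd t (\<lambda>y. sgl (wmul x y)))"
  unfolding kern_def
proof (intro conjI ballI allI impI)
  fix f assume "t \<in> M" "mlin f"
  then show "mlin (\<lambda>x. bnd t (\<lambda>y. sgl (wmul x y)) f)"
    using mlin_star by (simp add: bnd_eval)
qed (rule bnd_M[OF _ kern_wmul])

lemma star_M [simp]: "s \<in> M \<Longrightarrow> t \<in> M \<Longrightarrow> s \<star> t \<in> M"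
  unfolding star_def by (intro bnd_M kern_star)

lemma star_eval: "mlin f \<Longrightarrow> (s \<star> t) f = s (\<lambda>x. t (\<lambda>y. f (wmul x y)))"
  by (simp add: star_def bnd_eval)

lemma kern_spl: "kern (\<lambda>x f. if mlin f then sw Z (\<Delta> (x i)) (\<lambda>a b. f (spl i x a b)) else undefined)"
  unfolding kern_def
proof (intro conjI ballI allI impI)
  fix x assume x: "x \<in> W"
  let ?xs = "map (\<lambda>(a, b). spl i x a b) (terms (\<Delta> (x i)))"
  have "(\<lambda>f. if mlin f then sw Z (\<Delta> (x i)) (\<lambda>a b. f (spl i x a b)) else undefined) = sem ?xs"
    by (auto simp: sem_def sw_def fun_eq_iff comp_def split_def)
  moreover have "set ?xs \<subseteq> W"
    using terms_carrier'[OF mH mH, of "\<Delta> (x i)"] x by auto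
  ultimately show "(\<lambda>f. if mlin f then sw Z (\<Delta> (x i)) (\<lambda>a b. f (spl i x a b)) else undefined) \<in> M"
    using semM by metis
qed (simp add: mlin_spl)

lemma kern_ins: "kern (\<lambda>x. sgl (ins i x))"
  by (rule kern_sgl) (auto intro: mlin_ins)

lemma kern_epsw: "kern (\<lambda>x. sgl (epsw i x))"
  by (rule kern_sgl) (auto intro: mlin_epsw)

lemma D_M [simp]: "t \<in> M \<Longrightarrow> D i t \<in> M"
  unfolding D_def by (intro bnd_M kern_spl)

lemma U_M [simp]: "t \<in> M \<Longrightarrow> U i t \<in> M"
  unfolding U_def by (intro bnd_M kern_ins)

lemma E_M [simp]: "t \<in> M \<Longrightarrow> E i t \<in> M"
  unfolding E_def by (intro bnd_M kern_epsw)

lemma D_eval: "mlin f \<Longrightarrow> D i t f = t (\<lambda>x. sw Z (\<Delta> (x i)) (\<lambda>a b. f (spl i x a b)))"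
  by (simp add: D_def bnd_eval)

lemma U_eval: "mlin f \<Longrightarrow> U i t f = t (\<lambda>x. f (ins i x))"
  by (simp add: U_def bnd_eval)

lemma E_eval: "mlin f \<Longrightarrow> E i t f = t (\<lambda>x. f (epsw i x))"
  by (simp add: E_def bnd_eval)

lemma star_assoc: "r \<in> M \<Longrightarrow> s \<in> M \<Longrightarrow> t \<in> M \<Longrightarrow> r \<star> s \<star> t = r \<star> (s \<star> t)"
proof (rule M_ext)
  fix f assume M: "r \<in> M" "s \<in> M" "t \<in> M" and f: "mlin f"
  have "(r \<star> s \<star> t) f = r (\<lambda>x. s (\<lambda>y. t (\<lambda>z. f (wmul (wmul x y) z))))"
    by (simp add: star_eval[OF f] star_eval[OF mlin_star[OF M(3) f]])
  also have "\<dots> = r (\<lambda>x. (s \<star> t) (\<lambda>y. f (wmul x y)))"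
  proof (rule M_cong[OF M(1)])
    fix x assume x: "x \<in> W"
    show "s (\<lambda>y. t (\<lambda>z. f (wmul (wmul x y) z))) = (s \<star> t) (\<lambda>y. f (wmul x y))"
      unfolding star_eval[OF mlin_wmul_right[OF f x]]
      by (intro M_cong[OF M(2)] M_cong[OF M(3)]) (simp add: wmul_assoc x)
  qed
  also have "\<dots> = (r \<star> (s \<star> t)) f"
    by (simp add: star_eval[OF f])
  finally show "(r \<star> s \<star> t) f = (r \<star> (s \<star> t)) f" .
qed auto

lemma star_one [simp]:
  assumes t: "t \<in> M" shows "one_M \<star> t = t" "t \<star> one_M = t"
proof -
  have "(one_M \<star> t) f = t f" if f: "mlin f" for f
    using t by (simp add: star_eval[OF f] one_eval[OF mlin_star[OF t f]]) (auto intro: M_cong)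
  then show "one_M \<star> t = t" using t by (auto intro!: M_ext)
  have "(t \<star> one_M) f = t f" if f: "mlin f" for f
    unfolding star_eval[OF f] by (rule M_cong[OF t]) (simp add: one_eval mlin_wmul_right[OF f])
  then show "t \<star> one_M = t" using t by (auto intro!: M_ext)
qed

text \<open>A map on words that is multiplicative into the functionals extends to a multiplicative
  operator. The two sides evaluate in different orders; \<open>M_fubini\<close> moves the sum for
  \<open>t\<close> inside \<open>k x\<close>.\<close>

lemma bnd_hom:
  assumes k: "kern k" "\<And>x y. x \<in> W \<Longrightarrow> y \<in> W \<Longrightarrow> k (wmul x y) = k x \<star> k y"
    and M: "s \<in> M" "t \<in> M"
  shows "bnd (s \<star> t) k = bnd s k \<star> bnd t k"
proof (rule M_ext)
  fix f assume f: "mlin f"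
  have fk: "mlin (\<lambda>x. k x f)" by (rule kernD(2)[OF k(1) f])
  have "bnd (s \<star> t) k f = s (\<lambda>x. t (\<lambda>y. k (wmul x y) f))"
    by (simp add: bnd_eval[OF f] star_eval[OF fk])
  also have "\<dots> = s (\<lambda>x. k x (\<lambda>x'. bnd t k (\<lambda>y'. f (wmul x' y'))))"
  proof (rule M_cong[OF M(1)])
    fix x assume x: "x \<in> W"
    have "t (\<lambda>y. k (wmul x y) f) = t (\<lambda>y. k x (\<lambda>x'. k y (\<lambda>y'. f (wmul x' y'))))"
      by (rule M_cong[OF M(2)]) (simp add: k(2) x star_eval[OF f])
    also have "\<dots> = k x (\<lambda>x'. t (\<lambda>y. k y (\<lambda>y'. f (wmul x' y'))))"
      by (rule M_fubini[OF M(2) kernD(1)[OF k(1) x]])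
        (rule mlin_star[OF kernD(1)[OF k(1)] f] kernD(2)[OF k(1) mlin_wmul_right[OF f]]; assumption)+
    also have "\<dots> = k x (\<lambda>x'. bnd t k (\<lambda>y'. f (wmul x' y')))"
      by (rule M_cong[OF kernD(1)[OF k(1) x]]) (simp add: bnd_eval[OF mlin_wmul_right[OF f]])
    finally show "t (\<lambda>y. k (wmul x y) f) = k x (\<lambda>x'. bnd t k (\<lambda>y'. f (wmul x' y')))" .
  qed
  also have "\<dots> = (bnd s k \<star> bnd t k) f"
    by (simp add: star_eval[OF f] bnd_eval[OF mlin_star[OF bnd_M[OF M(2) k(1)] f]])
  finally show "bnd (s \<star> t) k f = (bnd s k \<star> bnd t k) f" .
qed (simp_all add: M k(1) bnd_M)

lemma sgl_star:
  assumes "x \<in> W" "y \<in> W" shows "sgl x \<star> sgl y = sgl (wmul x y)"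
proof (rule M_ext)
  fix f assume f: "mlin f"
  show "(sgl x \<star> sgl y) f = sgl (wmul x y) f"
    using assms
    by (simp add: star_eval[OF f] sgl_eval[OF mlin_star[OF sgl_M f]] sgl_eval[OF mlin_wmul_right[OF f]] f)
qed (simp_all add: assms)

lemma U_star: "s \<in> M \<Longrightarrow> t \<in> M \<Longrightarrow> U i (s \<star> t) = U i s \<star> U i t"
  unfolding U_def by (rule bnd_hom[OF kern_ins]) (simp_all add: ins_wmul sgl_star)

lemma epsw_wmul:
  assumes x: "x \<in> W" and y: "y \<in> W" shows "epsw i (wmul x y) = wmul (epsw i x) (epsw i y)"
proof
  fix j
  have "(\<epsilon> a \<odot>\<^bsub>H\<^esub> \<one>\<^sub>H) \<cdot> (\<epsilon> b \<odot>\<^bsub>H\<^esub> \<one>\<^sub>H) = \<epsilon> (a \<cdot> b) \<odot>\<^bsub>H\<^esub> \<one>\<^sub>H" if "a \<in> \<H>" "b \<in> \<H>" for a b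
    using that by (simp add: smult_mult_left eps_mult smult_assoc1)
  then show "epsw i (wmul x y) j = wmul (epsw i x) (epsw i y) j"
    using x y by (simp add: epsw_def wmul_def)
qed

lemma E_star: "s \<in> M \<Longrightarrow> t \<in> M \<Longrightarrow> E i (s \<star> t) = E i s \<star> E i t"
  unfolding E_def by (rule bnd_hom[OF kern_epsw]) (simp_all add: epsw_wmul sgl_star)

text \<open>Multiplicativity of \<Delta> in the split slot, through \<open>H2.sw_mult\<close>; the
  other slots multiply letterwise by \<open>spl_wmul\<close>.\<close>

lemma D_star: "s \<in> M \<Longrightarrow> t \<in> M \<Longrightarrow> D i (s \<star> t) = D i s \<star> D i t"
  unfolding D_def
proof (rule bnd_hom[OF kern_spl])
  let ?k = "\<lambda>x f. if mlin f then sw Z (\<Delta> (x i)) (\<lambda>a b. f (spl i x a b)) else undefined"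
  fix x y assume xy: "x \<in> W" "y \<in> W"
  show "?k (wmul x y) = ?k x \<star> ?k y"
  proof (rule M_ext)
    fix f assume f: "mlin f"
    have "?k (wmul x y) f = sw Z (\<Delta> (x i) \<otimes>\<^bsub>H2\<^esub> \<Delta> (y i)) (\<lambda>a b. f (spl i (wmul x y) a b))"
      using f xy by (simp add: wmul_def Delta_mult)
    also have "\<dots> = sw Z (\<Delta> (x i)) (\<lambda>a b. sw Z (\<Delta> (y i)) (\<lambda>c d. f (wmul (spl i x a b) (spl i y c d))))"
      using f xy by (subst H2.sw_mult[OF mZ bilin_spl]) (auto simp: spl_wmul)
    also have "\<dots> = (?k x \<star> ?k y) f"
      unfolding star_eval[OF f] using xy
      by (simp add: mlin_spl[OF mlin_wmul_right[OF f]] mlin_star[OF kernD(1)[OF kern_spl] f] f)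
        (auto intro!: sw_cong[OF mH mH] simp: mlin_wmul_right[OF f])
    finally show "?k (wmul x y) f = (?k x \<star> ?k y) f" .
  qed (use xy kernD(1)[OF kern_spl[of i]] in auto)
qed

lemma U_one [simp]: "U i one_M = one_M"
  by (rule M_ext) (simp_all add: U_eval one_eval[OF mlin_ins] one_eval)

lemma epsw_unit [simp]: "epsw i unit_word = unit_word"
  by (auto simp: epsw_def unit_word_def)

lemma E_one [simp]: "E i one_M = one_M"
  by (rule M_ext) (simp_all add: E_eval one_eval[OF mlin_epsw] one_eval)

lemma spl_unit: "spl i unit_word \<one>\<^sub>H \<one>\<^sub>H = unit_word"
  by (auto simp: spl_def ins_def unit_word_def)

lemma D_one [simp]: "D i one_M = one_M"
proof (rule M_ext)
  fix f assume f: "mlin f"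
  have "D i one_M f = sw Z (\<Delta> \<one>\<^sub>H) (\<lambda>a b. f (spl i unit_word a b))"
    by (simp add: D_eval[OF f] one_eval[OF mlin_spl[OF f]]) (simp add: unit_word_def)
  then show "D i one_M f = one_M f"
    using f by (simp add: Delta_one sw_pure[OF mH mH mZ bilin_spl] spl_unit one_eval)
qed auto

end

section \<open>Commutation of the structure maps\<close>

context quasi_hopf
begin

definition wcons :: "'b \<Rightarrow> (nat \<Rightarrow> 'b) \<Rightarrow> nat \<Rightarrow> 'b" (infixr \<open>##\<close> 65)
  where "h ## x = (\<lambda>i. case i of 0 \<Rightarrow> h | Suc j \<Rightarrow> x j)"

lemma wcons_simps [simp]:
  "(h ## x) 0 = h" "(h ## x) (Suc i) = x i"
  "(h ## x)(0 := a) = a ## x" "(h ## x)(Suc i := a) = h ## x(i := a)"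
  by (auto simp: wcons_def fun_eq_iff split: nat.split)

lemma W_wcons [simp]: "h \<in> \<H> \<Longrightarrow> x \<in> W \<Longrightarrow> h ## x \<in> W"
  by (rule WE[of x], assumption) (rule_tac n="Suc n" in WI; simp add: wcons_def split: nat.split)

lemma unit_wcons [simp]: "\<one>\<^sub>H ## unit_word = unit_word"
  by (auto simp: wcons_def unit_word_def fun_eq_iff split: nat.split)

lemma wcons_unfold: "x 0 ## (\<lambda>i. x (Suc i)) = x"
  by (auto simp: wcons_def fun_eq_iff split: nat.split)

lemma W_tl [simp]: "x \<in> W \<Longrightarrow> (\<lambda>i. x (Suc i)) \<in> W"
  by (rule WE[of x], assumption) (rule_tac n="n" in WI; simp)

lemma W_cases:
  assumes "x \<in> W" obtains h y where "x = h ## y" "h \<in> \<H>" "y \<in> W"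
  using wcons_unfold[of x] W_tl[OF assms] W_closed[OF assms] by metis

lemma wmul_wcons [simp]: "wmul (g ## x) (h ## y) = g \<cdot> h ## wmul x y"
  by (auto simp: wcons_def wmul_def fun_eq_iff split: nat.split)

lemma ins_wcons [simp]: "ins 0 x = \<one>\<^sub>H ## x" "ins (Suc i) (h ## x) = h ## ins i x"
  by (auto simp: wcons_def ins_def fun_eq_iff split: nat.split)

lemma spl_wcons [simp]: "spl 0 (h ## x) a b = a ## b ## x" "spl (Suc i) (h ## x) a b = h ## spl i x a b"
  by (simp_all add: spl_def)

lemma epsw_wcons [simp]: "epsw 0 (h ## x) = (\<epsilon> h \<odot>\<^bsub>H\<^esub> \<one>\<^sub>H) ## x" "epsw (Suc i) (h ## x) = h ## epsw i x"
  by (simp_all add: epsw_def)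

lemma unit_word_apply [simp]: "unit_word i = \<one>\<^sub>H"
  by (simp add: unit_word_def)

lemma unit_word_upd: "unit_word(0 := a) = a ## unit_word" "unit_word(Suc i := a) = \<one>\<^sub>H ## unit_word(i := a)"
  by (auto simp: wcons_def unit_word_def fun_eq_iff split: nat.split)

lemma ins_ins: "i < j \<Longrightarrow> ins j (ins i x) = ins i (ins (j - 1) x)"
  by (auto simp: ins_def fun_eq_iff)

lemma spl_ins_greater: "i < j \<Longrightarrow> spl j (ins i x) a b = ins i (spl (j - 1) x a b)"
  by (auto simp: spl_def ins_def fun_eq_iff)

lemma spl_ins_same: "spl i (ins i x) \<one>\<^sub>H \<one>\<^sub>H = ins i (ins i x)"
  by (auto simp: spl_def ins_def fun_eq_iff)

lemma spl_spl: "Suc i < j \<Longrightarrow> spl j (spl i x a b) c d = spl i (spl (j - 1) x c d) a b"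
  by (auto simp: spl_def ins_def fun_eq_iff)

lemma epsw_ins_greater: "i < j \<Longrightarrow> epsw j (ins i x) = ins i (epsw (j - 1) x)"
  by (auto simp: epsw_def ins_def fun_eq_iff)

lemma epsw_ins_same: "epsw i (ins i x) = ins i x"
  by (auto simp: epsw_def ins_def fun_eq_iff)

lemma epsw_spl_less: "j < i \<Longrightarrow> epsw j (spl i x a b) = spl i (epsw j x) a b"
  by (auto simp: epsw_def spl_def ins_def fun_eq_iff)

lemma epsw_spl_greater: "Suc i < j \<Longrightarrow> epsw j (spl i x a b) = spl i (epsw (j - 1) x) a b"
  by (auto simp: epsw_def spl_def ins_def fun_eq_iff)

lemma spl_apply: "j < i \<Longrightarrow> spl i x a b j = x j" "Suc i < j \<Longrightarrow> spl i x a b j = x (j - 1)"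
  by (simp_all add: spl_def ins_def)

lemma counit_left_sw: "h \<in> \<H> \<Longrightarrow> sw H (\<Delta> h) (\<lambda>a b. \<epsilon> a \<odot>\<^bsub>H\<^esub> b) = h"
  using counit_left by (simp add: sw_def)

lemma counit_right_sw: "h \<in> \<H> \<Longrightarrow> sw H (\<Delta> h) (\<lambda>a b. \<epsilon> b \<odot>\<^bsub>H\<^esub> a) = h"
  using counit_right by (simp add: sw_def)

end

context quasi_hopf_val
begin

lemma U_U:
  assumes "t \<in> M" "i < j" shows "U j (U i t) = U i (U (j - 1) t)"
proof (rule M_ext)
  fix f assume f: "mlin f"
  show "U j (U i t) f = U i (U (j - 1) t) f"
    using assms
    by (simp add: U_eval[OF f] E_eval[OF f] U_eval[OF mlin_ins[OF f]] U_eval[OF mlin_epsw[OF f]]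
        E_eval[OF mlin_ins[OF f]] ins_ins)
qed (simp_all add: assms)

lemma D_U_greater:
  assumes t: "t \<in> M" and ij: "i < j" shows "D j (U i t) = U i (D (j - 1) t)"
proof (rule M_ext)
  fix f assume f: "mlin f"
  show "D j (U i t) f = U i (D (j - 1) t) f"
    using ij by (simp add: D_eval[OF f] U_eval[OF mlin_spl[OF f]] U_eval[OF f] D_eval[OF mlin_ins[OF f]]
        spl_ins_greater)
      (simp add: ins_def)
qed (simp_all add: t)

lemma D_U_same:
  assumes t: "t \<in> M" shows "D i (U i t) = U i (U i t)"
proof (rule M_ext)
  fix f assume f: "mlin f"
  have "D i (U i t) f = t (\<lambda>x. sw Z (\<Delta> \<one>\<^sub>H) (\<lambda>a b. f (spl i (ins i x) a b)))"
    by (simp add: D_eval[OF f] U_eval[OF mlin_spl[OF f]]) (simp add: ins_def)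
  also have "\<dots> = t (\<lambda>x. f (ins i (ins i x)))"
    by (rule M_cong[OF t]) (simp add: Delta_one sw_pure[OF mH mH mZ bilin_spl[OF f]] spl_ins_same)
  finally show "D i (U i t) f = U i (U i t) f"
    by (simp add: U_eval[OF f] U_eval[OF mlin_ins[OF f]])
qed (simp_all add: t)

text \<open>The gap between the slots makes the two splits independent. For neighbouring splits,
  \<open>j = Suc i\<close>, the corresponding equality fails in general: coassociativity holds up to
  conjugation by the associator (\<open>coassoc0\<close>).\<close>

lemma D_D:
  assumes t: "t \<in> M" and ij: "Suc i < j" shows "D j (D i t) = D i (D (j - 1) t)"
proof (rule M_ext)
  fix f assume f: "mlin f"
  have "D j (D i t) f = t (\<lambda>x. sw Z (\<Delta> (x i)) (\<lambda>a b. sw Z (\<Delta> (x (j - 1))) (\<lambda>c d. f (spl j (spl i x a b) c d))))"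
    using ij by (simp add: D_eval[OF f] D_eval[OF mlin_spl[OF f]] spl_apply)
  also have "\<dots> = t (\<lambda>x. sw Z (\<Delta> (x (j - 1))) (\<lambda>c d. sw Z (\<Delta> (x i)) (\<lambda>a b. f (spl i (spl (j - 1) x c d) a b))))"
    using ij by (intro M_cong[OF t]) (subst sw_swap[OF mH mH mH mH mZ]; auto simp: spl_spl intro: mlin_closed[OF f])
  also have "\<dots> = D i (D (j - 1) t) f"
    using ij by (simp add: D_eval[OF f] D_eval[OF mlin_spl[OF f]] spl_apply)
  finally show "D j (D i t) f = D i (D (j - 1) t) f" .
qed (simp_all add: t)

lemma E_U_greater:
  assumes "t \<in> M" "i < j" shows "E j (U i t) = U i (E (j - 1) t)"
proof (rule M_ext)
  fix f assume f: "mlin f"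
  show "E j (U i t) f = U i (E (j - 1) t) f"
    using assms
    by (simp add: U_eval[OF f] E_eval[OF f] U_eval[OF mlin_ins[OF f]] U_eval[OF mlin_epsw[OF f]]
        E_eval[OF mlin_ins[OF f]] epsw_ins_greater)
qed (simp_all add: assms)

lemma E_U_same:
  assumes "t \<in> M" shows "E i (U i t) = U i t"
proof (rule M_ext)
  fix f assume f: "mlin f"
  show "E i (U i t) f = U i t f"
    using assms
    by (simp add: U_eval[OF f] E_eval[OF f] U_eval[OF mlin_ins[OF f]] U_eval[OF mlin_epsw[OF f]]
        E_eval[OF mlin_ins[OF f]] epsw_ins_same)
qed (simp_all add: assms)

lemma E_D_less:
  assumes t: "t \<in> M" and ij: "j < i" shows "E j (D i t) = D i (E j t)"
proof (rule M_ext)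
  fix f assume f: "mlin f"
  show "E j (D i t) f = D i (E j t) f"
    using ij by (simp add: E_eval[OF f] D_eval[OF mlin_epsw[OF f]] D_eval[OF f] E_eval[OF mlin_spl[OF f]]
        epsw_spl_less)
      (simp add: epsw_def)
qed (simp_all add: t)

lemma E_D_greater:
  assumes t: "t \<in> M" and ij: "Suc i < j" shows "E j (D i t) = D i (E (j - 1) t)"
proof (rule M_ext)
  fix f assume f: "mlin f"
  have ne: "(i = j - Suc 0) = False" using ij by simp
  show "E j (D i t) f = D i (E (j - 1) t) f"
    using ij
    by (simp add: E_eval[OF f] D_eval[OF mlin_epsw[OF f]] D_eval[OF f] E_eval[OF mlin_spl[OF f]] epsw_spl_greater)
      (simp add: epsw_def ne)
qed (simp_all add: t)

lemma mlin_smult: "mlin f \<Longrightarrow> x \<in> W \<Longrightarrow> c \<in> carrier K \<Longrightarrow> a \<in> \<H> \<Longrightarrow>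
    f (x(i := c \<odot>\<^bsub>H\<^esub> a)) = c \<odot>\<^bsub>Z\<^esub> f (x(i := a))"
  using linear_map_smult[OF mlinD] .

text \<open>Counit axiom. The result is \<open>U i t\<close> instead of \<open>t\<close> because
  \<open>E i\<close> leaves the emptied slot in place.\<close>

lemma E_D_left:
  assumes t: "t \<in> M" shows "E i (D i t) = U i t"
proof (rule M_ext)
  fix f assume f: "mlin f"
  have "sw Z (\<Delta> (x i)) (\<lambda>a b. f (epsw i (spl i x a b))) = f (ins i x)" if x: "x \<in> W" for x
  proof -
    \<comment> \<open>Multilinearity carries the scalar from slot \<open>i\<close> over to the
      letter \<open>b\<close>, where the counit axiom can use it.\<close>
    have "f (epsw i (spl i x a b)) = f ((ins i x)(Suc i := \<epsilon> a \<odot>\<^bsub>H\<^esub> b))"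
      if ab: "a \<in> \<H>" "b \<in> \<H>" for a b
    proof -
      let ?y = "(ins i x)(Suc i := b)"
      have "epsw i (spl i x a b) = ?y(i := \<epsilon> a \<odot>\<^bsub>H\<^esub> \<one>\<^sub>H)"
        by (auto simp: epsw_def spl_def ins_def fun_eq_iff)
      moreover have "?y(i := \<one>\<^sub>H) = ?y" by (auto simp: ins_def)
      ultimately show ?thesis
        using mlin_smult[OF f, of ?y "\<epsilon> a" "\<one>\<^sub>H" i] mlin_smult[OF f, of "ins i x" "\<epsilon> a" b "Suc i"] x ab by simp
    qed
    then have "sw Z (\<Delta> (x i)) (\<lambda>a b. f (epsw i (spl i x a b))) =
        sw Z (\<Delta> (x i)) (\<lambda>a b. f ((ins i x)(Suc i := \<epsilon> a \<odot>\<^bsub>H\<^esub> b)))"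
      using x by (intro sw_cong[OF mH mH]) auto
    also have "\<dots> = f ((ins i x)(Suc i := sw H (\<Delta> (x i)) (\<lambda>a b. \<epsilon> a \<odot>\<^bsub>H\<^esub> b)))"
      using x by (intro linear_map_apply_sw[OF mH mH mH mZ mlinD[OF f], symmetric]) auto
    also have "(ins i x)(Suc i := sw H (\<Delta> (x i)) (\<lambda>a b. \<epsilon> a \<odot>\<^bsub>H\<^esub> b)) = ins i x"
      using x by (auto simp: counit_left_sw ins_def)
    finally show ?thesis .
  qed
  then show "E i (D i t) f = U i t f"
    by (simp add: E_eval[OF f] D_eval[OF mlin_epsw[OF f]] U_eval[OF f]) (auto intro: M_cong[OF t])
qed (simp_all add: t)

lemma E_D_right:
  assumes t: "t \<in> M" shows "E (Suc i) (D i t) = U (Suc i) t"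
proof (rule M_ext)
  fix f assume f: "mlin f"
  have "sw Z (\<Delta> (x i)) (\<lambda>a b. f (epsw (Suc i) (spl i x a b))) = f (ins (Suc i) x)" if x: "x \<in> W" for x
  proof -
    have "f (epsw (Suc i) (spl i x a b)) = f ((ins (Suc i) x)(i := \<epsilon> b \<odot>\<^bsub>H\<^esub> a))"
      if ab: "a \<in> \<H>" "b \<in> \<H>" for a b
    proof -
      let ?y = "(ins (Suc i) x)(i := a)"
      have "epsw (Suc i) (spl i x a b) = ?y(Suc i := \<epsilon> b \<odot>\<^bsub>H\<^esub> \<one>\<^sub>H)"
        by (auto simp: epsw_def spl_def ins_def fun_eq_iff)
      moreover have "?y(Suc i := \<one>\<^sub>H) = ?y" by (auto simp: ins_def)
      ultimately show ?thesis
        using mlin_smult[OF f, of ?y "\<epsilon> b" "\<one>\<^sub>H" "Suc i"] mlin_smult[OF f, of "ins (Suc i) x" "\<epsilon> b" a i] x ab by simp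
    qed
    then have "sw Z (\<Delta> (x i)) (\<lambda>a b. f (epsw (Suc i) (spl i x a b))) =
        sw Z (\<Delta> (x i)) (\<lambda>a b. f ((ins (Suc i) x)(i := \<epsilon> b \<odot>\<^bsub>H\<^esub> a)))"
      using x by (intro sw_cong[OF mH mH]) auto
    also have "\<dots> = f ((ins (Suc i) x)(i := sw H (\<Delta> (x i)) (\<lambda>a b. \<epsilon> b \<odot>\<^bsub>H\<^esub> a)))"
      using x by (intro linear_map_apply_sw[OF mH mH mH mZ mlinD[OF f], symmetric]) auto
    also have "(ins (Suc i) x)(i := sw H (\<Delta> (x i)) (\<lambda>a b. \<epsilon> b \<odot>\<^bsub>H\<^esub> a)) = ins (Suc i) x"
      using x by (auto simp: counit_right_sw ins_def)
    finally show ?thesis .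
  qed
  then show "E (Suc i) (D i t) f = U (Suc i) t f"
    by (simp add: E_eval[OF f] D_eval[OF mlin_epsw[OF f]] U_eval[OF f]) (auto intro: M_cong[OF t])
qed (simp_all add: t)

text \<open>The last condition says that the operator is determined by its values on words.
  Composites of coproducts with multiplication by a fixed functional fall under this notion, so that
  naturality statements can be checked on one word by \<open>linop_ext\<close>.\<close>

definition linop :: "((((nat \<Rightarrow> 'h) \<Rightarrow> 'z) \<Rightarrow> 'z) \<Rightarrow> ((nat \<Rightarrow> 'h) \<Rightarrow> 'z) \<Rightarrow> 'z) \<Rightarrow> bool"
  where "linop P \<longleftrightarrow> (\<forall>t\<in>M. P t \<in> M) \<and> (\<forall>f. mlin f \<longrightarrow> mlin (\<lambda>x. P (sgl x) f)) \<and>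
    (\<forall>t\<in>M. \<forall>f. mlin f \<longrightarrow> P t f = t (\<lambda>x. P (sgl x) f))"

lemma linopD:
  assumes "linop P"
  shows "t \<in> M \<Longrightarrow> P t \<in> M" "mlin f \<Longrightarrow> mlin (\<lambda>x. P (sgl x) f)" "t \<in> M \<Longrightarrow> mlin f \<Longrightarrow> P t f = t (\<lambda>x. P (sgl x) f)"
  using assms unfolding linop_def by blast+

lemma linop_ext:
  assumes "linop P" "linop Q" "t \<in> M" "\<And>x. x \<in> W \<Longrightarrow> P (sgl x) = Q (sgl x)"
  shows "P t = Q t"
proof (rule M_ext)
  fix f assume f: "mlin f"
  show "P t f = Q t f"
    unfolding linopD(3)[OF assms(1,3) f] linopD(3)[OF assms(2,3) f]
    by (rule M_cong[OF assms(3)]) (simp add: assms(4))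
qed (simp_all add: linopD(1)[OF assms(1,3)] linopD(1)[OF assms(2,3)])

lemma linop_bnd: "kern k \<Longrightarrow> linop (\<lambda>t. bnd t k)"
  unfolding linop_def
proof (intro conjI ballI allI impI)
  fix f assume k: "kern k" and f: "mlin f"
  note m = kernD(2)[OF k f]
  have e: "bnd (sgl x) k f = k x f" for x by (simp add: bnd_eval[OF f] sgl_eval[OF m])
  show "mlin (\<lambda>x. bnd (sgl x) k f)" using m by (simp only: e)
  fix t show "bnd t k f = t (\<lambda>x. bnd (sgl x) k f)" unfolding e by (rule bnd_eval[OF f])
qed (rule bnd_M)

lemma linop_D: "linop (D i)" using linop_bnd[OF kern_spl] by (simp add: D_def[abs_def])

lemma linop_comp:
  assumes P: "linop P" and Q: "linop Q" shows "linop (\<lambda>t. P (Q t))"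
  unfolding linop_def
proof (intro conjI ballI allI impI)
  have e: "P (Q t) f = Q t (\<lambda>x. P (sgl x) f)" if "t \<in> M" "mlin f" for t f
    using that linopD[OF P] linopD[OF Q] by blast
  fix f assume f: "mlin f"
  have g: "mlin (\<lambda>x. P (sgl x) f)" by (rule linopD(2)[OF P f])
  show "mlin (\<lambda>x. P (Q (sgl x)) f)"
    by (rule mlin_cong[OF _ linopD(2)[OF Q g]]) (simp add: e[OF _ f])
  fix t assume t: "t \<in> M"
  have "P (Q t) f = t (\<lambda>x. Q (sgl x) (\<lambda>x. P (sgl x) f))"
    unfolding e[OF t f] by (rule linopD(3)[OF Q t g])
  also have "\<dots> = t (\<lambda>x. P (Q (sgl x)) f)"
    by (rule M_cong[OF t]) (simp only: e[OF sgl_M f])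
  finally show "P (Q t) f = t (\<lambda>x. P (Q (sgl x)) f)" .
qed (simp add: linopD(1)[OF P] linopD(1)[OF Q])

lemma linop_star_right:
  assumes c: "c \<in> M" shows "linop (\<lambda>t. t \<star> c)"
  unfolding linop_def
proof (intro conjI ballI allI impI)
  fix f assume f: "mlin f"
  note m = mlin_star[OF c f]
  have e: "(sgl x \<star> c) f = c (\<lambda>y. f (wmul x y))" for x
    by (simp add: star_eval[OF f] sgl_eval[OF m])
  show "mlin (\<lambda>x. (sgl x \<star> c) f)" using m by (simp only: e)
  fix t show "(t \<star> c) f = t (\<lambda>x. (sgl x \<star> c) f)" unfolding e by (rule star_eval[OF f])
qed (simp add: c)

lemma linop_star_left:
  assumes c: "c \<in> M" shows "linop (\<lambda>t. c \<star> t)"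
  unfolding linop_def
proof (intro conjI ballI allI impI)
  fix f assume f: "mlin f"
  have e: "(c \<star> sgl x) f = c (\<lambda>y. f (wmul y x))" if x: "x \<in> W" for x
    unfolding star_eval[OF f] by (rule M_cong[OF c]) (simp add: mlin_wmul_right[OF f])
  have m: "mlin (\<lambda>x. c (\<lambda>y. f (wmul y x)))"
    by (rule M_param[OF c mlin_wmul_left[OF f] mlin_wmul_right[OF f]])
  show "mlin (\<lambda>x. (c \<star> sgl x) f)" by (rule mlin_cong[OF _ m]) (simp add: e)
  fix t assume t: "t \<in> M"
  have "(c \<star> t) f = t (\<lambda>x. c (\<lambda>y. f (wmul y x)))"
    unfolding star_eval[OF f] by (rule M_fubini[OF c t mlin_wmul_right[OF f] mlin_wmul_left[OF f]])
  also have "\<dots> = t (\<lambda>x. (c \<star> sgl x) f)" by (rule M_cong[OF t]) (simp add: e)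
  finally show "(c \<star> t) f = t (\<lambda>x. (c \<star> sgl x) f)" .
qed (simp add: c)

end

section \<open>Evaluation of tensors over \<^term>\<open>H\<close>\<close>

context quasi_hopf_val
begin

lemma mlin_wcons: "mlin f \<Longrightarrow> h \<in> \<H> \<Longrightarrow> mlin (\<lambda>x. f (h ## x))"
proof (rule mlinI)
  fix x i assume "mlin f" "h \<in> \<H>" "x \<in> W"
  then show "linear_map K H Z (\<lambda>a. f (h ## x(i := a)))"
    using mlinD[of f "h ## x" "Suc i"] by simp
qed

lemma wcons_lin: "mlin f \<Longrightarrow> x \<in> W \<Longrightarrow> linear_map K H Z (\<lambda>h. f (h ## x))"
  using mlinD[of f "\<one>\<^sub>H ## x" 0] by simp

lemma M_lin:
  assumes t: "t \<in> M" and Y: "module K Y" and g: "\<And>u. u \<in> carrier Y \<Longrightarrow> mlin (g u)"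
    "\<And>y. y \<in> W \<Longrightarrow> linear_map K Y Z (\<lambda>u. g u y)"
  shows "linear_map K Y Z (\<lambda>u. t (g u))"
proof (rule ME[OF t])
  fix xs assume xs: "set xs \<subseteq> W" "\<And>f. t f = (if mlin f then lsum Z (map f xs) else undefined)"
  have "linear_map K Y Z (\<lambda>u. lsum Z (map (\<lambda>y. g u y) xs))"
    using xs(1) by (intro linear_map_sum[OF Y mZ] g(2)) auto
  then show "linear_map K Y Z (\<lambda>u. t (g u))"
    by (rule linear_map_cong[OF _ Y]) (use g(1) in \<open>simp add: xs(2)\<close>)
qed

lemma mlin_sw:
  assumes "module K V" "module K V'" "s \<in> carrier (tensor K V V')"
    "\<And>a b. a \<in> carrier V \<Longrightarrow> b \<in> carrier V' \<Longrightarrow> mlin (g a b)"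
  shows "mlin (\<lambda>x. sw Z s (\<lambda>a b. g a b x))"
  using assms by (intro mlinI linear_map_sw_param[OF assms(1,2) mH mZ assms(3)]) (auto intro: mlinD)

text \<open>Fubini between a functional and a Sweedler sum: once more two finite sums are
  exchanged.\<close>

lemma M_sw:
  assumes t: "t \<in> M" and s: "module K V" "module K V'" "s \<in> carrier (tensor K V V')"
    and g: "\<And>a b. a \<in> carrier V \<Longrightarrow> b \<in> carrier V' \<Longrightarrow> mlin (g a b)"
  shows "t (\<lambda>x. sw Z s (\<lambda>a b. g a b x)) = sw Z s (\<lambda>a b. t (g a b))"
proof (rule ME[OF t])
  fix xs assume xs: "set xs \<subseteq> W" "\<And>f. t f = (if mlin f then lsum Z (map f xs) else undefined)"
  note c = terms_carrier'[OF s]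
  have m: "mlin (\<lambda>x. sw Z s (\<lambda>a b. g a b x))" by (rule mlin_sw[OF s g])
  have "t (\<lambda>x. sw Z s (\<lambda>a b. g a b x)) = lsum Z (map (\<lambda>x. sw Z s (\<lambda>a b. g a b x)) xs)"
    by (simp add: xs(2) m)
  also have "\<dots> = lsum Z (map (\<lambda>x. lsum Z (map (\<lambda>p. g (fst p) (snd p) x) (terms s))) xs)"
    by (simp add: sw_def split_def)
  also have "\<dots> = lsum Z (map (\<lambda>p. lsum Z (map (\<lambda>x. g (fst p) (snd p) x) xs)) (terms s))"
    using xs(1) c g mlin_closed by (intro Z.lsum_swap) (metis prod.collapse subsetD)
  also have "\<dots> = sw Z s (\<lambda>a b. t (g a b))"
    unfolding sw_def using c g by (intro arg_cong[where f="lsum Z"] map_cong) (auto simp: xs(2))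
  finally show ?thesis .
qed

text \<open>Follows the right nesting of the tensor types: \<open>e\<close> evaluates the tail and
  the leg in \<open>H\<close> becomes the first letter. Iteration gives \<open>ev2\<close> to
  \<open>ev5\<close>.\<close>

definition ev_tensor ::
  "('a \<Rightarrow> ((nat \<Rightarrow> 'h) \<Rightarrow> 'z) \<Rightarrow> 'z) \<Rightarrow> ('h, 'a) tens \<Rightarrow> ((nat \<Rightarrow> 'h) \<Rightarrow> 'z) \<Rightarrow> 'z"
  where "ev_tensor e t = (\<lambda>f. if mlin f then sw Z t (\<lambda>h a. e a (\<lambda>x. f (h ## x))) else undefined)"

definition eval_hom :: "('k, 'a, 'n) module_scheme \<Rightarrow> ('a \<Rightarrow> ((nat \<Rightarrow> 'h) \<Rightarrow> 'z) \<Rightarrow> 'z) \<Rightarrow> bool"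
  where "eval_hom A e \<longleftrightarrow> (\<forall>a\<in>carrier A. e a \<in> M) \<and> (\<forall>f. mlin f \<longrightarrow> linear_map K A Z (\<lambda>a. e a f)) \<and>
    (\<forall>a\<in>carrier A. \<forall>b\<in>carrier A. e (a \<otimes>\<^bsub>A\<^esub> b) = e a \<star> e b) \<and> e \<one>\<^bsub>A\<^esub> = one_M"

lemma eval_homD:
  assumes "eval_hom A e"
  shows "a \<in> carrier A \<Longrightarrow> e a \<in> M" "mlin f \<Longrightarrow> linear_map K A Z (\<lambda>a. e a f)"
    "a \<in> carrier A \<Longrightarrow> b \<in> carrier A \<Longrightarrow> e (a \<otimes>\<^bsub>A\<^esub> b) = e a \<star> e b" "e \<one>\<^bsub>A\<^esub> = one_M"
  using assms unfolding eval_hom_def by blast+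

lemma kern_wcons: "h \<in> \<H> \<Longrightarrow> kern (\<lambda>x. sgl (h ## x))"
  by (rule kern_sgl) (auto intro: mlin_wcons)

lemma ev_tensor_bilin:
  assumes A: "module K A" and e: "eval_hom A e" and f: "mlin f"
  shows "bilin K H A Z (\<lambda>h a. e a (\<lambda>x. f (h ## x)))"
proof (rule bilinI)
  fix h assume "h \<in> \<H>"
  then show "linear_map K A Z (\<lambda>a. e a (\<lambda>x. f (h ## x)))"
    by (intro eval_homD(2)[OF e] mlin_wcons[OF f])
next
  fix a assume a: "a \<in> carrier A"
  show "linear_map K H Z (\<lambda>h. e a (\<lambda>x. f (h ## x)))"
    by (rule M_lin[OF eval_homD(1)[OF e a] mH mlin_wcons[OF f] wcons_lin[OF f]])
qed

lemma ev_tensor_eval: "mlin f \<Longrightarrow> ev_tensor e t f = sw Z t (\<lambda>h a. e a (\<lambda>x. f (h ## x)))"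
  by (simp add: ev_tensor_def)

text \<open>Membership in \<open>M\<close> requires a list of words; it is assembled from lists for
  the functionals \<open>e a\<close> attached to the terms of \<open>t\<close>.\<close>

lemma ev_tensor_M:
  assumes A: "module K A" and e: "eval_hom A e" and t: "t \<in> carrier (tensor K H A)"
  shows "ev_tensor e t \<in> M"
proof -
  have "\<exists>ys. set ys \<subseteq> W \<and> bnd (e a) (\<lambda>x. sgl (h ## x)) = sem ys"
    if "h \<in> \<H>" "a \<in> carrier A" for h a
    using bnd_M[OF eval_homD(1)[OF e that(2)] kern_wcons[OF that(1)]] unfolding M_def by blast
  then obtain ks where ks: "\<And>h a. h \<in> \<H> \<Longrightarrow> a \<in> carrier A \<Longrightarrow> set (ks h a) \<subseteq> W"
    "\<And>h a. h \<in> \<H> \<Longrightarrow> a \<in> carrier A \<Longrightarrow> bnd (e a) (\<lambda>x. sgl (h ## x)) = sem (ks h a)"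
    by metis
  note c = terms_carrier'[OF mH A t]
  let ?ys = "concat (map (\<lambda>p. ks (fst p) (snd p)) (terms t))"
  have ks_W: "set (ks (fst p) (snd p)) \<subseteq> W" if "p \<in> set (terms t)" for p
    using ks(1)[of "fst p" "snd p"] c[of "fst p" "snd p"] that by simp
  then have W: "set ?ys \<subseteq> W" by (simp only: set_concat set_map) blast
  have "ev_tensor e t = sem ?ys"
  proof
    fix f
    show "ev_tensor e t f = sem ?ys f"
    proof (cases "mlin f")
      case True
      have *: "e a (\<lambda>x. f (h ## x)) = lsum Z (map f (ks h a))" if "(h, a) \<in> set (terms t)" for h a
      proof -
        have "e a (\<lambda>x. sgl (h ## x) f) = lsum Z (map f (ks h a))"
          using fun_cong[OF ks(2)[OF c[OF that]], of f] by (simp add: bnd_eval[OF True] sem_def True)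
        then show ?thesis by (simp only: sgl_eval[OF True])
      qed
      have "ev_tensor e t f = lsum Z (map (\<lambda>p. lsum Z (map f (ks (fst p) (snd p)))) (terms t))"
        unfolding ev_tensor_eval[OF True] sw_def
        by (intro arg_cong[where f="lsum Z"] map_cong HOL.refl) (simp add: split_def *)
      also have "\<dots> = lsum Z (concat (map (\<lambda>p. map f (ks (fst p) (snd p))) (terms t)))"
        using ks_W mlin_closed[OF True] by (intro Z.lsum_concat[symmetric]) (simp only: set_map, blast)
      finally show ?thesis using True by (simp add: sem_def map_concat comp_def split_def)
    qed (simp add: ev_tensor_def sem_def)
  qed
  then show ?thesis using semM[OF W] by simp
qed

text \<open>Induction step on the number of legs. The product in \<open>H \<otimes> A\<close>
  multiplies letter by letter, as \<open>star\<close> does on words; the work lies in moving the sum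
  over \<open>t\<close> inside the functional \<open>e a\<close>.\<close>

lemma eval_hom_tensor:
  assumes A: "k_algebra K A" and e: "eval_hom A e"
  shows "eval_hom (tensor K H A) (ev_tensor e)"
proof -
  interpret A: k_algebra K A by fact
  interpret T: tensor_algebra K H A by (simp add: tensor_algebra_def A k_algebra_axioms)
  note b = ev_tensor_bilin[OF A.module_self e]
  show ?thesis
    unfolding eval_hom_def
  proof (intro conjI ballI allI impI)
    fix t assume "t \<in> carrier (tensor K H A)"
    then show "ev_tensor e t \<in> M" by (rule ev_tensor_M[OF A.module_self e])
  next
    fix f assume f: "mlin f"
    show "linear_map K (tensor K H A) Z (\<lambda>t. ev_tensor e t f)"
      unfolding ev_tensor_eval[OF f] by (rule linear_map_sw[OF mH A.module_self mZ b[OF f]])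
  next
    fix s t assume s: "s \<in> carrier (tensor K H A)" and t: "t \<in> carrier (tensor K H A)"
    note sM = ev_tensor_M[OF A.module_self e s] and tM = ev_tensor_M[OF A.module_self e t]
    show "ev_tensor e (s \<otimes>\<^bsub>tensor K H A\<^esub> t) = ev_tensor e s \<star> ev_tensor e t"
    proof (rule M_ext)
      fix f assume f: "mlin f"
      have "ev_tensor e (s \<otimes>\<^bsub>tensor K H A\<^esub> t) f =
          sw Z s (\<lambda>h a. sw Z t (\<lambda>g b. e (a \<otimes>\<^bsub>A\<^esub> b) (\<lambda>x. f (h \<cdot> g ## x))))"
        unfolding ev_tensor_eval[OF f] by (rule T.sw_mult[OF mZ b[OF f] s t])
      also have "\<dots> = sw Z s (\<lambda>h a. e a (\<lambda>x. ev_tensor e t (\<lambda>y. f (wmul (h ## x) y))))"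
      proof (rule sw_cong[OF mH A.module_self s])
        fix h a assume h: "h \<in> \<H>" and a: "a \<in> carrier A"
        have "sw Z t (\<lambda>g b. e (a \<otimes>\<^bsub>A\<^esub> b) (\<lambda>x. f (h \<cdot> g ## x))) =
            sw Z t (\<lambda>g b. e a (\<lambda>x. e b (\<lambda>y. f (wmul (h ## x) (g ## y)))))" (is "?lhs = _")
        proof (rule sw_cong[OF mH A.module_self t])
          fix g b assume gb: "g \<in> \<H>" "b \<in> carrier A"
          then show "e (a \<otimes>\<^bsub>A\<^esub> b) (\<lambda>x. f (h \<cdot> g ## x)) = e a (\<lambda>x. e b (\<lambda>y. f (wmul (h ## x) (g ## y))))"
            using h a by (simp add: eval_homD(3)[OF e] star_eval[OF mlin_wcons[OF f]])
        qed
        also have "\<dots> = e a (\<lambda>x. sw Z t (\<lambda>g b. e b (\<lambda>y. f (wmul (h ## x) (g ## y)))))"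
        proof (rule M_sw[OF eval_homD(1)[OF e a] mH A.module_self t, symmetric])
          fix g b assume gb: "g \<in> \<H>" "b \<in> carrier A"
          show "mlin (\<lambda>x. e b (\<lambda>y. f (wmul (h ## x) (g ## y))))"
            using mlin_star[OF eval_homD(1)[OF e gb(2)] mlin_wcons[OF f], of "h \<cdot> g"] h gb by simp
        qed
        also have "\<dots> = e a (\<lambda>x. ev_tensor e t (\<lambda>y. f (wmul (h ## x) y)))" (is "_ = ?rhs")
          by (rule M_cong[OF eval_homD(1)[OF e a]]) (simp add: ev_tensor_eval mlin_wmul_right[OF f] h)
        finally show "?lhs = ?rhs" .
      qed
      also have "\<dots> = (ev_tensor e s \<star> ev_tensor e t) f"
        by (simp add: star_eval[OF f] ev_tensor_eval[OF mlin_star[OF tM f]])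
      finally show "ev_tensor e (s \<otimes>\<^bsub>tensor K H A\<^esub> t) f = (ev_tensor e s \<star> ev_tensor e t) f" .
    qed (use sM tM s t in \<open>auto intro: ev_tensor_M[OF A.module_self e] T.mult_closed\<close>)
  next
    show "ev_tensor e \<one>\<^bsub>tensor K H A\<^esub> = one_M"
    proof (rule M_ext)
      fix f assume f: "mlin f"
      show "ev_tensor e \<one>\<^bsub>tensor K H A\<^esub> f = one_M f"
        by (simp add: ev_tensor_eval[OF f] T.one_pure sw_pure[OF mH A.module_self mZ b[OF f]]
            eval_homD(4)[OF e] one_eval[OF mlin_wcons[OF f]] one_eval[OF f])
    qed (use T.T_one_closed in \<open>auto intro: ev_tensor_M[OF A.module_self e]\<close>)
  qed
qed

definition ev1 :: "'h \<Rightarrow> ((nat \<Rightarrow> 'h) \<Rightarrow> 'z) \<Rightarrow> 'z" where "ev1 h = sgl (h ## unit_word)"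
definition "ev2 = ev_tensor ev1"
definition "ev3 = ev_tensor ev2"
definition "ev4 = ev_tensor ev3"
definition "ev5 = ev_tensor ev4"

lemma eval_hom1: "eval_hom H ev1"
  unfolding eval_hom_def
  by (auto simp: ev1_def one_M_def sgl_star sgl_eval wcons_lin)

lemma eval_hom2: "eval_hom H2 ev2"
  unfolding ev2_def by (rule eval_hom_tensor[OF k_algebra_axioms eval_hom1])

lemma eval_hom3: "eval_hom H3 ev3"
  unfolding ev3_def by (rule eval_hom_tensor[OF H2.tensor_k_algebra eval_hom2])

lemma eval_hom4: "eval_hom H4 ev4"
  unfolding ev4_def by (rule eval_hom_tensor[OF H3.tensor_k_algebra eval_hom3])

lemma eval_hom5: "eval_hom H5 ev5"
  unfolding ev5_def by (rule eval_hom_tensor[OF H4.tensor_k_algebra eval_hom4])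

lemmas ev_M [simp] = eval_homD(1)[OF eval_hom1] eval_homD(1)[OF eval_hom2] eval_homD(1)[OF eval_hom3]
  eval_homD(1)[OF eval_hom4] eval_homD(1)[OF eval_hom5]

lemma ev_tensor_tens:
  assumes "module K A" "eval_hom A e" "mlin f" "set xs \<subseteq> \<H> \<times> carrier A"
  shows "ev_tensor e (tens K H A xs) f = lsum Z (map (\<lambda>(h, a). e a (\<lambda>x. f (h ## x))) xs)"
  unfolding ev_tensor_eval[OF assms(3)]
  by (rule sw_tens[OF mH assms(1) mZ ev_tensor_bilin[OF assms(1-3)] assms(4)])

lemma ev2_tens:
  assumes f: "mlin f" and xs: "set xs \<subseteq> \<H> \<times> \<H>"
  shows "ev2 (tens2 xs) f = lsum Z (map (\<lambda>(a, b). f (a ## b ## unit_word)) xs)"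
  unfolding ev2_def ev_tensor_tens[OF mH eval_hom1 f xs] using xs
  by (intro arg_cong[where f="lsum Z"] map_cong) (auto simp: ev1_def mlin_wcons[OF f])

lemma ev3_tens:
  assumes f: "mlin f" and xs: "set xs \<subseteq> \<H> \<times> \<H> \<times> \<H>"
  shows "ev3 (tens3 xs) f = lsum Z (map (\<lambda>(a, b, c). f (a ## b ## c ## unit_word)) xs)"
proof -
  have c: "a \<in> \<H> \<and> b \<in> \<H> \<and> c \<in> \<H>" if "(a, b, c) \<in> set xs" for a b c
    using subsetD[OF xs that] by simp
  have sub: "set [(a, tens2 [(b, c)]). (a, b, c) \<leftarrow> xs] \<subseteq> \<H> \<times> carrier H2"
    by (auto dest!: c intro!: tens_closed)
  have "ev3 (tens3 xs) f = lsum Z (map (\<lambda>(a, b, c). ev2 (tens2 [(b, c)]) (\<lambda>x. f (a ## x))) xs)"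
    unfolding ev3_def ev_tensor_tens[OF mH2 eval_hom2 f sub] by (simp add: comp_def split_def)
  also have "\<dots> = lsum Z (map (\<lambda>(a, b, c). f (a ## b ## c ## unit_word)) xs)"
  proof (intro arg_cong[where f="lsum Z"] map_cong HOL.refl)
    fix p assume p: "p \<in> set xs"
    obtain a b c where [simp]: "p = (a, b, c)" by (cases p)
    show "(case p of (a, b, c) \<Rightarrow> ev2 (tens2 [(b, c)]) (\<lambda>x. f (a ## x))) = (case p of (a, b, c) \<Rightarrow> f (a ## b ## c
        ## unit_word))"
      using ev2_tens[OF mlin_wcons[OF f], of a "[(b, c)]"] mlin_closed[OF f, of "a ## b ## c ## unit_word"]
          c[of a b c] p by simp
  qed
  finally show ?thesis .
qed

lemma tens3_closed:
  assumes xs: "set xs \<subseteq> \<H> \<times> \<H> \<times> \<H>" shows "tens3 xs \<in> carrier H3"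
proof -
  have c: "a \<in> \<H> \<and> b \<in> \<H> \<and> c \<in> \<H>" if "(a, b, c) \<in> set xs" for a b c
    using subsetD[OF xs that] by simp
  show ?thesis by (rule tens_closed) (auto dest!: c intro!: tens_closed)
qed

lemma ev4_tens:
  assumes f: "mlin f" and xs: "set xs \<subseteq> \<H> \<times> \<H> \<times> \<H> \<times> \<H>"
  shows "ev4 (tens4 xs) f = lsum Z (map (\<lambda>(a, b, c, d). f (a ## b ## c ## d ## unit_word)) xs)" (is "_ = ?B")
proof -
  have c: "a \<in> \<H> \<and> b \<in> \<H> \<and> c \<in> \<H> \<and> d \<in> \<H>" if "(a, b, c, d) \<in> set xs" for a b c d
    using subsetD[OF xs that] by simp
  have sub: "set [(a, tens3 [(b, c, d)]). (a, b, c, d) \<leftarrow> xs] \<subseteq> \<H> \<times> carrier H3"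
    by (auto dest!: c intro!: tens_closed)
  have "ev4 (tens4 xs) f = lsum Z (map (\<lambda>(a, b, c, d). ev3 (tens3 [(b, c, d)]) (\<lambda>x. f (a ## x))) xs)"
    unfolding ev4_def ev_tensor_tens[OF mH3 eval_hom3 f sub] by (simp add: comp_def split_def)
  also have "\<dots> = ?B"
  proof (intro arg_cong[where f="lsum Z"] map_cong HOL.refl)
    fix p assume p: "p \<in> set xs"
    obtain a b c d where [simp]: "p = (a, b, c, d)" by (cases p)
    show "(case p of (a, b, c, d) \<Rightarrow> ev3 (tens3 [(b, c, d)]) (\<lambda>x. f (a ## x))) = (case p of (a, b, c, d) \<Rightarrow> f (a
        ## b ## c ## d ## unit_word))"
      using ev3_tens[OF mlin_wcons[OF f], of a "[(b, c, d)]"] mlin_closed[OF f, of "a ## b ## c ## d ##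
          unit_word"] c[of a b c d] p by simp
  qed
  finally show ?thesis .
qed

lemma tens4_closed:
  assumes xs: "set xs \<subseteq> \<H> \<times> \<H> \<times> \<H> \<times> \<H>" shows "tens4 xs \<in> carrier H4"
proof -
  have c: "a \<in> \<H> \<and> b \<in> \<H> \<and> c \<in> \<H> \<and> d \<in> \<H>" if "(a, b, c, d) \<in> set xs" for a b c d
    using subsetD[OF xs that] by simp
  show ?thesis by (rule tens_closed) (auto dest!: c intro!: tens_closed)
qed

lemma ev5_tens:
  assumes f: "mlin f" and xs: "set xs \<subseteq> \<H> \<times> \<H> \<times> \<H> \<times> \<H> \<times> \<H>"
  shows "ev5 (tens5 xs) f = lsum Z (map (\<lambda>(a, b, c, d, e). f (a ## b ## c ## d ## e ## unit_word)) xs)" (is "_ = ?B")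
proof -
  have c: "a \<in> \<H> \<and> b \<in> \<H> \<and> c \<in> \<H> \<and> d \<in> \<H> \<and> e \<in> \<H>" if "(a, b, c, d, e) \<in> set xs" for a b c d e
    using subsetD[OF xs that] by simp
  have sub: "set [(a, tens4 [(b, c, d, e)]). (a, b, c, d, e) \<leftarrow> xs] \<subseteq> \<H> \<times> carrier H4"
    by (auto dest!: c intro!: tens_closed)
  have "ev5 (tens5 xs) f = lsum Z (map (\<lambda>(a, b, c, d, e). ev4 (tens4 [(b, c, d, e)]) (\<lambda>x. f (a ## x))) xs)"
    unfolding ev5_def ev_tensor_tens[OF mH4 eval_hom4 f sub] by (simp add: comp_def split_def)
  also have "\<dots> = ?B"
  proof (intro arg_cong[where f="lsum Z"] map_cong HOL.refl)
    fix p assume p: "p \<in> set xs"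
    obtain a b c d e where [simp]: "p = (a, b, c, d, e)" by (cases p)
    show "(case p of (a, b, c, d, e) \<Rightarrow> ev4 (tens4 [(b, c, d, e)]) (\<lambda>x. f (a ## x))) = (case p of (a, b, c, d,
        e) \<Rightarrow> f (a ## b ## c ## d ## e ## unit_word))"
      using ev4_tens[OF mlin_wcons[OF f], of a "[(b, c, d, e)]"] mlin_closed[OF f, of "a ## b ## c ## d ## e ##
          unit_word"] c[of a b c d e] p by simp
  qed
  finally show ?thesis .
qed

lemma tens5_closed:
  assumes xs: "set xs \<subseteq> \<H> \<times> \<H> \<times> \<H> \<times> \<H> \<times> \<H>" shows "tens5 xs \<in> carrier H5"
proof -
  have c: "a \<in> \<H> \<and> b \<in> \<H> \<and> c \<in> \<H> \<and> d \<in> \<H> \<and> e \<in> \<H>" if "(a, b, c, d, e) \<in> set xs" for a b c d e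
    using subsetD[OF xs that] by simp
  show ?thesis by (rule tens_closed) (auto dest!: c intro!: tens_closed)
qed

end

section \<open>The associator and the pentagon\<close>

context quasi_hopf
begin

lemma H3_monoid: "Group.monoid H3"
  using H3.tensor_k_algebra by (simp add: k_algebra_def ring_def)

lemma phi_closed [simp]: "\<phi> \<in> carrier H3"
  using associator by (simp add: Units_def)

lemma phi_inv_closed [simp]: "\<phi>inv \<in> carrier H3"
  unfolding phi_inv_def using Group.monoid.Units_inv_closed[OF H3_monoid associator] .

lemma phi_inv_mult: "\<phi> \<otimes>\<^bsub>H3\<^esub> \<phi>inv = \<one>\<^bsub>H3\<^esub>" "\<phi>inv \<otimes>\<^bsub>H3\<^esub> \<phi> = \<one>\<^bsub>H3\<^esub>"
  unfolding phi_inv_def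
  using Group.monoid.Units_r_inv[OF H3_monoid associator] Group.monoid.Units_l_inv[OF H3_monoid associator] .

lemma terms3_eq: "terms3 t = concat (map (\<lambda>p. map (\<lambda>q. (fst p, fst q, snd q)) (terms (snd p))) (terms t))"
  by (simp add: terms3_def split_def)

lemma terms3_carrier:
  assumes "t \<in> carrier H3" "(a, b, c) \<in> set (terms3 t)"
  shows "a \<in> \<H> \<and> b \<in> \<H> \<and> c \<in> \<H>"
proof -
  obtain t' where "(a, t') \<in> set (terms t)" "(b, c) \<in> set (terms t')"
    using assms(2) by (auto simp: terms3_eq)
  then show ?thesis
    using terms_carrier'[OF mH mH2 assms(1)] terms_carrier'[OF mH mH] by blast
qed

lemma terms_Delta_carrier:
  "h \<in> \<H> \<Longrightarrow> (a, b) \<in> set (terms (\<Delta> h)) \<Longrightarrow> a \<in> \<H> \<and> b \<in> \<H>"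
  using terms_carrier'[OF mH mH Delta_closed] by blast

end

definition sw3 :: "('z, 'm) ring_scheme \<Rightarrow> ('u, ('v, 'w) tens) tens \<Rightarrow> ('u \<Rightarrow> 'v \<Rightarrow> 'w \<Rightarrow> 'z) \<Rightarrow> 'z"
  where "sw3 Z t F = lsum Z (map (\<lambda>(a, b, c). F a b c) (terms3 t))"

lemma lsum_map_terms: "lsum Z (map g (map (\<lambda>(a, b). p a b) (terms t))) = sw Z t (\<lambda>a b. g (p a b))"
  by (simp add: sw_def comp_def split_def)

lemma lsum_map_terms3: "lsum Z (map g (map (\<lambda>(a, b, c). p a b c) (terms3 t))) = sw3 Z t (\<lambda>a b c. g (p a b c))"
  by (simp add: sw3_def comp_def split_def)

lemma lsum_map_Pair: "lsum Z (map g (map (Pair a) (terms t))) = sw Z t (\<lambda>b c. g (a, b, c))"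
  by (simp add: sw_def comp_def split_def)

lemma lsum_map_Pair3: "lsum Z (map g (map (Pair a) (terms3 t))) = sw3 Z t (\<lambda>b c d. g (a, b, c, d))"
  by (simp add: sw3_def comp_def split_def)

lemma (in abelian_monoid) lsum_bind_terms:
  assumes "\<And>a b p. (a, b) \<in> set (terms t) \<Longrightarrow> p \<in> set (L a b) \<Longrightarrow> g p \<in> carrier G"
  shows "lsum G (map g (concat (map (\<lambda>(a, b). L a b) (terms t)))) = sw G t (\<lambda>a b. lsum G (map g (L a b)))"
proof -
  have "set (map g (L (fst x) (snd x))) \<subseteq> carrier G" if "x \<in> set (terms t)" for x
    using assms[of "fst x" "snd x"] that by auto
  from lsum_concat[OF this] show ?thesis by (simp add: sw_def map_concat comp_def split_def)
qed

lemma (in abelian_monoid) lsum_bind_terms3: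
  assumes "\<And>a b c p. (a, b, c) \<in> set (terms3 t) \<Longrightarrow> p \<in> set (L a b c) \<Longrightarrow> g p \<in> carrier G"
  shows "lsum G (map g (concat (map (\<lambda>(a, b, c). L a b c) (terms3 t)))) = sw3 G t (\<lambda>a b c. lsum G (map g (L a b c)))"
proof -
  have "set (map g (L (fst x) (fst (snd x)) (snd (snd x)))) \<subseteq> carrier G" if "x \<in> set (terms3 t)" for x
    using assms[of "fst x" "fst (snd x)" "snd (snd x)"] that by auto
  from lsum_concat[OF this] show ?thesis by (simp add: sw3_def map_concat comp_def split_def)
qed

context quasi_hopf
begin

lemma sw3_cong:
  assumes "t \<in> carrier H3"
    "\<And>a b c. \<lbrakk>a \<in> \<H>; b \<in> \<H>; c \<in> \<H>\<rbrakk> \<Longrightarrow> F a b c = G a b c"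
  shows "sw3 Z t F = sw3 Z t G"
  unfolding sw3_def using assms(2) terms3_carrier[OF assms(1)]
  by (intro arg_cong[where f="lsum Z"] map_cong) auto

end

context quasi_hopf_val
begin

lemma sw3_closed:
  assumes "t \<in> carrier H3"
    "\<And>a b c. \<lbrakk>a \<in> \<H>; b \<in> \<H>; c \<in> \<H>\<rbrakk> \<Longrightarrow> F a b c \<in> carrier Z"
  shows "sw3 Z t F \<in> carrier Z"
  unfolding sw3_def using assms(2) terms3_carrier[OF assms(1)] by (intro Z.lsum_map_closed) auto

lemma sw3_sw:
  assumes t: "t \<in> carrier H3"
    and F: "\<And>a b c. \<lbrakk>a \<in> \<H>; b \<in> \<H>; c \<in> \<H>\<rbrakk> \<Longrightarrow> F a b c \<in> carrier Z"
  shows "sw3 Z t F = sw Z t (\<lambda>a t'. sw Z t' (F a))"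
proof -
  note c1 = terms_carrier'[OF mH mH2 t] and c2 = terms_carrier'[OF mH mH]
  have "sw3 Z t F = lsum Z (map (\<lambda>(a, b, c). F a b c)
      (concat (map (\<lambda>(a, t'). map (\<lambda>(b, c). (a, b, c)) (terms t')) (terms t))))"
    by (simp add: sw3_def terms3_def)
  also have "\<dots> = sw Z t (\<lambda>a t'. lsum Z (map (\<lambda>(a, b, c). F a b c) (map (\<lambda>(b, c). (a, b, c)) (terms t'))))"
  proof (rule Z.lsum_bind_terms)
    fix a t' p assume "(a, t') \<in> set (terms t)" "p \<in> set (map (\<lambda>(b, c). (a, b, c)) (terms t'))"
    then show "(case p of (a, b, c) \<Rightarrow> F a b c) \<in> carrier Z" using c1[of a t'] c2[of t'] F by auto
  qed
  finally show ?thesis by (simp only: lsum_map_terms) simp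
qed

lemma ev2_eval: "t \<in> carrier H2 \<Longrightarrow> mlin f \<Longrightarrow> ev2 t f = sw Z t (\<lambda>a b. f (a ## b ## unit_word))"
  unfolding ev2_def
  by (simp add: ev_tensor_eval) (auto intro!: sw_cong[OF mH mH] simp: ev1_def mlin_wcons)

lemma ev3_eval:
  assumes t: "t \<in> carrier H3" and f: "mlin f"
  shows "ev3 t f = sw3 Z t (\<lambda>a b c. f (a ## b ## c ## unit_word))"
proof -
  have "ev3 t f = sw Z t (\<lambda>a t'. sw Z t' (\<lambda>b c. f (a ## b ## c ## unit_word)))"
    unfolding ev3_def ev_tensor_eval[OF f]
    by (rule sw_cong[OF mH mH2 t]) (simp add: ev2_eval mlin_wcons[OF f])
  then show ?thesis using mlin_closed[OF f] by (simp add: sw3_sw[OF t])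
qed

definition PH :: "((nat \<Rightarrow> 'h) \<Rightarrow> 'z) \<Rightarrow> 'z" where "PH = ev3 \<phi>"

definition PI :: "((nat \<Rightarrow> 'h) \<Rightarrow> 'z) \<Rightarrow> 'z" where "PI = ev3 \<phi>inv"

lemma PH_M [simp]: "PH \<in> M" and PI_M [simp]: "PI \<in> M"
  by (simp_all add: PH_def PI_def)

lemma PH_eval: "mlin f \<Longrightarrow> PH f = sw3 Z \<phi> (\<lambda>a b c. f (a ## b ## c ## unit_word))"
  by (simp add: PH_def ev3_eval)

lemma PI_eval: "mlin f \<Longrightarrow> PI f = sw3 Z \<phi>inv (\<lambda>a b c. f (a ## b ## c ## unit_word))"
  by (simp add: PI_def ev3_eval)

lemma PH_PI [simp]: "PH \<star> PI = one_M" "PI \<star> PH = one_M"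
  unfolding PH_def PI_def
  using eval_homD(3)[OF eval_hom3 phi_closed phi_inv_closed] eval_homD(3)[OF eval_hom3 phi_inv_closed phi_closed]
  by (simp_all add: phi_inv_mult eval_homD(4)[OF eval_hom3])

text \<open>From slot 3 on all letters are 1, and inserting, splitting or evaluating a letter 1
  changes nothing. As simplification rules these identities erase operators beyond the
  support.\<close>

lemma ev3_supp:
  assumes t: "t \<in> carrier H3"
  shows "U (Suc (Suc (Suc k))) (ev3 t) = ev3 t" "E (Suc (Suc (Suc k))) (ev3 t) = ev3 t"
    "D (Suc (Suc (Suc k))) (ev3 t) = ev3 t"
proof -
  show "U (Suc (Suc (Suc k))) (ev3 t) = ev3 t"
  proof (rule M_ext)
    fix f assume f: "mlin f"
    show "U (Suc (Suc (Suc k))) (ev3 t) f = ev3 t f"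
      by (simp add: U_eval[OF f] ev3_eval[OF t f] ev3_eval[OF t mlin_ins[OF f]])
  qed (simp_all add: t)
  show "E (Suc (Suc (Suc k))) (ev3 t) = ev3 t"
  proof (rule M_ext)
    fix f assume f: "mlin f"
    show "E (Suc (Suc (Suc k))) (ev3 t) f = ev3 t f"
      by (simp add: E_eval[OF f] ev3_eval[OF t f] ev3_eval[OF t mlin_epsw[OF f]])
  qed (simp_all add: t)
  have s: "spl k unit_word \<one>\<^sub>H \<one>\<^sub>H = unit_word" by (rule spl_unit)
  show "D (Suc (Suc (Suc k))) (ev3 t) = ev3 t"
  proof (rule M_ext)
    fix f assume f: "mlin f"
    show "D (Suc (Suc (Suc k))) (ev3 t) f = ev3 t f"
      unfolding D_eval[OF f] ev3_eval[OF t f] ev3_eval[OF t mlin_spl[OF f]]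
    proof (rule sw3_cong[OF t])
      fix a b c assume "a \<in> \<H>" "b \<in> \<H>" "c \<in> \<H>"
      then show "sw Z (\<Delta> ((a ## b ## c ## unit_word) (Suc (Suc (Suc k)))))
          (\<lambda>a' b'. f (spl (Suc (Suc (Suc k))) (a ## b ## c ## unit_word) a' b')) = f (a ## b ## c ## unit_word)"
        using bilin_spl[OF f, of "a ## b ## c ## unit_word" "Suc (Suc (Suc k))"]
        by (simp only: wcons_simps unit_word_apply Delta_one)
          (subst sw_pure[OF mH mH mZ]; simp add: s)
    qed
  qed (simp_all add: t)
qed

lemmas PH_supp [simp] = ev3_supp[OF phi_closed, folded PH_def]
lemmas PI_supp [simp] = ev3_supp[OF phi_inv_closed, folded PI_def]

text \<open>Dictionary between the Sweedler expressions of the axioms and the operators. A leg 1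
  appended at the end leaves the functional unchanged, since words are padded with 1 anyway.\<close>

lemma ev4_D:
  assumes t: "t \<in> carrier H3"
  shows "ev4 (tens4 [(a, b, c1, c2). (a, b, c) \<leftarrow> terms3 t, (c1, c2) \<leftarrow> terms (\<Delta> c)]) = D 2 (ev3 t)"
    "ev4 (tens4 [(a, b1, b2, c). (a, b, c) \<leftarrow> terms3 t, (b1, b2) \<leftarrow> terms (\<Delta> b)]) = D 1 (ev3 t)"
    "ev4 (tens4 [(a1, a2, b, c). (a, b, c) \<leftarrow> terms3 t, (a1, a2) \<leftarrow> terms (\<Delta> a)]) = D 0 (ev3 t)"
    "ev4 (tens4 [(\<one>\<^sub>H, a, b, c). (a, b, c) \<leftarrow> terms3 t]) = U 0 (ev3 t)"
    "ev4 (tens4 [(a, b, c, \<one>\<^sub>H). (a, b, c) \<leftarrow> terms3 t]) = ev3 t"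
proof -
  let ?C = "\<H> \<times> \<H> \<times> \<H> \<times> \<H>"
  note tc = terms3_carrier[OF t] and dc = terms_Delta_carrier
  have M4: "ev4 (tens4 xs) \<in> M" if "set xs \<subseteq> ?C" for xs
    by (rule eval_homD(1)[OF eval_hom4 tens4_closed[OF that]])
  show "ev4 (tens4 [(a, b, c1, c2). (a, b, c) \<leftarrow> terms3 t, (c1, c2) \<leftarrow> terms (\<Delta> c)]) = D 2 (ev3 t)"
    (is "ev4 (tens4 ?xs) = _")
  proof (rule M_ext)
    have xs: "set ?xs \<subseteq> ?C" by (auto dest!: tc dest: dc)
    then show "ev4 (tens4 ?xs) \<in> M" by (rule M4)
    fix f assume f: "mlin f"
    show "ev4 (tens4 ?xs) f = D 2 (ev3 t) f"
      unfolding ev4_tens[OF f xs] D_eval[OF f] ev3_eval[OF t mlin_spl[OF f]] numeral_2_eq_2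
      by (subst Z.lsum_bind_terms3)
        (auto simp: lsum_map_terms lsum_map_Pair mlin_closed[OF f] dest!: tc dest: dc simp del: map_map)
  qed (simp add: t)
  show "ev4 (tens4 [(a, b1, b2, c). (a, b, c) \<leftarrow> terms3 t, (b1, b2) \<leftarrow> terms (\<Delta> b)]) = D 1 (ev3 t)"
    (is "ev4 (tens4 ?xs) = _")
  proof (rule M_ext)
    have xs: "set ?xs \<subseteq> ?C" by (auto dest!: tc dest: dc)
    then show "ev4 (tens4 ?xs) \<in> M" by (rule M4)
    fix f assume f: "mlin f"
    show "ev4 (tens4 ?xs) f = D 1 (ev3 t) f"
      unfolding ev4_tens[OF f xs] D_eval[OF f] ev3_eval[OF t mlin_spl[OF f]] One_nat_def
      by (subst Z.lsum_bind_terms3)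
        (auto simp: lsum_map_terms lsum_map_Pair mlin_closed[OF f] dest!: tc dest: dc simp del: map_map)
  qed (simp add: t)
  show "ev4 (tens4 [(a1, a2, b, c). (a, b, c) \<leftarrow> terms3 t, (a1, a2) \<leftarrow> terms (\<Delta> a)]) = D 0 (ev3 t)"
    (is "ev4 (tens4 ?xs) = _")
  proof (rule M_ext)
    have xs: "set ?xs \<subseteq> ?C" by (auto dest!: tc dest: dc)
    then show "ev4 (tens4 ?xs) \<in> M" by (rule M4)
    fix f assume f: "mlin f"
    show "ev4 (tens4 ?xs) f = D 0 (ev3 t) f"
      unfolding ev4_tens[OF f xs] D_eval[OF f] ev3_eval[OF t mlin_spl[OF f]]
      by (subst Z.lsum_bind_terms3)
        (auto simp: lsum_map_terms lsum_map_Pair mlin_closed[OF f] dest!: tc dest: dc simp del: map_map)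
  qed (simp add: t)
  show "ev4 (tens4 [(\<one>\<^sub>H, a, b, c). (a, b, c) \<leftarrow> terms3 t]) = U 0 (ev3 t)" (is "ev4 (tens4 ?xs) = _")
  proof (rule M_ext)
    have xs: "set ?xs \<subseteq> ?C" by (auto dest!: tc)
    then show "ev4 (tens4 ?xs) \<in> M" by (rule M4)
    fix f assume f: "mlin f"
    show "ev4 (tens4 ?xs) f = U 0 (ev3 t) f"
      unfolding ev4_tens[OF f xs] U_eval[OF f] ev3_eval[OF t mlin_ins[OF f]]
      by (simp add: lsum_map_terms3 lsum_map_Pair3 del: map_map)
  qed (simp add: t)
  show "ev4 (tens4 [(a, b, c, \<one>\<^sub>H). (a, b, c) \<leftarrow> terms3 t]) = ev3 t" (is "ev4 (tens4 ?xs) = _")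
  proof (rule M_ext)
    have xs: "set ?xs \<subseteq> ?C" by (auto dest!: tc)
    then show "ev4 (tens4 ?xs) \<in> M" by (rule M4)
    fix f assume f: "mlin f"
    show "ev4 (tens4 ?xs) f = ev3 t f"
      unfolding ev4_tens[OF f xs] ev3_eval[OF t f]
      by (simp add: lsum_map_terms3 lsum_map_Pair3 del: map_map)
  qed (simp add: t)
qed

lemma ev4_D_closed:
  assumes t: "t \<in> carrier H3"
  shows "tens4 [(a, b, c1, c2). (a, b, c) \<leftarrow> terms3 t, (c1, c2) \<leftarrow> terms (\<Delta> c)] \<in> carrier H4"
    "tens4 [(a, b1, b2, c). (a, b, c) \<leftarrow> terms3 t, (b1, b2) \<leftarrow> terms (\<Delta> b)] \<in> carrier H4"
    "tens4 [(a1, a2, b, c). (a, b, c) \<leftarrow> terms3 t, (a1, a2) \<leftarrow> terms (\<Delta> a)] \<in> carrier H4"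
    "tens4 [(\<one>\<^sub>H, a, b, c). (a, b, c) \<leftarrow> terms3 t] \<in> carrier H4"
    "tens4 [(a, b, c, \<one>\<^sub>H). (a, b, c) \<leftarrow> terms3 t] \<in> carrier H4"
  by ((rule tens4_closed, auto dest!: terms3_carrier[OF t] dest: terms_Delta_carrier)[1])+

lemma pentagon_M: "D 2 PH \<star> D 0 PH = U 0 PH \<star> D 1 PH \<star> PH"
proof -
  note c = ev4_D_closed[OF phi_closed] and e = ev4_D[OF phi_closed]
  have cc: "tens4 [(\<one>\<^sub>H, a, b, c). (a, b, c) \<leftarrow> terms3 \<phi>] \<otimes>\<^bsub>H4\<^esub>
       tens4 [(a, b1, b2, c). (a, b, c) \<leftarrow> terms3 \<phi>, (b1, b2) \<leftarrow> terms (\<Delta> b)] \<in> carrier H4"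
    by (rule H4.mult_closed[OF c(4,2)])
  show ?thesis
    using arg_cong[OF pentagon, of ev4]
    unfolding eval_homD(3)[OF eval_hom4 c(1,3)] eval_homD(3)[OF eval_hom4 cc c(5)]
      eval_homD(3)[OF eval_hom4 c(4,2)] e
    by (simp only: PH_def)
qed

text \<open>The axiom \<open>quasi_coassoc\<close> evaluated on a one-letter word; arbitrary
  functionals follow in \<open>coassoc0\<close>.\<close>

lemma coassoc_word:
  assumes h: "h \<in> \<H>"
  shows "D 1 (D 0 (ev1 h)) = PH \<star> D 0 (D 0 (ev1 h)) \<star> PI"
proof -
  let ?C = "\<H> \<times> \<H> \<times> \<H>"
  note dc = terms_Delta_carrier
  let ?xs = "[(h1, h21, h22). (h1, h2) \<leftarrow> terms (\<Delta> h), (h21, h22) \<leftarrow> terms (\<Delta> h2)]"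
  let ?ys = "[(h11, h12, h2). (h1, h2) \<leftarrow> terms (\<Delta> h), (h11, h12) \<leftarrow> terms (\<Delta> h1)]"
  have xs: "set ?xs \<subseteq> ?C" and ys: "set ?ys \<subseteq> ?C"
    by (auto dest!: dc[OF h] dest: dc)
  note M3 = eval_homD(1)[OF eval_hom3 tens3_closed]
  have X: "ev3 (tens3 ?xs) = D 1 (D 0 (ev1 h))"
  proof (rule M_ext)
    fix f assume f: "mlin f"
    note m = mlin_spl[OF f]
    show "ev3 (tens3 ?xs) f = D 1 (D 0 (ev1 h)) f"
      unfolding ev3_tens[OF f xs] D_eval[OF f] D_eval[OF m] ev1_def sgl_eval[OF mlin_spl[OF m]] One_nat_def
      by (subst Z.lsum_bind_terms)
        (auto simp: lsum_map_terms lsum_map_Pair mlin_closed[OF f] dest!: dc[OF h] dest: dc simp del: map_map)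
  qed (use M3[OF xs] h in simp_all)
  have Y: "ev3 (tens3 ?ys) = D 0 (D 0 (ev1 h))"
  proof (rule M_ext)
    fix f assume f: "mlin f"
    note m = mlin_spl[OF f]
    show "ev3 (tens3 ?ys) f = D 0 (D 0 (ev1 h)) f"
      unfolding ev3_tens[OF f ys] D_eval[OF f] D_eval[OF m] ev1_def sgl_eval[OF mlin_spl[OF m]]
      by (subst Z.lsum_bind_terms)
        (auto simp: lsum_map_terms lsum_map_Pair mlin_closed[OF f] dest!: dc[OF h] dest: dc simp del: map_map)
  qed (use M3[OF ys] h in simp_all)
  note c = tens3_closed[OF ys]
  show ?thesis
    using arg_cong[OF quasi_coassoc[OF h], of ev3]
    unfolding X eval_homD(3)[OF eval_hom3 H3.mult_closed[OF phi_closed c] phi_inv_closed]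
      eval_homD(3)[OF eval_hom3 phi_closed c] Y
    by (simp only: PH_def PI_def)
qed

text \<open>Separates the letter that is going to be split from the rest of the word, as a product
  of two functionals.\<close>

lemma sgl_wcons: "h \<in> \<H> \<Longrightarrow> x \<in> W \<Longrightarrow> sgl (h ## x) = ev1 h \<star> U 0 (sgl x)"
proof (rule M_ext)
  fix f assume h: "h \<in> \<H>" and x: "x \<in> W" and f: "mlin f"
  have m: "mlin (\<lambda>y. f (wmul (h ## unit_word) y))" using mlin_wmul_right[OF f] h by simp
  have m': "mlin (\<lambda>x. U 0 (sgl x') (\<lambda>y. f (wmul x y)))" if "x' \<in> W" for x'
    using that by (intro mlin_star f) simp
  have m'': "mlin (\<lambda>x. f (h ## wmul unit_word x))"
    using mlin_ins[OF m, of 0] h by simp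
  show "sgl (h ## x) f = (ev1 h \<star> U 0 (sgl x)) f"
    using h x
    by (simp add: star_eval[OF f] ev1_def sgl_eval[OF f] sgl_eval[OF m'] U_eval[OF m] sgl_eval[OF m''])
qed simp_all

text \<open>Three insertions at the front push \<open>s\<close> beyond the three slots that
  \<open>ev3 t\<close> occupies, and factors in disjoint slots commute.\<close>

lemma ev3_commute:
  assumes t: "t \<in> carrier H3" and s: "s \<in> M"
  shows "ev3 t \<star> U 0 (U 0 (U 0 s)) = U 0 (U 0 (U 0 s)) \<star> ev3 t"
proof (rule M_ext)
  fix f assume f: "mlin f"
  have tM: "ev3 t \<in> M" using t by simp
  have e: "U 0 (U 0 (U 0 s)) g = s (\<lambda>x. g (\<one>\<^sub>H ## \<one>\<^sub>H ## \<one>\<^sub>H ## x))" if g: "mlin g" for g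
    by (simp add: U_eval[OF g] U_eval[OF mlin_wcons[OF g]] U_eval[OF mlin_wcons[OF mlin_wcons[OF g]]])
  have m: "mlin (\<lambda>x. f (wmul (\<one>\<^sub>H ## \<one>\<^sub>H ## \<one>\<^sub>H ## x) y))" "mlin (\<lambda>x. f (wmul y (\<one>\<^sub>H ## \<one>\<^sub>H ## \<one>\<^sub>H ## x)))"
    if y: "y \<in> W" for y
    using mlin_ins[OF mlin_ins[OF mlin_ins[OF mlin_wmul_left[OF f y], of 0], of 0], of 0]
      mlin_ins[OF mlin_ins[OF mlin_ins[OF mlin_wmul_right[OF f y], of 0], of 0], of 0] by simp_all
  have "(ev3 t \<star> U 0 (U 0 (U 0 s))) f = ev3 t (\<lambda>y. s (\<lambda>x. f (wmul y (\<one>\<^sub>H ## \<one>\<^sub>H ## \<one>\<^sub>H ## x))))"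
    unfolding star_eval[OF f] by (rule M_cong[OF tM]) (simp add: e mlin_wmul_right[OF f])
  also have "\<dots> = s (\<lambda>x. ev3 t (\<lambda>y. f (wmul y (\<one>\<^sub>H ## \<one>\<^sub>H ## \<one>\<^sub>H ## x))))"
    by (rule M_fubini[OF tM s]) (simp_all add: m mlin_wmul_left[OF f])
  also have "\<dots> = s (\<lambda>x. ev3 t (\<lambda>y. f (wmul (\<one>\<^sub>H ## \<one>\<^sub>H ## \<one>\<^sub>H ## x) y)))"
  proof (rule M_cong[OF s])
    fix x assume x: "x \<in> W"
    show "ev3 t (\<lambda>y. f (wmul y (\<one>\<^sub>H ## \<one>\<^sub>H ## \<one>\<^sub>H ## x))) = ev3 t (\<lambda>y. f (wmul (\<one>\<^sub>H ## \<one>\<^sub>H ## \<one>\<^sub>H ## x) y))"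
      using x by (simp add: ev3_eval[OF t] mlin_wmul_left[OF f] mlin_wmul_right[OF f])
        (auto intro!: sw3_cong[OF t])
  qed
  also have "\<dots> = (U 0 (U 0 (U 0 s)) \<star> ev3 t) f"
    by (simp add: star_eval[OF f] e mlin_star[OF tM f])
  finally show "(ev3 t \<star> U 0 (U 0 (U 0 s))) f = (U 0 (U 0 (U 0 s)) \<star> ev3 t) f" .
qed (simp_all add: t s)

text \<open>Naturality of the associator. One word suffices by \<open>linop_ext\<close>: its first
  letter obeys \<open>coassoc_word\<close>, and after two splits the remaining letters start at slot
  3, hence commute with \<open>PH\<close>.\<close>

lemma coassoc0: "t \<in> M \<Longrightarrow> D 1 (D 0 t) \<star> PH = PH \<star> D 0 (D 0 t)"
proof (rule linop_ext[where P="\<lambda>t. D 1 (D 0 t) \<star> PH" and Q="\<lambda>t. PH \<star> D 0 (D 0 t)"])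
  show "linop (\<lambda>t. D 1 (D 0 t) \<star> PH)"
    by (rule linop_comp[OF linop_star_right[OF PH_M] linop_comp[OF linop_D linop_D]])
  show "linop (\<lambda>t. PH \<star> D 0 (D 0 t))"
    by (rule linop_comp[OF linop_star_left[OF PH_M] linop_comp[OF linop_D linop_D]])
  fix x assume "x \<in> W"
  then obtain h y where x: "x = h ## y" and h: "h \<in> \<H>" and y: "y \<in> W" by (rule W_cases)
  let ?s = "sgl y"
  have s: "?s \<in> M" using y by simp
  have d: "D 0 (U 0 ?s) = U 0 (U 0 ?s)" "D 1 (U 0 (U 0 ?s)) = U 0 (U 0 (U 0 ?s))"
    "D 0 (U 0 (U 0 ?s)) = U 0 (U 0 (U 0 ?s))"
    using s by (simp_all add: D_U_same D_U_greater)
  have "D 1 (D 0 (sgl x)) \<star> PH = D 1 (D 0 (ev1 h)) \<star> (U 0 (U 0 (U 0 ?s)) \<star> PH)"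
    using h y s by (simp only: x sgl_wcons D_star U_M ev_M D_M d star_assoc star_M PH_M)
  also have "\<dots> = PH \<star> D 0 (D 0 (ev1 h)) \<star> PI \<star> (PH \<star> U 0 (U 0 (U 0 ?s)))"
    using ev3_commute[OF phi_closed s] by (simp only: coassoc_word[OF h] PH_def)
  also have "\<dots> = PH \<star> D 0 (D 0 (ev1 h)) \<star> (PI \<star> PH) \<star> U 0 (U 0 (U 0 ?s))"
    using h s by (simp only: star_assoc star_M PH_M PI_M D_M U_M ev_M)
  also have "\<dots> = PH \<star> D 0 (D 0 (sgl x))"
    using h y s by (simp add: x sgl_wcons D_star d star_assoc)
  finally show "D 1 (D 0 (sgl x)) \<star> PH = PH \<star> D 0 (D 0 (sgl x))" .
qed

lemma ev1_commute:
  assumes h: "h \<in> \<H>" and s: "s \<in> M"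
  shows "ev1 h \<star> U 0 s = U 0 s \<star> ev1 h"
proof (rule M_ext)
  fix f assume f: "mlin f"
  have m: "mlin (\<lambda>x. f (wmul (h ## unit_word) x))" "mlin (\<lambda>x. f (wmul x (h ## unit_word)))"
    using mlin_wmul_right[OF f] mlin_wmul_left[OF f] h by simp_all
  have U0: "U 0 s \<in> M" using s by simp
  have "(ev1 h \<star> U 0 s) f = s (\<lambda>x. f (wmul (h ## unit_word) (ins 0 x)))"
    using h by (simp add: star_eval[OF f] ev1_def sgl_eval[OF mlin_star[OF U0 f]] U_eval[OF m(1)])
  also have "\<dots> = s (\<lambda>x. f (wmul (ins 0 x) (h ## unit_word)))"
    using h by (intro M_cong[OF s]) simp
  also have "\<dots> = U 0 s (\<lambda>x. f (wmul x (h ## unit_word)))"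
    by (rule U_eval[OF m(2), symmetric])
  also have "\<dots> = (U 0 s \<star> ev1 h) f"
    unfolding star_eval[OF f] by (rule M_cong[OF U0]) (simp add: ev1_def mlin_wmul_right[OF f])
  finally show "(ev1 h \<star> U 0 s) f = (U 0 s \<star> ev1 h) f" .
qed (simp_all add: h s)

text \<open>Induction on the slot. The letter in slot 0 is touched neither by the splits nor by
  \<open>U 0 P\<close>, so it can be moved past \<open>U 0 P\<close>; the induction hypothesis acts
  on the tail.\<close>

lemma coassoc_Suc:
  assumes P: "P \<in> M" and IH: "\<And>t. t \<in> M \<Longrightarrow> D (Suc i) (D i t) \<star> P = P \<star> D i (D i t)" and t: "t \<in> M"
  shows "D (Suc (Suc i)) (D (Suc i) t) \<star> U 0 P = U 0 P \<star> D (Suc i) (D (Suc i) t)"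
proof (rule linop_ext[where P="\<lambda>t. D (Suc (Suc i)) (D (Suc i) t) \<star> U 0 P"
      and Q="\<lambda>t. U 0 P \<star> D (Suc i) (D (Suc i) t)", OF _ _ t])
  show "linop (\<lambda>t. D (Suc (Suc i)) (D (Suc i) t) \<star> U 0 P)"
    by (rule linop_comp[OF linop_star_right[OF U_M[OF P]] linop_comp[OF linop_D linop_D]])
  show "linop (\<lambda>t. U 0 P \<star> D (Suc i) (D (Suc i) t))"
    by (rule linop_comp[OF linop_star_left[OF U_M[OF P]] linop_comp[OF linop_D linop_D]])
  fix x assume "x \<in> W"
  then obtain h y where x: "x = h ## y" and h: "h \<in> \<H>" and y: "y \<in> W" by (rule W_cases)
  let ?s = "sgl y"
  have s: "?s \<in> M" using y by simp
  have dh: "D (Suc j) (ev1 h) = ev1 h" for j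
  proof (rule M_ext)
    fix f assume f: "mlin f"
    have "bilin K H H Z (\<lambda>a b. f (spl (Suc j) (h ## unit_word) a b))" using h by (intro bilin_spl[OF f]) simp
    then show "D (Suc j) (ev1 h) f = ev1 h f"
      by (simp add: D_eval[OF f] ev1_def sgl_eval[OF mlin_spl[OF f]] sgl_eval[OF f] Delta_one
          sw_pure[OF mH mH mZ] spl_unit)
  qed (simp_all add: h)
  have d: "D (Suc j) (U 0 r) = U 0 (D j r)" if "r \<in> M" for j r
    using D_U_greater[OF that, of 0 "Suc j"] by simp
  have "D (Suc (Suc i)) (D (Suc i) (sgl x)) \<star> U 0 P = ev1 h \<star> U 0 (D (Suc i) (D i ?s) \<star> P)"
    using h y s P by (simp add: x sgl_wcons D_star d dh star_assoc U_star)
  also have "\<dots> = ev1 h \<star> U 0 (P \<star> D i (D i ?s))" by (simp only: IH[OF s])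
  also have "\<dots> = ev1 h \<star> U 0 P \<star> U 0 (D i (D i ?s))"
    using h s P by (simp only: U_star star_assoc star_M D_M U_M ev_M)
  also have "\<dots> = U 0 P \<star> ev1 h \<star> U 0 (D i (D i ?s))"
    using h P by (simp only: ev1_commute)
  also have "\<dots> = U 0 P \<star> D (Suc i) (D (Suc i) (sgl x))"
    using h y s P by (simp add: x sgl_wcons D_star d dh star_assoc)
  finally show "D (Suc (Suc i)) (D (Suc i) (sgl x)) \<star> U 0 P = U 0 P \<star> D (Suc i) (D (Suc i) (sgl x))" .
qed

lemma coassoc1: "t \<in> M \<Longrightarrow> D 2 (D 1 t) \<star> U 0 PH = U 0 PH \<star> D 1 (D 1 t)"
  using coassoc_Suc[of PH 0 t] coassoc0 by (simp add: numeral_2_eq_2)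

lemma coassoc3: "t \<in> M \<Longrightarrow> D 4 (D 3 t) \<star> U 0 (U 0 (U 0 PH)) = U 0 (U 0 (U 0 PH)) \<star> D 3 (D 3 t)"
  using coassoc_Suc[of "U 0 (U 0 PH)" 2 t] coassoc_Suc[of "U 0 PH" 1] coassoc1
  by (simp add: eval_nat_numeral)

end

section \<open>Counits of the associator, rearranged pentagons, and absorption by test
  functions\<close>

context quasi_hopf_val
begin

text \<open>In the axiom the counit of the middle leg is a scalar on the third leg and the slot is
  gone. Inserting a 1 in slot 1 and moving the scalar there by multilinearity matches the convention
  of \<open>E 1\<close>.\<close>

lemma E1_PH: "E 1 PH = one_M"
proof (rule M_ext)
  fix f assume f: "mlin f"
  let ?xs = "[(a, \<epsilon> b \<odot>\<^bsub>H\<^esub> c). (a, b, c) \<leftarrow> terms3 \<phi>]"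
  have xs: "set ?xs \<subseteq> \<H> \<times> \<H>" by (auto dest!: terms3_carrier[OF phi_closed])
  have "one_M f = ev2 (tens2 ?xs) (\<lambda>x. f (ins 1 x))"
    by (simp only: counit_associator eval_homD(4)[OF eval_hom2] one_eval[OF f] one_eval[OF mlin_ins[OF f]] ins_unit)
  also have "ev2 (tens2 ?xs) (\<lambda>x. f (ins 1 x)) = sw3 Z \<phi> (\<lambda>a b c. f (a ## \<one>\<^sub>H ## (\<epsilon> b \<odot>\<^bsub>H\<^esub> c) ## unit_word))"
    unfolding ev2_tens[OF mlin_ins[OF f] xs] lsum_map_terms3 by simp
  also have "\<dots> = sw3 Z \<phi> (\<lambda>a b c. f (a ## (\<epsilon> b \<odot>\<^bsub>H\<^esub> \<one>\<^sub>H) ## c ## unit_word))"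
  proof (rule sw3_cong[OF phi_closed])
    fix a b c assume abc: "a \<in> \<H>" "b \<in> \<H>" "c \<in> \<H>"
    show "f (a ## \<one>\<^sub>H ## (\<epsilon> b \<odot>\<^bsub>H\<^esub> c) ## unit_word) = f (a ## (\<epsilon> b \<odot>\<^bsub>H\<^esub> \<one>\<^sub>H) ## c ## unit_word)"
      using mlin_smult[OF f, of "a ## \<one>\<^sub>H ## c ## unit_word" "\<epsilon> b" c "Suc (Suc 0)"]
        mlin_smult[OF f, of "a ## \<one>\<^sub>H ## c ## unit_word" "\<epsilon> b" "\<one>\<^sub>H" "Suc 0"] abc by simp
  qed
  also have "\<dots> = E 1 PH f"
    by (simp add: E_eval[OF f] PH_eval[OF mlin_epsw[OF f]])
  finally show "E 1 PH f = one_M f" by (rule HOL.sym)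
qed simp_all

lemma star_cancel:
  assumes "a \<star> b = one_M" "a \<in> M" "b \<in> M" "x \<in> M" shows "a \<star> (b \<star> x) = x"
  using star_assoc[OF assms(2-4)] assms by simp

lemma D_inv:
  assumes "a \<star> b = one_M" "a \<in> M" "b \<in> M" shows "D i a \<star> D i b = one_M"
  using D_star[OF assms(2,3), of i] assms(1) by simp

lemma U_inv:
  assumes "a \<star> b = one_M" "a \<in> M" "b \<in> M" shows "U i a \<star> U i b = one_M"
  using U_star[OF assms(2,3), of i] assms(1) by simp

lemma E_inv:
  assumes "a \<star> b = one_M" "a \<in> M" "b \<in> M" "E i a = one_M" shows "E i b = one_M"
  using E_star[OF assms(2,3), of i] assms by simp

lemmas PH_cancel [simp] =
  D_inv[OF PH_PI(1) PH_M PI_M] D_inv[OF PH_PI(2) PI_M PH_M]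
  U_inv[OF PH_PI(1) PH_M PI_M] U_inv[OF PH_PI(2) PI_M PH_M]
  star_cancel[OF PH_PI(1) PH_M PI_M] star_cancel[OF PH_PI(2) PI_M PH_M]
  star_cancel[OF D_inv[OF PH_PI(1) PH_M PI_M] D_M[OF PH_M] D_M[OF PI_M]]
  star_cancel[OF D_inv[OF PH_PI(2) PI_M PH_M] D_M[OF PI_M] D_M[OF PH_M]]
  star_cancel[OF U_inv[OF PH_PI(1) PH_M PI_M] U_M[OF PH_M] U_M[OF PI_M]]
  star_cancel[OF U_inv[OF PH_PI(2) PI_M PH_M] U_M[OF PI_M] U_M[OF PH_M]]

text \<open>Test function for a left inverse of \<open>U 0\<close>: slot 0 is evaluated by the
  counit and dropped. Dropping it without the counit would not be linear in slot 0.\<close>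

lemma mlin_tl:
  assumes f: "mlin f" shows "mlin (\<lambda>x. \<epsilon> (x 0) \<odot>\<^bsub>Z\<^esub> f (\<lambda>i. x (Suc i)))"
proof (rule mlinI)
  fix x i assume x: "x \<in> W"
  then obtain h y where xy: "x = h ## y" "h \<in> \<H>" "y \<in> W" by (rule W_cases)
  show "linear_map K H Z (\<lambda>a. \<epsilon> ((x(i := a)) 0) \<odot>\<^bsub>Z\<^esub> f (\<lambda>j. (x(i := a)) (Suc j)))"
  proof (cases i)
    case 0
    then show ?thesis using xy mlin_closed[OF f xy(3)] lin_smult_left[OF mZ eps_lin] by simp
  next
    case (Suc j)
    then show ?thesis using xy linear_map_scale[OF mH mZ mlinD[OF f xy(3), of j]] by (simp del: fun_upd_apply)
  qed
qed

text \<open>Testing against the function of \<open>mlin_tl\<close> recovers \<open>t f\<close> from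
  \<open>U 0 t\<close>.\<close>

lemma U0_inj: "t \<in> M \<Longrightarrow> U 0 t = one_M \<Longrightarrow> t = one_M"
proof (rule M_ext)
  fix f assume t: "t \<in> M" and u: "U 0 t = one_M" and f: "mlin f"
  have "U 0 t (\<lambda>x. \<epsilon> (x 0) \<odot>\<^bsub>Z\<^esub> f (\<lambda>i. x (Suc i))) = t f"
    unfolding U_eval[OF mlin_tl[OF f]] by (rule M_cong[OF t]) (simp add: mlin_closed[OF f])
  moreover have "(\<lambda>i. unit_word (Suc i)) = unit_word" by (simp add: unit_word_def)
  ultimately show "t f = one_M f"
    using mlin_closed[OF f W_unit] by (simp add: u one_eval[OF mlin_tl[OF f]] one_eval[OF f])
qed simp_all

text \<open>The counit axiom concerns the middle leg. Applying \<open>E 1\<close> to the pentagon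
  turns both \<open>D 0 PH\<close> and \<open>D 1 PH\<close> into \<open>U 1 PH\<close>, which
  cancels and leaves the statement for the outer leg.\<close>

lemma E0_PH: "E 0 PH = one_M"
proof -
  have "E 1 (D 2 PH \<star> D 0 PH) = E 1 (U 0 PH \<star> D 1 PH \<star> PH)" by (simp only: pentagon_M)
  then have "U 1 PH = U 0 (E 0 PH) \<star> U 1 PH"
    using E_D_right[of PH 0] E_D_left[of PH 1] E1_PH by (simp add: E_star E_D_less E_U_greater)
  then have "U 1 PH \<star> U 1 PI = U 0 (E 0 PH) \<star> U 1 PH \<star> U 1 PI" by simp
  then have "U 0 (E 0 PH) = one_M" by (simp add: star_assoc)
  then show ?thesis by (rule U0_inj[rotated]) simp
qed

text \<open>Mirror image, with \<open>E 2\<close>: here \<open>D 2 PH\<close> and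
  \<open>D 1 PH\<close> both become \<open>U 2 PH\<close>.\<close>

lemma E2_PH: "E 2 PH = one_M"
proof -
  have "E 2 (D 2 PH \<star> D 0 PH) = E 2 (U 0 PH \<star> D 1 PH \<star> PH)" by (simp only: pentagon_M)
  then have "U 2 PH = U 2 PH \<star> E 2 PH"
    using E_D_right[of PH 1] E_D_left[of PH 2] E1_PH
    by (simp add: E_star E_D_greater E_U_greater numeral_2_eq_2)
  then have "U 2 PI \<star> U 2 PH = U 2 PI \<star> (U 2 PH \<star> E 2 PH)" by simp
  then show ?thesis by simp
qed

lemma E_PH_PI [simp]:
  "E 0 PH = one_M" "E (Suc 0) PH = one_M" "E 2 PH = one_M" "E (Suc (Suc 0)) PH = one_M"
  "E 0 PI = one_M" "E (Suc 0) PI = one_M" "E 2 PI = one_M" "E (Suc (Suc 0)) PI = one_M"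
  using E0_PH E1_PH E2_PH E_inv[OF PH_PI(1) PH_M PI_M E0_PH] E_inv[OF PH_PI(1) PH_M PI_M E1_PH]
    E_inv[OF PH_PI(1) PH_M PI_M E2_PH] by (simp_all add: numeral_2_eq_2)

text \<open>This and the next five lemmas are the pentagon and its inverse in the forms used later.
  Which form applies is dictated by the pairs of slots that a test function absorbs: a suitable
  \<open>D i\<close> has to reach the outer end of the product.\<close>

lemma pentagon_c: "U 0 PI \<star> D 2 PH = D 1 PH \<star> PH \<star> D 0 PI"
proof -
  have "U 0 PI \<star> D 2 PH = U 0 PI \<star> (D 2 PH \<star> D 0 PH) \<star> D 0 PI" by (simp add: star_assoc)
  then show ?thesis by (simp add: pentagon_M star_assoc)
qed

lemma pentagon_b: "D 0 PH \<star> PI = D 2 PI \<star> U 0 PH \<star> D 1 PH"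
proof -
  have "D 0 PH \<star> PI = D 2 PI \<star> (D 2 PH \<star> D 0 PH) \<star> PI" by (simp add: star_assoc)
  then show ?thesis by (simp add: pentagon_M star_assoc)
qed

lemma pentagon_e: "U 0 PH \<star> D 1 PH = D 2 PH \<star> D 0 PH \<star> PI"
  by (simp add: pentagon_M star_assoc)

lemma pentagon_d: "PH \<star> D 0 PI = D 1 PI \<star> U 0 PI \<star> D 2 PH"
proof -
  have "PH \<star> D 0 PI = D 1 PI \<star> (U 0 PI \<star> D 2 PH)" by (simp add: pentagon_c star_assoc)
  then show ?thesis by (simp add: star_assoc)
qed

lemma pentagon_f: "D 2 PI \<star> U 0 PH = D 0 PH \<star> PI \<star> D 1 PI"
  by (simp add: pentagon_b star_assoc)

lemma pentagon_a: "PI \<star> D 1 PI = D 0 PI \<star> D 2 PI \<star> U 0 PH"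
  by (simp add: star_assoc pentagon_f)

text \<open>
  A function of the first \<^term>\<open>n\<close> letters of a word becomes multilinear in all letters if the
  remaining letters are sent to their counits.
\<close>

definition tail :: "nat \<Rightarrow> (nat \<Rightarrow> 'h) \<Rightarrow> 'k"
  where "tail n x = finprod K (\<lambda>i. \<epsilon> (if n \<le> i then x i else \<one>\<^sub>H)) {i. n \<le> i \<and> x i \<noteq> \<one>\<^sub>H}"

definition ext :: "nat \<Rightarrow> ((nat \<Rightarrow> 'h) \<Rightarrow> 'z) \<Rightarrow> (nat \<Rightarrow> 'h) \<Rightarrow> 'z"
  where "ext n C x = tail n x \<odot>\<^bsub>Z\<^esub> C x"

definition mlinn :: "nat \<Rightarrow> ((nat \<Rightarrow> 'h) \<Rightarrow> 'z) \<Rightarrow> bool"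
  where "mlinn n C \<longleftrightarrow> (\<forall>x\<in>W. C x \<in> carrier Z) \<and> (\<forall>x\<in>W. \<forall>i<n. linear_map K H Z (\<lambda>a. C (x(i := a)))) \<and>
    (\<forall>x\<in>W. \<forall>i\<ge>n. \<forall>a\<in>\<H>. C (x(i := a)) = C x)"

lemma finite_W: "x \<in> W \<Longrightarrow> finite {i. x i \<noteq> \<one>\<^sub>H}"
proof (rule WE[of x], assumption)
  fix m assume "\<And>i. i \<ge> m \<Longrightarrow> x i = \<one>\<^sub>H"
  then have "{i. x i \<noteq> \<one>\<^sub>H} \<subseteq> {..<m}" by (auto simp: not_less[symmetric])
  then show "finite {i. x i \<noteq> \<one>\<^sub>H}" by (rule finite_subset) simp
qed

lemma finprod_eps_closed: "x \<in> W \<Longrightarrow> finprod K (\<lambda>i. \<epsilon> (x i)) A \<in> carrier K"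
  by (intro finprod_closed) auto

lemma tail_closed [simp]: "x \<in> W \<Longrightarrow> tail n x \<in> carrier K"
  unfolding tail_def by (intro finprod_closed) auto

lemma tail_mono:
  assumes x: "x \<in> W" and A: "finite A" "{i. n \<le> i \<and> x i \<noteq> \<one>\<^sub>H} \<subseteq> A" "A \<subseteq> {n..}"
  shows "tail n x = finprod K (\<lambda>i. \<epsilon> (x i)) A"
  unfolding tail_def using A x by (intro finprod_mono_neutral_cong_left) auto

lemma tail_less: "i < n \<Longrightarrow> tail n (x(i := a)) = tail n x"
proof -
  assume i: "i < n"
  have "(\<lambda>j. \<epsilon> (if n \<le> j then (x(i := a)) j else \<one>\<^sub>H)) = (\<lambda>j. \<epsilon> (if n \<le> j then x j else \<one>\<^sub>H))"
    "{j. n \<le> j \<and> (x(i := a)) j \<noteq> \<one>\<^sub>H} = {j. n \<le> j \<and> x j \<noteq> \<one>\<^sub>H}"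
    using i by (auto simp: fun_eq_iff)
  then show ?thesis by (simp only: tail_def)
qed

lemma tail_unit: "(\<And>i. i \<ge> n \<Longrightarrow> x i = \<one>\<^sub>H) \<Longrightarrow> tail n x = \<one>\<^bsub>K\<^esub>"
proof -
  assume "\<And>i. i \<ge> n \<Longrightarrow> x i = \<one>\<^sub>H"
  then have "{i. n \<le> i \<and> x i \<noteq> \<one>\<^sub>H} = {}" by auto
  then show ?thesis by (simp only: tail_def finprod_empty)
qed

lemma mlin_ext:
  assumes C: "mlinn n C" shows "mlin (ext n C)"
proof (rule mlinI)
  fix x i assume x: "x \<in> W"
  show "linear_map K H Z (\<lambda>a. ext n C (x(i := a)))"
  proof (cases "i < n")
    case True
    then have "linear_map K H Z (\<lambda>a. tail n x \<odot>\<^bsub>Z\<^esub> C (x(i := a)))"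
      using C x by (intro linear_map_scale[OF mH mZ]) (auto simp: mlinn_def)
    then show ?thesis using True by (simp add: ext_def tail_less)
  next
    case False
    let ?A = "{j. n \<le> j \<and> x j \<noteq> \<one>\<^sub>H} - {i}"
    have fin: "finite ?A" using finite_W[OF x] by (auto intro: finite_subset[rotated])
    let ?P = "finprod K (\<lambda>j. \<epsilon> (x j)) ?A"
    have t: "tail n (x(i := a)) = ?P \<otimes>\<^bsub>K\<^esub> \<epsilon> a" if a: "a \<in> \<H>" for a
    proof -
      \<comment> \<open>Slot \<open>i\<close> is kept in the index set even if the new letter is 1,
        so that the factor \<open>\<epsilon> a\<close> appears for every \<open>a\<close>;
        \<open>tail_mono\<close> permits this because \<epsilon> sends 1 to 1.\<close>
      have "tail n (x(i := a)) = finprod K (\<lambda>j. \<epsilon> ((x(i := a)) j)) (insert i ?A)"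
        using False a x fin by (intro tail_mono) auto
      also have "\<dots> = \<epsilon> a \<otimes>\<^bsub>K\<^esub> finprod K (\<lambda>j. \<epsilon> ((x(i := a)) j)) ?A"
        using fin a x by (subst finprod_insert) auto
      also have "finprod K (\<lambda>j. \<epsilon> ((x(i := a)) j)) ?A = finprod K (\<lambda>j. \<epsilon> (x j)) ?A"
        using x by (intro finprod_cong') auto
      finally show ?thesis
        by (simp only: m_comm[OF finprod_eps_closed[OF x] eps_closed[OF a]])
    qed
    have Cx: "C x \<in> carrier Z" "\<And>a. a \<in> \<H> \<Longrightarrow> C (x(i := a)) = C x"
      using C x False by (auto simp: mlinn_def)
    have "linear_map K H Z (\<lambda>a. (finprod K (\<lambda>j. \<epsilon> (x j)) ?A \<otimes>\<^bsub>K\<^esub> \<epsilon> a) \<odot>\<^bsub>Z\<^esub> C x)"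
      by (intro lin_smult_left[OF mZ] linear_map_scalar_mult is_cring eps_lin finprod_eps_closed x Cx)
    then show ?thesis by (rule linear_map_cong[OF _ mH]) (simp add: ext_def t Cx)
  qed
qed

lemma ext_unit: "mlinn n C \<Longrightarrow> x \<in> W \<Longrightarrow> (\<And>i. i \<ge> n \<Longrightarrow> x i = \<one>\<^sub>H) \<Longrightarrow> ext n C x = C x"
  by (simp add: ext_def tail_unit mlinn_def)

text \<open>
  Functions such as \<open>S x\<^sub>i \<cdot> \<alpha> \<cdot> x\<^sub>j\<close> (\<open>lcol\<close>) and \<open>x\<^sub>i \<cdot> \<beta> \<cdot>
      S x\<^sub>j\<close> (\<open>rcol\<close>) absorb a coproduct multiplied
  from the left, respectively right, into the slots \<open>i\<close> and \<open>j\<close>.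
\<close>

definition lcol :: "nat \<Rightarrow> nat \<Rightarrow> ((nat \<Rightarrow> 'h) \<Rightarrow> 'z) \<Rightarrow> bool"
  where "lcol i j f \<longleftrightarrow> (\<forall>x\<in>W. \<forall>h\<in>\<H>.
    sw Z (\<Delta> h) (\<lambda>a b. f (x(i := a \<cdot> x i, j := b \<cdot> x j))) = \<epsilon> h \<odot>\<^bsub>Z\<^esub> f x)"

definition rcol :: "nat \<Rightarrow> nat \<Rightarrow> ((nat \<Rightarrow> 'h) \<Rightarrow> 'z) \<Rightarrow> bool"
  where "rcol i j f \<longleftrightarrow> (\<forall>x\<in>W. \<forall>h\<in>\<H>.
    sw Z (\<Delta> h) (\<lambda>a b. f (x(i := x i \<cdot> a, j := x j \<cdot> b))) = \<epsilon> h \<odot>\<^bsub>Z\<^esub> f x)"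

lemma sw_scale:
  assumes "c \<in> carrier K" "t \<in> carrier H2" "\<And>a b. a \<in> \<H> \<Longrightarrow> b \<in> \<H> \<Longrightarrow> B a b \<in> carrier Z"
  shows "sw Z t (\<lambda>a b. c \<odot>\<^bsub>Z\<^esub> B a b) = c \<odot>\<^bsub>Z\<^esub> sw Z t B"
  using linear_map_apply_sw[OF mH mH mZ mZ linear_map_scale[OF mZ mZ linear_map_id assms(1)] assms(2), of B] assms(3)
  by simp

lemma lcol_ext:
  assumes C: "mlinn n C" and l: "lcol i j C" and ij: "i < n" "j < n"
  shows "lcol i j (ext n C)"
  unfolding lcol_def
proof (intro ballI)
  fix x h assume x: "x \<in> W" and h: "h \<in> \<H>"
  have cl: "C y \<in> carrier Z" if "y \<in> W" for y using C that by (simp add: mlinn_def)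
  have "sw Z (\<Delta> h) (\<lambda>a b. ext n C (x(i := a \<cdot> x i, j := b \<cdot> x j))) =
      tail n x \<odot>\<^bsub>Z\<^esub> sw Z (\<Delta> h) (\<lambda>a b. C (x(i := a \<cdot> x i, j := b \<cdot> x j)))" (is "?lhs = _")
    using x h ij by (simp add: ext_def tail_less) (rule sw_scale; simp add: cl)
  also have "\<dots> = \<epsilon> h \<odot>\<^bsub>Z\<^esub> ext n C x"
    using l x h cl[OF x] by (simp add: lcol_def ext_def Z.smult_assoc1[symmetric] m_comm)
  finally show "?lhs = \<epsilon> h \<odot>\<^bsub>Z\<^esub> ext n C x" .
qed

lemma rcol_ext:
  assumes C: "mlinn n C" and l: "rcol i j C" and ij: "i < n" "j < n"
  shows "rcol i j (ext n C)"
  unfolding rcol_def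
proof (intro ballI)
  fix x h assume x: "x \<in> W" and h: "h \<in> \<H>"
  have cl: "C y \<in> carrier Z" if "y \<in> W" for y using C that by (simp add: mlinn_def)
  have "sw Z (\<Delta> h) (\<lambda>a b. ext n C (x(i := x i \<cdot> a, j := x j \<cdot> b))) =
      tail n x \<odot>\<^bsub>Z\<^esub> sw Z (\<Delta> h) (\<lambda>a b. C (x(i := x i \<cdot> a, j := x j \<cdot> b)))" (is "?lhs = _")
    using x h ij by (simp add: ext_def tail_less) (rule sw_scale; simp add: cl)
  also have "\<dots> = \<epsilon> h \<odot>\<^bsub>Z\<^esub> ext n C x"
    using l x h cl[OF x] by (simp add: rcol_def ext_def Z.smult_assoc1[symmetric] m_comm)
  finally show "?lhs = \<epsilon> h \<odot>\<^bsub>Z\<^esub> ext n C x" .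
qed

lemma lcol_wmul: "lcol i j f \<Longrightarrow> y \<in> W \<Longrightarrow> lcol i j (\<lambda>x. f (wmul x y))"
  unfolding lcol_def
proof (intro ballI)
  fix x h assume l: "\<forall>x\<in>W. \<forall>h\<in>\<H>. sw Z (\<Delta> h) (\<lambda>a b. f (x(i := a \<cdot> x i, j := b \<cdot> x j))) = \<epsilon> h \<odot>\<^bsub>Z\<^esub> f x"
    and x: "x \<in> W" and y: "y \<in> W" and h: "h \<in> \<H>"
  have "wmul (x(i := a \<cdot> x i, j := b \<cdot> x j)) y = (wmul x y)(i := a \<cdot> wmul x y i, j := b \<cdot> wmul x y j)"
    if "a \<in> \<H>" "b \<in> \<H>" for a b
    using x y that by (auto simp: wmul_def fun_eq_iff m_assoc)
  then have "sw Z (\<Delta> h) (\<lambda>a b. f (wmul (x(i := a \<cdot> x i, j := b \<cdot> x j)) y)) =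
      sw Z (\<Delta> h) (\<lambda>a b. f ((wmul x y)(i := a \<cdot> wmul x y i, j := b \<cdot> wmul x y j)))"
    using h by (intro sw_cong[OF mH mH]) auto
  then show "sw Z (\<Delta> h) (\<lambda>a b. f (wmul (x(i := a \<cdot> x i, j := b \<cdot> x j)) y)) = \<epsilon> h \<odot>\<^bsub>Z\<^esub> f (wmul x y)"
    using l x y h by simp
qed

text \<open>The coproduct has to stay the rightmost factor in its two slots, so \<open>y\<close>
  must be 1 there. In \<open>lcol_wmul\<close> the factor \<open>y\<close> is on the far side and
  may be arbitrary.\<close>

lemma rcol_wmul: "rcol i j f \<Longrightarrow> y \<in> W \<Longrightarrow> y i = \<one>\<^sub>H \<Longrightarrow> y j = \<one>\<^sub>H \<Longrightarrow> rcol i j (\<lambda>x. f (wmul x y))"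
  unfolding rcol_def
proof (intro ballI)
  fix x h assume l: "\<forall>x\<in>W. \<forall>h\<in>\<H>. sw Z (\<Delta> h) (\<lambda>a b. f (x(i := x i \<cdot> a, j := x j \<cdot> b))) = \<epsilon> h \<odot>\<^bsub>Z\<^esub> f x"
    and x: "x \<in> W" and y: "y \<in> W" "y i = \<one>\<^sub>H" "y j = \<one>\<^sub>H" and h: "h \<in> \<H>"
  have "wmul (x(i := x i \<cdot> a, j := x j \<cdot> b)) y = (wmul x y)(i := wmul x y i \<cdot> a, j := wmul x y j \<cdot> b)"
    if "a \<in> \<H>" "b \<in> \<H>" for a b
    using x y that by (auto simp: wmul_def fun_eq_iff m_assoc)
  then have "sw Z (\<Delta> h) (\<lambda>a b. f (wmul (x(i := x i \<cdot> a, j := x j \<cdot> b)) y)) =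
      sw Z (\<Delta> h) (\<lambda>a b. f ((wmul x y)(i := wmul x y i \<cdot> a, j := wmul x y j \<cdot> b)))"
    using h by (intro sw_cong[OF mH mH]) auto
  then show "sw Z (\<Delta> h) (\<lambda>a b. f (wmul (x(i := x i \<cdot> a, j := x j \<cdot> b)) y)) = \<epsilon> h \<odot>\<^bsub>Z\<^esub> f (wmul x y)"
    using l x y h by simp
qed

abbreviation shift :: "nat \<Rightarrow> nat \<Rightarrow> nat" where "shift k i \<equiv> (if i < k then i else Suc i)"

lemma ins_shift: "ins k x (shift k i) = x i"
  by (auto simp: ins_def)

lemma ins_upd2: "ins k (x(i := a, j := b)) = (ins k x)(shift k i := a, shift k j := b)"
  by (simp only: ins_upd)

text \<open>Absorption concerns the two named slots, so empty slots may be inserted around or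
  between them. Distant slots of \<open>f\<close> thereby become neighbours for the restricted
  function, as \<open>left_collapse\<close> requires.\<close>

lemma lcol_ins: "lcol (shift k i) (shift k j) f \<Longrightarrow> lcol i j (\<lambda>x. f (ins k x))"
  unfolding lcol_def
  by (simp only: ins_upd2) (metis W_ins ins_shift)

lemma rcol_ins: "rcol (shift k i) (shift k j) f \<Longrightarrow> rcol i j (\<lambda>x. f (ins k x))"
  unfolding rcol_def
  by (simp only: ins_upd2) (metis W_ins ins_shift)

lemma f_epsw: "mlin f \<Longrightarrow> x \<in> W \<Longrightarrow> c \<in> carrier K \<Longrightarrow> x i = \<one>\<^sub>H \<Longrightarrow> f (x(i := c \<odot>\<^bsub>H\<^esub> \<one>\<^sub>H)) = c \<odot>\<^bsub>Z\<^esub> f x"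
  using mlin_smult[of f x c "\<one>\<^sub>H" i] fun_upd_triv[of x i] by simp

lemma M_scale: "t \<in> M \<Longrightarrow> mlin f \<Longrightarrow> c \<in> carrier K \<Longrightarrow> t (\<lambda>x. c \<odot>\<^bsub>Z\<^esub> f x) = c \<odot>\<^bsub>Z\<^esub> t f"
proof (erule ME)
  fix xs assume f: "mlin f" and c: "c \<in> carrier K" and xs: "set xs \<subseteq> W"
    "\<And>f. t f = (if mlin f then lsum Z (map f xs) else undefined)"
  note sc = linear_map_scale[OF mZ mZ linear_map_id c]
  have "mlin (\<lambda>x. c \<odot>\<^bsub>Z\<^esub> f x)"
    by (rule mlinI) (rule linear_map_comp[OF mlinD[OF f] sc])
  then show "t (\<lambda>x. c \<odot>\<^bsub>Z\<^esub> f x) = c \<odot>\<^bsub>Z\<^esub> t f"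
    using linear_map_lsum[OF sc mZ mZ, of xs f] subsetD[OF xs(1)] mlin_closed[OF f] f by (simp add: xs(2))
qed

text \<open>The coproduct stands leftmost in slots \<open>i\<close> and \<open>Suc i\<close>, where
  \<open>lcol\<close> absorbs it. What remains is its counit, which \<open>U (Suc i) (E i s)\<close>
  places in slot \<open>i\<close> with a 1 behind it.\<close>

lemma left_collapse:
  assumes s: "s \<in> M" and t: "t \<in> M" and f: "mlin f" and l: "lcol i (Suc i) f"
  shows "(D i s \<star> t) f = (U (Suc i) (E i s) \<star> t) f"
proof -
  let ?g = "\<lambda>x. t (\<lambda>y. f (wmul x y))"
  have g: "mlin ?g" by (rule mlin_star[OF t f])
  have "sw Z (\<Delta> (x i)) (\<lambda>a b. ?g (spl i x a b)) = ?g (ins (Suc i) (epsw i x))" if x: "x \<in> W" for x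
  proof -
    let ?u = "spl i x \<one>\<^sub>H \<one>\<^sub>H"
    have "sw Z (\<Delta> (x i)) (\<lambda>a b. ?g (spl i x a b)) = t (\<lambda>y. sw Z (\<Delta> (x i)) (\<lambda>a b. f (wmul (spl i x a b) y)))"
      using x by (intro M_sw[OF t mH mH, symmetric] mlin_wmul_right[OF f]) auto
    also have "\<dots> = t (\<lambda>y. \<epsilon> (x i) \<odot>\<^bsub>Z\<^esub> f (wmul ?u y))"
    proof (rule M_cong[OF t])
      fix y assume y: "y \<in> W"
      \<comment> \<open>Factoring through the word with 1 in both split slots brings the summand
        into the shape of \<open>lcol\<close>.\<close>
      define w where "w = wmul ?u y"
      have w: "w \<in> W" using x y by (simp add: w_def)
      have e: "wmul (spl i x a b) y = w(i := a \<cdot> w i, Suc i := b \<cdot> w (Suc i))"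
        if "a \<in> \<H>" "b \<in> \<H>" for a b
        using y that by (auto simp: w_def wmul_def spl_def fun_eq_iff)
      have "sw Z (\<Delta> (x i)) (\<lambda>a b. f (wmul (spl i x a b) y)) =
        sw Z (\<Delta> (x i)) (\<lambda>a b. f (w(i := a \<cdot> w i, Suc i := b \<cdot> w (Suc i))))" (is "?lhs = _")
        by (rule sw_cong[OF mH mH]) (simp_all only: e W_closed[OF x] Delta_closed)
      also have "\<dots> = \<epsilon> (x i) \<odot>\<^bsub>Z\<^esub> f (wmul ?u y)"
        using l x w by (simp add: lcol_def w_def[symmetric])
      finally show "?lhs = \<epsilon> (x i) \<odot>\<^bsub>Z\<^esub> f (wmul ?u y)" .
    qed
    also have "\<dots> = \<epsilon> (x i) \<odot>\<^bsub>Z\<^esub> ?g ?u"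
      using x by (intro M_scale t mlin_wmul_right[OF f]) auto
    also have "\<dots> = ?g (?u(i := \<epsilon> (x i) \<odot>\<^bsub>H\<^esub> \<one>\<^sub>H))"
      using x by (intro f_epsw[OF g, symmetric]) (auto simp: spl_def)
    also have "?u(i := \<epsilon> (x i) \<odot>\<^bsub>H\<^esub> \<one>\<^sub>H) = ins (Suc i) (epsw i x)"
      by (auto simp: spl_def epsw_def ins_def fun_eq_iff)
    finally show ?thesis .
  qed
  then show ?thesis
    by (simp add: star_eval[OF f] D_eval[OF g] U_eval[OF g] E_eval[OF mlin_ins[OF g]]) (auto intro: M_cong[OF s])
qed

lemma right_collapse:
  assumes s: "s \<in> M" and t: "t \<in> M" and f: "mlin f" and l: "rcol i (Suc i) f"
  shows "(t \<star> D i s) f = (t \<star> U (Suc i) (E i s)) f"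
  unfolding star_eval[OF f]
proof (rule M_cong[OF t])
  fix x assume x: "x \<in> W"
  let ?g = "\<lambda>y. f (wmul x y)"
  have g: "mlin ?g" by (rule mlin_wmul_right[OF f x])
  have "sw Z (\<Delta> (y i)) (\<lambda>a b. ?g (spl i y a b)) = ?g (ins (Suc i) (epsw i y))" if y: "y \<in> W" for y
  proof -
    let ?u = "spl i y \<one>\<^sub>H \<one>\<^sub>H"
    define w where "w = wmul x ?u"
    have w: "w \<in> W" using x y by (simp add: w_def)
    have e: "wmul x (spl i y a b) = w(i := w i \<cdot> a, Suc i := w (Suc i) \<cdot> b)"
      if "a \<in> \<H>" "b \<in> \<H>" for a b
      using x that by (auto simp: w_def wmul_def spl_def fun_eq_iff)
    have "sw Z (\<Delta> (y i)) (\<lambda>a b. ?g (spl i y a b)) =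
        sw Z (\<Delta> (y i)) (\<lambda>a b. f (w(i := w i \<cdot> a, Suc i := w (Suc i) \<cdot> b)))"
      by (rule sw_cong[OF mH mH]) (simp_all only: e W_closed[OF y] Delta_closed)
    also have "\<dots> = \<epsilon> (y i) \<odot>\<^bsub>Z\<^esub> ?g ?u"
      using l y w by (simp add: rcol_def w_def[symmetric])
    also have "\<dots> = ?g (?u(i := \<epsilon> (y i) \<odot>\<^bsub>H\<^esub> \<one>\<^sub>H))"
      using y by (intro f_epsw[OF g, symmetric]) (auto simp: spl_def)
    also have "?u(i := \<epsilon> (y i) \<odot>\<^bsub>H\<^esub> \<one>\<^sub>H) = ins (Suc i) (epsw i y)"
      by (auto simp: spl_def epsw_def ins_def fun_eq_iff)
    finally show ?thesis .
  qed
  then show "D i s ?g = U (Suc i) (E i s) ?g"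
    by (simp add: D_eval[OF g] U_eval[OF g] E_eval[OF mlin_ins[OF g]]) (auto intro: M_cong[OF s])
qed

text \<open>The usual case: \<open>s\<close> is built from the associator, whose counits are
  trivial, and the whole factor disappears.\<close>

lemma left_collapse_one:
  assumes "s \<in> M" "E i s = one_M" "t \<in> M" "mlin f" "lcol i (Suc i) f"
  shows "(D i s \<star> t) f = t f"
  using left_collapse[OF assms(1,3-5)] assms(2,3) by simp

lemma right_collapse_one:
  assumes "s \<in> M" "E i s = one_M" "t \<in> M" "mlin f" "rcol i (Suc i) f"
  shows "(t \<star> D i s) f = t f"
  using right_collapse[OF assms(1,3-5)] assms(2,3) by simp

end

context quasi_hopf
begin

lemma wcons_numeral [simp]: "(h ## x) (numeral k) = x (pred_numeral k)"
  by (simp add: numeral_eq_Suc)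

end

section \<open>Test functions of a bounded number of letters\<close>

context quasi_hopf_val
begin

lemma mlinnI:
  assumes "\<And>x. x \<in> W \<Longrightarrow> C x \<in> carrier Z"
    and "\<And>x i. x \<in> W \<Longrightarrow> i < n \<Longrightarrow> linear_map K H Z (\<lambda>a. C (x(i := a)))"
    and "\<And>x i a. x \<in> W \<Longrightarrow> i \<ge> n \<Longrightarrow> C (x(i := a)) = C x"
  shows "mlinn n C"
  using assms by (simp add: mlinn_def)

lemma mlinn3:
  assumes cl: "\<And>a b c. \<lbrakk>a \<in> \<H>; b \<in> \<H>; c \<in> \<H>\<rbrakk> \<Longrightarrow> F a b c \<in> carrier Z"
    and lin: "\<And>b c. b \<in> \<H> \<Longrightarrow> c \<in> \<H> \<Longrightarrow> linear_map K H Z (\<lambda>v. F v b c)"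
      "\<And>a c. a \<in> \<H> \<Longrightarrow> c \<in> \<H> \<Longrightarrow> linear_map K H Z (\<lambda>v. F a v c)"
      "\<And>a b. a \<in> \<H> \<Longrightarrow> b \<in> \<H> \<Longrightarrow> linear_map K H Z (\<lambda>v. F a b v)"
  shows "mlinn 3 (\<lambda>x. F (x 0) (x (Suc 0)) (x 2))"
proof (rule mlinnI)
  fix x :: "nat \<Rightarrow> 'h" and i assume x: "x \<in> W"
  { assume "i < (3 :: nat)"
    then consider "i = 0" | "i = 1" | "i = 2" by linarith
    then show "linear_map K H Z (\<lambda>a. F ((x(i := a)) 0) ((x(i := a)) (Suc 0)) ((x(i := a)) 2))"
      by cases (use x in \<open>simp_all add: lin\<close>) }
qed (simp_all add: cl)

lemma mlinn4:
  assumes cl: "\<And>a b c d. \<lbrakk>a \<in> \<H>; b \<in> \<H>; c \<in> \<H>; d \<in> \<H>\<rbrakk> \<Longrightarrow> F a b c d \<in> carrier Z"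
    and lin: "\<And>b c d. \<lbrakk>b \<in> \<H>; c \<in> \<H>; d \<in> \<H>\<rbrakk> \<Longrightarrow> linear_map K H Z (\<lambda>v. F v b c d)"
      "\<And>a c d. \<lbrakk>a \<in> \<H>; c \<in> \<H>; d \<in> \<H>\<rbrakk> \<Longrightarrow> linear_map K H Z (\<lambda>v. F a v c d)"
      "\<And>a b d. \<lbrakk>a \<in> \<H>; b \<in> \<H>; d \<in> \<H>\<rbrakk> \<Longrightarrow> linear_map K H Z (\<lambda>v. F a b v d)"
      "\<And>a b c. \<lbrakk>a \<in> \<H>; b \<in> \<H>; c \<in> \<H>\<rbrakk> \<Longrightarrow> linear_map K H Z (\<lambda>v. F a b c v)"
  shows "mlinn 4 (\<lambda>x. F (x 0) (x (Suc 0)) (x 2) (x 3))"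
proof (rule mlinnI)
  fix x :: "nat \<Rightarrow> 'h" and i assume x: "x \<in> W"
  { assume "i < (4 :: nat)"
    then consider "i = 0" | "i = 1" | "i = 2" | "i = 3" by linarith
    then show "linear_map K H Z (\<lambda>a. F ((x(i := a)) 0) ((x(i := a)) (Suc 0)) ((x(i := a)) 2) ((x(i := a)) 3))"
      by cases (use x in \<open>simp_all add: lin\<close>) }
qed (simp_all add: cl)

lemma mlinn6:
  assumes cl: "\<And>a b c d e k. \<lbrakk>a \<in> \<H>; b \<in> \<H>; c \<in> \<H>; d \<in> \<H>; e \<in> \<H>; k \<in> \<H>\<rbrakk> \<Longrightarrow> F a b c d e k \<in> carrier Z"
    and lin: "\<And>b c d e k. \<lbrakk>b \<in> \<H>; c \<in> \<H>; d \<in> \<H>; e \<in> \<H>; k \<in> \<H>\<rbrakk> \<Longrightarrow> linear_map K H Z (\<lambda>v. F v b c d e k)"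
      "\<And>a c d e k. \<lbrakk>a \<in> \<H>; c \<in> \<H>; d \<in> \<H>; e \<in> \<H>; k \<in> \<H>\<rbrakk> \<Longrightarrow> linear_map K H Z (\<lambda>v. F a v c d e k)"
      "\<And>a b d e k. \<lbrakk>a \<in> \<H>; b \<in> \<H>; d \<in> \<H>; e \<in> \<H>; k \<in> \<H>\<rbrakk> \<Longrightarrow> linear_map K H Z (\<lambda>v. F a b v d e k)"
      "\<And>a b c e k. \<lbrakk>a \<in> \<H>; b \<in> \<H>; c \<in> \<H>; e \<in> \<H>; k \<in> \<H>\<rbrakk> \<Longrightarrow> linear_map K H Z (\<lambda>v. F a b c v e k)"
      "\<And>a b c d k. \<lbrakk>a \<in> \<H>; b \<in> \<H>; c \<in> \<H>; d \<in> \<H>; k \<in> \<H>\<rbrakk> \<Longrightarrow> linear_map K H Z (\<lambda>v. F a b c d v k)"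
      "\<And>a b c d e. \<lbrakk>a \<in> \<H>; b \<in> \<H>; c \<in> \<H>; d \<in> \<H>; e \<in> \<H>\<rbrakk> \<Longrightarrow> linear_map K H Z (\<lambda>v. F a b c d e v)"
  shows "mlinn 6 (\<lambda>x. F (x 0) (x (Suc 0)) (x 2) (x 3) (x 4) (x 5))"
proof (rule mlinnI)
  fix x :: "nat \<Rightarrow> 'h" and i assume x: "x \<in> W"
  { assume "i < (6 :: nat)"
    then consider "i = 0" | "i = 1" | "i = 2" | "i = 3" | "i = 4" | "i = 5" by linarith
    then show "linear_map K H Z (\<lambda>a. F ((x(i := a)) 0) ((x(i := a)) (Suc 0)) ((x(i := a)) 2) ((x(i := a)) 3)
        ((x(i := a)) 4) ((x(i := a)) 5))"
      by cases (use x in \<open>simp_all add: lin\<close>) }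
qed (simp_all add: cl)

lemma PH_ext:
  assumes "mlinn n C" "n \<ge> 3" shows "PH (ext n C) = sw3 Z \<phi> (\<lambda>a b c. C (a ## b ## c ## unit_word))"
proof -
  have u: "(a ## b ## c ## unit_word) i = \<one>\<^sub>H" if "i \<ge> n" for a b c i
    using that assms(2) by (cases i rule: nat.exhaust) (auto simp: wcons_def split: nat.split)
  show ?thesis
    unfolding PH_eval[OF mlin_ext[OF assms(1)]]
    by (rule sw3_cong[OF phi_closed]) (simp add: ext_unit[OF assms(1) _ u])
qed

lemma PI_ext:
  assumes "mlinn n C" "n \<ge> 3" shows "PI (ext n C) = sw3 Z \<phi>inv (\<lambda>a b c. C (a ## b ## c ## unit_word))"
proof -
  have u: "(a ## b ## c ## unit_word) i = \<one>\<^sub>H" if "i \<ge> n" for a b c i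
    using that assms(2) by (cases i rule: nat.exhaust) (auto simp: wcons_def split: nat.split)
  show ?thesis
    unfolding PI_eval[OF mlin_ext[OF assms(1)]]
    by (rule sw3_cong[OF phi_inv_closed]) (simp add: ext_unit[OF assms(1) _ u])
qed

lemma ext3_eval:
  "mlinn 3 C \<Longrightarrow> \<lbrakk>a \<in> \<H>; b \<in> \<H>; c \<in> \<H>\<rbrakk> \<Longrightarrow> ext 3 C (a ## b ## c ## unit_word) = C (a ## b ## c ## unit_word)"
  by (rule ext_unit, assumption, simp) (auto simp: wcons_def split: nat.split)

lemma unit_beyond: "n \<ge> 4 \<Longrightarrow> i \<ge> n \<Longrightarrow> (a ## b ## c ## d ## unit_word) i = \<one>\<^sub>H"
  by (auto simp: wcons_def split: nat.split)

lemma U0_PH_ext: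
  assumes "mlinn n C" "n \<ge> 4" shows "U 0 PH (ext n C) = sw3 Z \<phi> (\<lambda>a b c. C (\<one>\<^sub>H ## a ## b ## c ## unit_word))"
  unfolding U_eval[OF mlin_ext[OF assms(1)]] PH_eval[OF mlin_ins[OF mlin_ext[OF assms(1)]]]
  by (rule sw3_cong[OF phi_closed]) (simp add: ext_unit[OF assms(1) _ unit_beyond[OF assms(2)]])

lemma U_sgl: "x \<in> W \<Longrightarrow> U i (sgl x) = sgl (ins i x)"
  by (rule M_ext) (simp_all add: U_eval sgl_eval[OF mlin_ins])

lemma sw3_apply_linear:
  assumes L: "linear_map K Z Z L" and t: "t \<in> carrier H3"
    and F: "\<And>a b c. \<lbrakk>a \<in> \<H>; b \<in> \<H>; c \<in> \<H>\<rbrakk> \<Longrightarrow> F a b c \<in> carrier Z"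
  shows "L (sw3 Z t F) = sw3 Z t (\<lambda>a b c. L (F a b c))"
proof -
  have "(case p of (a, b, c) \<Rightarrow> F a b c) \<in> carrier Z" if "p \<in> set (terms3 t)" for p
    using F terms3_carrier[OF t] that by (cases p) auto
  from linear_map_lsum[OF L mZ mZ this] show ?thesis by (simp add: sw3_def split_def)
qed

end

section \<open>Dual systems\<close>

locale quasi_hopf_alg = quasi_hopf K H + Z: k_algebra K Z
  for K :: "'k ring" and H :: "('k, 'h) quasi_hopf" and Z :: "('k, 'z, 'm) module_scheme"

sublocale quasi_hopf_alg \<subseteq> quasi_hopf_val
  by (simp add: quasi_hopf_val_def quasi_hopf_axioms Z.module_self)

context quasi_hopf_alg
begin

abbreviation zmult :: "'z \<Rightarrow> 'z \<Rightarrow> 'z" (infixl \<open>\<odot>Z\<close> 70) where "x \<odot>Z y \<equiv> x \<otimes>\<^bsub>Z\<^esub> y"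

text \<open>
  \<open>(f, g, r, s)\<close> satisfies the antipode axioms with \<open>g\<close>, \<open>r\<close>,
      \<open>s\<close> in place of \<open>S\<close>, \<open>\<alpha>\<close>, \<open>\<beta>\<close>, relative to \<open>f\<close>.
  Any two such systems for the same \<open>f\<close> are conjugate by an invertible element.
\<close>

definition dual_system :: "('h \<Rightarrow> 'z) \<Rightarrow> ('h \<Rightarrow> 'z) \<Rightarrow> 'z \<Rightarrow> 'z \<Rightarrow> bool"
  where "dual_system f g r s \<longleftrightarrow> algebra_map K H Z f \<and> anti_algebra_map K H Z g \<and>
    r \<in> carrier Z \<and> s \<in> carrier Z \<and>
    (\<forall>h\<in>\<H>. sw Z (\<Delta> h) (\<lambda>a b. g a \<odot>Z r \<odot>Z f b) = \<epsilon> h \<odot>\<^bsub>Z\<^esub> r) \<and>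
    (\<forall>h\<in>\<H>. sw Z (\<Delta> h) (\<lambda>a b. f a \<odot>Z s \<odot>Z g b) = \<epsilon> h \<odot>\<^bsub>Z\<^esub> s) \<and>
    sw3 Z \<phi> (\<lambda>a b c. f a \<odot>Z s \<odot>Z g b \<odot>Z r \<odot>Z f c) = \<one>\<^bsub>Z\<^esub> \<and>
    sw3 Z \<phi>inv (\<lambda>a b c. g a \<odot>Z r \<odot>Z f b \<odot>Z s \<odot>Z g c) = \<one>\<^bsub>Z\<^esub>"

lemma sw_sandwich:
  assumes "p \<in> carrier Z" "q \<in> carrier Z" "t \<in> carrier H2"
    "\<And>a b. a \<in> \<H> \<Longrightarrow> b \<in> \<H> \<Longrightarrow> B a b \<in> carrier Z"
  shows "sw Z t (\<lambda>a b. p \<odot>Z B a b \<odot>Z q) = p \<odot>Z sw Z t B \<odot>Z q"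
  using linear_map_apply_sw[OF mH mH mZ mZ Z.lin_mult_left[OF Z.lin_mult_right[OF linear_map_id assms(1)]
      assms(2)] assms(3,4)]
  by simp

lemma sw3_sandwich:
  assumes "p \<in> carrier Z" "q \<in> carrier Z" "t \<in> carrier H3"
    "\<And>a b c. \<lbrakk>a \<in> \<H>; b \<in> \<H>; c \<in> \<H>\<rbrakk> \<Longrightarrow> F a b c \<in> carrier Z"
  shows "sw3 Z t (\<lambda>a b c. p \<odot>Z F a b c \<odot>Z q) = p \<odot>Z sw3 Z t F \<odot>Z q"
  using sw3_apply_linear[OF Z.lin_mult_left[OF Z.lin_mult_right[OF linear_map_id assms(1)] assms(2)] assms(3,4)]
  by simp

text \<open>Drinfeld's comparison element between two antipode structures: the last axiom of a dual
  system, with \<open>g'\<close> and \<open>r'\<close> from one system and \<open>s\<close>,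
  \<open>g\<close> from the other. For equal systems it is 1.\<close>

definition twist :: "('h \<Rightarrow> 'z) \<Rightarrow> 'z \<Rightarrow> ('h \<Rightarrow> 'z) \<Rightarrow> 'z \<Rightarrow> ('h \<Rightarrow> 'z) \<Rightarrow> 'z"
  where "twist g' r' f s g = sw3 Z \<phi>inv (\<lambda>a b c. g' a \<odot>Z r' \<odot>Z f b \<odot>Z s \<odot>Z g c)"

context
  fixes f g g' :: "'h \<Rightarrow> 'z" and r s r' s' :: 'z
  assumes D1: "dual_system f g r s" and D2: "dual_system f g' r' s'"
begin

lemma dual_facts:
  shows f_lin: "linear_map K H Z f" and g_lin: "linear_map K H Z g" and g'_lin: "linear_map K H Z g'"
    and f_mult: "\<And>a b. a \<in> \<H> \<Longrightarrow> b \<in> \<H> \<Longrightarrow> f (a \<cdot> b) = f a \<odot>Z f b"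
    and g_mult: "\<And>a b. a \<in> \<H> \<Longrightarrow> b \<in> \<H> \<Longrightarrow> g (a \<cdot> b) = g b \<odot>Z g a"
    and g'_mult: "\<And>a b. a \<in> \<H> \<Longrightarrow> b \<in> \<H> \<Longrightarrow> g' (a \<cdot> b) = g' b \<odot>Z g' a"
    and f_one: "f \<one>\<^sub>H = \<one>\<^bsub>Z\<^esub>" and g_one: "g \<one>\<^sub>H = \<one>\<^bsub>Z\<^esub>" and g'_one: "g' \<one>\<^sub>H = \<one>\<^bsub>Z\<^esub>"
    and rs: "r \<in> carrier Z" "s \<in> carrier Z" "r' \<in> carrier Z" "s' \<in> carrier Z"
  using D1 D2 by (simp_all add: dual_system_def algebra_map_def anti_algebra_map_def)

lemmas fg_closed = linear_map_closed[OF f_lin] linear_map_closed[OF g_lin] linear_map_closed[OF g'_lin]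

lemmas lins = Z.lin_mult_left Z.lin_mult_right f_lin g_lin g'_lin Z.m_closed fg_closed rs

lemma dual_left:
  assumes "p \<in> carrier Z" "q \<in> carrier Z" "h \<in> \<H>"
  shows "sw Z (\<Delta> h) (\<lambda>a b. p \<odot>Z (g' a \<odot>Z r' \<odot>Z f b) \<odot>Z q) = \<epsilon> h \<odot>\<^bsub>Z\<^esub> (p \<odot>Z r' \<odot>Z q)"
    "sw Z (\<Delta> h) (\<lambda>a b. p \<odot>Z (g a \<odot>Z r \<odot>Z f b) \<odot>Z q) = \<epsilon> h \<odot>\<^bsub>Z\<^esub> (p \<odot>Z r \<odot>Z q)"
    "sw Z (\<Delta> h) (\<lambda>a b. p \<odot>Z (f a \<odot>Z s \<odot>Z g b) \<odot>Z q) = \<epsilon> h \<odot>\<^bsub>Z\<^esub> (p \<odot>Z s \<odot>Z q)"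
  using D1 D2 assms
  by (simp_all add: sw_sandwich dual_system_def fg_closed rs Z.smult_mult_right Z.smult_mult_left)

lemma twist_closed: "twist g' r' f s g \<in> carrier Z"
  unfolding twist_def by (rule sw3_closed) (simp_all add: fg_closed rs)

text \<open>Naturality moves the doubly split \<open>ev1 h\<close> past \<open>PI\<close>. To the
  right of \<open>PI\<close> its coproduct in slots 1 and 2 is absorbed at \<open>s\<close> and
  \<open>h\<close> ends up under \<open>g'\<close>; to the left of \<open>PI\<close> slots 0 and 1
  are absorbed at \<open>r'\<close> and \<open>h\<close> ends up under \<open>g\<close>.\<close>

lemma twist_intertwines:
  assumes h: "h \<in> \<H>"
  shows "twist g' r' f s g \<odot>Z g h = g' h \<odot>Z twist g' r' f s g"
proof -
  let ?C = "\<lambda>x. g' (x 0) \<odot>Z r' \<odot>Z f (x (Suc 0)) \<odot>Z s \<odot>Z g (x 2)"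
  have m: "mlinn 3 ?C" by (rule mlinn3) (simp_all add: lins)
  note me = mlin_ext[OF m]
  have l: "lcol 0 1 (ext 3 ?C)"
  proof (rule lcol_ext[OF m])
    show "lcol 0 1 ?C"
      unfolding lcol_def
    proof (intro ballI)
      fix x k assume x: "x \<in> W" and k: "k \<in> \<H>"
      have "sw Z (\<Delta> k) (\<lambda>a b. ?C (x(0 := a \<cdot> x 0, 1 := b \<cdot> x 1))) =
          sw Z (\<Delta> k) (\<lambda>a b. g' (x 0) \<odot>Z (g' a \<odot>Z r' \<odot>Z f b) \<odot>Z (f (x (Suc 0)) \<odot>Z s \<odot>Z g (x 2)))"
        using x k by (intro sw_cong[OF mH mH]) (simp_all add: f_mult g'_mult fg_closed rs Z.m_assoc)
      then show "sw Z (\<Delta> k) (\<lambda>a b. ?C (x(0 := a \<cdot> x 0, 1 := b \<cdot> x 1))) = \<epsilon> k \<odot>\<^bsub>Z\<^esub> ?C x"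
        using x k by (simp add: dual_left fg_closed rs Z.m_assoc)
    qed
  qed simp_all
  have r: "rcol 1 2 (ext 3 ?C)"
  proof (rule rcol_ext[OF m])
    show "rcol 1 2 ?C"
      unfolding rcol_def
    proof (intro ballI)
      fix x k assume x: "x \<in> W" and k: "k \<in> \<H>"
      have "sw Z (\<Delta> k) (\<lambda>a b. ?C (x(1 := x 1 \<cdot> a, 2 := x 2 \<cdot> b))) =
          sw Z (\<Delta> k) (\<lambda>a b. (g' (x 0) \<odot>Z r' \<odot>Z f (x (Suc 0))) \<odot>Z (f a \<odot>Z s \<odot>Z g b) \<odot>Z g (x 2))"
        using x k by (intro sw_cong[OF mH mH]) (simp_all add: f_mult g_mult fg_closed rs Z.m_assoc)
      then show "sw Z (\<Delta> k) (\<lambda>a b. ?C (x(1 := x 1 \<cdot> a, 2 := x 2 \<cdot> b))) = \<epsilon> k \<odot>\<^bsub>Z\<^esub> ?C x"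
        using x k by (simp add: dual_left fg_closed rs Z.m_assoc)
    qed
  qed simp_all
  have hM: "ev1 h \<in> M" using h by simp
  have e1: "U 2 (E 1 (D 0 (ev1 h))) = ev1 h"
    using E_D_right[OF hM, of 0] h by (simp add: ev1_def U_sgl numeral_2_eq_2)
  have e2: "U 1 (E 0 (D 0 (ev1 h))) = sgl (\<one>\<^sub>H ## \<one>\<^sub>H ## h ## unit_word)"
    using E_D_left[OF hM, of 0] h by (simp add: ev1_def U_sgl)
  have "PI \<star> D 1 (D 0 (ev1 h)) = PI \<star> (D 1 (D 0 (ev1 h)) \<star> PH) \<star> PI"
    using hM by (simp add: star_assoc)
  also have "\<dots> = D 0 (D 0 (ev1 h)) \<star> PI"
    unfolding coassoc0[OF hM] using hM by (simp add: star_assoc)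
  finally have c: "(PI \<star> D 1 (D 0 (ev1 h))) (ext 3 ?C) = (D 0 (D 0 (ev1 h)) \<star> PI) (ext 3 ?C)" by simp
  have "(PI \<star> D 1 (D 0 (ev1 h))) (ext 3 ?C) = (PI \<star> ev1 h) (ext 3 ?C)"
    using right_collapse[OF _ PI_M me, of "D 0 (ev1 h)" 1] r hM e1 by (simp add: numeral_2_eq_2)
  also have "\<dots> = PI (\<lambda>x. ext 3 ?C (wmul x (h ## unit_word)))"
    unfolding star_eval[OF me] by (rule M_cong[OF PI_M]) (simp add: ev1_def mlin_wmul_right[OF me])
  also have "\<dots> = sw3 Z \<phi>inv (\<lambda>a b c. ext 3 ?C (a \<cdot> h ## b ## c ## unit_word))"
    using h by (simp add: PI_eval[OF mlin_wmul_left[OF me]]) (auto intro!: sw3_cong[OF phi_inv_closed])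
  also have "\<dots> = sw3 Z \<phi>inv (\<lambda>a b c. g' h \<odot>Z (g' a \<odot>Z r' \<odot>Z f b \<odot>Z s \<odot>Z g c) \<odot>Z \<one>\<^bsub>Z\<^esub>)"
    using h by (intro sw3_cong[OF phi_inv_closed]) (simp add: ext3_eval[OF m] g'_mult fg_closed rs Z.m_assoc)
  also have "\<dots> = g' h \<odot>Z twist g' r' f s g"
    unfolding twist_def using h by (subst sw3_sandwich) (simp_all add: fg_closed rs sw3_closed)
  finally have L: "(PI \<star> D 1 (D 0 (ev1 h))) (ext 3 ?C) = g' h \<odot>Z twist g' r' f s g" .
  have w: "\<one>\<^sub>H ## \<one>\<^sub>H ## h ## unit_word \<in> W" using h by simp
  have "(D 0 (D 0 (ev1 h)) \<star> PI) (ext 3 ?C) = (sgl (\<one>\<^sub>H ## \<one>\<^sub>H ## h ## unit_word) \<star> PI) (ext 3 ?C)"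
    using left_collapse[OF _ PI_M me, of "D 0 (ev1 h)" 0] l hM e2 by simp
  also have "\<dots> = sw3 Z \<phi>inv (\<lambda>a b c. ext 3 ?C (wmul (\<one>\<^sub>H ## \<one>\<^sub>H ## h ## unit_word) (a ## b ## c ## unit_word)))"
    by (simp only: star_eval[OF me] sgl_eval[OF mlin_star[OF PI_M me]] PI_eval[OF mlin_wmul_right[OF me w]])
  also have "\<dots> = sw3 Z \<phi>inv (\<lambda>a b c. \<one>\<^bsub>Z\<^esub> \<odot>Z (g' a \<odot>Z r' \<odot>Z f b \<odot>Z s \<odot>Z g c) \<odot>Z g h)"
    using h by (intro sw3_cong[OF phi_inv_closed]) (simp add: ext3_eval[OF m] g_mult fg_closed rs Z.m_assoc)
  also have "\<dots> = twist g' r' f s g \<odot>Z g h"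
    unfolding twist_def using h by (subst sw3_sandwich) (simp_all add: fg_closed rs sw3_closed)
  finally show ?thesis using L c by simp
qed

text \<open>The summand of the twist is followed by \<open>r\<close> and a fourth letter under
  \<open>f\<close>. In \<open>pentagon_a\<close> every coproduct then meets an absorbing pair:
  \<open>D 1 PI\<close> at \<open>s\<close>, \<open>D 0 PI\<close> at \<open>r'\<close>,
  \<open>D 2 PI\<close> at \<open>r\<close>. One side leaves the twist times \<open>r\<close>, the
  other \<open>r'\<close> times the normalisation with \<phi>, which is 1.\<close>

lemma twist_r: "twist g' r' f s g \<odot>Z r = r'"
proof -
  let ?C = "\<lambda>x. g' (x 0) \<odot>Z r' \<odot>Z f (x (Suc 0)) \<odot>Z s \<odot>Z g (x 2) \<odot>Z r \<odot>Z f (x 3)"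
  have m: "mlinn 4 ?C" by (rule mlinn4) (simp_all add: lins)
  note me = mlin_ext[OF m]
  have l0: "lcol 0 1 (ext 4 ?C)"
  proof (rule lcol_ext[OF m])
    show "lcol 0 1 ?C"
      unfolding lcol_def
    proof (intro ballI)
      fix x k assume x: "x \<in> W" and k: "k \<in> \<H>"
      have "sw Z (\<Delta> k) (\<lambda>a b. ?C (x(0 := a \<cdot> x 0, 1 := b \<cdot> x 1))) =
          sw Z (\<Delta> k) (\<lambda>a b. g' (x 0) \<odot>Z (g' a \<odot>Z r' \<odot>Z f b) \<odot>Z (f (x (Suc 0)) \<odot>Z s \<odot>Z g (x 2) \<odot>Z r \<odot>Z f (x 3)))"
        using x k by (intro sw_cong[OF mH mH]) (simp_all add: f_mult g'_mult fg_closed rs Z.m_assoc)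
      then show "sw Z (\<Delta> k) (\<lambda>a b. ?C (x(0 := a \<cdot> x 0, 1 := b \<cdot> x 1))) = \<epsilon> k \<odot>\<^bsub>Z\<^esub> ?C x"
        using x k by (simp add: dual_left fg_closed rs Z.m_assoc)
    qed
  qed simp_all
  have l2: "lcol 2 3 (ext 4 ?C)"
  proof (rule lcol_ext[OF m])
    show "lcol 2 3 ?C"
      unfolding lcol_def
    proof (intro ballI)
      fix x k assume x: "x \<in> W" and k: "k \<in> \<H>"
      have "sw Z (\<Delta> k) (\<lambda>a b. ?C (x(2 := a \<cdot> x 2, 3 := b \<cdot> x 3))) =
          sw Z (\<Delta> k) (\<lambda>a b. (g' (x 0) \<odot>Z r' \<odot>Z f (x (Suc 0)) \<odot>Z s \<odot>Z g (x 2)) \<odot>Z (g a \<odot>Z r \<odot>Z f b) \<odot>Z f (x 3))"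
        using x k by (intro sw_cong[OF mH mH]) (simp_all add: f_mult g_mult fg_closed rs Z.m_assoc)
      then show "sw Z (\<Delta> k) (\<lambda>a b. ?C (x(2 := a \<cdot> x 2, 3 := b \<cdot> x 3))) = \<epsilon> k \<odot>\<^bsub>Z\<^esub> ?C x"
        using x k by (simp add: dual_left fg_closed rs Z.m_assoc)
    qed
  qed simp_all
  have r: "rcol 1 2 (ext 4 ?C)"
  proof (rule rcol_ext[OF m])
    show "rcol 1 2 ?C"
      unfolding rcol_def
    proof (intro ballI)
      fix x k assume x: "x \<in> W" and k: "k \<in> \<H>"
      have "sw Z (\<Delta> k) (\<lambda>a b. ?C (x(1 := x 1 \<cdot> a, 2 := x 2 \<cdot> b))) =
          sw Z (\<Delta> k) (\<lambda>a b. (g' (x 0) \<odot>Z r' \<odot>Z f (x (Suc 0))) \<odot>Z (f a \<odot>Z s \<odot>Z g b) \<odot>Z (g (x 2) \<odot>Z r \<odot>Z f (x 3)))"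
        using x k by (intro sw_cong[OF mH mH]) (simp_all add: f_mult g_mult fg_closed rs Z.m_assoc)
      then show "sw Z (\<Delta> k) (\<lambda>a b. ?C (x(1 := x 1 \<cdot> a, 2 := x 2 \<cdot> b))) = \<epsilon> k \<odot>\<^bsub>Z\<^esub> ?C x"
        using x k by (simp add: dual_left fg_closed rs Z.m_assoc)
    qed
  qed simp_all
  have "PI (ext 4 ?C) = (PI \<star> D 1 PI) (ext 4 ?C)"
    using right_collapse_one[OF PI_M _ PI_M me, of 1] r by (simp add: numeral_2_eq_2)
  also have "\<dots> = (D 0 PI \<star> (D 2 PI \<star> U 0 PH)) (ext 4 ?C)"
    by (simp only: pentagon_a star_assoc D_M U_M PI_M PH_M)
  also have "\<dots> = U 0 PH (ext 4 ?C)"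
    using left_collapse_one[OF PI_M _ _ me, of 0 "D 2 PI \<star> U 0 PH"] l0
      left_collapse_one[OF PI_M _ _ me, of 2 "U 0 PH"] l2 by simp
  finally have e: "PI (ext 4 ?C) = U 0 PH (ext 4 ?C)" .
  have "PI (ext 4 ?C) = sw3 Z \<phi>inv (\<lambda>a b c. \<one>\<^bsub>Z\<^esub> \<odot>Z (g' a \<odot>Z r' \<odot>Z f b \<odot>Z s \<odot>Z g c) \<odot>Z r)"
    by (subst PI_ext[OF m]) (auto intro!: sw3_cong[OF phi_inv_closed] simp: f_one fg_closed rs)
  also have "\<dots> = twist g' r' f s g \<odot>Z r"
    unfolding twist_def by (subst sw3_sandwich) (simp_all add: fg_closed rs sw3_closed)
  finally have L: "PI (ext 4 ?C) = twist g' r' f s g \<odot>Z r" .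
  have "U 0 PH (ext 4 ?C) = sw3 Z \<phi> (\<lambda>a b c. r' \<odot>Z (f a \<odot>Z s \<odot>Z g b \<odot>Z r \<odot>Z f c) \<odot>Z \<one>\<^bsub>Z\<^esub>)"
    by (subst U0_PH_ext[OF m]) (auto intro!: sw3_cong[OF phi_closed] simp: g'_one fg_closed rs Z.m_assoc)
  also have "\<dots> = r'"
    using D1 by (subst sw3_sandwich) (simp_all add: fg_closed rs dual_system_def)
  finally show ?thesis using L e by simp
qed

text \<open>The first twist passes \<open>g a\<close> by \<open>twist_intertwines\<close> and turns
  \<open>r\<close> into \<open>r'\<close> by \<open>twist_r\<close>; the sum for the second twist
  becomes the normalisation of the primed system. Exchanging the systems gives the inverse on the
  other side.\<close>

lemma twist_mult: "twist g' r' f s g \<odot>Z twist g r f s' g' = \<one>\<^bsub>Z\<^esub>"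
proof -
  let ?T = "twist g' r' f s g"
  have "?T \<odot>Z twist g r f s' g' = ?T \<odot>Z sw3 Z \<phi>inv (\<lambda>a b c. g a \<odot>Z r \<odot>Z f b \<odot>Z s' \<odot>Z g' c) \<odot>Z \<one>\<^bsub>Z\<^esub>"
    by (simp add: twist_def sw3_closed fg_closed rs)
  also have "\<dots> = sw3 Z \<phi>inv (\<lambda>a b c. ?T \<odot>Z (g a \<odot>Z r \<odot>Z f b \<odot>Z s' \<odot>Z g' c) \<odot>Z \<one>\<^bsub>Z\<^esub>)"
    by (rule sw3_sandwich[symmetric]) (simp_all add: twist_closed fg_closed rs)
  also have "\<dots> = sw3 Z \<phi>inv (\<lambda>a b c. g' a \<odot>Z r' \<odot>Z f b \<odot>Z s' \<odot>Z g' c)"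
  proof (rule sw3_cong[OF phi_inv_closed])
    fix a b c assume abc: "a \<in> \<H>" "b \<in> \<H>" "c \<in> \<H>"
    have "?T \<odot>Z (g a \<odot>Z r \<odot>Z f b \<odot>Z s' \<odot>Z g' c) \<odot>Z \<one>\<^bsub>Z\<^esub> = (?T \<odot>Z g a) \<odot>Z r \<odot>Z (f b \<odot>Z s' \<odot>Z g' c)"
      using abc by (simp add: twist_closed fg_closed rs Z.m_assoc)
    also have "\<dots> = g' a \<odot>Z (?T \<odot>Z r) \<odot>Z (f b \<odot>Z s' \<odot>Z g' c)"
      using abc by (simp add: twist_intertwines twist_closed fg_closed rs Z.m_assoc)
    finally show "?T \<odot>Z (g a \<odot>Z r \<odot>Z f b \<odot>Z s' \<odot>Z g' c) \<odot>Z \<one>\<^bsub>Z\<^esub> = g' a \<odot>Z r' \<odot>Z f b \<odot>Z s' \<odot>Z g' c"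
      using abc by (simp add: twist_r fg_closed rs Z.m_assoc)
  qed
  also have "\<dots> = \<one>\<^bsub>Z\<^esub>" using D2 by (simp add: dual_system_def)
  finally show ?thesis .
qed

end

end

section \<open>Functionals of bounded support and the reassociation of four legs\<close>

context quasi_hopf_val
begin

text \<open>Test functions may be exchanged under such a functional as soon as they agree on words
  that are 1 from \<open>n\<close> on. The closed formulas for functions extended by
  \<open>ext\<close> are available on such words.\<close>

definition supp :: "nat \<Rightarrow> (((nat \<Rightarrow> 'h) \<Rightarrow> 'z) \<Rightarrow> 'z) \<Rightarrow> bool"
  where "supp n t \<longleftrightarrow> (\<forall>g g'. mlin g \<longrightarrow> mlin g' \<longrightarrow>
    (\<forall>x\<in>W. (\<forall>i\<ge>n. x i = \<one>\<^sub>H) \<longrightarrow> g x = g' x) \<longrightarrow> t g = t g')"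

lemma suppD:
  "supp n t \<Longrightarrow> mlin g \<Longrightarrow> mlin g' \<Longrightarrow> (\<And>x. x \<in> W \<Longrightarrow> (\<And>i. i \<ge> n \<Longrightarrow> x i = \<one>\<^sub>H) \<Longrightarrow> g x = g' x) \<Longrightarrow> t g = t g'"
  unfolding supp_def by blast

lemma supp_ev3: "t \<in> carrier H3 \<Longrightarrow> supp 3 (ev3 t)"
  unfolding supp_def
proof (intro allI impI)
  fix g g' assume t: "t \<in> carrier H3" and g: "mlin g" "mlin g'"
    and eq: "\<forall>x\<in>W. (\<forall>i\<ge>3. x i = \<one>\<^sub>H) \<longrightarrow> g x = g' x"
  have "(a ## b ## c ## unit_word) i = \<one>\<^sub>H" if "i \<ge> 3" for a b c i
    using that by (auto simp: wcons_def split: nat.split)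
  then show "ev3 t g = ev3 t g'"
    using eq by (simp add: ev3_eval[OF t] g) (auto intro!: sw3_cong[OF t])
qed

lemma supp_D:
  assumes s: "supp n t" and i: "i < n" shows "supp (Suc n) (D i t)"
  unfolding supp_def
proof (intro allI impI)
  fix g g' assume g: "mlin g" "mlin g'" and eq: "\<forall>x\<in>W. (\<forall>i\<ge>Suc n. x i = \<one>\<^sub>H) \<longrightarrow> g x = g' x"
  show "D i t g = D i t g'"
    unfolding D_eval[OF g(1)] D_eval[OF g(2)]
  proof (rule suppD[OF s mlin_spl[OF g(1)] mlin_spl[OF g(2)]])
    fix x assume x: "x \<in> W" "\<And>i. i \<ge> n \<Longrightarrow> x i = \<one>\<^sub>H"
    have u: "spl i x a b j = \<one>\<^sub>H" if "j \<ge> Suc n" for a b j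
      using x(2)[of "j - 1"] that i by (simp add: spl_apply)
    show "sw Z (\<Delta> (x i)) (\<lambda>a b. g (spl i x a b)) = sw Z (\<Delta> (x i)) (\<lambda>a b. g' (spl i x a b))"
      using x(1) by (intro sw_cong[OF mH mH] eq[rule_format] u) auto
  qed
qed

lemma supp_U:
  assumes s: "supp n t" and i: "i \<le> n" shows "supp (Suc n) (U i t)"
  unfolding supp_def
proof (intro allI impI)
  fix g g' assume g: "mlin g" "mlin g'" and eq: "\<forall>x\<in>W. (\<forall>i\<ge>Suc n. x i = \<one>\<^sub>H) \<longrightarrow> g x = g' x"
  show "U i t g = U i t g'"
    unfolding U_eval[OF g(1)] U_eval[OF g(2)]
  proof (rule suppD[OF s mlin_ins[OF g(1)] mlin_ins[OF g(2)]])
    fix x assume x: "x \<in> W" "\<And>i. i \<ge> n \<Longrightarrow> x i = \<one>\<^sub>H"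
    have "ins i x j = \<one>\<^sub>H" if "j \<ge> Suc n" for j
      using x(2)[of "j - 1"] that i by (simp add: ins_def)
    then show "g (ins i x) = g' (ins i x)" using x(1) eq by simp
  qed
qed

lemma supp_star:
  assumes s: "supp n s" and t: "supp n t" "t \<in> M" shows "supp n (s \<star> t)"
  unfolding supp_def
proof (intro allI impI)
  fix g g' assume g: "mlin g" "mlin g'" and eq: "\<forall>x\<in>W. (\<forall>i\<ge>n. x i = \<one>\<^sub>H) \<longrightarrow> g x = g' x"
  show "(s \<star> t) g = (s \<star> t) g'"
    unfolding star_eval[OF g(1)] star_eval[OF g(2)]
  proof (rule suppD[OF s mlin_star[OF t(2) g(1)] mlin_star[OF t(2) g(2)]])
    fix x assume x: "x \<in> W" "\<And>i. i \<ge> n \<Longrightarrow> x i = \<one>\<^sub>H"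
    show "t (\<lambda>y. g (wmul x y)) = t (\<lambda>y. g' (wmul x y))"
    proof (rule suppD[OF t(1) mlin_wmul_right[OF g(1) x(1)] mlin_wmul_right[OF g(2) x(1)]])
      fix y assume y: "y \<in> W" "\<And>i. i \<ge> n \<Longrightarrow> y i = \<one>\<^sub>H"
      have "wmul x y i = \<one>\<^sub>H" if "i \<ge> n" for i
        using that x(2) y(2) by (simp add: wmul_def)
      then show "g (wmul x y) = g' (wmul x y)"
        using x(1) y(1) eq by simp
    qed
  qed
qed

lemma W4_cases:
  assumes "x \<in> W" "\<And>i. i \<ge> 4 \<Longrightarrow> x i = \<one>\<^sub>H"
  obtains a b c d where "x = a ## b ## c ## d ## unit_word" "a \<in> \<H>" "b \<in> \<H>" "c \<in> \<H>" "d \<in> \<H>"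
proof -
  have "x = x 0 ## x 1 ## x 2 ## x 3 ## unit_word"
  proof
    fix i :: nat
    have "i \<ge> 4 \<or> i = 0 \<or> i = 1 \<or> i = 2 \<or> i = 3" by linarith
    then show "x i = (x 0 ## x 1 ## x 2 ## x 3 ## unit_word) i"
      using assms(2) unit_beyond[of 4 i "x 0" "x 1" "x 2" "x 3"] by auto
  qed
  then show ?thesis using that assms(1) by simp
qed

lemma supp_PH: "supp 3 PH" and supp_PI: "supp 3 PI"
  by (simp_all add: PH_def PI_def supp_ev3)

text \<open>Reassociation from (01)(23) to 0((12)3), with inverse \<open>DT\<close>. The pair 12 can
  be contracted first and the pair 03 around it, as for the evaluation on a product of two dual
  objects.\<close>

definition "ET = U 0 PI \<star> D 2 PH"
definition "DT = D 2 PI \<star> U 0 PH"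

lemma ET_M [simp]: "ET \<in> M" and DT_M [simp]: "DT \<in> M"
  by (simp_all add: ET_def DT_def)

lemma ET_DT [simp]: "ET \<star> DT = one_M" "DT \<star> ET = one_M"
  by (simp_all add: ET_def DT_def star_assoc)

lemma supp_ET: "supp 4 ET" and supp_DT: "supp 4 DT"
  unfolding ET_def DT_def
  using supp_D[OF supp_PH, of 2] supp_D[OF supp_PI, of 2] supp_U[OF supp_PH, of 0] supp_U[OF supp_PI, of 0]
  by (simp_all add: supp_star)

lemma M_apply_linear:
  assumes t: "t \<in> M" and f: "mlin f" and L: "linear_map K Z Z L" shows "t (\<lambda>x. L (f x)) = L (t f)"
proof (rule ME[OF t])
  fix xs assume xs: "set xs \<subseteq> W" "\<And>f. t f = (if mlin f then lsum Z (map f xs) else undefined)"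
  have "mlin (\<lambda>x. L (f x))" by (rule mlinI) (rule linear_map_comp[OF mlinD[OF f] L])
  then show "t (\<lambda>x. L (f x)) = L (t f)"
    using linear_map_lsum[OF L mZ mZ, of xs f] subsetD[OF xs(1)] mlin_closed[OF f] f by (simp add: xs(2))
qed

lemma mlin_linear: "mlin f \<Longrightarrow> linear_map K Z Z L \<Longrightarrow> mlin (\<lambda>x. L (f x))"
  by (rule mlinI) (rule linear_map_comp[OF mlinD])

text \<open>\<^term>\<open>DD h\<close> is \<^term>\<open>h\<close> split into four legs, grouped as (12)(34).\<close>

definition DD :: "'h \<Rightarrow> ((nat \<Rightarrow> 'h) \<Rightarrow> 'z) \<Rightarrow> 'z"
  where "DD h = D 2 (D 0 (D 0 (ev1 h)))"

lemma DD_M [simp]: "h \<in> \<H> \<Longrightarrow> DD h \<in> M"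
  by (simp add: DD_def)

lemma D0_ev1_eval: "h \<in> \<H> \<Longrightarrow> mlin f \<Longrightarrow> D 0 (ev1 h) f = sw Z (\<Delta> h) (\<lambda>a b. f (a ## b ## unit_word))"
  by (simp add: D_eval ev1_def sgl_eval[OF mlin_spl])

lemma DD_eval:
  assumes h: "h \<in> \<H>" and f: "mlin f"
  shows "DD h f = sw Z (\<Delta> h) (\<lambda>a b. sw Z (\<Delta> a) (\<lambda>a1 a2. sw Z (\<Delta> b) (\<lambda>b1 b2. f (a1 ## a2 ## b1 ## b2 ## unit_word))))"
  unfolding DD_def D_eval[OF f] D_eval[OF mlin_spl[OF f]] D0_ev1_eval[OF h mlin_spl[OF mlin_spl[OF f]]]
  by (simp add: numeral_2_eq_2)

text \<open>Naturality of \<open>ET\<close>, by one use each of \<open>coassoc0\<close> and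
  \<open>coassoc1\<close>: a letter split as (01)(23) passes to the left and arrives split as
  0((12)3).\<close>

lemma ET_DD:
  assumes h: "h \<in> \<H>"
  shows "ET \<star> DD h = D 1 (D 1 (D 0 (ev1 h))) \<star> ET"
proof -
  let ?t = "D 0 (ev1 h)"
  have t: "?t \<in> M" using h by simp
  have "ET \<star> DD h = U 0 PI \<star> D 2 (PH \<star> D 0 ?t)"
    using t by (simp add: ET_def DD_def D_star star_assoc)
  also have "PH \<star> D 0 ?t = D 1 ?t \<star> PH" by (simp only: coassoc0[OF ev_M(1)[OF h]])
  also have "U 0 PI \<star> D 2 (D 1 ?t \<star> PH) = U 0 PI \<star> (D 2 (D 1 ?t) \<star> U 0 PH) \<star> U 0 PI \<star> D 2 PH"
    using t by (simp add: D_star star_assoc)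
  also have "\<dots> = D 1 (D 1 ?t) \<star> ET"
    unfolding coassoc1[OF t] using t by (simp add: ET_def star_assoc)
  finally show ?thesis .
qed

lemma DD_DT:
  assumes h: "h \<in> \<H>"
  shows "DD h \<star> DT = DT \<star> D 1 (D 1 (D 0 (ev1 h)))"
proof -
  have "DD h \<star> DT = DT \<star> (ET \<star> DD h) \<star> DT"
    using h star_cancel[OF ET_DT(2) DT_M ET_M] by (simp add: star_assoc)
  then show ?thesis using h by (simp add: ET_DD star_assoc)
qed

text \<open>Criterion for concrete test functions: \<open>L x v\<close> is the function with the
  \<alpha> between the two slots replaced by \<open>v\<close>, so that the antipode axiom applies
  inside a linear map.\<close>

lemma lcol_alpha:
  assumes "\<And>x. x \<in> W \<Longrightarrow> linear_map K H Z (L x)"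
    and "\<And>x a b. x \<in> W \<Longrightarrow> a \<in> \<H> \<Longrightarrow> b \<in> \<H> \<Longrightarrow> f (x(i := a \<cdot> x i, j := b \<cdot> x j)) = L x (S a \<cdot> \<alpha> \<cdot> b)"
    and "\<And>x. x \<in> W \<Longrightarrow> f x = L x \<alpha>"
  shows "lcol i j f"
  unfolding lcol_def
proof (intro ballI)
  fix x h assume x: "x \<in> W" and h: "h \<in> \<H>"
  have "sw Z (\<Delta> h) (\<lambda>a b. f (x(i := a \<cdot> x i, j := b \<cdot> x j))) = sw Z (\<Delta> h) (\<lambda>a b. L x (S a \<cdot> \<alpha> \<cdot> b))" (is "?lhs = _")
    using x h by (intro sw_cong[OF mH mH] assms(2)) auto
  also have "\<dots> = L x (sw H (\<Delta> h) (\<lambda>a b. S a \<cdot> \<alpha> \<cdot> b))"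
    using h by (intro linear_map_apply_sw[OF mH mH mH mZ assms(1)[OF x], symmetric]) auto
  also have "\<dots> = L x (\<epsilon> h \<odot>\<^bsub>H\<^esub> \<alpha>)" using antipode_alpha[OF h] by (simp add: sw_def)
  also have "\<dots> = \<epsilon> h \<odot>\<^bsub>Z\<^esub> f x" using x h by (simp add: linear_map_smult[OF assms(1)] assms(3))
  finally show "?lhs = \<epsilon> h \<odot>\<^bsub>Z\<^esub> f x" .
qed

lemma rcol_beta:
  assumes "\<And>x. x \<in> W \<Longrightarrow> linear_map K H Z (L x)"
    and "\<And>x a b. x \<in> W \<Longrightarrow> a \<in> \<H> \<Longrightarrow> b \<in> \<H> \<Longrightarrow> f (x(i := x i \<cdot> a, j := x j \<cdot> b)) = L x (a \<cdot> \<beta> \<cdot> S b)"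
    and "\<And>x. x \<in> W \<Longrightarrow> f x = L x \<beta>"
  shows "rcol i j f"
  unfolding rcol_def
proof (intro ballI)
  fix x h assume x: "x \<in> W" and h: "h \<in> \<H>"
  have "sw Z (\<Delta> h) (\<lambda>a b. f (x(i := x i \<cdot> a, j := x j \<cdot> b))) = sw Z (\<Delta> h) (\<lambda>a b. L x (a \<cdot> \<beta> \<cdot> S b))" (is "?lhs = _")
    using x h by (intro sw_cong[OF mH mH] assms(2)) auto
  also have "\<dots> = L x (sw H (\<Delta> h) (\<lambda>a b. a \<cdot> \<beta> \<cdot> S b))"
    using h by (intro linear_map_apply_sw[OF mH mH mH mZ assms(1)[OF x], symmetric]) auto
  also have "\<dots> = L x (\<epsilon> h \<odot>\<^bsub>H\<^esub> \<beta>)" using antipode_beta[OF h] by (simp add: sw_def)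
  also have "\<dots> = \<epsilon> h \<odot>\<^bsub>Z\<^esub> f x" using x h by (simp add: linear_map_smult[OF assms(1)] assms(3))
  finally show "?lhs = \<epsilon> h \<odot>\<^bsub>Z\<^esub> f x" .
qed

lemma contract_phi:
  assumes L: "linear_map K H Z L" shows "sw3 Z \<phi> (\<lambda>a b c. L (a \<cdot> \<beta> \<cdot> S b \<cdot> \<alpha> \<cdot> c)) = L \<one>\<^sub>H"
proof -
  have "(case p of (a, b, c) \<Rightarrow> a \<cdot> \<beta> \<cdot> S b \<cdot> \<alpha> \<cdot> c) \<in> \<H>" if "p \<in> set (terms3 \<phi>)" for p
    using terms3_carrier[OF phi_closed] that by (cases p) auto
  from linear_map_lsum[OF L mH mZ, of "terms3 \<phi>" "\<lambda>(a, b, c). a \<cdot> \<beta> \<cdot> S b \<cdot> \<alpha> \<cdot> c", OF this] show ?thesis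
    using antipode_phi by (simp add: sw3_def split_def)
qed

lemma contract_phi_inv:
  assumes L: "linear_map K H Z L" shows "sw3 Z \<phi>inv (\<lambda>a b c. L (S a \<cdot> \<alpha> \<cdot> b \<cdot> \<beta> \<cdot> S c)) = L \<one>\<^sub>H"
proof -
  have "(case p of (a, b, c) \<Rightarrow> S a \<cdot> \<alpha> \<cdot> b \<cdot> \<beta> \<cdot> S c) \<in> \<H>" if "p \<in> set (terms3 \<phi>inv)" for p
    using terms3_carrier[OF phi_inv_closed] that by (cases p) auto
  from linear_map_lsum[OF L mH mZ, of "terms3 \<phi>inv" "\<lambda>(a, b, c). S a \<cdot> \<alpha> \<cdot> b \<cdot> \<beta> \<cdot> S c", OF this] show ?thesis
    using antipode_phi_inv by (simp add: sw3_def split_def)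
qed

end

text \<open>A stand-in for \<open>H \<otimes> H\<close>: it is instantiated with \<open>H2\<close>
  for \<open>Z\<close> and the pure tensor for \<open>P\<close>. Keeping \<open>P\<close> abstract
  lets products be computed by \<open>P_mult\<close> without touching formal sums.\<close>

locale quasi_hopf_sq = quasi_hopf_alg K H Z
  for K :: "'k ring" and H :: "('k, 'h) quasi_hopf" and Z :: "('k, 'z, 'm) module_scheme" +
  fixes P :: "'h \<Rightarrow> 'h \<Rightarrow> 'z"
  assumes P_bilin: "bilin K H H Z P"
    and P_mult: "\<And>a b c d. \<lbrakk>a \<in> \<H>; b \<in> \<H>; c \<in> \<H>; d \<in> \<H>\<rbrakk> \<Longrightarrow> P (a \<cdot> c) (b \<cdot> d) = P a b \<otimes>\<^bsub>Z\<^esub> P c d"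
    and P_one: "P \<one>\<^sub>H \<one>\<^sub>H = \<one>\<^bsub>Z\<^esub>"
begin

lemma P_closed [simp]: "a \<in> \<H> \<Longrightarrow> b \<in> \<H> \<Longrightarrow> P a b \<in> carrier Z"
  by (rule bilin_closed[OF P_bilin])

lemma P_lin_left: "linear_map K H H f \<Longrightarrow> b \<in> \<H> \<Longrightarrow> linear_map K H Z (\<lambda>v. P (f v) b)"
  by (rule linear_map_comp[OF _ bilin_left[OF P_bilin]])

lemma P_lin_right: "linear_map K H H f \<Longrightarrow> a \<in> \<H> \<Longrightarrow> linear_map K H Z (\<lambda>v. P a (f v))"
  by (rule linear_map_comp[OF _ bilin_right[OF P_bilin]])

lemma S_comp_lin: "linear_map K H H f \<Longrightarrow> linear_map K H H (\<lambda>v. S (f v))"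
  by (rule linear_map_comp[OF _ S_lin])

lemmas P_lins = P_lin_left P_lin_right lin_mult_left lin_mult_right S_comp_lin linear_map_id m_closed S_closed
  alpha_closed beta_closed one_closed

definition Dl :: "'h \<Rightarrow> 'z" where "Dl h = sw Z (\<Delta> h) P"

definition Sc :: "'h \<Rightarrow> 'z" where "Sc h = sw Z (\<Delta> h) (\<lambda>a b. P (S b) (S a))"

lemma bilin_PS: "bilin K H H Z (\<lambda>a b. P (S b) (S a))"
  by (intro bilinI P_lin_left P_lin_right S_lin S_closed)

lemma Dl_hom: "algebra_map K H Z Dl"
proof -
  have "linear_map K H Z Dl"
    unfolding Dl_def[abs_def] by (rule linear_map_comp[OF Delta_lin linear_map_sw[OF mH mH mZ P_bilin]])
  moreover have "Dl \<one>\<^sub>H = \<one>\<^bsub>Z\<^esub>"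
    by (simp add: Dl_def Delta_one sw_pure[OF mH mH mZ P_bilin] P_one)
  moreover have "Dl (x \<cdot> y) = Dl x \<odot>Z Dl y" if "x \<in> \<H>" "y \<in> \<H>" for x y
  proof -
    have "Dl (x \<cdot> y) = sw Z (\<Delta> x) (\<lambda>a b. sw Z (\<Delta> y) (\<lambda>c d. P a b \<odot>Z P c d))"
      using that by (simp add: Dl_def Delta_mult H2.sw_mult[OF mZ P_bilin]) (auto intro!: sw_cong[OF mH mH]
          simp: P_mult)
    also have "\<dots> = sw Z (\<Delta> x) (\<lambda>a b. P a b \<odot>Z Dl y)"
      unfolding Dl_def using that
      by (intro sw_cong[OF mH mH] linear_map_apply_sw[OF mH mH mZ mZ Z.lin_mult_right[OF linear_map_id],
          symmetric]) auto
    also have "\<dots> = Dl x \<odot>Z Dl y"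
      using that linear_map_closed[OF \<open>linear_map K H Z Dl\<close>]
      by (subst Dl_def[of x]) (intro linear_map_apply_sw[OF mH mH mZ mZ Z.lin_mult_left[OF linear_map_id],
          symmetric]; simp)
    finally show ?thesis .
  qed
  ultimately show ?thesis by (simp add: algebra_map_def)
qed

lemma Sc_hom: "anti_algebra_map K H Z Sc"
proof -
  have l: "linear_map K H Z Sc"
    unfolding Sc_def[abs_def] by (rule linear_map_comp[OF Delta_lin linear_map_sw[OF mH mH mZ bilin_PS]])
  moreover have "Sc \<one>\<^sub>H = \<one>\<^bsub>Z\<^esub>"
    by (simp add: Sc_def Delta_one sw_pure[OF mH mH mZ bilin_PS] P_one)
  moreover have "Sc (x \<cdot> y) = Sc y \<odot>Z Sc x" if "x \<in> \<H>" "y \<in> \<H>" for x y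
  proof -
    have "Sc (x \<cdot> y) = sw Z (\<Delta> x) (\<lambda>a b. sw Z (\<Delta> y) (\<lambda>c d. P (S d) (S c) \<odot>Z P (S b) (S a)))"
      using that by (simp add: Sc_def Delta_mult H2.sw_mult[OF mZ bilin_PS])
        (auto intro!: sw_cong[OF mH mH] simp: S_mult P_mult)
    also have "\<dots> = sw Z (\<Delta> x) (\<lambda>a b. Sc y \<odot>Z P (S b) (S a))"
      unfolding Sc_def using that
      by (intro sw_cong[OF mH mH] linear_map_apply_sw[OF mH mH mZ mZ Z.lin_mult_left[OF linear_map_id],
          symmetric]) auto
    also have "\<dots> = Sc y \<odot>Z Sc x"
      using that linear_map_closed[OF l]
      by (subst Sc_def[of x]) (intro linear_map_apply_sw[OF mH mH mZ mZ Z.lin_mult_right[OF linear_map_id],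
          symmetric]; simp)
    finally show ?thesis .
  qed
  ultimately show ?thesis by (simp add: anti_algebra_map_def)
qed

lemma Dl_closed [simp]: "h \<in> \<H> \<Longrightarrow> Dl h \<in> carrier Z"
  by (rule linear_map_closed[OF algebra_map_linear[OF Dl_hom]])

lemma Sc_closed [simp]: "h \<in> \<H> \<Longrightarrow> Sc h \<in> carrier Z"
  by (rule linear_map_closed[OF anti_algebra_map_linear[OF Sc_hom]])

lemma Dl_mult: "x \<in> \<H> \<Longrightarrow> y \<in> \<H> \<Longrightarrow> Dl (x \<cdot> y) = Dl x \<odot>Z Dl y"
  using Dl_hom by (simp add: algebra_map_def)

text \<open>The antipode axioms of \<open>H\<close>, transported along the algebra map
  \<open>Dl\<close>.\<close>

lemma dual_system_S: "dual_system Dl (\<lambda>h. Dl (S h)) (Dl \<alpha>) (Dl \<beta>)"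
proof -
  note l = algebra_map_linear[OF Dl_hom]
  have o: "Dl \<one>\<^sub>H = \<one>\<^bsub>Z\<^esub>" using Dl_hom by (simp add: algebra_map_def)
  have "anti_algebra_map K H Z (\<lambda>h. Dl (S h))"
    using linear_map_comp[OF S_lin l] o by (simp add: anti_algebra_map_def S_mult Dl_mult)
  moreover have "sw Z (\<Delta> h) (\<lambda>a b. Dl (S a) \<odot>Z Dl \<alpha> \<odot>Z Dl b) = \<epsilon> h \<odot>\<^bsub>Z\<^esub> Dl \<alpha>" if h: "h \<in> \<H>" for h
  proof -
    have "sw Z (\<Delta> h) (\<lambda>a b. Dl (S a) \<odot>Z Dl \<alpha> \<odot>Z Dl b) = sw Z (\<Delta> h) (\<lambda>a b. Dl (S a \<cdot> \<alpha> \<cdot> b))"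
      using h by (intro sw_cong[OF mH mH]) (simp_all add: Dl_mult)
    also have "\<dots> = Dl (sw H (\<Delta> h) (\<lambda>a b. S a \<cdot> \<alpha> \<cdot> b))"
      using h by (intro linear_map_apply_sw[OF mH mH mH mZ l, symmetric]) auto
    also have "sw H (\<Delta> h) (\<lambda>a b. S a \<cdot> \<alpha> \<cdot> b) = \<epsilon> h \<odot>\<^bsub>H\<^esub> \<alpha>" using antipode_alpha[OF h] by (simp add: sw_def)
    finally show ?thesis using h by (simp add: linear_map_smult[OF l])
  qed
  moreover have "sw Z (\<Delta> h) (\<lambda>a b. Dl a \<odot>Z Dl \<beta> \<odot>Z Dl (S b)) = \<epsilon> h \<odot>\<^bsub>Z\<^esub> Dl \<beta>" if h: "h \<in> \<H>" for h
  proof -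
    have "sw Z (\<Delta> h) (\<lambda>a b. Dl a \<odot>Z Dl \<beta> \<odot>Z Dl (S b)) = sw Z (\<Delta> h) (\<lambda>a b. Dl (a \<cdot> \<beta> \<cdot> S b))"
      using h by (intro sw_cong[OF mH mH]) (simp_all add: Dl_mult)
    also have "\<dots> = Dl (sw H (\<Delta> h) (\<lambda>a b. a \<cdot> \<beta> \<cdot> S b))"
      using h by (intro linear_map_apply_sw[OF mH mH mH mZ l, symmetric]) auto
    also have "sw H (\<Delta> h) (\<lambda>a b. a \<cdot> \<beta> \<cdot> S b) = \<epsilon> h \<odot>\<^bsub>H\<^esub> \<beta>" using antipode_beta[OF h] by (simp add: sw_def)
    finally show ?thesis using h by (simp add: linear_map_smult[OF l])
  qed
  moreover have "sw3 Z \<phi> (\<lambda>a b c. Dl a \<odot>Z Dl \<beta> \<odot>Z Dl (S b) \<odot>Z Dl \<alpha> \<odot>Z Dl c) = \<one>\<^bsub>Z\<^esub>"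
    using contract_phi[OF l] o by (subst sw3_cong[OF phi_closed, where G="\<lambda>a b c. Dl (a \<cdot> \<beta> \<cdot> S b \<cdot> \<alpha> \<cdot> c)"])
      (simp_all add: Dl_mult)
  moreover have "sw3 Z \<phi>inv (\<lambda>a b c. Dl (S a) \<odot>Z Dl \<alpha> \<odot>Z Dl b \<odot>Z Dl \<beta> \<odot>Z Dl (S c)) = \<one>\<^bsub>Z\<^esub>"
    using contract_phi_inv[OF l] o by (subst sw3_cong[OF phi_inv_closed, where G="\<lambda>a b c. Dl (S a \<cdot> \<alpha> \<cdot> b \<cdot> \<beta> \<cdot>
        S c)"])
      (simp_all add: Dl_mult)
  ultimately show ?thesis using Dl_hom by (simp add: dual_system_def)
qed

text \<open>Nested pairings of slot 1 with 2 and of slot 0 with 3. The inner one lands in the first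
  tensor factor for \<open>Cg\<close> and in the second for \<open>Cd\<close>, because
  \<open>Sc\<close> exchanges the two legs.\<close>

definition "Cg = (\<lambda>x. P (S (x (Suc 0)) \<cdot> \<alpha> \<cdot> x 2) (S (x 0) \<cdot> \<alpha> \<cdot> x 3))"
definition "Cd = (\<lambda>x. P (x 0 \<cdot> \<beta> \<cdot> S (x 3)) (x (Suc 0) \<cdot> \<beta> \<cdot> S (x 2)))"

lemma mlinn_Cg: "mlinn 4 Cg" and mlinn_Cd: "mlinn 4 Cd"
  unfolding Cg_def Cd_def by (rule mlinn4; intro P_lins P_closed; assumption)+

lemmas mlin_Cg = mlin_ext[OF mlinn_Cg]
lemmas mlin_Cd = mlin_ext[OF mlinn_Cd]

text \<open>\<open>gam\<close> and \<open>del\<close> take the places of \<alpha> and \<beta> for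
  the antipode \<open>Sc\<close>; they are Drinfeld's gamma and delta. \<open>gam\<close> agrees
  with \<open>twist_a\<close>, see \<open>S2_gam\<close>.\<close>

definition gam :: 'z where "gam = ET (ext 4 Cg)"
definition del :: 'z where "del = DT (ext 4 Cd)"

lemma gam_closed [simp]: "gam \<in> carrier Z" and del_closed [simp]: "del \<in> carrier Z"
  by (simp_all add: gam_def del_def M_closed[OF _ mlin_Cg] M_closed[OF _ mlin_Cd])

lemma ext4_eval:
  "mlinn 4 C \<Longrightarrow> \<lbrakk>a \<in> \<H>; b \<in> \<H>; c \<in> \<H>; d \<in> \<H>\<rbrakk> \<Longrightarrow>
      ext 4 C (a ## b ## c ## d ## unit_word) = C (a ## b ## c ## d ## unit_word)"
  by (rule ext_unit) (simp_all add: unit_beyond)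

lemma sandwich_lin: "p \<in> carrier Z \<Longrightarrow> q \<in> carrier Z \<Longrightarrow> linear_map K Z Z (\<lambda>v. p \<odot>Z v \<odot>Z q)"
  by (rule Z.lin_mult_left[OF Z.lin_mult_right[OF linear_map_id]])

text \<open>Letters multiplied from the right come out at the outside of the nested pairing: the
  first two under the antipode with legs exchanged, the last two unchanged. Agreement on four-letter
  words is enough by \<open>supp_ET\<close>.\<close>

lemma ET_sandwich:
  assumes "a1 \<in> \<H>" "a2 \<in> \<H>" "b1 \<in> \<H>" "b2 \<in> \<H>"
  shows "ET (\<lambda>x. ext 4 Cg (wmul x (a1 ## a2 ## b1 ## b2 ## unit_word))) = P (S a2) (S a1) \<odot>Z gam \<odot>Z P b1 b2"
      (is "?A = _")
proof -
  have L: "linear_map K Z Z (\<lambda>v. P (S a2) (S a1) \<odot>Z v \<odot>Z P b1 b2)" using assms by (intro sandwich_lin) auto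
  have "?A =
      ET (\<lambda>x. P (S a2) (S a1) \<odot>Z ext 4 Cg x \<odot>Z P b1 b2)"
  proof (rule suppD[OF supp_ET mlin_wmul_left[OF mlin_Cg] mlin_linear[OF mlin_Cg L]])
    fix x assume "x \<in> W" "\<And>i. i \<ge> 4 \<Longrightarrow> x i = \<one>\<^sub>H"
    then obtain a b c d where "x = a ## b ## c ## d ## unit_word"
      "a \<in> \<H>" "b \<in> \<H>" "c \<in> \<H>" "d \<in> \<H>" by (rule W4_cases)
    then show "ext 4 Cg (wmul x (a1 ## a2 ## b1 ## b2 ## unit_word)) = P (S a2) (S a1) \<odot>Z ext 4 Cg x \<odot>Z P b1 b2"
      using assms
      by (simp add: ext4_eval[OF mlinn_Cg]) (simp add: Cg_def S_mult P_mult[symmetric] m_assoc)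
  qed (use assms in simp)
  then show ?thesis by (simp add: M_apply_linear[OF ET_M mlin_Cg L] gam_def)
qed

lemma DT_sandwich:
  assumes "a1 \<in> \<H>" "a2 \<in> \<H>" "b1 \<in> \<H>" "b2 \<in> \<H>"
  shows "DT (\<lambda>x. ext 4 Cd (wmul (a1 ## a2 ## b1 ## b2 ## unit_word) x)) = P a1 a2 \<odot>Z del \<odot>Z P (S b2) (S b1)"
      (is "?A = _")
proof -
  have L: "linear_map K Z Z (\<lambda>v. P a1 a2 \<odot>Z v \<odot>Z P (S b2) (S b1))" using assms by (intro sandwich_lin) auto
  have "?A =
      DT (\<lambda>x. P a1 a2 \<odot>Z ext 4 Cd x \<odot>Z P (S b2) (S b1))"
  proof (rule suppD[OF supp_DT mlin_wmul_right[OF mlin_Cd] mlin_linear[OF mlin_Cd L]])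
    fix x assume "x \<in> W" "\<And>i. i \<ge> 4 \<Longrightarrow> x i = \<one>\<^sub>H"
    then obtain a b c d where "x = a ## b ## c ## d ## unit_word"
      "a \<in> \<H>" "b \<in> \<H>" "c \<in> \<H>" "d \<in> \<H>" by (rule W4_cases)
    then show "ext 4 Cd (wmul (a1 ## a2 ## b1 ## b2 ## unit_word) x) = P a1 a2 \<odot>Z ext 4 Cd x \<odot>Z P (S b2) (S b1)"
      using assms
      by (simp add: ext4_eval[OF mlinn_Cd]) (simp add: Cd_def S_mult P_mult[symmetric] m_assoc)
  qed (use assms in simp)
  then show ?thesis by (simp add: M_apply_linear[OF DT_M mlin_Cd L] del_def)
qed

lemma sum_sandwich_left:
  assumes "v \<in> carrier Z" "h \<in> \<H>" "k \<in> \<H>"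
  shows "sw Z (\<Delta> h) (\<lambda>a1 a2. sw Z (\<Delta> k) (\<lambda>b1 b2. P (S a2) (S a1) \<odot>Z v \<odot>Z P b1 b2)) = Sc h \<odot>Z v \<odot>Z Dl k" (is "?A = _")
proof -
  have "?A =
      sw Z (\<Delta> h) (\<lambda>a1 a2. \<one>\<^bsub>Z\<^esub> \<odot>Z P (S a2) (S a1) \<odot>Z (v \<odot>Z Dl k))"
  proof (rule sw_cong[OF mH mH Delta_closed[OF assms(2)]])
    fix a1 a2 assume a: "a1 \<in> \<H>" "a2 \<in> \<H>"
    have "sw Z (\<Delta> k) (\<lambda>b1 b2. P (S a2) (S a1) \<odot>Z v \<odot>Z P b1 b2) =
        sw Z (\<Delta> k) (\<lambda>b1 b2. (P (S a2) (S a1) \<odot>Z v) \<odot>Z P b1 b2 \<odot>Z \<one>\<^bsub>Z\<^esub>)" (is "?lhs = _")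
      using assms a by (intro sw_cong[OF mH mH]) auto
    also have "\<dots> = P (S a2) (S a1) \<odot>Z v \<odot>Z Dl k"
      using assms a by (subst sw_sandwich) (simp_all add: Dl_def[symmetric])
    finally show "?lhs =         \<one>\<^bsub>Z\<^esub> \<odot>Z P (S a2) (S a1) \<odot>Z (v \<odot>Z Dl k)"
      using assms a by (simp add: Z.m_assoc)
  qed
  also have "\<dots> = Sc h \<odot>Z v \<odot>Z Dl k"
    using assms by (subst sw_sandwich) (simp_all add: Sc_def[symmetric] Z.m_assoc)
  finally show ?thesis .
qed

lemma sum_sandwich_right:
  assumes "v \<in> carrier Z" "h \<in> \<H>" "k \<in> \<H>"
  shows "sw Z (\<Delta> h) (\<lambda>a1 a2. sw Z (\<Delta> k) (\<lambda>b1 b2. P a1 a2 \<odot>Z v \<odot>Z P (S b2) (S b1))) = Dl h \<odot>Z v \<odot>Z Sc k" (is "?A = _")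
proof -
  have "?A =
      sw Z (\<Delta> h) (\<lambda>a1 a2. \<one>\<^bsub>Z\<^esub> \<odot>Z P a1 a2 \<odot>Z (v \<odot>Z Sc k))"
  proof (rule sw_cong[OF mH mH Delta_closed[OF assms(2)]])
    fix a1 a2 assume a: "a1 \<in> \<H>" "a2 \<in> \<H>"
    have "sw Z (\<Delta> k) (\<lambda>b1 b2. P a1 a2 \<odot>Z v \<odot>Z P (S b2) (S b1)) =
        sw Z (\<Delta> k) (\<lambda>b1 b2. (P a1 a2 \<odot>Z v) \<odot>Z P (S b2) (S b1) \<odot>Z \<one>\<^bsub>Z\<^esub>)" (is "?lhs = _")
      using assms a by (intro sw_cong[OF mH mH]) auto
    also have "\<dots> = P a1 a2 \<odot>Z v \<odot>Z Sc k"
      using assms a by (subst sw_sandwich) (simp_all add: Sc_def[symmetric])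
    finally show "?lhs =         \<one>\<^bsub>Z\<^esub> \<odot>Z P a1 a2 \<odot>Z (v \<odot>Z Sc k)"
      using assms a by (simp add: Z.m_assoc)
  qed
  also have "\<dots> = Dl h \<odot>Z v \<odot>Z Sc k"
    using assms by (subst sw_sandwich) (simp_all add: Dl_def[symmetric] Z.m_assoc)
  finally show ?thesis .
qed

text \<open>After the inner pair has been absorbed, \<open>h\<close> survives split over the outer
  slots 0 and 3.\<close>

lemma D11_eval:
  assumes h: "h \<in> \<H>" and f: "mlin f"
  shows "U 2 (E 1 (D 1 (D 0 (ev1 h)))) f = sw Z (\<Delta> h) (\<lambda>a b. f (a ## \<one>\<^sub>H ## \<one>\<^sub>H ## b ## unit_word))"
proof -
  have "E 1 (D 1 (D 0 (ev1 h))) = U 1 (D 0 (ev1 h))" using h by (simp add: E_D_left)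
  then show ?thesis
    using h by (simp add: U_eval[OF f] U_eval[OF mlin_ins[OF f]] D0_ev1_eval[OF h mlin_ins[OF mlin_ins[OF f]]]
        numeral_2_eq_2)
qed

text \<open>\<open>ET \<star> DD h\<close> is evaluated on \<open>Cg\<close> in two ways. Directly,
  the four pieces of \<open>h\<close> come out as \<open>Sc\<close> and \<open>Dl\<close> around
  \<open>gam\<close>. After \<open>ET_DD\<close> they stand on the left, grouped as 0((12)3), and
  \<alpha> absorbs first the inner and then the outer pair.\<close>

lemma gam_dual:
  assumes h: "h \<in> \<H>"
  shows "sw Z (\<Delta> h) (\<lambda>a b. Sc a \<odot>Z gam \<odot>Z Dl b) = \<epsilon> h \<odot>\<^bsub>Z\<^esub> gam"
proof -
  let ?f = "ext 4 Cg"
  note f = mlin_Cg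
  have l1: "lcol 1 2 ?f"
    by (rule lcol_ext[OF mlinn_Cg], rule lcol_alpha[where L="\<lambda>x v. P (S (x (Suc 0)) \<cdot> v \<cdot> x 2) (S (x 0) \<cdot> \<alpha> \<cdot> x 3)"])
      (auto simp: Cg_def S_mult m_assoc intro!: P_lins)
  have l2: "lcol 0 3 ?f"
    by (rule lcol_ext[OF mlinn_Cg], rule lcol_alpha[where L="\<lambda>x v. P (S (x (Suc 0)) \<cdot> \<alpha> \<cdot> x 2) (S (x 0) \<cdot> v \<cdot> x 3)"])
      (auto simp: Cg_def S_mult m_assoc intro!: P_lins)
  have mE: "mlin (\<lambda>y. ET (\<lambda>x. ?f (wmul x y)))"
    by (rule M_param[OF ET_M mlin_wmul_left[OF f] mlin_wmul_right[OF f]])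
  have "(ET \<star> DD h) ?f = DD h (\<lambda>y. ET (\<lambda>x. ?f (wmul x y)))"
    unfolding star_eval[OF f]
    by (rule M_fubini[OF ET_M DD_M[OF h] mlin_wmul_right[OF f] mlin_wmul_left[OF f]])
  also have "\<dots> = sw Z (\<Delta> h) (\<lambda>a b. Sc a \<odot>Z gam \<odot>Z Dl b)"
    unfolding DD_eval[OF h mE]
  proof (rule sw_cong[OF mH mH Delta_closed[OF h]])
    fix a b assume ab: "a \<in> \<H>" "b \<in> \<H>"
    have "sw Z (\<Delta> a) (\<lambda>a1 a2. sw Z (\<Delta> b) (\<lambda>b1 b2. ET (\<lambda>x. ?f (wmul x (a1 ## a2 ## b1 ## b2 ## unit_word))))) =
        sw Z (\<Delta> a) (\<lambda>a1 a2. sw Z (\<Delta> b) (\<lambda>b1 b2. P (S a2) (S a1) \<odot>Z gam \<odot>Z P b1 b2))"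
      using ab by (intro sw_cong[OF mH mH] ET_sandwich) auto
    then show "sw Z (\<Delta> a) (\<lambda>a1 a2. sw Z (\<Delta> b) (\<lambda>b1 b2. ET (\<lambda>x. ?f (wmul x (a1 ## a2 ## b1 ## b2 ## unit_word))))) =
        Sc a \<odot>Z gam \<odot>Z Dl b"
      using ab by (simp add: sum_sandwich_left)
  qed
  finally have L: "(ET \<star> DD h) ?f = sw Z (\<Delta> h) (\<lambda>a b. Sc a \<odot>Z gam \<odot>Z Dl b)" .
  have "(ET \<star> DD h) ?f = (U 2 (E 1 (D 1 (D 0 (ev1 h)))) \<star> ET) ?f"
    unfolding ET_DD[OF h] using left_collapse[OF _ ET_M f, of "D 1 (D 0 (ev1 h))" 1] l1 h
    by (simp add: numeral_2_eq_2)
  also have "\<dots> = sw Z (\<Delta> h) (\<lambda>a b. ET (\<lambda>y. ?f (wmul (a ## \<one>\<^sub>H ## \<one>\<^sub>H ## b ## unit_word) y)))"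
    unfolding star_eval[OF f] by (rule D11_eval[OF h mlin_star[OF ET_M f]])
  also have "\<dots> = ET (\<lambda>y. sw Z (\<Delta> h) (\<lambda>a b. ?f (wmul (a ## \<one>\<^sub>H ## \<one>\<^sub>H ## b ## unit_word) y)))"
    using h by (intro M_sw[OF ET_M mH mH, symmetric] mlin_wmul_right[OF f]) auto
  also have "\<dots> = ET (\<lambda>y. \<epsilon> h \<odot>\<^bsub>Z\<^esub> ?f y)"
  proof (rule M_cong[OF ET_M])
    fix y assume y: "y \<in> W"
    have "wmul (a ## \<one>\<^sub>H ## \<one>\<^sub>H ## b ## unit_word) y = y(0 := a \<cdot> y 0, 3 := b \<cdot> y 3)" for a b
      using y by (auto simp: wmul_def wcons_def fun_eq_iff eval_nat_numeral split: nat.split)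
    then show "sw Z (\<Delta> h) (\<lambda>a b. ?f (wmul (a ## \<one>\<^sub>H ## \<one>\<^sub>H ## b ## unit_word) y)) = \<epsilon> h \<odot>\<^bsub>Z\<^esub> ?f y"
      using l2 y h by (simp only: lcol_def)
  qed
  also have "\<dots> = \<epsilon> h \<odot>\<^bsub>Z\<^esub> gam"
    unfolding gam_def using h by (intro M_scale[OF ET_M f]) simp
  finally show ?thesis using L by simp
qed

text \<open>Mirror image with \<open>DT\<close>: the pieces of \<open>h\<close> are moved to the
  right and absorbed by \<beta>.\<close>

lemma del_dual:
  assumes h: "h \<in> \<H>"
  shows "sw Z (\<Delta> h) (\<lambda>a b. Dl a \<odot>Z del \<odot>Z Sc b) = \<epsilon> h \<odot>\<^bsub>Z\<^esub> del"
proof -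
  let ?f = "ext 4 Cd"
  note f = mlin_Cd
  have l1: "rcol 1 2 ?f"
    by (rule rcol_ext[OF mlinn_Cd], rule rcol_beta[where L="\<lambda>x v. P (x 0 \<cdot> \<beta> \<cdot> S (x 3)) (x (Suc 0) \<cdot> v \<cdot> S (x 2))"])
      (auto simp: Cd_def S_mult m_assoc intro!: P_lins)
  have l2: "rcol 0 3 ?f"
    by (rule rcol_ext[OF mlinn_Cd], rule rcol_beta[where L="\<lambda>x v. P (x 0 \<cdot> v \<cdot> S (x 3)) (x (Suc 0) \<cdot> \<beta> \<cdot> S (x 2))"])
      (auto simp: Cd_def S_mult m_assoc intro!: P_lins)
  have "(DD h \<star> DT) ?f = sw Z (\<Delta> h) (\<lambda>a b. Dl a \<odot>Z del \<odot>Z Sc b)"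
    unfolding star_eval[OF f] DD_eval[OF h mlin_star[OF DT_M f]]
  proof (rule sw_cong[OF mH mH Delta_closed[OF h]])
    fix a b assume ab: "a \<in> \<H>" "b \<in> \<H>"
    have "sw Z (\<Delta> a) (\<lambda>a1 a2. sw Z (\<Delta> b) (\<lambda>b1 b2. DT (\<lambda>x. ?f (wmul (a1 ## a2 ## b1 ## b2 ## unit_word) x)))) =
        sw Z (\<Delta> a) (\<lambda>a1 a2. sw Z (\<Delta> b) (\<lambda>b1 b2. P a1 a2 \<odot>Z del \<odot>Z P (S b2) (S b1)))"
      using ab by (intro sw_cong[OF mH mH] DT_sandwich) auto
    then show "sw Z (\<Delta> a) (\<lambda>a1 a2. sw Z (\<Delta> b) (\<lambda>b1 b2. DT (\<lambda>x. ?f (wmul (a1 ## a2 ## b1 ## b2 ## unit_word) x)))) =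
        Dl a \<odot>Z del \<odot>Z Sc b"
      using ab by (simp add: sum_sandwich_right)
  qed
  then have L: "(DD h \<star> DT) ?f = sw Z (\<Delta> h) (\<lambda>a b. Dl a \<odot>Z del \<odot>Z Sc b)" .
  have "(DD h \<star> DT) ?f = (DT \<star> U 2 (E 1 (D 1 (D 0 (ev1 h))))) ?f"
    unfolding DD_DT[OF h] using right_collapse[OF _ DT_M f, of "D 1 (D 0 (ev1 h))" 1] l1 h
    by (simp add: numeral_2_eq_2)
  also have "\<dots> = DT (\<lambda>x. sw Z (\<Delta> h) (\<lambda>a b. ?f (wmul x (a ## \<one>\<^sub>H ## \<one>\<^sub>H ## b ## unit_word))))"
    unfolding star_eval[OF f] by (rule M_cong[OF DT_M]) (rule D11_eval[OF h mlin_wmul_right[OF f]])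
  also have "\<dots> = DT (\<lambda>y. \<epsilon> h \<odot>\<^bsub>Z\<^esub> ?f y)"
  proof (rule M_cong[OF DT_M])
    fix y assume y: "y \<in> W"
    have "wmul y (a ## \<one>\<^sub>H ## \<one>\<^sub>H ## b ## unit_word) = y(0 := y 0 \<cdot> a, 3 := y 3 \<cdot> b)" for a b
      using y by (auto simp: wmul_def wcons_def fun_eq_iff eval_nat_numeral split: nat.split)
    then show "sw Z (\<Delta> h) (\<lambda>a b. ?f (wmul y (a ## \<one>\<^sub>H ## \<one>\<^sub>H ## b ## unit_word))) = \<epsilon> h \<odot>\<^bsub>Z\<^esub> ?f y"
      using l2 y h by (simp only: rcol_def)
  qed
  also have "\<dots> = \<epsilon> h \<odot>\<^bsub>Z\<^esub> del"
    unfolding del_def using h by (intro M_scale[OF DT_M f]) simp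
  finally show ?thesis using L by simp
qed

end

context quasi_hopf
begin

lemma wcons_numeral_simps [simp]:
  "(h ## x)(numeral k := a) = h ## x(pred_numeral k := a)"
  "ins (numeral k) (h ## x) = h ## ins (pred_numeral k) x"
  "spl (numeral k) (h ## x) a b = h ## spl (pred_numeral k) x a b"
  by (simp_all add: numeral_eq_Suc)

end

section \<open>Reassociation of six legs, for the normalisation axioms of the second system\<close>

context quasi_hopf_val
begin

lemma supp_numeral [simp]:
  "D 3 PH = PH" "D 3 PI = PI" "E 3 PH = PH" "E 3 PI = PI" "U 3 PH = PH" "U 3 PI = PI"
  "U 4 PH = PH" "U 4 PI = PI"
  using PH_supp[of 0] PI_supp[of 0] PH_supp(1)[of 1] PI_supp(1)[of 1] by (simp_all add: eval_nat_numeral)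

lemma lcol_wmul_right:
  "lcol i j f \<Longrightarrow> x \<in> W \<Longrightarrow> x i = \<one>\<^sub>H \<Longrightarrow> x j = \<one>\<^sub>H \<Longrightarrow> lcol i j (\<lambda>y. f (wmul x y))"
  unfolding lcol_def
proof (intro ballI)
  fix y h assume l: "\<forall>x\<in>W. \<forall>h\<in>\<H>. sw Z (\<Delta> h) (\<lambda>a b. f (x(i := a \<cdot> x i, j := b \<cdot> x j))) = \<epsilon> h \<odot>\<^bsub>Z\<^esub> f x"
    and x: "x \<in> W" "x i = \<one>\<^sub>H" "x j = \<one>\<^sub>H" and y: "y \<in> W" and h: "h \<in> \<H>"
  have "wmul x (y(i := a \<cdot> y i, j := b \<cdot> y j)) = (wmul x y)(i := a \<cdot> wmul x y i, j := b \<cdot> wmul x y j)"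
    if "a \<in> \<H>" "b \<in> \<H>" for a b
    using x y that by (auto simp: wmul_def fun_eq_iff)
  then have "sw Z (\<Delta> h) (\<lambda>a b. f (wmul x (y(i := a \<cdot> y i, j := b \<cdot> y j)))) =
      sw Z (\<Delta> h) (\<lambda>a b. f ((wmul x y)(i := a \<cdot> wmul x y i, j := b \<cdot> wmul x y j)))"
    using h by (intro sw_cong[OF mH mH]) auto
  then show "sw Z (\<Delta> h) (\<lambda>a b. f (wmul x (y(i := a \<cdot> y i, j := b \<cdot> y j)))) = \<epsilon> h \<odot>\<^bsub>Z\<^esub> f (wmul x y)"
    using l x y h by simp
qed

lemma rcol_wmul_right: "rcol i j f \<Longrightarrow> x \<in> W \<Longrightarrow> rcol i j (\<lambda>y. f (wmul x y))"
  unfolding rcol_def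
proof (intro ballI)
  fix y h assume l: "\<forall>x\<in>W. \<forall>h\<in>\<H>. sw Z (\<Delta> h) (\<lambda>a b. f (x(i := x i \<cdot> a, j := x j \<cdot> b))) = \<epsilon> h \<odot>\<^bsub>Z\<^esub> f x"
    and x: "x \<in> W" and y: "y \<in> W" and h: "h \<in> \<H>"
  have "wmul x (y(i := y i \<cdot> a, j := y j \<cdot> b)) = (wmul x y)(i := wmul x y i \<cdot> a, j := wmul x y j \<cdot> b)"
    if "a \<in> \<H>" "b \<in> \<H>" for a b
    using x y that by (auto simp: wmul_def fun_eq_iff m_assoc)
  then have "sw Z (\<Delta> h) (\<lambda>a b. f (wmul x (y(i := y i \<cdot> a, j := y j \<cdot> b)))) =
      sw Z (\<Delta> h) (\<lambda>a b. f ((wmul x y)(i := wmul x y i \<cdot> a, j := wmul x y j \<cdot> b)))"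
    using h by (intro sw_cong[OF mH mH]) auto
  then show "sw Z (\<Delta> h) (\<lambda>a b. f (wmul x (y(i := y i \<cdot> a, j := y j \<cdot> b)))) = \<epsilon> h \<odot>\<^bsub>Z\<^esub> f (wmul x y)"
    using l x y h by simp
qed

text \<open>Each of the three legs is doubled. In \<open>XT\<close> the doubled legs of \<phi> will
  become \<open>Dl\<close>, \<open>Sc\<close>, \<open>Dl\<close>, while \<open>DT\<close> supplies
  \<open>del\<close> and \<open>ET\<close> supplies \<open>gam\<close>; \<open>XI\<close> serves the
  inverse associator in the same way.\<close>

definition "WT t = D 4 (D 2 (D 0 t))"
definition "XT = U 0 (U 0 ET) \<star> WT PH \<star> DT"
definition "XI = ET \<star> WT PI \<star> U 0 (U 0 DT)"
text \<open>\<open>XA\<close> and \<open>XB\<close> are the factors of \<open>XT\<close> with slots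
  3, 4 respectively 1, 2 still joined into one; \<open>YA\<close> and \<open>YB\<close> are their
  inverses.\<close>

definition "XA = D 3 (D 0 PH) \<star> PI"
definition "XB = U 0 (U 0 PI) \<star> D 0 (D 2 PH) \<star> PI"
definition "YA = PH \<star> D 3 (D 0 PI)"
definition "YB = PH \<star> D 0 (D 2 PI) \<star> U 0 (U 0 PH)"

lemma WT_M [simp]: "t \<in> M \<Longrightarrow> WT t \<in> M" by (simp add: WT_def)

lemma X_M [simp]: "XT \<in> M" "XI \<in> M" "XA \<in> M" "XB \<in> M" "YA \<in> M" "YB \<in> M"
  by (simp_all add: XT_def XI_def XA_def XB_def YA_def YB_def)

text \<open>
  \<^term>\<open>XT\<close> is the canonical morphism from (0((12)3))(45) to (01)(2((34)5)). By the pentagon and naturality it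
  factors through (0(12))((34)5), which keeps 12 together in one factor and 34 in the other.
\<close>

lemma XT_decomp: "XT = D 3 XA \<star> D 1 XB"
proof -
  let ?u = "U 0 (U 0 (U 0 PI))" and ?v = "U 0 (U 0 (U 0 PH))"
  have f1: "D 4 (D 0 (U 0 PH)) = U 0 (U 0 (D 2 PH))"
    by (simp add: D_U_same D_U_greater)
  have f2: "D 4 (D 0 (D 1 PH)) = WT PH" by (simp add: WT_def D_D)
  have f3: "D 4 (D 0 PH) = D 0 PH" by (simp add: D_D)
  \<comment> \<open>The pentagon with its first and last legs split; one of its factors is
    \<open>WT PH\<close>.\<close>
  have f4: "D 4 (D 0 (D 2 PH)) \<star> D 4 (D 0 (D 0 PH)) = U 0 (U 0 (D 2 PH)) \<star> WT PH \<star> D 0 PH"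
    using arg_cong[OF pentagon_M, of "\<lambda>t. D 4 (D 0 t)"] by (simp add: D_star f1 f2[unfolded One_nat_def] f3)
  have f4': "U 0 (U 0 (D 2 PH)) \<star> WT PH = D 4 (D 0 (D 2 PH)) \<star> D 4 (D 0 (D 0 PH)) \<star> D 0 PI"
    unfolding f4 by (simp add: star_assoc)
  \<comment> \<open>Naturality of the associator at slot 0.\<close>
  have f5: "D 4 (D 0 (D 0 PH)) \<star> PI = PI \<star> D 1 (D 0 (D 2 PH))"
  proof -
    have "D 4 (D 0 (D 0 PH)) = D 0 (D 0 (D 2 PH))" by (simp add: D_D)
    then have "D 4 (D 0 (D 0 PH)) \<star> PI = PI \<star> (PH \<star> D 0 (D 0 (D 2 PH))) \<star> PI" by (simp add: star_assoc)
    also have "\<dots> = PI \<star> D 1 (D 0 (D 2 PH))"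
      unfolding coassoc0[OF D_M[OF PH_M], symmetric] by (simp add: star_assoc)
    finally show ?thesis .
  qed
  have uv: "?u \<star> ?v = one_M" "?v \<star> ?u = one_M" by (simp_all add: U_star[symmetric])
  \<comment> \<open>Naturality of the associator at slot 3, in the form
    \<open>coassoc3\<close>.\<close>
  have f6: "?u \<star> D 4 (D 0 (D 2 PH)) = D 3 (D 3 (D 0 PH)) \<star> ?u"
  proof -
    have "D 4 (D 0 (D 2 PH)) = D 4 (D 3 (D 0 PH))" by (simp add: D_D)
    then have "?u \<star> D 4 (D 0 (D 2 PH)) = ?u \<star> (D 4 (D 3 (D 0 PH)) \<star> ?v) \<star> ?u"
      by (simp add: star_assoc uv)
    also have "\<dots> = D 3 (D 3 (D 0 PH)) \<star> ?u"
      unfolding coassoc3[OF D_M[OF PH_M]] using star_cancel[OF uv(1)] by (simp add: star_assoc)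
    finally show ?thesis .
  qed
  \<comment> \<open>Disjoint slots: 0 to 2 against 3 to 5.\<close>
  have f7: "?u \<star> PI = PI \<star> ?u" using ev3_commute[OF phi_inv_closed PI_M] by (simp add: PI_def)
  have r1: "D 3 XA = D 3 (D 3 (D 0 PH)) \<star> PI" by (simp add: XA_def D_star)
  have "D 1 (U 0 (U 0 PI)) = ?u" by (simp add: D_U_greater D_U_same)
  then have r2: "D 1 XB = ?u \<star> D 1 (D 0 (D 2 PH)) \<star> D 1 PI" by (simp add: XB_def D_star)
  have "XT = ?u \<star> (U 0 (U 0 (D 2 PH)) \<star> WT PH) \<star> (D 2 PI \<star> U 0 PH)"
    by (simp add: XT_def ET_def DT_def U_star star_assoc)
  also have "\<dots> = ?u \<star> D 4 (D 0 (D 2 PH)) \<star> D 4 (D 0 (D 0 PH)) \<star> (D 0 PI \<star> D 2 PI \<star> U 0 PH)"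
    unfolding f4' by (simp add: star_assoc)
  also have "\<dots> = D 3 (D 3 (D 0 PH)) \<star> ?u \<star> (D 4 (D 0 (D 0 PH)) \<star> PI) \<star> D 1 PI"
    unfolding f6 pentagon_a[symmetric] by (simp add: star_assoc)
  also have "\<dots> = D 3 (D 3 (D 0 PH)) \<star> (?u \<star> PI) \<star> (D 1 (D 0 (D 2 PH)) \<star> D 1 PI)"
    unfolding f5 by (simp add: star_assoc)
  also have "\<dots> = D 3 XA \<star> D 1 XB"
    unfolding f7 r1 r2 by (simp add: star_assoc)
  finally show ?thesis .
qed

text \<open>Obtained by inverting \<open>XT_decomp\<close>: \<open>XI\<close> is a right inverse of
  \<open>XT\<close> and \<open>D 1 YB \<star> D 3 YA\<close> a left inverse.\<close>

lemma XI_decomp: "XI = D 1 YB \<star> D 3 YA"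
proof -
  have w: "WT PH \<star> WT PI = one_M" by (simp add: WT_def D_star[symmetric])
  have u: "U 0 (U 0 ET) \<star> U 0 (U 0 DT) = one_M" by (simp add: U_star[symmetric])
  have "XT \<star> XI = U 0 (U 0 ET) \<star> (WT PH \<star> ((DT \<star> ET) \<star> (WT PI \<star> U 0 (U 0 DT))))"
    by (simp only: XT_def XI_def star_assoc star_M U_M WT_M ET_M DT_M PH_M PI_M)
  also have "\<dots> = one_M" using star_cancel[OF w] u by simp
  finally have XX: "XT \<star> XI = one_M" .
  have a: "YA \<star> XA = one_M"
    using star_cancel[OF D_inv[OF D_inv[OF PH_PI(2) PI_M PH_M] D_M[OF PI_M] D_M[OF PH_M]]]
    by (simp add: YA_def XA_def star_assoc)
  have b1: "D 0 (D 2 PI) \<star> D 0 (D 2 PH) = one_M" by (simp add: D_star[symmetric])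
  have b2: "U 0 (U 0 PH) \<star> U 0 (U 0 PI) = one_M" by (simp add: U_star[symmetric])
  have b: "YB \<star> XB = one_M"
    using star_cancel[OF b1] star_cancel[OF b2] by (simp add: YB_def XB_def star_assoc)
  have "D 1 YB \<star> D 3 YA \<star> XT = D 1 YB \<star> (D 3 (YA \<star> XA) \<star> D 1 XB)"
    unfolding XT_decomp by (simp add: star_assoc D_star)
  also have "\<dots> = one_M" using D_inv[OF b] by (simp add: a)
  finally have YX: "D 1 YB \<star> D 3 YA \<star> XT = one_M" .
  have "XI = D 1 YB \<star> D 3 YA \<star> XT \<star> XI" by (simp only: YX star_one X_M)
  also have "\<dots> = D 1 YB \<star> D 3 YA \<star> (XT \<star> XI)" by (simp add: star_assoc)
  finally show ?thesis by (simp add: XX)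
qed

text \<open>What is left of the factors once the joined slot has been absorbed: two empty slots, 3
  and 4 or 1 and 2, and a reassociation of the four others.\<close>

lemma X_collapsed:
  "U 4 (E 3 XA) = U 3 (U 3 (D 0 PH \<star> PI))" "U 2 (E 1 XB) = U 1 (U 1 ET)"
  "U 2 (E 1 YB) = U 1 (U 1 DT)" "U 4 (E 3 YA) = U 3 (U 3 (PH \<star> D 0 PI))"
proof -
  show "U 4 (E 3 XA) = U 3 (U 3 (D 0 PH \<star> PI))" "U 4 (E 3 YA) = U 3 (U 3 (PH \<star> D 0 PI))"
    by (simp_all add: XA_def YA_def E_star U_star E_D_left U_U)
  have e: "E 1 (D 0 t) = U 1 t" if "t \<in> M" for t using E_D_right[OF that, of 0] by simp
  show "U 2 (E 1 XB) = U 1 (U 1 ET)" "U 2 (E 1 YB) = U 1 (U 1 DT)"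
    by (simp_all add: XB_def YB_def ET_def DT_def E_star U_star e[unfolded One_nat_def] E_U_greater E_U_same U_U)
qed

lemma UU_star_eval:
  assumes f: "mlin f" and st: "s \<in> M" "t \<in> M"
  shows "(U i (U i s) \<star> U j (U j t)) f = s (\<lambda>x. t (\<lambda>y. f (wmul (ins i (ins i x)) (ins j (ins j y)))))"
proof -
  have tt: "U j (U j t) (\<lambda>y. f (wmul x y)) = t (\<lambda>y. f (wmul x (ins j (ins j y))))" if x: "x \<in> W" for x
    by (simp add: U_eval[OF mlin_wmul_right[OF f x]] U_eval[OF mlin_ins[OF mlin_wmul_right[OF f x]]])
  have m: "mlin (\<lambda>x. U j (U j t) (\<lambda>y. f (wmul x y)))" by (rule mlin_star[OF _ f]) (simp add: st)
  have "(U i (U i s) \<star> U j (U j t)) f = s (\<lambda>x. U j (U j t) (\<lambda>y. f (wmul (ins i (ins i x)) y)))"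
    by (simp add: star_eval[OF f] U_eval[OF m] U_eval[OF mlin_ins[OF m]])
  also have "\<dots> = s (\<lambda>x. t (\<lambda>y. f (wmul (ins i (ins i x)) (ins j (ins j y)))))"
    by (rule M_cong[OF st(1)]) (simp add: tt)
  finally show ?thesis .
qed

lemma mlin_ins_wmul:
  assumes f: "mlin f"
  shows "x \<in> W \<Longrightarrow> mlin (\<lambda>y. f (wmul x (ins j (ins j y))))" "y \<in> W \<Longrightarrow> mlin (\<lambda>x. f (wmul (ins i (ins i x)) y))"
  by (rule mlin_ins[OF mlin_ins[OF mlin_wmul_right[OF f]]] mlin_ins[OF mlin_ins[OF mlin_wmul_left[OF f]]];
      assumption)+

lemma ext6_eval:
  "mlinn 6 C \<Longrightarrow> \<lbrakk>a \<in> \<H>; b \<in> \<H>; c \<in> \<H>; d \<in> \<H>; e \<in> \<H>; k \<in> \<H>\<rbrakk> \<Longrightarrow> 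
      ext 6 C (a ## b ## c ## d ## e ## k ## unit_word) = C (a ## b ## c ## d ## e ## k ## unit_word)"
  by (rule ext_unit, assumption, simp) (auto simp: wcons_def split: nat.split)

lemma WT_eval:
  assumes g: "mlin g" and t: "t \<in> carrier H3"
  shows "WT (ev3 t) g = sw3 Z t (\<lambda>a b c. sw Z (\<Delta> a) (\<lambda>a1 a2. sw Z (\<Delta> b) (\<lambda>b1 b2. sw Z (\<Delta> c) (\<lambda>c1 c2.
    g (a1 ## a2 ## b1 ## b2 ## c1 ## c2 ## unit_word)))))"
  unfolding WT_def D_eval[OF g] D_eval[OF mlin_spl[OF g]] D_eval[OF mlin_spl[OF mlin_spl[OF g]]]
    ev3_eval[OF t mlin_spl[OF mlin_spl[OF mlin_spl[OF g]]]]
  by simp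

end

context quasi_hopf_sq
begin

text \<open>Summands of the two normalisation axioms for \<open>Sc\<close>, \<open>gam\<close>,
  \<open>del\<close>, multiplied out in \<open>H \<otimes> H\<close>: each tensor factor carries one
  zigzag of \<alpha> and \<beta>.\<close>

definition "Cx = (\<lambda>x. P (x 0 \<cdot> \<beta> \<cdot> S (x 3) \<cdot> \<alpha> \<cdot> x 4) (x (Suc 0) \<cdot> \<beta> \<cdot> S (x 2) \<cdot> \<alpha> \<cdot> x 5))"
definition "Cy = (\<lambda>x. P (S (x (Suc 0)) \<cdot> \<alpha> \<cdot> x 2 \<cdot> \<beta> \<cdot> S (x 5)) (S (x 0) \<cdot> \<alpha> \<cdot> x 3 \<cdot> \<beta> \<cdot> S (x 4)))"

lemma mlinn_Cx: "mlinn 6 Cx" and mlinn_Cy: "mlinn 6 Cy"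
  unfolding Cx_def Cy_def by (rule mlinn6; intro P_lins P_closed; assumption)+

lemmas mlin_Cx = mlin_ext[OF mlinn_Cx]
lemmas mlin_Cy = mlin_ext[OF mlinn_Cy]

text \<open>Absorbing the pairs 34 and 12 disentangles the zigzags of the two tensor factors. They
  are then straightened one at a time: first the second factor, in slots 1, 2, 5, with the letters
  of \<open>ET\<close> held fixed, then the first.\<close>

lemma XT_contract: "XT (ext 6 Cx) = \<one>\<^bsub>Z\<^esub>"
proof -
  let ?f = "ext 6 Cx"
  note f = mlin_Cx
  have l34: "lcol 3 4 ?f"
    by (rule lcol_ext[OF mlinn_Cx], rule lcol_alpha[where L="\<lambda>x v. P (x 0 \<cdot> \<beta> \<cdot> S (x 3) \<cdot> v \<cdot> x 4) (x (Suc 0) \<cdot>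
        \<beta> \<cdot> S (x 2) \<cdot> \<alpha> \<cdot> x 5)"])
      (auto simp: Cx_def S_mult m_assoc intro!: P_lins)
  have l25: "lcol 2 5 ?f"
    by (rule lcol_ext[OF mlinn_Cx], rule lcol_alpha[where L="\<lambda>x v. P (x 0 \<cdot> \<beta> \<cdot> S (x 3) \<cdot> \<alpha> \<cdot> x 4) (x (Suc 0) \<cdot>
        \<beta> \<cdot> S (x 2) \<cdot> v \<cdot> x 5)"])
      (auto simp: Cx_def S_mult m_assoc intro!: P_lins)
  have r12: "rcol 1 2 ?f"
    by (rule rcol_ext[OF mlinn_Cx], rule rcol_beta[where L="\<lambda>x v. P (x 0 \<cdot> \<beta> \<cdot> S (x 3) \<cdot> \<alpha> \<cdot> x 4) (x (Suc 0) \<cdot>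
        v \<cdot> S (x 2) \<cdot> \<alpha> \<cdot> x 5)"])
      (auto simp: Cx_def S_mult m_assoc intro!: P_lins)
  let ?e = "D 0 PH \<star> PI"
  let ?C = "\<lambda>y. P (y 0 \<cdot> \<beta> \<cdot> S (y (Suc 0)) \<cdot> \<alpha> \<cdot> y 2) (y 3)"
  have m4: "mlinn 4 ?C" by (rule mlinn4; intro P_lins P_closed; assumption)
  note g = mlin_ext[OF m4]
  have "XT ?f = (U 4 (E 3 XA) \<star> D 1 XB) ?f"
    unfolding XT_decomp using left_collapse[OF _ _ f, of XA "D 1 XB" 3] l34 by simp
  also have "\<dots> = (U 3 (U 3 ?e) \<star> U 1 (U 1 ET)) ?f"
    using right_collapse[OF _ _ f, of XB "U 4 (E 3 XA)" 1] r12 unfolding X_collapsed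
    by (simp add: numeral_2_eq_2 X_collapsed[unfolded One_nat_def numeral_2_eq_2])
  also have "\<dots> = ?e (\<lambda>x. ET (\<lambda>y. ?f (wmul (ins 3 (ins 3 x)) (ins 1 (ins 1 y)))))"
    by (rule UU_star_eval[OF f]) simp_all
  also have "\<dots> = ET (\<lambda>y. ?e (\<lambda>x. ?f (wmul (ins 3 (ins 3 x)) (ins 1 (ins 1 y)))))"
    by (rule M_fubini) (auto intro: mlin_ins_wmul[OF f])
  also have "\<dots> = ET (ext 4 ?C)"
  proof (rule suppD[OF supp_ET _ g])
    show "mlin (\<lambda>y. ?e (\<lambda>x. ?f (wmul (ins 3 (ins 3 x)) (ins 1 (ins 1 y)))))"
      by (rule M_param) (auto intro: mlin_ins_wmul[OF f])
    fix y assume "y \<in> W" "\<And>i. i \<ge> 4 \<Longrightarrow> y i = \<one>\<^sub>H"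
    then obtain y0 y1 y2 y3 where y: "y = y0 ## y1 ## y2 ## y3 ## unit_word"
      "y0 \<in> \<H>" "y1 \<in> \<H>" "y2 \<in> \<H>" "y3 \<in> \<H>" by (rule W4_cases)
    define y' where "y' = y0 ## \<one>\<^sub>H ## \<one>\<^sub>H ## y1 ## y2 ## y3 ## unit_word"
    have y': "ins 1 (ins 1 y) = y'" by (simp add: y y'_def)
    have yW: "y' \<in> W" "y' 1 = \<one>\<^sub>H" "y' 2 = \<one>\<^sub>H" using y by (simp_all add: y'_def)
    let ?h = "\<lambda>x. ?f (wmul (ins 3 (ins 3 x)) y')"
    have h: "mlin ?h" by (rule mlin_ins_wmul(2)[OF f yW(1)])
    have "lcol 2 4 (\<lambda>x. ?f (wmul (ins 3 x) y'))"
      using lcol_ins[where k=3 and i=2 and j=4 and f="\<lambda>x. ?f (wmul x y')"] lcol_wmul[OF l25 yW(1)] by simp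
    then have lh: "lcol 2 3 ?h" using lcol_ins[where k=3 and i=2 and j=3 and f="\<lambda>x. ?f (wmul (ins 3 x) y')"] by simp
    have "rcol 1 2 (\<lambda>x. ?f (wmul (ins 3 x) y'))"
      using rcol_ins[where k=3 and i=1 and j=2 and f="\<lambda>x. ?f (wmul x y')"] rcol_wmul[OF r12 yW] by simp
    then have rh: "rcol 1 2 ?h" using rcol_ins[where k=3 and i=1 and j=2 and f="\<lambda>x. ?f (wmul (ins 3 x) y')"] by simp
    \<comment> \<open>\<open>D 2 PI\<close> is absorbed by \<alpha> and \<open>D 1 PH\<close> by
      \<beta>; \<open>U 0 PH\<close> survives and is contracted to 1 by the antipode identity for
      \<phi>.\<close>
    have "?e ?h = (D 2 PI \<star> (U 0 PH \<star> D 1 PH)) ?h" by (simp only: pentagon_b star_assoc D_M U_M PH_M PI_M)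
    also have "\<dots> = (U 0 PH \<star> D 1 PH) ?h"
      using left_collapse_one[OF PI_M _ _ h, of 2 "U 0 PH \<star> D 1 PH"] lh by simp
    also have "\<dots> = U 0 PH ?h"
      using right_collapse_one[OF PH_M _ _ h, of 1 "U 0 PH"] rh by (simp add: numeral_2_eq_2)
    also have "\<dots> = sw3 Z \<phi> (\<lambda>a b c. ?h (\<one>\<^sub>H ## a ## b ## c ## unit_word))"
      unfolding U_eval[OF h] PH_eval[OF mlin_ins[OF h]] by (simp only: ins_wcons)
    also have "\<dots> = sw3 Z \<phi> (\<lambda>a b c. P (y0 \<cdot> \<beta> \<cdot> S y1 \<cdot> \<alpha> \<cdot> y2) ((a \<cdot> \<beta> \<cdot> S b \<cdot> \<alpha> \<cdot> c) \<cdot> y3))"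
      using y by (intro sw3_cong[OF phi_closed]) (simp add: y'_def ext6_eval[OF mlinn_Cx], simp add: Cx_def m_assoc)
    also have "\<dots> = P (y0 \<cdot> \<beta> \<cdot> S y1 \<cdot> \<alpha> \<cdot> y2) y3"
      using contract_phi[of "\<lambda>v. P (y0 \<cdot> \<beta> \<cdot> S y1 \<cdot> \<alpha> \<cdot> y2) (v \<cdot> y3)"] y
      by (simp add: P_lins)
    finally show "?e (\<lambda>x. ?f (wmul (ins 3 (ins 3 x)) (ins 1 (ins 1 y)))) = ext 4 ?C y"
      using y unfolding y' by (simp add: ext4_eval[OF m4])
  qed
  \<comment> \<open>The same scheme for the first tensor factor, with the pentagon solved for
    \<open>ET\<close>.\<close>
  also have "\<dots> = (D 1 PH \<star> (PH \<star> D 0 PI)) (ext 4 ?C)"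
    by (simp only: ET_def pentagon_c star_assoc D_M PH_M PI_M)
  also have "\<dots> = (PH \<star> D 0 PI) (ext 4 ?C)"
  proof -
    have "lcol 1 2 (ext 4 ?C)"
      by (rule lcol_ext[OF m4], rule lcol_alpha[where L="\<lambda>x v. P (x 0 \<cdot> \<beta> \<cdot> S (x (Suc 0)) \<cdot> v \<cdot> x 2) (x 3)"])
        (auto simp: S_mult m_assoc intro!: P_lins)
    then show ?thesis using left_collapse_one[OF PH_M _ _ g, of 1 "PH \<star> D 0 PI"] by (simp add: numeral_2_eq_2)
  qed
  also have "\<dots> = PH (ext 4 ?C)"
  proof -
    have "rcol 0 1 (ext 4 ?C)"
      by (rule rcol_ext[OF m4], rule rcol_beta[where L="\<lambda>x v. P (x 0 \<cdot> v \<cdot> S (x (Suc 0)) \<cdot> \<alpha> \<cdot> x 2) (x 3)"])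
        (auto simp: S_mult m_assoc intro!: P_lins)
    then show ?thesis using right_collapse_one[OF PI_M _ _ g, of 0 PH] by simp
  qed
  also have "\<dots> = sw3 Z \<phi> (\<lambda>a b c. P (a \<cdot> \<beta> \<cdot> S b \<cdot> \<alpha> \<cdot> c) \<one>\<^sub>H)"
    by (subst PH_ext[OF m4]) simp_all
  also have "\<dots> = \<one>\<^bsub>Z\<^esub>" using contract_phi[of "\<lambda>v. P v \<one>\<^sub>H"] by (simp add: P_lins P_one)
  finally show ?thesis .
qed

text \<open>Mirror image of \<open>XT_contract\<close>: 12 is absorbed by \<alpha> from the left, 34
  by \<beta> from the right, and the antipode identity for the inverse associator straightens each
  factor.\<close>

lemma XI_contract: "XI (ext 6 Cy) = \<one>\<^bsub>Z\<^esub>"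
proof -
  let ?f = "ext 6 Cy"
  note f = mlin_Cy
  have l12: "lcol 1 2 ?f"
    by (rule lcol_ext[OF mlinn_Cy], rule lcol_alpha[where L="\<lambda>x v. P (S (x (Suc 0)) \<cdot> v \<cdot> x 2 \<cdot> \<beta> \<cdot> S (x 5)) (S
        (x 0) \<cdot> \<alpha> \<cdot> x 3 \<cdot> \<beta> \<cdot> S (x 4))"])
      (auto simp: Cy_def S_mult m_assoc intro!: P_lins)
  have r34: "rcol 3 4 ?f"
    by (rule rcol_ext[OF mlinn_Cy], rule rcol_beta[where L="\<lambda>x v. P (S (x (Suc 0)) \<cdot> \<alpha> \<cdot> x 2 \<cdot> \<beta> \<cdot> S (x 5)) (S
        (x 0) \<cdot> \<alpha> \<cdot> x 3 \<cdot> v \<cdot> S (x 4))"])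
      (auto simp: Cy_def S_mult m_assoc intro!: P_lins)
  have r25: "rcol 2 5 ?f"
    by (rule rcol_ext[OF mlinn_Cy], rule rcol_beta[where L="\<lambda>x v. P (S (x (Suc 0)) \<cdot> \<alpha> \<cdot> x 2 \<cdot> v \<cdot> S (x 5)) (S
        (x 0) \<cdot> \<alpha> \<cdot> x 3 \<cdot> \<beta> \<cdot> S (x 4))"])
      (auto simp: Cy_def S_mult m_assoc intro!: P_lins)
  let ?e = "PH \<star> D 0 PI"
  let ?C = "\<lambda>x. P (S (x 3)) (S (x 0) \<cdot> \<alpha> \<cdot> x (Suc 0) \<cdot> \<beta> \<cdot> S (x 2))"
  have m4: "mlinn 4 ?C" by (rule mlinn4; intro P_lins S_lin P_closed; assumption)
  note g = mlin_ext[OF m4]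
  have "XI ?f = (U 2 (E 1 YB) \<star> D 3 YA) ?f"
    unfolding XI_decomp using left_collapse[OF _ _ f, of YB "D 3 YA" 1] l12 by (simp add: numeral_2_eq_2)
  also have "\<dots> = (U 1 (U 1 DT) \<star> U 3 (U 3 ?e)) ?f"
    using right_collapse[OF _ _ f, of YA "U 2 (E 1 YB)" 3] r34 unfolding X_collapsed
    by (simp add: X_collapsed)
  also have "\<dots> = DT (\<lambda>x. ?e (\<lambda>y. ?f (wmul (ins 1 (ins 1 x)) (ins 3 (ins 3 y)))))"
    by (rule UU_star_eval[OF f]) simp_all
  also have "\<dots> = DT (ext 4 ?C)"
  proof (rule suppD[OF supp_DT _ g])
    show "mlin (\<lambda>x. ?e (\<lambda>y. ?f (wmul (ins 1 (ins 1 x)) (ins 3 (ins 3 y)))))"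
      by (rule M_param) (auto intro: mlin_ins_wmul[OF f])
    fix x assume "x \<in> W" "\<And>i. i \<ge> 4 \<Longrightarrow> x i = \<one>\<^sub>H"
    then obtain x0 x1 x2 x3 where x: "x = x0 ## x1 ## x2 ## x3 ## unit_word"
      "x0 \<in> \<H>" "x1 \<in> \<H>" "x2 \<in> \<H>" "x3 \<in> \<H>" by (rule W4_cases)
    define x' where "x' = x0 ## \<one>\<^sub>H ## \<one>\<^sub>H ## x1 ## x2 ## x3 ## unit_word"
    have x': "ins 1 (ins 1 x) = x'" by (simp add: x x'_def)
    have xW: "x' \<in> W" "x' 1 = \<one>\<^sub>H" "x' 2 = \<one>\<^sub>H" using x by (simp_all add: x'_def)
    let ?h = "\<lambda>y. ?f (wmul x' (ins 3 (ins 3 y)))"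
    have h: "mlin ?h" by (rule mlin_ins_wmul(1)[OF f xW(1)])
    have "lcol 1 2 (\<lambda>y. ?f (wmul x' (ins 3 y)))"
      using lcol_ins[where k=3 and i=1 and j=2 and f="\<lambda>y. ?f (wmul x' y)"] lcol_wmul_right[OF l12 xW] by simp
    then have lh: "lcol 1 2 ?h" using lcol_ins[where k=3 and i=1 and j=2 and f="\<lambda>y. ?f (wmul x' (ins 3 y))"] by simp
    have "rcol 2 4 (\<lambda>y. ?f (wmul x' (ins 3 y)))"
      using rcol_ins[where k=3 and i=2 and j=4 and f="\<lambda>y. ?f (wmul x' y)"] rcol_wmul_right[OF r25 xW(1)] by simp
    then have rh: "rcol 2 3 ?h" using rcol_ins[where k=3 and i=2 and j=3 and f="\<lambda>y. ?f (wmul x' (ins 3 y))"] by simp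
    have "?e ?h = (D 1 PI \<star> (U 0 PI \<star> D 2 PH)) ?h" by (simp only: pentagon_d star_assoc D_M U_M PH_M PI_M)
    also have "\<dots> = (U 0 PI \<star> D 2 PH) ?h"
      using left_collapse_one[OF PI_M _ _ h, of 1 "U 0 PI \<star> D 2 PH"] lh by (simp add: numeral_2_eq_2)
    also have "\<dots> = U 0 PI ?h"
      using right_collapse_one[OF PH_M _ _ h, of 2 "U 0 PI"] rh by simp
    also have "\<dots> = sw3 Z \<phi>inv (\<lambda>a b c. ?h (\<one>\<^sub>H ## a ## b ## c ## unit_word))"
      unfolding U_eval[OF h] PI_eval[OF mlin_ins[OF h]] by (simp only: ins_wcons)
    also have "\<dots> = sw3 Z \<phi>inv (\<lambda>a b c. P ((S a \<cdot> \<alpha> \<cdot> b \<cdot> \<beta> \<cdot> S c) \<cdot> S x3) (S x0 \<cdot> \<alpha> \<cdot> x1 \<cdot> \<beta> \<cdot> S x2))"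
      using x by (intro sw3_cong[OF phi_inv_closed]) (simp add: x'_def ext6_eval[OF mlinn_Cy], simp add: Cy_def
          S_mult m_assoc)
    also have "\<dots> = P (S x3) (S x0 \<cdot> \<alpha> \<cdot> x1 \<cdot> \<beta> \<cdot> S x2)"
      using contract_phi_inv[of "\<lambda>v. P (v \<cdot> S x3) (S x0 \<cdot> \<alpha> \<cdot> x1 \<cdot> \<beta> \<cdot> S x2)"] x
      by (simp add: P_lins)
    finally show "?e (\<lambda>y. ?f (wmul (ins 1 (ins 1 x)) (ins 3 (ins 3 y)))) = ext 4 ?C x"
      using x unfolding x' by (simp add: ext4_eval[OF m4])
  qed
  also have "\<dots> = (D 0 PH \<star> (PI \<star> D 1 PI)) (ext 4 ?C)"
    by (simp only: DT_def pentagon_f star_assoc D_M PH_M PI_M)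
  also have "\<dots> = (PI \<star> D 1 PI) (ext 4 ?C)"
  proof -
    have "lcol 0 1 (ext 4 ?C)"
      by (rule lcol_ext[OF m4], rule lcol_alpha[where L="\<lambda>x v. P (S (x 3)) (S (x 0) \<cdot> v \<cdot> x (Suc 0) \<cdot> \<beta> \<cdot> S (x 2))"])
        (auto simp: S_mult m_assoc intro!: P_lins)
    then show ?thesis using left_collapse_one[OF PH_M _ _ g, of 0 "PI \<star> D 1 PI"] by simp
  qed
  also have "\<dots> = PI (ext 4 ?C)"
  proof -
    have "rcol 1 2 (ext 4 ?C)"
      by (rule rcol_ext[OF m4], rule rcol_beta[where L="\<lambda>x v. P (S (x 3)) (S (x 0) \<cdot> \<alpha> \<cdot> x (Suc 0) \<cdot> v \<cdot> S (x 2))"])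
        (auto simp: S_mult m_assoc intro!: P_lins)
    then show ?thesis using right_collapse_one[OF PI_M _ _ g, of 1 PI] by (simp add: numeral_2_eq_2)
  qed
  also have "\<dots> = sw3 Z \<phi>inv (\<lambda>a b c. P \<one>\<^sub>H (S a \<cdot> \<alpha> \<cdot> b \<cdot> \<beta> \<cdot> S c))"
    by (subst PI_ext[OF m4]) simp_all
  also have "\<dots> = \<one>\<^bsub>Z\<^esub>" using contract_phi_inv[of "\<lambda>v. P \<one>\<^sub>H v"] by (simp add: P_lins P_one bilin_right[OF P_bilin])
  finally show ?thesis .
qed

end

context quasi_hopf_sq
begin

lemma mlin_ins_wmul2:
  assumes f: "mlin f" and w: "w \<in> W"
  shows "mlin (\<lambda>z. DT (\<lambda>x. f (wmul (ins 0 (ins 0 z)) (wmul w x))))"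
proof -
  have "mlin (\<lambda>z. DT (\<lambda>x. f (wmul z (wmul w x))))"
    using w by (intro M_param[OF DT_M] mlin_wmul_right[OF mlin_wmul_right[OF f]] mlin_wmul_left[OF f]) auto
  from mlin_ins[OF mlin_ins[OF this]] show ?thesis .
qed

lemma sandwich_sum3:
  assumes "h \<in> \<H>" "k \<in> \<H>" "l \<in> \<H>"
    and F: "\<And>a b. a \<in> \<H> \<Longrightarrow> b \<in> \<H> \<Longrightarrow> F a b \<in> carrier Z"
    and G: "\<And>a b. a \<in> \<H> \<Longrightarrow> b \<in> \<H> \<Longrightarrow> G a b \<in> carrier Z"
    and R: "\<And>a b. a \<in> \<H> \<Longrightarrow> b \<in> \<H> \<Longrightarrow> R a b \<in> carrier Z"
    and uv: "u \<in> carrier Z" "v \<in> carrier Z"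
  shows "sw Z (\<Delta> h) (\<lambda>a1 a2. sw Z (\<Delta> k) (\<lambda>b1 b2. sw Z (\<Delta> l) (\<lambda>c1 c2. F a1 a2 \<odot>Z u \<odot>Z G b1 b2 \<odot>Z v \<odot>Z R c1 c2))) =
    sw Z (\<Delta> h) F \<odot>Z u \<odot>Z sw Z (\<Delta> k) G \<odot>Z v \<odot>Z sw Z (\<Delta> l) R" (is "?A = _")
proof -
  have cl: "sw Z (\<Delta> x) B \<in> carrier Z" if "x \<in> \<H>" "\<And>a b. a \<in> \<H> \<Longrightarrow> b \<in> \<H> \<Longrightarrow> B a b \<in> carrier Z" for x B
    using that by (intro sw_closed[OF mH mH mZ]) auto
  have 1: "sw Z (\<Delta> l) (\<lambda>c1 c2. p \<odot>Z R c1 c2) = p \<odot>Z sw Z (\<Delta> l) R" if "p \<in> carrier Z" for p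
    using assms that by (intro linear_map_apply_sw[OF mH mH mZ mZ Z.lin_mult_right[OF linear_map_id], symmetric]) auto
  have 2: "sw Z (\<Delta> k) (\<lambda>b1 b2. p \<odot>Z G b1 b2 \<odot>Z q) = p \<odot>Z sw Z (\<Delta> k) G \<odot>Z q" if "p \<in> carrier Z" "q \<in> carrier Z" for p q
    using assms that by (intro sw_sandwich) auto
  have 3: "sw Z (\<Delta> h) (\<lambda>a1 a2. F a1 a2 \<odot>Z q) = sw Z (\<Delta> h) F \<odot>Z q" if "q \<in> carrier Z" for q
    using assms that by (intro linear_map_apply_sw[OF mH mH mZ mZ Z.lin_mult_left[OF linear_map_id], symmetric]) auto
  have "?A =
      sw Z (\<Delta> h) (\<lambda>a1 a2. F a1 a2 \<odot>Z (u \<odot>Z sw Z (\<Delta> k) G \<odot>Z v \<odot>Z sw Z (\<Delta> l) R))"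
  proof (rule sw_cong[OF mH mH Delta_closed[OF assms(1)]])
    fix a1 a2 assume a: "a1 \<in> \<H>" "a2 \<in> \<H>"
    have "sw Z (\<Delta> k) (\<lambda>b1 b2. sw Z (\<Delta> l) (\<lambda>c1 c2. F a1 a2 \<odot>Z u \<odot>Z G b1 b2 \<odot>Z v \<odot>Z R c1 c2)) =
        sw Z (\<Delta> k) (\<lambda>b1 b2. F a1 a2 \<odot>Z u \<odot>Z G b1 b2 \<odot>Z (v \<odot>Z sw Z (\<Delta> l) R))"
    proof (rule sw_cong[OF mH mH Delta_closed[OF assms(2)]])
      fix b1 b2 assume b: "b1 \<in> \<H>" "b2 \<in> \<H>"
      show "sw Z (\<Delta> l) (\<lambda>c1 c2. F a1 a2 \<odot>Z u \<odot>Z G b1 b2 \<odot>Z v \<odot>Z R c1 c2) = F a1 a2 \<odot>Z u \<odot>Z G b1 b2 \<odot>Z (v \<odot>Z sw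
          Z (\<Delta> l) R)"
        using a b assms cl[of l R] by (subst 1) (simp_all add: Z.m_assoc)
    qed
    then show "sw Z (\<Delta> k) (\<lambda>b1 b2. sw Z (\<Delta> l) (\<lambda>c1 c2. F a1 a2 \<odot>Z u \<odot>Z G b1 b2 \<odot>Z v \<odot>Z R c1 c2)) =
        F a1 a2 \<odot>Z (u \<odot>Z sw Z (\<Delta> k) G \<odot>Z v \<odot>Z sw Z (\<Delta> l) R)"
      using a assms cl[of l R] cl[of k G] by (simp add: 2 Z.m_assoc)
  qed
  then show ?thesis using assms cl[of l R] cl[of k G] cl[of h F] by (simp add: 3 Z.m_assoc)
qed

text \<open>The sums for \<open>ET\<close> and \<open>DT\<close> are pulled inside the one over the
  doubled legs of \<phi> by \<open>M_fubini\<close>. There the test function factors in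
  \<open>Z\<close>, and summing the three pairs of legs produces \<open>Dl\<close>,
  \<open>Sc\<close> and \<open>Dl\<close> around \<open>del\<close> and \<open>gam\<close>.\<close>

lemma XT_eval: "XT (ext 6 Cx) = sw3 Z \<phi> (\<lambda>a b c. Dl a \<odot>Z del \<odot>Z Sc b \<odot>Z gam \<odot>Z Dl c)"
proof -
  let ?f = "ext 6 Cx"
  note f = mlin_Cx
  let ?g = "\<lambda>z w. DT (\<lambda>x. ?f (wmul (ins 0 (ins 0 z)) (wmul w x)))"
  have g1: "mlin (?g z)" if "z \<in> W" for z
    using mlin_star[OF DT_M mlin_wmul_right[OF f, of "ins 0 (ins 0 z)"]] that by simp
  have g2: "mlin (\<lambda>z. ?g z w)" if "w \<in> W" for w by (rule mlin_ins_wmul2[OF f that])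
  have WD: "WT PH \<star> DT \<in> M" by simp
  have g3: "mlin (\<lambda>z. (WT PH \<star> DT) (\<lambda>x. ?f (wmul z x)))" by (rule mlin_star[OF WD f])
  have "XT ?f = (U 0 (U 0 ET) \<star> (WT PH \<star> DT)) ?f" by (simp add: XT_def star_assoc)
  also have "\<dots> = ET (\<lambda>z. (WT PH \<star> DT) (\<lambda>x. ?f (wmul (ins 0 (ins 0 z)) x)))"
    unfolding star_eval[OF f] U_eval[OF g3] U_eval[OF mlin_ins[OF g3]] ..
  also have "\<dots> = ET (\<lambda>z. WT PH (?g z))"
    by (rule M_cong[OF ET_M]) (rule star_eval, simp add: mlin_wmul_right[OF f])
  also have "\<dots> = WT PH (\<lambda>w. ET (\<lambda>z. ?g z w))"
    by (rule M_fubini[OF ET_M WT_M[OF PH_M] g1 g2])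
  also have "\<dots> = sw3 Z \<phi> (\<lambda>a b c. sw Z (\<Delta> a) (\<lambda>a1 a2. sw Z (\<Delta> b) (\<lambda>b1 b2. sw Z (\<Delta> c) (\<lambda>c1 c2.
      ET (\<lambda>z. ?g z (a1 ## a2 ## b1 ## b2 ## c1 ## c2 ## unit_word))))))"
    unfolding PH_def by (rule WT_eval[OF M_param[OF ET_M g2 g1] phi_closed])
  also have "\<dots> = sw3 Z \<phi> (\<lambda>a b c. sw Z (\<Delta> a) (\<lambda>a1 a2. sw Z (\<Delta> b) (\<lambda>b1 b2. sw Z (\<Delta> c) (\<lambda>c1 c2.
      P a1 a2 \<odot>Z del \<odot>Z P (S b2) (S b1) \<odot>Z gam \<odot>Z P c1 c2))))"
  proof (intro sw3_cong[OF phi_closed] sw_cong[OF mH mH Delta_closed]; assumption?)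
    fix a1 a2 b1 b2 c1 c2
    assume c: "a1 \<in> \<H>" "a2 \<in> \<H>" "b1 \<in> \<H>" "b2 \<in> \<H>" "c1 \<in> \<H>" "c2 \<in> \<H>"
    let ?w = "a1 ## a2 ## b1 ## b2 ## c1 ## c2 ## unit_word"
    have w: "?w \<in> W" using c by simp
    have L: "linear_map K Z Z (\<lambda>v. (P a1 a2 \<odot>Z del \<odot>Z P (S b2) (S b1)) \<odot>Z v \<odot>Z P c1 c2)"
      using c by (intro sandwich_lin) auto
    have "ET (\<lambda>z. ?g z ?w) = ET (\<lambda>z. (P a1 a2 \<odot>Z del \<odot>Z P (S b2) (S b1)) \<odot>Z ext 4 Cg z \<odot>Z P c1 c2)"
    proof (rule suppD[OF supp_ET g2[OF w] mlin_linear[OF mlin_Cg L]])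
      fix z assume "z \<in> W" "\<And>i. i \<ge> 4 \<Longrightarrow> z i = \<one>\<^sub>H"
      then obtain z0 z1 z2 z3 where z: "z = z0 ## z1 ## z2 ## z3 ## unit_word"
        "z0 \<in> \<H>" "z1 \<in> \<H>" "z2 \<in> \<H>" "z3 \<in> \<H>" by (rule W4_cases)
      have q: "P (S b2) (S b1) \<odot>Z Cg z \<odot>Z P c1 c2 \<in> carrier Z" using c z by (simp add: Cg_def)
      have L': "linear_map K Z Z (\<lambda>v. P a1 a2 \<odot>Z v \<odot>Z (P (S b2) (S b1) \<odot>Z Cg z \<odot>Z P c1 c2))"
        using c q by (intro sandwich_lin) auto
      have zW: "ins 0 (ins 0 z) \<in> W" using z by simp
      have "?g z ?w = DT (\<lambda>x. P a1 a2 \<odot>Z ext 4 Cd x \<odot>Z (P (S b2) (S b1) \<odot>Z Cg z \<odot>Z P c1 c2))"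
      proof (rule suppD[OF supp_DT mlin_wmul_right[OF mlin_wmul_right[OF f zW] w] mlin_linear[OF mlin_Cd L']])
        fix x assume "x \<in> W" "\<And>i. i \<ge> 4 \<Longrightarrow> x i = \<one>\<^sub>H"
        then obtain x0 x1 x2 x3 where x: "x = x0 ## x1 ## x2 ## x3 ## unit_word"
          "x0 \<in> \<H>" "x1 \<in> \<H>" "x2 \<in> \<H>" "x3 \<in> \<H>" by (rule W4_cases)
        then show "?f (wmul (ins 0 (ins 0 z)) (wmul ?w x)) =
            P a1 a2 \<odot>Z ext 4 Cd x \<odot>Z (P (S b2) (S b1) \<odot>Z Cg z \<odot>Z P c1 c2)"
          using c z by (simp add: ext4_eval[OF mlinn_Cd] ext6_eval[OF mlinn_Cx])
            (simp add: Cd_def Cx_def Cg_def S_mult P_mult[symmetric] m_assoc)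
      qed
      also have "\<dots> = P a1 a2 \<odot>Z del \<odot>Z (P (S b2) (S b1) \<odot>Z Cg z \<odot>Z P c1 c2)"
        by (simp add: M_apply_linear[OF DT_M mlin_Cd L'] del_def)
      also have "\<dots> = (P a1 a2 \<odot>Z del \<odot>Z P (S b2) (S b1)) \<odot>Z ext 4 Cg z \<odot>Z P c1 c2" (is "_ = ?rhs")
        using c z by (simp add: ext4_eval[OF mlinn_Cg] Z.m_assoc) (simp add: Cg_def Z.m_assoc)
      finally show "?g z ?w = ?rhs" .
    qed
    also have "\<dots> = P a1 a2 \<odot>Z del \<odot>Z P (S b2) (S b1) \<odot>Z gam \<odot>Z P c1 c2" (is "_ = ?rhs")
      by (simp add: M_apply_linear[OF ET_M mlin_Cg L] gam_def)
    finally show "ET (\<lambda>z. ?g z ?w) = ?rhs" .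
  qed
  also have "\<dots> = sw3 Z \<phi> (\<lambda>a b c. Dl a \<odot>Z del \<odot>Z Sc b \<odot>Z gam \<odot>Z Dl c)"
    unfolding Dl_def Sc_def by (intro sw3_cong[OF phi_closed] sandwich_sum3) auto
  finally show ?thesis .
qed

lemma XI_eval: "XI (ext 6 Cy) = sw3 Z \<phi>inv (\<lambda>a b c. Sc a \<odot>Z gam \<odot>Z Dl b \<odot>Z del \<odot>Z Sc c)"
proof -
  let ?f = "ext 6 Cy"
  note f = mlin_Cy
  let ?g = "\<lambda>z w. DT (\<lambda>x. ?f (wmul z (wmul w (ins 0 (ins 0 x)))))"
  have mx: "mlin (\<lambda>x. ?f (wmul z (wmul w (ins 0 (ins 0 x)))))" if "z \<in> W" "w \<in> W" for z w
    by (rule mlin_ins_wmul(1)[OF mlin_wmul_right[OF f that(1)] that(2)])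
  have g1: "mlin (?g z)" if z: "z \<in> W" for z
    by (rule M_param[OF DT_M mx[OF z]], assumption) (rule mlin_wmul_left[OF mlin_wmul_right[OF f z]], simp)
  have g2: "mlin (\<lambda>z. ?g z w)" if w: "w \<in> W" for w
    by (rule M_param[OF DT_M mx[OF _ w]], assumption) (rule mlin_wmul_left[OF f], simp add: w)
  have UD: "U 0 (U 0 DT) \<in> M" by simp
  have "XI ?f = (ET \<star> (WT PI \<star> U 0 (U 0 DT))) ?f" by (simp add: XI_def star_assoc)
  also have "\<dots> = ET (\<lambda>z. WT PI (?g z))"
    unfolding star_eval[OF f]
  proof (rule M_cong[OF ET_M])
    fix z assume z: "z \<in> W"
    show "(WT PI \<star> U 0 (U 0 DT)) (\<lambda>x. ?f (wmul z x)) = WT PI (?g z)"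
      unfolding star_eval[OF mlin_wmul_right[OF f z]]
    proof (rule M_cong[OF WT_M[OF PI_M]])
      fix w assume w: "w \<in> W"
      note m = mlin_wmul_right[OF mlin_wmul_right[OF f z] w]
      show "U 0 (U 0 DT) (\<lambda>x. ?f (wmul z (wmul w x))) = ?g z w"
        by (simp only: U_eval[OF m] U_eval[OF mlin_ins[OF m]])
    qed
  qed
  also have "\<dots> = WT PI (\<lambda>w. ET (\<lambda>z. ?g z w))"
    by (rule M_fubini[OF ET_M WT_M[OF PI_M] g1 g2])
  also have "\<dots> = sw3 Z \<phi>inv (\<lambda>a b c. sw Z (\<Delta> a) (\<lambda>a1 a2. sw Z (\<Delta> b) (\<lambda>b1 b2. sw Z (\<Delta> c) (\<lambda>c1 c2.
      ET (\<lambda>z. ?g z (a1 ## a2 ## b1 ## b2 ## c1 ## c2 ## unit_word))))))"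
    unfolding PI_def by (rule WT_eval[OF M_param[OF ET_M g2 g1] phi_inv_closed])
  also have "\<dots> = sw3 Z \<phi>inv (\<lambda>a b c. sw Z (\<Delta> a) (\<lambda>a1 a2. sw Z (\<Delta> b) (\<lambda>b1 b2. sw Z (\<Delta> c) (\<lambda>c1 c2.
      P (S a2) (S a1) \<odot>Z gam \<odot>Z P b1 b2 \<odot>Z del \<odot>Z P (S c2) (S c1)))))"
  proof (intro sw3_cong[OF phi_inv_closed] sw_cong[OF mH mH Delta_closed]; assumption?)
    fix a1 a2 b1 b2 c1 c2
    assume c: "a1 \<in> \<H>" "a2 \<in> \<H>" "b1 \<in> \<H>" "b2 \<in> \<H>" "c1 \<in> \<H>" "c2 \<in> \<H>"
    let ?w = "a1 ## a2 ## b1 ## b2 ## c1 ## c2 ## unit_word"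
    have w: "?w \<in> W" using c by simp
    have L: "linear_map K Z Z (\<lambda>v. P (S a2) (S a1) \<odot>Z v \<odot>Z (P b1 b2 \<odot>Z del \<odot>Z P (S c2) (S c1)))"
      using c by (intro sandwich_lin) auto
    have "ET (\<lambda>z. ?g z ?w) = ET (\<lambda>z. P (S a2) (S a1) \<odot>Z ext 4 Cg z \<odot>Z (P b1 b2 \<odot>Z del \<odot>Z P (S c2) (S c1)))"
    proof (rule suppD[OF supp_ET g2[OF w] mlin_linear[OF mlin_Cg L]])
      fix z assume "z \<in> W" "\<And>i. i \<ge> 4 \<Longrightarrow> z i = \<one>\<^sub>H"
      then obtain z0 z1 z2 z3 where z: "z = z0 ## z1 ## z2 ## z3 ## unit_word"
        "z0 \<in> \<H>" "z1 \<in> \<H>" "z2 \<in> \<H>" "z3 \<in> \<H>" by (rule W4_cases)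
      have q: "P (S a2) (S a1) \<odot>Z Cg z \<odot>Z P b1 b2 \<in> carrier Z" using c z by (simp add: Cg_def)
      have L': "linear_map K Z Z (\<lambda>v. (P (S a2) (S a1) \<odot>Z Cg z \<odot>Z P b1 b2) \<odot>Z v \<odot>Z P (S c2) (S c1))"
        using c q by (intro sandwich_lin) auto
      have zW: "z \<in> W" using z by simp
      have "?g z ?w = DT (\<lambda>x. (P (S a2) (S a1) \<odot>Z Cg z \<odot>Z P b1 b2) \<odot>Z ext 4 Cd x \<odot>Z P (S c2) (S c1))"
      proof (rule suppD[OF supp_DT mx[OF zW w] mlin_linear[OF mlin_Cd L']])
        fix x assume "x \<in> W" "\<And>i. i \<ge> 4 \<Longrightarrow> x i = \<one>\<^sub>H"
        then obtain x0 x1 x2 x3 where x: "x = x0 ## x1 ## x2 ## x3 ## unit_word"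
          "x0 \<in> \<H>" "x1 \<in> \<H>" "x2 \<in> \<H>" "x3 \<in> \<H>" by (rule W4_cases)
        then show "?f (wmul z (wmul ?w (ins 0 (ins 0 x)))) =
            (P (S a2) (S a1) \<odot>Z Cg z \<odot>Z P b1 b2) \<odot>Z ext 4 Cd x \<odot>Z P (S c2) (S c1)"
          using c z by (simp add: ext4_eval[OF mlinn_Cd] ext6_eval[OF mlinn_Cy])
            (simp add: Cd_def Cy_def Cg_def S_mult P_mult[symmetric] m_assoc)
      qed
      also have "\<dots> = (P (S a2) (S a1) \<odot>Z Cg z \<odot>Z P b1 b2) \<odot>Z del \<odot>Z P (S c2) (S c1)"
        by (simp add: M_apply_linear[OF DT_M mlin_Cd L'] del_def)
      also have "\<dots> = P (S a2) (S a1) \<odot>Z ext 4 Cg z \<odot>Z (P b1 b2 \<odot>Z del \<odot>Z P (S c2) (S c1))" (is "_ = ?rhs")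
        using c z by (simp add: ext4_eval[OF mlinn_Cg] Z.m_assoc) (simp add: Cg_def Z.m_assoc)
      finally show "?g z ?w = ?rhs" .
    qed
    also have "\<dots> = P (S a2) (S a1) \<odot>Z gam \<odot>Z P b1 b2 \<odot>Z del \<odot>Z P (S c2) (S c1)" (is "_ = ?rhs")
      unfolding M_apply_linear[OF ET_M mlin_Cg L] using c by (simp add: gam_def[symmetric] Z.m_assoc)
    finally show "ET (\<lambda>z. ?g z ?w) = ?rhs" .
  qed
  also have "\<dots> = sw3 Z \<phi>inv (\<lambda>a b c. Sc a \<odot>Z gam \<odot>Z Dl b \<odot>Z del \<odot>Z Sc c)"
    unfolding Dl_def Sc_def by (intro sw3_cong[OF phi_inv_closed] sandwich_sum3) auto
  finally show ?thesis .
qed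

lemma dual_system_Sc: "dual_system Dl Sc gam del"
  using Dl_hom Sc_hom XT_eval XI_eval XT_contract XI_contract gam_dual del_dual
  by (simp add: dual_system_def)

text \<open>This is the twist \<open>twist_f\<close>, see \<open>twist_f_eq\<close>;
  \<open>Tw'\<close> is the comparison in the opposite direction, hence its inverse.\<close>

definition "Tw = twist Sc gam Dl (Dl \<beta>) (\<lambda>h. Dl (S h))"
definition "Tw' = twist (\<lambda>h. Dl (S h)) (Dl \<alpha>) Dl del Sc"

lemma Tw_closed: "Tw \<in> carrier Z" "Tw' \<in> carrier Z"
  unfolding Tw_def Tw'_def
  using twist_closed[OF dual_system_S dual_system_Sc] twist_closed[OF dual_system_Sc dual_system_S] by auto

lemma Tw_inverse: "Tw \<odot>Z Tw' = \<one>\<^bsub>Z\<^esub>" "Tw' \<odot>Z Tw = \<one>\<^bsub>Z\<^esub>"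
  unfolding Tw_def Tw'_def
  using twist_mult[OF dual_system_S dual_system_Sc] twist_mult[OF dual_system_Sc dual_system_S] by auto

end

context quasi_hopf_val
begin

lemma ET_eval:
  assumes C: "mlinn 4 C"
  shows "ET (ext 4 C) = sw3 Z \<phi> (\<lambda>f1 f2 f3. sw3 Z \<phi>inv (\<lambda>g1 g2 g3. sw Z (\<Delta> f3) (\<lambda>a b.
    C (f1 ## g1 \<cdot> f2 ## g2 \<cdot> a ## g3 \<cdot> b ## unit_word))))" (is "_ = ?B")
proof -
  let ?f = "ext 4 C"
  note f = mlin_ext[OF C]
  let ?g = "\<lambda>x y. sw Z (\<Delta> (y 2)) (\<lambda>a b. ?f (wmul x (spl 2 y a b)))"
  have g1: "mlin (?g x)" if "x \<in> W" for x by (rule mlin_spl[OF mlin_wmul_right[OF f that]])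
  have g2: "mlin (\<lambda>x. ?g x y)" if "y \<in> W" for y
    using that by (intro mlin_sw[OF mH mH] mlin_wmul_left[OF f]) auto
  have "ET ?f = U 0 PI (\<lambda>x. PH (?g x))"
    unfolding ET_def star_eval[OF f]
    by (rule M_cong[OF U_M[OF PI_M]]) (rule D_eval[OF mlin_wmul_right[OF f]])
  also have "\<dots> = PH (\<lambda>y. U 0 PI (\<lambda>x. ?g x y))"
    by (rule M_fubini[OF U_M[OF PI_M] PH_M g1 g2])
  also have "\<dots> = sw3 Z \<phi> (\<lambda>f1 f2 f3. U 0 PI (\<lambda>x. ?g x (f1 ## f2 ## f3 ## unit_word)))"
    by (rule PH_eval[OF M_param[OF U_M[OF PI_M] g2 g1]])
  also have "\<dots> = ?B"
  proof (rule sw3_cong[OF phi_closed])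
    fix f1 f2 f3 assume c: "f1 \<in> \<H>" "f2 \<in> \<H>" "f3 \<in> \<H>"
    then have y: "f1 ## f2 ## f3 ## unit_word \<in> W" by simp
    have "U 0 PI (\<lambda>x. ?g x (f1 ## f2 ## f3 ## unit_word)) =
        sw3 Z \<phi>inv (\<lambda>g1 g2 g3. ?g (\<one>\<^sub>H ## g1 ## g2 ## g3 ## unit_word) (f1 ## f2 ## f3 ## unit_word))" (is "?lhs = _")
      unfolding U_eval[OF g2[OF y]] PI_eval[OF mlin_ins[OF g2[OF y]]] by (simp only: ins_wcons)
    also have "\<dots> = sw3 Z \<phi>inv (\<lambda>g1 g2 g3. sw Z (\<Delta> f3) (\<lambda>a b.
        C (f1 ## g1 \<cdot> f2 ## g2 \<cdot> a ## g3 \<cdot> b ## unit_word)))" (is "_ = ?rhs")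
      using c by (intro sw3_cong[OF phi_inv_closed])
        (auto intro!: sw_cong[OF mH mH] ext_unit[OF C] simp: numeral_2_eq_2 unit_beyond)
    finally show "?lhs = ?rhs" .
  qed
  finally show ?thesis .
qed

end

section \<open>The twist and the element \<^term>\<open>\<omega>\<close>\<close>

context quasi_hopf
begin

lemma epsw_numeral [simp]: "epsw (numeral k) (h ## x) = h ## epsw (pred_numeral k) x"
  by (simp add: numeral_eq_Suc)

text \<open>Apply \<epsilon> to the antipode axiom for \<alpha>; since \<epsilon> of \<alpha> is 1,
  the counit axiom removes the second leg and leaves the claim.\<close>

lemma eps_S: "h \<in> \<H> \<Longrightarrow> \<epsilon> (S h) = \<epsilon> h"
proof -
  assume h: "h \<in> \<H>"
  note e = eps_lin
  have "\<epsilon> (sw H (\<Delta> h) (\<lambda>a b. S a \<cdot> \<alpha> \<cdot> b)) = sw (base_field K) (\<Delta> h) (\<lambda>a b. \<epsilon> (S a \<cdot> \<alpha> \<cdot> b))"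
    using h by (intro linear_map_apply_sw[OF mH mH mH mK e]) auto
  also have "\<dots> = sw (base_field K) (\<Delta> h) (\<lambda>a b. \<epsilon> (S (\<epsilon> b \<odot>\<^bsub>H\<^esub> a)))"
    using h by (intro sw_cong[OF mH mH])
      (simp_all add: eps_mult counit_alpha linear_map_smult[OF S_lin] linear_map_smult[OF e] m_comm)
  also have "\<dots> = \<epsilon> (S (sw H (\<Delta> h) (\<lambda>a b. \<epsilon> b \<odot>\<^bsub>H\<^esub> a)))"
    using h by (intro linear_map_apply_sw[OF mH mH mH mK linear_map_comp[OF S_lin e], symmetric]) auto
  also have "\<dots> = \<epsilon> (S h)" using h by (simp add: counit_right_sw)
  finally show ?thesis
    using antipode_alpha[OF h] h by (simp add: sw_def linear_map_smult[OF e] counit_alpha)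
qed

lemma quasi_hopf_alg_H2: "quasi_hopf_alg K H H2"
  by (simp add: quasi_hopf_alg_def quasi_hopf_axioms H2.tensor_k_algebra)

lemma quasi_hopf_sq_H2: "quasi_hopf_sq K H H2 (pure K H H)"
proof -
  interpret A: quasi_hopf_alg K H H2 by (rule quasi_hopf_alg_H2)
  show ?thesis
    by unfold_locales (simp_all add: bilin_pure H2.mult_pure H2.one_pure)
qed

text \<open>The algebra map id \<otimes> \<epsilon>, a left inverse of \<Delta>. It enters because
  the second leg of the inverse twist sits in the fourth leg of \<open>omega\<close>, one of the two
  on which the counit acts.\<close>

definition kap :: "('b, 'b) tens \<Rightarrow> 'b" where "kap t = sw H t (\<lambda>a b. \<epsilon> b \<odot>\<^bsub>H\<^esub> a)"

lemma bilin_kap: "bilin K H H H (\<lambda>a b. \<epsilon> b \<odot>\<^bsub>H\<^esub> a)"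
  by (intro bilinI linear_map_scale[OF mH mH linear_map_id] lin_smult_left[OF mH eps_lin] eps_closed)

lemma kap_lin: "linear_map K H2 H kap"
  unfolding kap_def[abs_def] by (rule linear_map_sw[OF mH mH mH bilin_kap])

lemma kap_closed [simp]: "t \<in> carrier H2 \<Longrightarrow> kap t \<in> \<H>"
  by (rule linear_map_closed[OF kap_lin])

lemma kap_pure: "a \<in> \<H> \<Longrightarrow> b \<in> \<H> \<Longrightarrow> kap (pure K H H a b) = \<epsilon> b \<odot>\<^bsub>H\<^esub> a"
  unfolding kap_def by (rule sw_pure[OF mH mH mH bilin_kap])

lemma kap_Delta: "h \<in> \<H> \<Longrightarrow> kap (\<Delta> h) = h"
  unfolding kap_def by (rule counit_right_sw)

lemma kap_mult: "s \<in> carrier H2 \<Longrightarrow> t \<in> carrier H2 \<Longrightarrow> kap (s \<otimes>\<^bsub>H2\<^esub> t) = kap s \<cdot> kap t"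
proof -
  assume s: "s \<in> carrier H2" and t: "t \<in> carrier H2"
  have "kap (s \<otimes>\<^bsub>H2\<^esub> t) = sw H s (\<lambda>a b. sw H t (\<lambda>c d. (\<epsilon> b \<odot>\<^bsub>H\<^esub> a) \<cdot> (\<epsilon> d \<odot>\<^bsub>H\<^esub> c)))"
    unfolding kap_def H2.sw_mult[OF mH bilin_kap s t]
    by (intro sw_cong[OF mH mH s] sw_cong[OF mH mH t])
      (simp add: eps_mult smult_mult_left smult_mult_right smult_assoc1[symmetric] m_comm)
  also have "\<dots> = sw H s (\<lambda>a b. (\<epsilon> b \<odot>\<^bsub>H\<^esub> a) \<cdot> kap t)"
    unfolding kap_def
    by (intro sw_cong[OF mH mH s] linear_map_apply_sw[OF mH mH mH mH lin_mult_right[OF linear_map_id] t,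
        symmetric]) auto
  also have "\<dots> = kap s \<cdot> kap t"
    using t by (subst (2) kap_def) (intro linear_map_apply_sw[OF mH mH mH mH lin_mult_left[OF linear_map_id] s,
        symmetric]; simp)
  finally show ?thesis .
qed

lemma kap_one: "kap \<one>\<^bsub>H2\<^esub> = \<one>\<^sub>H"
  by (simp add: H2.one_pure kap_pure)

interpretation S2: quasi_hopf_sq K H H2 "pure K H H"
  by (rule quasi_hopf_sq_H2)

lemma S2_Dl: "h \<in> \<H> \<Longrightarrow> S2.Dl h = \<Delta> h"
  unfolding S2.Dl_def by (rule sw_pure_id[OF mH mH Delta_closed])

lemma S2_Sc: "h \<in> \<H> \<Longrightarrow> tens2 [(S h2, S h1). (h1, h2) \<leftarrow> terms (\<Delta> h)] = S2.Sc h"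
proof -
  assume h: "h \<in> \<H>"
  have "set [(S h2, S h1). (h1, h2) \<leftarrow> terms (\<Delta> h)] \<subseteq> \<H> \<times> \<H>"
    by (auto dest!: terms_Delta_carrier[OF h])
  from tens_sum[OF mH mH this] show ?thesis
    by (simp add: S2.Sc_def sw_def comp_def split_def)
qed

text \<open>By \<open>ET_eval\<close> the four letters of \<open>ET\<close> are \<open>f1\<close>,
  \<open>g1 \<cdot> f2\<close>, \<open>g2 \<cdot> f31\<close> and \<open>g3 \<cdot> f32\<close>;
  inserting them into \<open>Cg\<close> gives the expression in \<open>twist_a\<close>.\<close>

lemma S2_gam: "twist_a = S2.gam"
proof -
  let ?xs = "[(S (g1 \<cdot> f2) \<cdot> \<alpha> \<cdot> g2 \<cdot> f31, S f1 \<cdot> \<alpha> \<cdot> g3 \<cdot> f32).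
      (f1, f2, f3) \<leftarrow> terms3 \<phi>, (g1, g2, g3) \<leftarrow> terms3 \<phi>inv, (f31, f32) \<leftarrow> terms (\<Delta> f3)]"
  let ?p = "\<lambda>(a, b). pure K H H a b"
  note t3 = terms3_carrier[OF phi_closed] and t3' = terms3_carrier[OF phi_inv_closed] and td = terms_Delta_carrier
  have xs: "set ?xs \<subseteq> \<H> \<times> \<H>" by (auto dest!: t3 t3' dest: td)
  have "twist_a = lsum H2 (map ?p ?xs)"
    unfolding twist_a_def by (rule tens_sum[OF mH mH xs])
  also have "\<dots> = sw3 H2 \<phi> (\<lambda>f1 f2 f3. lsum H2 (map ?p [(S (g1 \<cdot> f2) \<cdot> \<alpha> \<cdot> g2 \<cdot> f31, S f1 \<cdot> \<alpha> \<cdot> g3 \<cdot> f32).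
      (g1, g2, g3) \<leftarrow> terms3 \<phi>inv, (f31, f32) \<leftarrow> terms (\<Delta> f3)]))"
    by (rule H3.B.lsum_bind_terms3) (auto dest!: t3 t3' dest: td intro!: pure_closed)
  also have "\<dots> = sw3 H2 \<phi> (\<lambda>f1 f2 f3. sw3 H2 \<phi>inv (\<lambda>g1 g2 g3. sw H2 (\<Delta> f3) (\<lambda>a b.
      S2.Cg (f1 ## g1 \<cdot> f2 ## g2 \<cdot> a ## g3 \<cdot> b ## unit_word))))"
  proof (rule sw3_cong[OF phi_closed])
    fix f1 f2 f3 assume f: "f1 \<in> \<H>" "f2 \<in> \<H>" "f3 \<in> \<H>"
    have "lsum H2 (map ?p [(S (g1 \<cdot> f2) \<cdot> \<alpha> \<cdot> g2 \<cdot> f31, S f1 \<cdot> \<alpha> \<cdot> g3 \<cdot> f32).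
        (g1, g2, g3) \<leftarrow> terms3 \<phi>inv, (f31, f32) \<leftarrow> terms (\<Delta> f3)]) =
      sw3 H2 \<phi>inv (\<lambda>g1 g2 g3. lsum H2 (map ?p [(S (g1 \<cdot> f2) \<cdot> \<alpha> \<cdot> g2 \<cdot> f31, S f1 \<cdot> \<alpha> \<cdot> g3 \<cdot> f32).
        (f31, f32) \<leftarrow> terms (\<Delta> f3)]))" (is "?lhs = _")
      by (rule H3.B.lsum_bind_terms3) (use f in \<open>auto dest!: t3' dest: td intro!: pure_closed\<close>)
    also have "\<dots> = sw3 H2 \<phi>inv (\<lambda>g1 g2 g3. sw H2 (\<Delta> f3) (\<lambda>a b.
      S2.Cg (f1 ## g1 \<cdot> f2 ## g2 \<cdot> a ## g3 \<cdot> b ## unit_word)))" (is "_ = ?rhs")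
      unfolding lsum_map_terms using f
      by (intro sw3_cong[OF phi_inv_closed] sw_cong[OF mH mH Delta_closed]) (simp_all add: S2.Cg_def m_assoc)
    finally show "?lhs = ?rhs" .
  qed
  also have "\<dots> = S2.gam" unfolding S2.gam_def by (rule S2.ET_eval[OF S2.mlinn_Cg, symmetric])
  finally show ?thesis .
qed

lemma pR_closed: "pR \<in> carrier H2"
  unfolding pR_def by (rule tens_closed) (auto dest!: terms3_carrier[OF phi_inv_closed])

lemma sw_pR:
  assumes Z: "module K Z" and B: "bilin K H H Z B"
  shows "sw Z pR B = sw3 Z \<phi>inv (\<lambda>a b c. B a (b \<cdot> \<beta> \<cdot> S c))"
proof -
  have "set [(g1, g2 \<cdot> \<beta> \<cdot> S g3). (g1, g2, g3) \<leftarrow> terms3 \<phi>inv] \<subseteq> \<H> \<times> \<H>"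
    by (auto dest!: terms3_carrier[OF phi_inv_closed])
  then show ?thesis
    unfolding pR_def by (subst sw_tens[OF mH mH Z B]) (auto simp: lsum_map_terms3 sw3_def comp_def split_def)
qed

text \<open>\<open>sw_pR\<close> resolves \<open>pR\<close> into the inverse associator, and the
  coproduct of \<open>b \<cdot> \<beta> \<cdot> S c\<close> splits into the three factors that
  \<open>twist\<close> asks for.\<close>

lemma twist_f_eq: "twist_f = S2.Tw"
proof -
  let ?B = "\<lambda>p q. S2.Sc p \<otimes>\<^bsub>H2\<^esub> S2.gam \<otimes>\<^bsub>H2\<^esub> \<Delta> q"
  have B: "bilin K H H H2 ?B"
    by (intro bilinI H3.B.lin_mult_left H3.B.lin_mult_right Delta_lin H3.B.m_closed S2.gam_closed S2.Sc_closed
        Delta_closed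
        anti_algebra_map_linear[OF S2.Sc_hom])
  have "twist_f = sw H2 pR ?B"
    unfolding twist_f_def sw_def using terms_carrier'[OF mH mH pR_closed]
    by (intro arg_cong[where f="lsum H2"] map_cong) (auto simp: S2_Sc S2_gam)
  also have "\<dots> = sw3 H2 \<phi>inv (\<lambda>a b c. ?B a (b \<cdot> \<beta> \<cdot> S c))" by (rule sw_pR[OF mH2 B])
  also have "\<dots> = S2.Tw"
    unfolding S2.Tw_def S2.twist_def
    by (rule sw3_cong[OF phi_inv_closed]) (simp add: S2_Dl Delta_mult H3.B.m_assoc H3.B.m_closed)
  finally show ?thesis .
qed

lemma twist_f_inv: "inv\<^bsub>H2\<^esub> twist_f = S2.Tw'"
  unfolding twist_f_eq
  by (rule H3.B.inv_char) (use S2.Tw_closed S2.Tw_inverse in auto)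

lemma twist_f_inv_closed: "inv\<^bsub>H2\<^esub> twist_f \<in> carrier H2"
  unfolding twist_f_inv by (rule S2.Tw_closed)

lemma linear_map_sw3:
  assumes L: "linear_map K V Y L" and V: "module K V" and Y: "module K Y" and t: "t \<in> carrier H3"
    and F: "\<And>a b c. \<lbrakk>a \<in> \<H>; b \<in> \<H>; c \<in> \<H>\<rbrakk> \<Longrightarrow> F a b c \<in> carrier V"
  shows "L (sw3 V t F) = sw3 Y t (\<lambda>a b c. L (F a b c))"
proof -
  have "(case p of (a, b, c) \<Rightarrow> F a b c) \<in> carrier V" if "p \<in> set (terms3 t)" for p
    using F terms3_carrier[OF t] that by (cases p) auto
  from linear_map_lsum[OF L V Y, of "terms3 t" "\<lambda>(a, b, c). F a b c", OF this] show ?thesis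
    by (simp add: sw3_def split_def)
qed

end

context quasi_hopf_val
begin

lemma eps_smult_one [simp]: "c \<in> carrier K \<Longrightarrow> \<epsilon> (c \<odot>\<^bsub>H\<^esub> \<one>\<^sub>H) = c"
  by (simp add: linear_map_smult[OF eps_lin])

text \<open>Sweedler form of the trivial counits of the associator, for functions of three
  letters.\<close>

lemma sw3_counit:
  assumes m: "mlinn 3 C"
  shows "sw3 Z \<phi> (\<lambda>a b c. C ((\<epsilon> a \<odot>\<^bsub>H\<^esub> \<one>\<^sub>H) ## b ## c ## unit_word)) = C unit_word"
    and "sw3 Z \<phi>inv (\<lambda>a b c. C ((\<epsilon> a \<odot>\<^bsub>H\<^esub> \<one>\<^sub>H) ## b ## c ## unit_word)) = C unit_word"
    and "sw3 Z \<phi>inv (\<lambda>a b c. C (a ## b ## (\<epsilon> c \<odot>\<^bsub>H\<^esub> \<one>\<^sub>H) ## unit_word)) = C unit_word"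
proof -
  note f = mlin_ext[OF m]
  have u: "ext 3 C unit_word = C unit_word" by (rule ext_unit[OF m]) simp_all
  have "sw3 Z \<phi> (\<lambda>a b c. C ((\<epsilon> a \<odot>\<^bsub>H\<^esub> \<one>\<^sub>H) ## b ## c ## unit_word)) = E 0 PH (ext 3 C)"
    unfolding E_eval[OF f] PH_eval[OF mlin_epsw[OF f]]
    by (rule sw3_cong[OF phi_closed]) (simp add: ext3_eval[OF m])
  then show "sw3 Z \<phi> (\<lambda>a b c. C ((\<epsilon> a \<odot>\<^bsub>H\<^esub> \<one>\<^sub>H) ## b ## c ## unit_word)) = C unit_word"
    by (simp add: one_eval[OF f] u)
  have "sw3 Z \<phi>inv (\<lambda>a b c. C ((\<epsilon> a \<odot>\<^bsub>H\<^esub> \<one>\<^sub>H) ## b ## c ## unit_word)) = E 0 PI (ext 3 C)"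
    unfolding E_eval[OF f] PI_eval[OF mlin_epsw[OF f]]
    by (rule sw3_cong[OF phi_inv_closed]) (simp add: ext3_eval[OF m])
  then show "sw3 Z \<phi>inv (\<lambda>a b c. C ((\<epsilon> a \<odot>\<^bsub>H\<^esub> \<one>\<^sub>H) ## b ## c ## unit_word)) = C unit_word"
    by (simp add: one_eval[OF f] u)
  have "sw3 Z \<phi>inv (\<lambda>a b c. C (a ## b ## (\<epsilon> c \<odot>\<^bsub>H\<^esub> \<one>\<^sub>H) ## unit_word)) = E 2 PI (ext 3 C)"
    unfolding E_eval[OF f] PI_eval[OF mlin_epsw[OF f]]
    by (rule sw3_cong[OF phi_inv_closed]) (simp add: ext3_eval[OF m] numeral_2_eq_2)
  then show "sw3 Z \<phi>inv (\<lambda>a b c. C (a ## b ## (\<epsilon> c \<odot>\<^bsub>H\<^esub> \<one>\<^sub>H) ## unit_word)) = C unit_word"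
    by (simp add: one_eval[OF f] u)
qed

end

context quasi_hopf
begin

interpretation S2: quasi_hopf_sq K H H2 "pure K H H"
  by (rule quasi_hopf_sq_H2)

lemma quasi_hopf_val_H: "quasi_hopf_val K H H"
  by (simp add: quasi_hopf_val_def quasi_hopf_axioms)

interpretation VH: quasi_hopf_val K H H
  by (rule quasi_hopf_val_H)

lemma kap_Sc: "h \<in> \<H> \<Longrightarrow> kap (S2.Sc h) = S h"
proof -
  assume h: "h \<in> \<H>"
  have "kap (S2.Sc h) = sw H (\<Delta> h) (\<lambda>a b. kap (pure K H H (S b) (S a)))"
    unfolding S2.Sc_def using h
    by (intro linear_map_apply_sw[OF mH mH mH2 mH kap_lin]) (auto intro: pure_closed)
  also have "\<dots> = sw H (\<Delta> h) (\<lambda>a b. S (\<epsilon> a \<odot>\<^bsub>H\<^esub> b))"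
    using h by (intro sw_cong[OF mH mH]) (simp_all add: kap_pure eps_S linear_map_smult[OF S_lin])
  also have "\<dots> = S (sw H (\<Delta> h) (\<lambda>a b. \<epsilon> a \<odot>\<^bsub>H\<^esub> b))"
    using h by (intro linear_map_apply_sw[OF mH mH mH mH S_lin, symmetric]) auto
  finally show ?thesis using h by (simp add: counit_left_sw)
qed

text \<open>Since \<epsilon> of \<alpha> is 1, the second tensor factor shrinks to scalars; the
  counit axiom for \<open>f3\<close> and the counits of \<phi> and its inverse then leave the
  \<alpha> of the first factor.\<close>

lemma kap_gam: "kap S2.gam = \<alpha>"
proof -
  have Cg: "S2.Cg (a ## b ## c ## d ## unit_word) = pure K H H (S b \<cdot> \<alpha> \<cdot> c) (S a \<cdot> \<alpha> \<cdot> d)" for a b c d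
    by (simp add: S2.Cg_def)
  have cl: "sw H2 (\<Delta> f3) (\<lambda>a b. S2.Cg (f1 ## g1 \<cdot> f2 ## g2 \<cdot> a ## g3 \<cdot> b ## unit_word)) \<in> carrier H2"
    if "f1 \<in> \<H>" "f2 \<in> \<H>" "f3 \<in> \<H>" "g1 \<in> \<H>" "g2 \<in> \<H>" "g3 \<in> \<H>"
    for f1 f2 f3 g1 g2 g3
    using that by (intro sw_closed[OF mH mH mH2]) (auto simp: Cg intro!: pure_closed)
  have "kap S2.gam = sw3 H \<phi> (\<lambda>f1 f2 f3. kap (sw3 H2 \<phi>inv (\<lambda>g1 g2 g3. sw H2 (\<Delta> f3) (\<lambda>a b.
      S2.Cg (f1 ## g1 \<cdot> f2 ## g2 \<cdot> a ## g3 \<cdot> b ## unit_word)))))"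
    unfolding S2.gam_def S2.ET_eval[OF S2.mlinn_Cg]
    by (rule linear_map_sw3[OF kap_lin mH2 mH phi_closed]) (rule S2.sw3_closed[OF phi_inv_closed cl])
  also have "\<dots> = sw3 H \<phi> (\<lambda>f1 f2 f3. S (f2 \<cdot> (\<epsilon> f1 \<odot>\<^bsub>H\<^esub> \<one>\<^sub>H)) \<cdot> \<alpha> \<cdot> f3)"
  proof (rule sw3_cong[OF phi_closed])
    fix f1 f2 f3 assume f: "f1 \<in> \<H>" "f2 \<in> \<H>" "f3 \<in> \<H>"
    let ?F = "\<lambda>g1 g2 g3. \<epsilon> (f1 \<cdot> g3) \<odot>\<^bsub>H\<^esub> (S (g1 \<cdot> f2) \<cdot> \<alpha> \<cdot> (g2 \<cdot> f3))"
    have "kap (sw3 H2 \<phi>inv (\<lambda>g1 g2 g3. sw H2 (\<Delta> f3) (\<lambda>a b. S2.Cg (f1 ## g1 \<cdot> f2 ## g2 \<cdot> a ## g3 \<cdot> b ## unit_word)))) =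
        sw3 H \<phi>inv (\<lambda>g1 g2 g3. kap (sw H2 (\<Delta> f3) (\<lambda>a b. S2.Cg (f1 ## g1 \<cdot> f2 ## g2 \<cdot> a ## g3 \<cdot> b ##
            unit_word))))" (is "?lhs = _")
      using f by (intro linear_map_sw3[OF kap_lin mH2 mH phi_inv_closed] cl)
    also have "\<dots> = sw3 H \<phi>inv ?F"
    proof (rule sw3_cong[OF phi_inv_closed])
      fix g1 g2 g3 assume g: "g1 \<in> \<H>" "g2 \<in> \<H>" "g3 \<in> \<H>"
      let ?L = "\<lambda>v. \<epsilon> (f1 \<cdot> g3) \<odot>\<^bsub>H\<^esub> (S (g1 \<cdot> f2) \<cdot> \<alpha> \<cdot> (g2 \<cdot> v))"
      have L: "linear_map K H H ?L"
        using f g by (intro linear_map_scale[OF mH mH] lin_mult_right linear_map_id) auto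
      have "kap (sw H2 (\<Delta> f3) (\<lambda>a b. S2.Cg (f1 ## g1 \<cdot> f2 ## g2 \<cdot> a ## g3 \<cdot> b ## unit_word))) =
          sw H (\<Delta> f3) (\<lambda>a b. kap (S2.Cg (f1 ## g1 \<cdot> f2 ## g2 \<cdot> a ## g3 \<cdot> b ## unit_word)))" (is "?lhs = _")
        using f g by (intro linear_map_apply_sw[OF mH mH mH2 mH kap_lin]) (auto simp: Cg intro!: pure_closed)
      also have "\<dots> = sw H (\<Delta> f3) (\<lambda>a b. ?L (\<epsilon> b \<odot>\<^bsub>H\<^esub> a))"
        using f g by (intro sw_cong[OF mH mH])
          (simp_all add: Cg kap_pure eps_mult eps_S counit_alpha smult_mult_right smult_assoc1[symmetric] m_ac)
      also have "\<dots> = ?L f3"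
        using f linear_map_apply_sw[OF mH mH mH mH L Delta_closed[OF f(3)], of "\<lambda>a b. \<epsilon> b \<odot>\<^bsub>H\<^esub> a"]
        by (simp add: counit_right_sw)
      finally show "?lhs = ?F g1 g2 g3" .
    qed
    \<comment> \<open>The leg \<open>g3\<close> occurs only under \<epsilon>, so it may be replaced
      by its counit times 1, the form that \<open>sw3_counit\<close> expects.\<close>
    also have "\<dots> = sw3 H \<phi>inv (\<lambda>g1 g2 g3. ?F g1 g2 (\<epsilon> g3 \<odot>\<^bsub>H\<^esub> \<one>\<^sub>H))"
      using f by (intro sw3_cong[OF phi_inv_closed]) (simp add: eps_mult)
    also have "\<dots> = ?F \<one>\<^sub>H \<one>\<^sub>H \<one>\<^sub>H"
    proof -
      have "mlinn 3 (\<lambda>x. ?F (x 0) (x (Suc 0)) (x 2))" if "VH.mlinn = mlinn" for mlinn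
        unfolding that[symmetric] using f
        by (intro VH.mlinn3)
          (auto intro!: linear_map_scale[OF mH mH] lin_smult_left[OF mH] lin_mult_right lin_mult_left
            linear_map_comp[OF _ S_lin] linear_map_comp[OF _ eps_lin] linear_map_id)
      from VH.sw3_counit(3)[OF this[OF HOL.refl]] show ?thesis by simp
    qed
    finally show "?lhs =         S (f2 \<cdot> (\<epsilon> f1 \<odot>\<^bsub>H\<^esub> \<one>\<^sub>H)) \<cdot> \<alpha> \<cdot> f3"
      using f by (simp add: smult_mult_left smult_mult_right linear_map_smult[OF S_lin])
  qed
  also have "\<dots> = \<alpha>"
  proof -
    have "VH.mlinn 3 (\<lambda>x. S (x (Suc 0) \<cdot> x 0) \<cdot> \<alpha> \<cdot> x 2)"
      by (intro VH.mlinn3)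
        (auto intro!: lin_mult_right lin_mult_left linear_map_comp[OF _ S_lin] linear_map_id)
    from VH.sw3_counit(1)[OF this] show ?thesis by simp
  qed
  finally show ?thesis .
qed

text \<open>\<open>kap\<close> turns \<open>Sc\<close>, \<open>gam\<close> and \<open>Dl\<close>
  back into \<open>S\<close>, \<alpha> and the identity, so the sum becomes the antipode identity
  for the inverse associator.\<close>

lemma kap_twist_f: "kap twist_f = \<one>\<^sub>H"
proof -
  have "kap twist_f = sw3 H \<phi>inv (\<lambda>a b c. kap (S2.Sc a \<otimes>\<^bsub>H2\<^esub> S2.gam \<otimes>\<^bsub>H2\<^esub> S2.Dl b \<otimes>\<^bsub>H2\<^esub> S2.Dl \<beta> \<otimes>\<^bsub>H2\<^esub> S2.Dl (S c)))"
    unfolding twist_f_eq S2.Tw_def S2.twist_def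
    by (intro linear_map_sw3[OF kap_lin mH2 mH phi_inv_closed] H3.B.m_closed) auto
  also have "\<dots> = sw3 H \<phi>inv (\<lambda>a b c. S a \<cdot> \<alpha> \<cdot> b \<cdot> \<beta> \<cdot> S c)"
    by (rule sw3_cong[OF phi_inv_closed])
      (simp add: kap_mult H3.B.m_closed kap_Sc kap_gam S2_Dl kap_Delta)
  finally show ?thesis using antipode_phi_inv by (simp add: sw3_def)
qed

lemma kap_twist_f_inv: "kap (inv\<^bsub>H2\<^esub> twist_f) = \<one>\<^sub>H"
proof -
  have "kap (S2.Tw \<otimes>\<^bsub>H2\<^esub> S2.Tw') = \<one>\<^sub>H" by (simp only: S2.Tw_inverse kap_one)
  then show ?thesis
    unfolding twist_f_inv using kap_twist_f S2.Tw_closed by (simp add: twist_f_eq kap_mult)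
qed

lemma terms4_carrier:
  assumes "t \<in> carrier H4" "(a, b, c, d) \<in> set (terms4 t)"
  shows "a \<in> \<H> \<and> b \<in> \<H> \<and> c \<in> \<H> \<and> d \<in> \<H>"
proof -
  obtain t' where t': "(a, t') \<in> set (terms t)" "(b, c, d) \<in> set (terms3 t')"
    using assms(2) by (auto simp: terms4_def)
  then show ?thesis
    using terms_carrier'[OF mH mH3 assms(1) t'(1)] terms3_carrier[OF _ t'(2)] by blast
qed

lemma terms5_carrier:
  assumes "t \<in> carrier H5" "(a, b, c, d, e) \<in> set (terms5 t)"
  shows "a \<in> \<H> \<and> b \<in> \<H> \<and> c \<in> \<H> \<and> d \<in> \<H> \<and> e \<in> \<H>"
proof -
  obtain t' where t': "(a, t') \<in> set (terms t)" "(b, c, d, e) \<in> set (terms4 t')"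
    using assms(2) by (auto simp: terms5_def)
  then show ?thesis
    using terms_carrier'[OF mH mH4 assms(1) t'(1)] terms4_carrier[OF _ t'(2)] by blast
qed

end

definition sw4 :: "('z, 'm) ring_scheme \<Rightarrow> ('u, ('v, ('w, 'x) tens) tens) tens \<Rightarrow> ('u \<Rightarrow> 'v \<Rightarrow> 'w \<Rightarrow> 'x \<Rightarrow> 'z) \<Rightarrow> 'z"
  where "sw4 Z t F = lsum Z (map (\<lambda>(a, b, c, d). F a b c d) (terms4 t))"

definition sw5 :: "('z, 'm) ring_scheme \<Rightarrow> ('u, ('v, ('w, ('x, 'y) tens) tens) tens) tens \<Rightarrow>
    ('u \<Rightarrow> 'v \<Rightarrow> 'w \<Rightarrow> 'x \<Rightarrow> 'y \<Rightarrow> 'z) \<Rightarrow> 'z"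
  where "sw5 Z t F = lsum Z (map (\<lambda>(a, b, c, d, e). F a b c d e) (terms5 t))"

lemma (in abelian_monoid) lsum_bind_terms4:
  assumes "\<And>a b c d p. (a, b, c, d) \<in> set (terms4 t) \<Longrightarrow> p \<in> set (L a b c d) \<Longrightarrow> g p \<in> carrier G"
  shows "lsum G (map g (concat (map (\<lambda>(a, b, c, d). L a b c d) (terms4 t)))) =
    sw4 G t (\<lambda>a b c d. lsum G (map g (L a b c d)))"
proof -
  have "set (map g (L (fst x) (fst (snd x)) (fst (snd (snd x))) (snd (snd (snd x))))) \<subseteq> carrier G"
    if "x \<in> set (terms4 t)" for x
    using assms[of "fst x" "fst (snd x)" "fst (snd (snd x))" "snd (snd (snd x))"] that by auto
  from lsum_concat[OF this] show ?thesis by (simp add: sw4_def map_concat comp_def split_def)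
qed

section \<open>The counit on the second and fourth legs of omega\<close>

context quasi_hopf_val
begin

lemma sw4_cong:
  assumes "t \<in> carrier H4"
    "\<And>a b c d. \<lbrakk>a \<in> \<H>; b \<in> \<H>; c \<in> \<H>; d \<in> \<H>\<rbrakk> \<Longrightarrow> F a b c d = G a b c d"
  shows "sw4 Z t F = sw4 Z t G"
  unfolding sw4_def using assms(2) terms4_carrier[OF assms(1)]
  by (intro arg_cong[where f="lsum Z"] map_cong) auto

lemma sw5_cong:
  assumes "t \<in> carrier H5"
    "\<And>a b c d e. \<lbrakk>a \<in> \<H>; b \<in> \<H>; c \<in> \<H>; d \<in> \<H>; e \<in> \<H>\<rbrakk> \<Longrightarrow> F a b c d e = G a b c d e"
  shows "sw5 Z t F = sw5 Z t G"
  unfolding sw5_def using assms(2) terms5_carrier[OF assms(1)]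
  by (intro arg_cong[where f="lsum Z"] map_cong) auto

lemma ev4_eval:
  assumes t: "t \<in> carrier H4" and f: "mlin f"
  shows "ev4 t f = sw4 Z t (\<lambda>a b c d. f (a ## b ## c ## d ## unit_word))"
proof -
  note c1 = terms_carrier'[OF mH mH3 t]
  have "sw4 Z t (\<lambda>a b c d. f (a ## b ## c ## d ## unit_word)) = lsum Z (map (\<lambda>(a, b, c, d). f (a ## b ## c ## d
      ## unit_word))
      (concat (map (\<lambda>(a, t'). map (\<lambda>(b, c, d). (a, b, c, d)) (terms3 t')) (terms t))))"
    by (simp add: sw4_def terms4_def)
  also have "\<dots> = sw Z t (\<lambda>a t'. lsum Z (map (\<lambda>(a, b, c, d). f (a ## b ## c ## d ## unit_word))
      (map (\<lambda>(b, c, d). (a, b, c, d)) (terms3 t'))))"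
  proof (rule Z.lsum_bind_terms)
    fix a t' p assume "(a, t') \<in> set (terms t)" "p \<in> set (map (\<lambda>(b, c, d). (a, b, c, d)) (terms3 t'))"
    then show "(case p of (a, b, c, d) \<Rightarrow> f (a ## b ## c ## d ## unit_word)) \<in> carrier Z"
      using c1[of a t'] by (auto dest!: terms3_carrier[rotated] intro!: mlin_closed[OF f])
  qed
  also have "\<dots> = sw Z t (\<lambda>a t'. ev3 t' (\<lambda>x. f (a ## x)))"
    by (rule sw_cong[OF mH mH3 t]) (simp only: lsum_map_terms3, simp add: ev3_eval mlin_wcons[OF f])
  finally show ?thesis unfolding ev4_def by (simp add: ev_tensor_eval[OF f])
qed

lemma ev5_eval:
  assumes t: "t \<in> carrier H5" and f: "mlin f"
  shows "ev5 t f = sw5 Z t (\<lambda>a b c d e. f (a ## b ## c ## d ## e ## unit_word))"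
proof -
  note c1 = terms_carrier'[OF mH mH4 t]
  have "sw5 Z t (\<lambda>a b c d e. f (a ## b ## c ## d ## e ## unit_word)) =
    lsum Z (map (\<lambda>(a, b, c, d, e). f (a ## b ## c ## d ## e ## unit_word))
      (concat (map (\<lambda>(a, t'). map (\<lambda>(b, c, d, e). (a, b, c, d, e)) (terms4 t')) (terms t))))"
    by (simp add: sw5_def terms5_def)
  also have "\<dots> = sw Z t (\<lambda>a t'. lsum Z (map (\<lambda>(a, b, c, d, e). f (a ## b ## c ## d ## e ## unit_word))
      (map (\<lambda>(b, c, d, e). (a, b, c, d, e)) (terms4 t'))))"
  proof (rule Z.lsum_bind_terms)
    fix a t' p assume "(a, t') \<in> set (terms t)" "p \<in> set (map (\<lambda>(b, c, d, e). (a, b, c, d, e)) (terms4 t'))"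
    then show "(case p of (a, b, c, d, e) \<Rightarrow> f (a ## b ## c ## d ## e ## unit_word)) \<in> carrier Z"
      using c1[of a t'] by (auto dest!: terms4_carrier[rotated] intro!: mlin_closed[OF f])
  qed
  also have "\<dots> = sw Z t (\<lambda>a t'. ev4 t' (\<lambda>x. f (a ## x)))"
    by (rule sw_cong[OF mH mH4 t]) (simp add: ev4_eval mlin_wcons[OF f] sw4_def comp_def split_def)
  finally show ?thesis unfolding ev5_def by (simp add: ev_tensor_eval[OF f])
qed

lemma chi_closed: "chi \<in> carrier H4"
  unfolding chi_def by (rule H4.mult_closed[OF ev4_D_closed(5)[OF phi_closed] ev4_D_closed(3)[OF phi_inv_closed]])

text \<open>In words \<open>chi\<close> is \<open>PH \<star> D 0 PI\<close>. Slot 2 holds the third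
  leg of \<phi> and the second leg of the inverse, and both have trivial counit.\<close>

lemma E2_chi: "E 2 (ev4 chi) = one_M"
proof -
  have "ev4 chi = PH \<star> D 0 PI"
    unfolding chi_def
      eval_homD(3)[OF eval_hom4 ev4_D_closed(5)[OF phi_closed] ev4_D_closed(3)[OF phi_inv_closed]]
      ev4_D[OF phi_closed] ev4_D[OF phi_inv_closed]
    by (simp only: PH_def PI_def)
  then show ?thesis by (simp add: E_star E_D_greater)
qed

text \<open>\<open>E 1\<close> and \<open>E 3\<close> are multiplicative, so the three factors of
  \<open>omega\<close> are treated separately: the twist by \<open>kap_twist_f_inv\<close>, the
  middle factor through \<open>E2_chi\<close>, the last by the counit on the middle leg of
  \<phi>.\<close>

lemma omega_counit: "E 1 (E 3 (ev5 omega)) = one_M"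
proof -
  let ?A = "[(\<one>\<^sub>H, \<one>\<^sub>H, \<one>\<^sub>H, f2, f1). (f1, f2) \<leftarrow> terms (inv\<^bsub>H2\<^esub> twist_f)]"
  let ?B = "[(a, b1, b2, S c, S d). (a, b, c, d) \<leftarrow> terms4 chi, (b1, b2) \<leftarrow> terms (\<Delta> b)]"
  let ?C = "[(a, b, c, \<one>\<^sub>H, \<one>\<^sub>H). (a, b, c) \<leftarrow> terms3 \<phi>]"
  let ?H5 = "\<H> \<times> \<H> \<times> \<H> \<times> \<H> \<times> \<H>"
  note fi = twist_f_inv_closed
  have A: "set ?A \<subseteq> ?H5" using terms_carrier'[OF mH mH fi] by auto
  have B: "set ?B \<subseteq> ?H5" by (auto dest!: terms4_carrier[OF chi_closed] dest: terms_Delta_carrier)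
  have C: "set ?C \<subseteq> ?H5" by (auto dest!: terms3_carrier[OF phi_closed])
  note cl = tens5_closed[OF A] tens5_closed[OF B] tens5_closed[OF C]
  note M5 = eval_homD(1)[OF eval_hom5]
  have e: "E 1 (E 3 t) f = t (\<lambda>x. f (epsw 1 (epsw 3 x)))" if "mlin f" for t f
    by (simp add: E_eval[OF that] E_eval[OF mlin_epsw[OF that]])
  have EA: "E 1 (E 3 (ev5 (tens5 ?A))) = one_M"
  proof (rule M_ext)
    fix f assume f: "mlin f"
    note m = mlin_epsw[OF mlin_epsw[OF f, of 1], of 3]
    let ?L = "\<lambda>v. f (\<one>\<^sub>H ## \<one>\<^sub>H ## \<one>\<^sub>H ## \<one>\<^sub>H ## v ## unit_word)"
    have L: "linear_map K H Z ?L"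
      using mlinD[OF f W_unit, of "Suc (Suc (Suc (Suc 0)))"] by (simp add: unit_word_upd)
    have "E 1 (E 3 (ev5 (tens5 ?A))) f = sw Z (inv\<^bsub>H2\<^esub> twist_f) (\<lambda>f1 f2. ?L (\<epsilon> f2 \<odot>\<^bsub>H\<^esub> f1))"
      unfolding e[OF f] ev5_tens[OF m A] lsum_map_terms
    proof (rule sw_cong[OF mH mH fi])
      fix f1 f2 assume c: "f1 \<in> \<H>" "f2 \<in> \<H>"
      have "f (\<one>\<^sub>H ## \<one>\<^sub>H ## \<one>\<^sub>H ## (\<epsilon> f2 \<odot>\<^bsub>H\<^esub> \<one>\<^sub>H) ## f1 ## unit_word) = \<epsilon> f2 \<odot>\<^bsub>Z\<^esub> ?L f1"
        using mlin_smult[OF f, of "\<one>\<^sub>H ## \<one>\<^sub>H ## \<one>\<^sub>H ## \<one>\<^sub>H ## f1 ## unit_word" "\<epsilon> f2" "\<one>\<^sub>H" 3] c by simp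
      then show "(case (\<one>\<^sub>H, \<one>\<^sub>H, \<one>\<^sub>H, f2, f1) of (a, b, c, d, e) \<Rightarrow>
          f (epsw 1 (epsw 3 (a ## b ## c ## d ## e ## unit_word)))) = ?L (\<epsilon> f2 \<odot>\<^bsub>H\<^esub> f1)"
        using c by (simp add: linear_map_smult[OF L] numeral_3_eq_3)
    qed
    also have "\<dots> = ?L (kap (inv\<^bsub>H2\<^esub> twist_f))"
      unfolding kap_def by (intro linear_map_apply_sw[OF mH mH mH mZ L fi, symmetric]) simp
    finally show "E 1 (E 3 (ev5 (tens5 ?A))) f = one_M f"
      by (simp add: kap_twist_f_inv one_eval[OF f])
  qed (use M5 cl in simp_all)
  \<comment> \<open>Slots 1 and 2 hold the two halves of one coproduct, so the counit in slot 1
    restores the letter; the counit in slot 3 passes through the antipode to the third leg of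
    \<open>chi\<close>.\<close>
  have EB: "E 1 (E 3 (ev5 (tens5 ?B))) = one_M"
  proof (rule M_ext)
    fix f assume f: "mlin f"
    note m = mlin_epsw[OF mlin_epsw[OF f, of 1], of 3]
    let ?F = "\<lambda>a b c d. f (a ## \<one>\<^sub>H ## b ## c ## S d ## unit_word)"
    have m4: "mlinn 4 (\<lambda>x. ?F (x 0) (x (Suc 0)) (x 2) (x 3))"
    proof (rule mlinn4)
      fix a b c d assume "a \<in> \<H>" "b \<in> \<H>" "c \<in> \<H>" "d \<in> \<H>"
      then show "?F a b c d \<in> carrier Z" by (simp add: mlin_closed[OF f])
    next
      fix b c d assume c: "b \<in> \<H>" "c \<in> \<H>" "d \<in> \<H>"
      show "linear_map K H Z (\<lambda>v. ?F v b c d)"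
        using mlinD[OF f, of "\<one>\<^sub>H ## \<one>\<^sub>H ## b ## c ## S d ## unit_word" 0] c by simp
      show "linear_map K H Z (\<lambda>v. ?F b v c d)"
        using mlinD[OF f, of "b ## \<one>\<^sub>H ## \<one>\<^sub>H ## c ## S d ## unit_word" 2] c by simp
      show "linear_map K H Z (\<lambda>v. ?F b c v d)"
        using mlinD[OF f, of "b ## \<one>\<^sub>H ## c ## \<one>\<^sub>H ## S d ## unit_word" 3] c by simp
      have "linear_map K H Z (\<lambda>v. f (b ## \<one>\<^sub>H ## c ## d ## v ## unit_word))"
        using mlinD[OF f, of "b ## \<one>\<^sub>H ## c ## d ## unit_word" 4] c by (simp add: unit_word_upd)
      from linear_map_comp[OF S_lin this] show "linear_map K H Z (\<lambda>v. ?F b c d v)" .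
    qed
    note f4 = mlin_ext[OF m4]
    have "E 1 (E 3 (ev5 (tens5 ?B))) f = sw4 Z chi (\<lambda>a b c d. sw Z (\<Delta> b) (\<lambda>b1 b2.
        f (a ## (\<epsilon> b1 \<odot>\<^bsub>H\<^esub> \<one>\<^sub>H) ## b2 ## (\<epsilon> (S c) \<odot>\<^bsub>H\<^esub> \<one>\<^sub>H) ## S d ## unit_word)))"
      unfolding e[OF f] ev5_tens[OF m B]
      by (subst Z.lsum_bind_terms4)
        (auto simp: lsum_map_terms mlin_closed[OF f] dest!: terms4_carrier[OF chi_closed] dest:
            terms_Delta_carrier simp del: map_map)
    also have "\<dots> = sw4 Z chi (\<lambda>a b c d. ext 4 (\<lambda>x. ?F (x 0) (x (Suc 0)) (x 2) (x 3)) (epsw 2 (a ## b ## c ## d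
        ## unit_word)))"
    proof (rule sw4_cong[OF chi_closed])
      fix a b c d assume c: "a \<in> \<H>" "b \<in> \<H>" "c \<in> \<H>" "d \<in> \<H>"
      let ?r = "(\<epsilon> c \<odot>\<^bsub>H\<^esub> \<one>\<^sub>H) ## S d ## unit_word"
      let ?L = "\<lambda>v. f (a ## \<one>\<^sub>H ## v ## ?r)"
      have L: "linear_map K H Z ?L"
        using mlinD[OF f, of "a ## \<one>\<^sub>H ## \<one>\<^sub>H ## ?r" 2] c by simp
      have "sw Z (\<Delta> b) (\<lambda>b1 b2. f (a ## (\<epsilon> b1 \<odot>\<^bsub>H\<^esub> \<one>\<^sub>H) ## b2 ## (\<epsilon> (S c) \<odot>\<^bsub>H\<^esub> \<one>\<^sub>H) ## S d ## unit_word)) =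
          sw Z (\<Delta> b) (\<lambda>b1 b2. ?L (\<epsilon> b1 \<odot>\<^bsub>H\<^esub> b2))" (is "?lhs = _")
      proof (rule sw_cong[OF mH mH Delta_closed[OF c(2)]])
        fix b1 b2 assume b: "b1 \<in> \<H>" "b2 \<in> \<H>"
        show "f (a ## (\<epsilon> b1 \<odot>\<^bsub>H\<^esub> \<one>\<^sub>H) ## b2 ## (\<epsilon> (S c) \<odot>\<^bsub>H\<^esub> \<one>\<^sub>H) ## S d ## unit_word) = ?L (\<epsilon> b1 \<odot>\<^bsub>H\<^esub> b2)"
          using mlin_smult[OF f, of "a ## \<one>\<^sub>H ## b2 ## ?r" "\<epsilon> b1" "\<one>\<^sub>H" 1] b c
          by (simp add: linear_map_smult[OF L] eps_S)
      qed
      also have "\<dots> = ?L (sw H (\<Delta> b) (\<lambda>b1 b2. \<epsilon> b1 \<odot>\<^bsub>H\<^esub> b2))"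
        using c by (intro linear_map_apply_sw[OF mH mH mH mZ L, symmetric]) auto
      also have "\<dots> = ?L b" using c by (simp add: counit_left_sw)
      finally show "?lhs =           ext 4 (\<lambda>x. ?F (x 0) (x (Suc 0)) (x 2) (x 3)) (epsw 2 (a ## b ## c ## d ##
          unit_word))"
        using c by (simp add: numeral_2_eq_2 ext_unit[OF m4[unfolded numeral_2_eq_2]] unit_beyond)
    qed
    also have "\<dots> = E 2 (ev4 chi) (ext 4 (\<lambda>x. ?F (x 0) (x (Suc 0)) (x 2) (x 3)))"
      unfolding E_eval[OF f4] ev4_eval[OF chi_closed mlin_epsw[OF f4]] ..
    also have "\<dots> = one_M f"
      unfolding E2_chi one_eval[OF f4] one_eval[OF f] by (subst ext_unit[OF m4]) simp_all
    finally show "E 1 (E 3 (ev5 (tens5 ?B))) f = one_M f" .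
  qed (use M5 cl in simp_all)
  have "ev5 (tens5 ?C) = PH"
  proof (rule M_ext)
    fix f assume f: "mlin f"
    show "ev5 (tens5 ?C) f = PH f"
      unfolding ev5_tens[OF f C] lsum_map_terms3 PH_eval[OF f] by simp
  qed (use M5 cl in simp_all)
  then have EC: "E 1 (E 3 (ev5 (tens5 ?C))) = one_M" by simp
  have AB: "tens5 ?A \<otimes>\<^bsub>H5\<^esub> tens5 ?B \<in> carrier H5" by (rule H5.mult_closed[OF cl(1,2)])
  have "ev5 omega = ev5 (tens5 ?A) \<star> ev5 (tens5 ?B) \<star> ev5 (tens5 ?C)"
    unfolding omega_def eval_homD(3)[OF eval_hom5 AB cl(3)] eval_homD(3)[OF eval_hom5 cl(1,2)] ..
  moreover note m = M5[OF cl(1)] M5[OF cl(2)] M5[OF cl(3)]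
  ultimately show ?thesis
    using EA EB EC by (simp only: E_star E_M star_M m star_one one_M)
qed

lemma omega_closed: "omega \<in> carrier H5"
proof -
  have fi: "a \<in> \<H> \<and> b \<in> \<H>" if "(a, b) \<in> set (terms (inv\<^bsub>H2\<^esub> twist_f))" for a b
    using terms_carrier'[OF mH mH twist_f_inv_closed that] by simp
  show ?thesis
    unfolding omega_def
    by (intro H5.mult_closed tens5_closed)
      (auto dest!: fi terms4_carrier[OF chi_closed] terms3_carrier[OF phi_closed] dest: terms_Delta_carrier)
qed

lemma omega_contract:
  assumes f: "mlin f"
  shows "sw5 Z omega (\<lambda>a b c d e. f (a ## (\<epsilon> b \<odot>\<^bsub>H\<^esub> \<one>\<^sub>H) ## c ## (\<epsilon> d \<odot>\<^bsub>H\<^esub> \<one>\<^sub>H) ## e ## unit_word)) = f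
      unit_word" (is "?A = _")
proof -
  have "one_M f = E 1 (E 3 (ev5 omega)) f" by (simp only: omega_counit)
  also have "\<dots> = ?A"
    unfolding E_eval[OF f] E_eval[OF mlin_epsw[OF f]] ev5_eval[OF omega_closed mlin_epsw[OF mlin_epsw[OF f]]]
    by (simp add: numeral_3_eq_3)
  finally show ?thesis by (simp add: one_eval[OF f])
qed

end

section \<open>Two identities for the associator\<close>

context quasi_hopf_val
begin

lemma mlinn5:
  assumes cl: "\<And>a b c d e. \<lbrakk>a \<in> \<H>; b \<in> \<H>; c \<in> \<H>; d \<in> \<H>; e \<in> \<H>\<rbrakk> \<Longrightarrow> F a b c d e \<in> carrier Z"
    and lin: "\<And>b c d e. \<lbrakk>b \<in> \<H>; c \<in> \<H>; d \<in> \<H>; e \<in> \<H>\<rbrakk> \<Longrightarrow> linear_map K H Z (\<lambda>v. F v b c d e)"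
      "\<And>a c d e. \<lbrakk>a \<in> \<H>; c \<in> \<H>; d \<in> \<H>; e \<in> \<H>\<rbrakk> \<Longrightarrow> linear_map K H Z (\<lambda>v. F a v c d e)"
      "\<And>a b d e. \<lbrakk>a \<in> \<H>; b \<in> \<H>; d \<in> \<H>; e \<in> \<H>\<rbrakk> \<Longrightarrow> linear_map K H Z (\<lambda>v. F a b v d e)"
      "\<And>a b c e. \<lbrakk>a \<in> \<H>; b \<in> \<H>; c \<in> \<H>; e \<in> \<H>\<rbrakk> \<Longrightarrow> linear_map K H Z (\<lambda>v. F a b c v e)"
      "\<And>a b c d. \<lbrakk>a \<in> \<H>; b \<in> \<H>; c \<in> \<H>; d \<in> \<H>\<rbrakk> \<Longrightarrow> linear_map K H Z (\<lambda>v. F a b c d v)"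
  shows "mlinn 5 (\<lambda>x. F (x 0) (x (Suc 0)) (x 2) (x 3) (x 4))"
proof (rule mlinnI)
  fix x :: "nat \<Rightarrow> 'h" and i assume x: "x \<in> W"
  { assume "i < (5 :: nat)"
    then consider "i = 0" | "i = 1" | "i = 2" | "i = 3" | "i = 4" by linarith
    then show "linear_map K H Z (\<lambda>a. F ((x(i := a)) 0) ((x(i := a)) (Suc 0)) ((x(i := a)) 2) ((x(i := a)) 3)
        ((x(i := a)) 4))"
      by cases (use x in \<open>simp_all add: lin\<close>) }
qed (simp_all add: cl)

lemma ext5_eval:
  "mlinn 5 C \<Longrightarrow> \<lbrakk>a \<in> \<H>; b \<in> \<H>; c \<in> \<H>; d \<in> \<H>; e \<in> \<H>\<rbrakk> \<Longrightarrow> 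
      ext 5 C (a ## b ## c ## d ## e ## unit_word) = C (a ## b ## c ## d ## e ## unit_word)"
  by (rule ext_unit, assumption, simp) (auto simp: wcons_def split: nat.split)

text \<open>
  The sums over the coaction of the second factor have the shape of \<open>inner_sum\<close>, with
      \<open>X\<close> containing
  the sums over the coaction of the first factor; those then have the shape of \<open>outer_sum\<close>.
\<close>

lemma inner_sum:
  assumes lin: "\<And>b c. b \<in> \<H> \<Longrightarrow> c \<in> \<H> \<Longrightarrow> linear_map K H Z (\<lambda>v. X v b c)"
      "\<And>a c. a \<in> \<H> \<Longrightarrow> c \<in> \<H> \<Longrightarrow> linear_map K H Z (\<lambda>v. X a v c)"
      "\<And>a b. a \<in> \<H> \<Longrightarrow> b \<in> \<H> \<Longrightarrow> linear_map K H Z (\<lambda>v. X a b v)"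
  shows "sw3 Z \<phi> (\<lambda>f1 f2 f3. sw3 Z \<phi>inv (\<lambda>g1 g2 g3. sw Z (\<Delta> g1) (\<lambda>h1 h2. sw Z (\<Delta> (f2 \<cdot> h2)) (\<lambda>q1 q2.
      sw3 Z \<phi> (\<lambda>k1 k2 k3. X (f1 \<cdot> h1) (k1 \<cdot> q1) (S (k2 \<cdot> q2) \<cdot> \<alpha> \<cdot> (k3 \<cdot> f3 \<cdot> g2) \<cdot> \<beta> \<cdot> S g3)))))) =
    sw3 Z \<phi>inv (\<lambda>a b c. X a b (S c))" (is "?A = _")
proof -
  have cl: "X a b c \<in> carrier Z" if "a \<in> \<H>" "b \<in> \<H>" "c \<in> \<H>" for a b c
    using linear_map_closed[OF lin(1)[OF that(2,3)] that(1)] .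
  note lins = linear_map_comp[OF _ lin(1)] linear_map_comp[OF _ lin(2)] linear_map_comp[OF _ lin(3)]
    lin_mult_left lin_mult_right linear_map_comp[OF _ S_lin] linear_map_id m_closed S_closed alpha_closed beta_closed
  \<comment> \<open>Five letters with a zigzag in the last three: \<alpha> between slots 2 and 3,
    \<beta> between 3 and 4. The left side of the claim is the value of
    \<open>U 0 PH \<star> D 1 (PH \<star> D 0 PI)\<close> on its extension.\<close>
  let ?C = "\<lambda>x. X (x 0) (x (Suc 0)) (S (x 2) \<cdot> \<alpha> \<cdot> x 3 \<cdot> \<beta> \<cdot> S (x 4))"
  have m: "mlinn 5 ?C"
    by (rule mlinn5; (intro cl m_closed S_closed alpha_closed beta_closed)?; (intro lins)?; assumption?)
  let ?f = "ext 5 ?C"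
  note f = mlin_ext[OF m]
  have l23: "lcol 2 3 ?f"
    by (rule lcol_ext[OF m], rule lcol_alpha[where L="\<lambda>x v. X (x 0) (x (Suc 0)) (S (x 2) \<cdot> v \<cdot> x 3 \<cdot> \<beta> \<cdot> S (x 4))"])
      (auto simp: S_mult m_assoc intro!: lins)
  have r34: "rcol 3 4 ?f"
    by (rule rcol_ext[OF m], rule rcol_beta[where L="\<lambda>x v. X (x 0) (x (Suc 0)) (S (x 2) \<cdot> \<alpha> \<cdot> x 3 \<cdot> v \<cdot> S (x 4))"])
      (auto simp: S_mult m_assoc intro!: lins)
  let ?k = "\<lambda>y. U 0 PH (\<lambda>z. ?f (wmul z y))"
  have mk: "mlin ?k" by (rule M_param[OF U_M[OF PH_M] mlin_wmul_left[OF f] mlin_wmul_right[OF f]])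
  have PD: "PH \<star> D 0 PI \<in> M" by simp
  have "(U 0 PH \<star> D 1 (PH \<star> D 0 PI)) ?f = D 1 (PH \<star> D 0 PI) ?k"
    unfolding star_eval[OF f]
    by (rule M_fubini[OF U_M[OF PH_M] D_M[OF PD] mlin_wmul_right[OF f] mlin_wmul_left[OF f]])
  also have "\<dots> = (PH \<star> D 0 PI) (\<lambda>x. sw Z (\<Delta> (x 1)) (\<lambda>a b. ?k (spl 1 x a b)))"
    by (rule D_eval[OF mk])
  also have "\<dots> = PH (\<lambda>x. D 0 PI (\<lambda>y. sw Z (\<Delta> (wmul x y 1)) (\<lambda>a b. ?k (spl 1 (wmul x y) a b))))"
    by (rule star_eval[OF mlin_spl[OF mk]])
  also have "\<dots> = sw3 Z \<phi> (\<lambda>f1 f2 f3. D 0 PI (\<lambda>y. sw Z (\<Delta> (wmul (f1 ## f2 ## f3 ## unit_word) y 1))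
      (\<lambda>a b. ?k (spl 1 (wmul (f1 ## f2 ## f3 ## unit_word) y) a b))))"
    by (rule PH_eval[OF mlin_star[OF D_M[OF PI_M] mlin_spl[OF mk]]])
  also have "\<dots> = ?A"
  proof (rule sw3_cong[OF phi_closed])
    fix f1 f2 f3 assume c: "f1 \<in> \<H>" "f2 \<in> \<H>" "f3 \<in> \<H>"
    let ?w = "f1 ## f2 ## f3 ## unit_word"
    have w: "?w \<in> W" using c by simp
    note mw = mlin_wmul_right[OF mlin_spl[OF mk] w]
    have "D 0 PI (\<lambda>y. sw Z (\<Delta> (wmul ?w y 1)) (\<lambda>a b. ?k (spl 1 (wmul ?w y) a b))) =
        sw3 Z \<phi>inv (\<lambda>g1 g2 g3. sw Z (\<Delta> g1) (\<lambda>h1 h2. sw Z (\<Delta> (f2 \<cdot> h2)) (\<lambda>q1 q2.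
          ?k (f1 \<cdot> h1 ## q1 ## q2 ## f3 \<cdot> g2 ## g3 ## unit_word))))" (is "?lhs = _")
      unfolding D_eval[OF mw] PI_eval[OF mlin_spl[OF mw]] using c
      by (intro sw3_cong[OF phi_inv_closed]) (auto intro!: sw_cong[OF mH mH])
    also have "\<dots> = sw3 Z \<phi>inv (\<lambda>g1 g2 g3. sw Z (\<Delta> g1) (\<lambda>h1 h2. sw Z (\<Delta> (f2 \<cdot> h2)) (\<lambda>q1 q2.
        sw3 Z \<phi> (\<lambda>k1 k2 k3. X (f1 \<cdot> h1) (k1 \<cdot> q1) (S (k2 \<cdot> q2) \<cdot> \<alpha> \<cdot> (k3 \<cdot> f3 \<cdot> g2) \<cdot> \<beta> \<cdot> S g3)))))" (is "_ = ?rhs")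
    proof (intro sw3_cong[OF phi_inv_closed] sw_cong[OF mH mH Delta_closed] m_closed; (rule c | assumption)?)
      fix g1 g2 g3 h1 h2 q1 q2
      assume d: "g1 \<in> \<H>" "g2 \<in> \<H>" "g3 \<in> \<H>" "h1 \<in> \<H>" "h2 \<in> \<H>"
        "q1 \<in> \<H>" "q2 \<in> \<H>"
      let ?y = "f1 \<cdot> h1 ## q1 ## q2 ## f3 \<cdot> g2 ## g3 ## unit_word"
      have y: "?y \<in> W" using c d by simp
      note my = mlin_wmul_left[OF f y]
      show "?k ?y = sw3 Z \<phi> (\<lambda>k1 k2 k3. X (f1 \<cdot> h1) (k1 \<cdot> q1) (S (k2 \<cdot> q2) \<cdot> \<alpha> \<cdot> (k3 \<cdot> f3 \<cdot> g2) \<cdot> \<beta> \<cdot> S g3))"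
        unfolding U_eval[OF my] PH_eval[OF mlin_ins[OF my]] using c d
        by (intro sw3_cong[OF phi_closed]) (simp add: ext5_eval[OF m] m_assoc)
    qed
    finally show "?lhs = ?rhs" .
  qed
  finally have L: "(U 0 PH \<star> D 1 (PH \<star> D 0 PI)) ?f = ?A" .
  have n: "PI \<star> D 1 (D 0 PI) = D 0 (D 0 PI) \<star> PI"
  proof -
    have "PI \<star> D 1 (D 0 PI) = PI \<star> (D 1 (D 0 PI) \<star> PH) \<star> PI" by (simp add: star_assoc)
    then show ?thesis unfolding coassoc0[OF PI_M] by (simp add: star_assoc)
  qed
  \<comment> \<open>The rewriting brings coproducts in slots 2 and 3 to the left end, where \<alpha>
    absorbs them, and one in slots 3 and 4 to the right end, where \<beta> absorbs it.\<close>
  have "U 0 PH \<star> D 1 (PH \<star> D 0 PI) = (U 0 PH \<star> D 1 PH) \<star> D 1 (D 0 PI)"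
    by (simp add: D_star star_assoc)
  also have "\<dots> = D 2 PH \<star> D 0 PH \<star> (PI \<star> D 1 (D 0 PI))"
    unfolding pentagon_e by (simp add: star_assoc)
  also have "\<dots> = D 2 PH \<star> D 0 (PH \<star> D 0 PI) \<star> PI"
    unfolding n by (simp add: D_star star_assoc)
  also have "\<dots> = D 2 PH \<star> (D 2 (D 0 PI) \<star> (U 0 (U 0 PI) \<star> D 3 (D 0 PH \<star> PI)))" (is "_ = ?rhs")
    unfolding pentagon_d by (simp add: D_star star_assoc D_D D_U_same)
  finally have e: "U 0 PH \<star> D 1 (PH \<star> D 0 PI) = ?rhs" .
  have E0: "E 2 (D 0 PI) = one_M" by (simp add: E_D_greater)
  have E3: "U 4 (E 3 (D 0 PH \<star> PI)) = PI" by (simp add: E_star E_D_greater)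
  have "(U 0 PH \<star> D 1 (PH \<star> D 0 PI)) ?f = (U 0 (U 0 PI) \<star> D 3 (D 0 PH \<star> PI)) ?f"
    unfolding e
    using left_collapse_one[OF PH_M _ _ f, of 2 "D 2 (D 0 PI) \<star> (U 0 (U 0 PI) \<star> D 3 (D 0 PH \<star> PI))"]
      left_collapse_one[OF _ E0 _ f, of "U 0 (U 0 PI) \<star> D 3 (D 0 PH \<star> PI)"] l23 by simp
  also have "\<dots> = (U 0 (U 0 PI) \<star> PI) ?f"
    using right_collapse[OF _ _ f, of "D 0 PH \<star> PI" "U 0 (U 0 PI)" 3] r34 E3 by simp
  also have "\<dots> = PI (\<lambda>x. PI (\<lambda>y. ?f (wmul (ins 0 (ins 0 y)) x)))"
  proof -
    have g1: "mlin (\<lambda>y. ?f (wmul (ins 0 (ins 0 y)) x))" if "x \<in> W" for x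
      by (rule mlin_ins[OF mlin_ins[OF mlin_wmul_left[OF f that]]])
    have g2: "mlin (\<lambda>x. ?f (wmul (ins 0 (ins 0 y)) x))" if "y \<in> W" for y
      by (rule mlin_wmul_right[OF f]) (simp add: that)
    have mm: "mlin (\<lambda>x. PI (\<lambda>y. ?f (wmul x y)))" by (rule mlin_star[OF PI_M f])
    have "(U 0 (U 0 PI) \<star> PI) ?f = PI (\<lambda>y. PI (\<lambda>x. ?f (wmul (ins 0 (ins 0 y)) x)))"
      unfolding star_eval[OF f] U_eval[OF mm] U_eval[OF mlin_ins[OF mm]] ..
    also have "\<dots> = PI (\<lambda>x. PI (\<lambda>y. ?f (wmul (ins 0 (ins 0 y)) x)))"
      by (rule M_fubini[OF PI_M PI_M g2 g1])
    finally show ?thesis .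
  qed
  also have "\<dots> =
      sw3 Z \<phi>inv (\<lambda>a b c. PI (\<lambda>y. ?f (wmul (ins 0 (ins 0 y)) (a ## b ## c ## unit_word))))"
    by (rule PI_eval, rule M_param[OF PI_M])
      (rule mlin_ins[OF mlin_ins[OF mlin_wmul_left[OF f]]] mlin_wmul_right[OF f]; simp)+
  also have "\<dots> = sw3 Z \<phi>inv (\<lambda>a b c. X a b (S c))"
  proof (rule sw3_cong[OF phi_inv_closed])
    fix a b c assume abc: "a \<in> \<H>" "b \<in> \<H>" "c \<in> \<H>"
    then have x: "a ## b ## c ## unit_word \<in> W" by simp
    note mm = mlin_ins[OF mlin_ins[OF mlin_wmul_left[OF f x]]]
    \<comment> \<open>The copy of the inverse associator in slots 2 to 4 is contracted to 1 behind
      \<open>S c\<close>.\<close>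
    have "PI (\<lambda>y. ?f (wmul (ins 0 (ins 0 y)) (a ## b ## c ## unit_word))) =
        sw3 Z \<phi>inv (\<lambda>g1 g2 g3. X a b (S c \<cdot> (S g1 \<cdot> \<alpha> \<cdot> g2 \<cdot> \<beta> \<cdot> S g3)))" (is "?lhs = _")
      unfolding PI_eval[OF mm] using abc
      by (intro sw3_cong[OF phi_inv_closed]) (simp add: ext5_eval[OF m] S_mult m_assoc)
    also have "\<dots> = X a b (S c)"
      using contract_phi_inv[of "\<lambda>v. X a b (S c \<cdot> v)"] abc
        linear_map_comp[OF lin_mult_right[OF linear_map_id] lin(3)] by simp
    finally show "?lhs = X a b (S c)" .
  qed
  finally show ?thesis using L by simp
qed

end

context quasi_hopf_val
begin

lemma star_eval_swap: "s \<in> M \<Longrightarrow> t \<in> M \<Longrightarrow> mlin f \<Longrightarrow> (s \<star> t) f = t (\<lambda>y. s (\<lambda>x. f (wmul x y)))"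
  unfolding star_eval by (rule M_fubini) (auto intro: mlin_wmul_right mlin_wmul_left)

lemma mlin_star_left: "s \<in> M \<Longrightarrow> mlin f \<Longrightarrow> mlin (\<lambda>y. s (\<lambda>x. f (wmul x y)))"
  by (rule M_param) (auto intro: mlin_wmul_left mlin_wmul_right)

lemma outer_sum:
  assumes lin: "\<And>b c d. \<lbrakk>b \<in> \<H>; c \<in> \<H>; d \<in> \<H>\<rbrakk> \<Longrightarrow> linear_map K H Z (\<lambda>v. T v b c d)"
      "\<And>a c d. \<lbrakk>a \<in> \<H>; c \<in> \<H>; d \<in> \<H>\<rbrakk> \<Longrightarrow> linear_map K H Z (\<lambda>v. T a v c d)"
      "\<And>a b d. \<lbrakk>a \<in> \<H>; b \<in> \<H>; d \<in> \<H>\<rbrakk> \<Longrightarrow> linear_map K H Z (\<lambda>v. T a b v d)"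
      "\<And>a b c. \<lbrakk>a \<in> \<H>; b \<in> \<H>; c \<in> \<H>\<rbrakk> \<Longrightarrow> linear_map K H Z (\<lambda>v. T a b c v)"
  shows "sw3 Z \<phi>inv (\<lambda>a b c. sw Z (\<Delta> b) (\<lambda>s1 s2. sw3 Z \<phi>inv (\<lambda>g1 g2 g3. sw Z (\<Delta> (g1 \<cdot> a)) (\<lambda>p1 p2.
      sw3 Z \<phi> (\<lambda>k1 k2 k3. T (k1 \<cdot> p1) (S (k2 \<cdot> p2) \<cdot> \<alpha> \<cdot> (k3 \<cdot> (g2 \<cdot> s1))) (g3 \<cdot> s2) (S c)))))) =
    sw3 Z \<phi> (\<lambda>f1 f2 f3. sw3 Z \<phi>inv (\<lambda>g1 g2 g3. sw3 Z \<phi>inv (\<lambda>h1 h2 h3. sw Z (\<Delta> h3) (\<lambda>h31 h32. sw Z (\<Delta> h1) (\<lambda>h11 h12.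
      sw3 Z \<phi> (\<lambda>k1 k2 k3. T (g1 \<cdot> (k1 \<cdot> h11)) (S (k2 \<cdot> h12) \<cdot> \<alpha> \<cdot> (k3 \<cdot> h2 \<cdot> f1))
        (g2 \<cdot> h31 \<cdot> f2) (S (g3 \<cdot> h32 \<cdot> f3))))))))" (is "?A = ?B")
proof -
  have cl: "T a b c d \<in> carrier Z" if "a \<in> \<H>" "b \<in> \<H>" "c \<in> \<H>" "d \<in> \<H>" for a b c d
    using linear_map_closed[OF lin(1)[OF that(2-4)] that(1)] .
  note lins = linear_map_comp[OF _ lin(1)] linear_map_comp[OF _ lin(2)] linear_map_comp[OF _ lin(3)]
    linear_map_comp[OF _ lin(4)]
    lin_mult_left lin_mult_right linear_map_comp[OF _ S_lin] linear_map_id m_closed S_closed alpha_closed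
  let ?C = "\<lambda>x. T (x 0) (S (x (Suc 0)) \<cdot> \<alpha> \<cdot> x 2) (x 3) (S (x 4))"
  have m: "mlinn 5 ?C"
    by (rule mlinn5; (intro cl m_closed S_closed alpha_closed)?; (intro lins)?; assumption?)
  let ?f = "ext 5 ?C"
  note f = mlin_ext[OF m]
  have l12: "lcol (Suc 0) (Suc (Suc 0)) ?f"
    by (rule lcol_ext[OF m], rule lcol_alpha[where L="\<lambda>x v. T (x 0) (S (x (Suc 0)) \<cdot> v \<cdot> x 2) (x 3) (S (x 4))"])
      (auto simp: S_mult m_assoc numeral_2_eq_2 intro!: lins)
  let ?k = "\<lambda>y. PH (\<lambda>z. ?f (wmul z y))"
  have k: "mlin ?k" by (rule mlin_star_left[OF PH_M f])
  let ?h = "\<lambda>x. sw Z (\<Delta> (x 0)) (\<lambda>a b. ?k (spl 0 x a b))"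
  have h: "mlin ?h" by (rule mlin_spl[OF k])
  let ?g = "\<lambda>y. PI (\<lambda>x. ?h (wmul x y))"
  have g: "mlin ?g" by (rule mlin_star_left[OF PI_M h])
  have "(PH \<star> D 0 (PI \<star> D 1 PI)) ?f = PI (\<lambda>x. sw Z (\<Delta> (x 1)) (\<lambda>a b. ?g (spl 1 x a b)))"
    by (simp only: star_eval_swap[OF PH_M D_M f] star_M PI_M D_M D_eval[OF k] star_eval_swap[OF PI_M D_M[OF PI_M] h]
        D_eval[OF g])
  also have "\<dots> = ?A" (is "_ = ?rhs")
    unfolding PI_eval[OF mlin_spl[OF g]]
  proof (intro sw3_cong[OF phi_inv_closed], simp, intro sw_cong[OF mH mH Delta_closed], assumption)
    fix a b c s1 s2 assume c: "a \<in> \<H>" "b \<in> \<H>" "c \<in> \<H>" "s1 \<in> \<H>" "s2 \<in> \<H>"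
    let ?y = "a ## s1 ## s2 ## c ## unit_word"
    have y: "?y \<in> W" using c by simp
    show "?g ?y = sw3 Z \<phi>inv (\<lambda>g1 g2 g3. sw Z (\<Delta> (g1 \<cdot> a)) (\<lambda>p1 p2.
      sw3 Z \<phi> (\<lambda>k1 k2 k3. T (k1 \<cdot> p1) (S (k2 \<cdot> p2) \<cdot> \<alpha> \<cdot> (k3 \<cdot> (g2 \<cdot> s1))) (g3 \<cdot> s2) (S c))))"
      unfolding PI_eval[OF mlin_wmul_left[OF h y]]
    proof (intro sw3_cong[OF phi_inv_closed], simp add: c, intro sw_cong[OF mH mH Delta_closed]; (rule
        m_closed[OF _ c(1)])?; (assumption)?)
      fix g1 g2 g3 p1 p2
      assume d: "g1 \<in> \<H>" "g2 \<in> \<H>" "g3 \<in> \<H>" "p1 \<in> \<H>" "p2 \<in> \<H>"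
      let ?z = "p1 ## p2 ## g2 \<cdot> s1 ## g3 \<cdot> s2 ## c ## unit_word"
      have z: "?z \<in> W" using c d by simp
      show "?k ?z = sw3 Z \<phi> (\<lambda>k1 k2 k3. T (k1 \<cdot> p1) (S (k2 \<cdot> p2) \<cdot> \<alpha> \<cdot> (k3 \<cdot> (g2 \<cdot> s1))) (g3 \<cdot> s2) (S c))"
        unfolding PH_eval[OF mlin_wmul_left[OF f z]]
        by (intro sw3_cong[OF phi_closed]) (use c d in \<open>simp add: ext5_eval[OF m]\<close>)
    qed
  qed
  finally have L: "(PH \<star> D 0 (PI \<star> D 1 PI)) ?f = ?rhs" .
  have c0: "D 1 (D 0 PI) \<star> PH = PH \<star> D 0 (D 0 PI)" by (rule coassoc0[OF PI_M])
  let ?R = "PH \<star> D 0 (D 2 PI) \<star> U 0 (U 0 PH)"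
  \<comment> \<open>\<open>pentagon_a\<close> and naturality bring \<open>D (Suc 0) (D 0 PI)\<close>
    to the left end. There \<alpha> absorbs it in slots 1 and 2, which leaves an inverse associator
    in slots 0, 3 and 4: the letters \<open>g1\<close>, \<open>g2\<close>, \<open>g3\<close> of the
    claim.\<close>
  have "PH \<star> D 0 (PI \<star> D 1 PI) = (PH \<star> D 0 (D 0 PI)) \<star> D 0 (D 2 PI) \<star> U 0 (U 0 PH)"
    unfolding pentagon_a by (simp add: D_star star_assoc D_U_same)
  also have "\<dots> = D (Suc 0) (D 0 PI) \<star> ?R"
    unfolding c0[symmetric] by (simp add: star_assoc)
  finally have "(PH \<star> D 0 (PI \<star> D 1 PI)) ?f = (U (Suc (Suc 0)) (E (Suc 0) (D 0 PI)) \<star> ?R) ?f"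
    using left_collapse[OF D_M[OF PI_M] _ f l12, of ?R 0] by simp
  also have "U (Suc (Suc 0)) (E (Suc 0) (D 0 PI)) \<star> ?R = U 2 (U 1 PI) \<star> (PH \<star> D 0 (D 2 PI)) \<star> U 0 (U 0 PH)"
    by (simp add: E_D_right star_assoc numeral_2_eq_2)
  finally have e: "(PH \<star> D 0 (PI \<star> D 1 PI)) ?f = (U 2 (U 1 PI) \<star> (PH \<star> D 0 (D 2 PI)) \<star> U 0 (U 0 PH)) ?f" .
  let ?s = "U 2 (U 1 PI)" and ?t = "D 0 (D 2 PI)"
  have AB: "?s \<in> M" "?t \<in> M" "PH \<star> ?t \<in> M" "?s \<star> (PH \<star> ?t) \<in> M" "U 0 (U 0 PH) \<in> M" "U 0 PH \<in> M" "D 2 PI \<in> M" "U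
      1 PI \<in> M"
    by simp_all
  note mq = mlin_star_left[OF AB(4) f]
  have "(?s \<star> (PH \<star> ?t) \<star> U 0 (U 0 PH)) ?f = PH (\<lambda>y. (?s \<star> (PH \<star> ?t)) (\<lambda>x. ?f (wmul x (ins 0 (ins 0 y)))))"
    unfolding star_eval_swap[OF AB(4,5) f] U_eval[OF mq] U_eval[OF mlin_ins[OF mq]] ..
  also have "\<dots> = sw3 Z \<phi> (\<lambda>f1 f2 f3. (?s \<star> (PH \<star> ?t)) (\<lambda>x. ?f (wmul x (\<one>\<^sub>H ## \<one>\<^sub>H ## f1 ## f2 ## f3 ## unit_word))))"
    unfolding PH_eval[OF mlin_ins[OF mlin_ins[OF mq]]] by simp
  also have "\<dots> = ?B"
  proof (intro sw3_cong[OF phi_closed])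
    fix f1 f2 f3 assume c: "f1 \<in> \<H>" "f2 \<in> \<H>" "f3 \<in> \<H>"
    let ?v = "\<one>\<^sub>H ## \<one>\<^sub>H ## f1 ## f2 ## f3 ## unit_word"
    have v: "?v \<in> W" using c by simp
    note mv = mlin_wmul_left[OF f v]
    note mw = mlin_star[OF AB(3) mv]
    have "(?s \<star> (PH \<star> ?t)) (\<lambda>x. ?f (wmul x ?v)) =
        sw3 Z \<phi>inv (\<lambda>g1 g2 g3. (PH \<star> ?t) (\<lambda>x. ?f (wmul (wmul (g1 ## \<one>\<^sub>H ## \<one>\<^sub>H ## g2 ## g3 ## unit_word) x) ?v)))"
      unfolding star_eval[OF mv] U_eval[OF mw] U_eval[OF mlin_ins[OF mw]] PI_eval[OF mlin_ins[OF mlin_ins[OF mw]]]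
      by (simp add: numeral_2_eq_2)
    also have "\<dots> = sw3 Z \<phi>inv (\<lambda>g1 g2 g3. sw3 Z \<phi>inv (\<lambda>h1 h2 h3. sw Z (\<Delta> h3) (\<lambda>h31 h32. sw Z (\<Delta> h1) (\<lambda>h11 h12.
      sw3 Z \<phi> (\<lambda>k1 k2 k3. T (g1 \<cdot> (k1 \<cdot> h11)) (S (k2 \<cdot> h12) \<cdot> \<alpha> \<cdot> (k3 \<cdot> h2 \<cdot> f1))
        (g2 \<cdot> h31 \<cdot> f2) (S (g3 \<cdot> h32 \<cdot> f3)))))))" (is "_ = ?rhs")
    proof (intro sw3_cong[OF phi_inv_closed])
      fix g1 g2 g3 assume d: "g1 \<in> \<H>" "g2 \<in> \<H>" "g3 \<in> \<H>"
      let ?u = "g1 ## \<one>\<^sub>H ## \<one>\<^sub>H ## g2 ## g3 ## unit_word"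
      have u: "?u \<in> W" using d by simp
      note mu = mlin_wmul_right[OF mv u]
      note mk = mlin_star_left[OF PH_M mu]
      show "(PH \<star> ?t) (\<lambda>x. ?f (wmul (wmul ?u x) ?v)) = sw3 Z \<phi>inv (\<lambda>h1 h2 h3. sw Z (\<Delta> h3) (\<lambda>h31 h32. sw Z (\<Delta>
          h1) (\<lambda>h11 h12.
      sw3 Z \<phi> (\<lambda>k1 k2 k3. T (g1 \<cdot> (k1 \<cdot> h11)) (S (k2 \<cdot> h12) \<cdot> \<alpha> \<cdot> (k3 \<cdot> h2 \<cdot> f1))
        (g2 \<cdot> h31 \<cdot> f2) (S (g3 \<cdot> h32 \<cdot> f3))))))"
        unfolding star_eval_swap[OF PH_M AB(2) mu] D_eval[OF mk] D_eval[OF mlin_spl[OF mk]] PI_eval[OF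
            mlin_spl[OF mlin_spl[OF mk]]]
      proof (intro sw3_cong[OF phi_inv_closed], simp, intro sw_cong[OF mH mH Delta_closed]; (assumption)?)
        fix h1 h2 h3 h31 h32 h11 h12
        assume q: "h1 \<in> \<H>" "h2 \<in> \<H>" "h3 \<in> \<H>" "h31 \<in> \<H>" "h32 \<in> \<H>"
          "h11 \<in> \<H>" "h12 \<in> \<H>"
        let ?y = "h11 ## h12 ## h2 ## h31 ## h32 ## unit_word"
        have y: "?y \<in> W" using q by simp
        show "PH (\<lambda>x. ?f (wmul (wmul ?u (wmul x ?y)) ?v)) = sw3 Z \<phi> (\<lambda>k1 k2 k3. T (g1 \<cdot> (k1 \<cdot> h11))
            (S (k2 \<cdot> h12) \<cdot> \<alpha> \<cdot> (k3 \<cdot> h2 \<cdot> f1)) (g2 \<cdot> h31 \<cdot> f2) (S (g3 \<cdot> h32 \<cdot> f3)))"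
          unfolding PH_eval[OF mlin_wmul_left[OF mu y]]
          by (intro sw3_cong[OF phi_closed]) (use c d q in \<open>simp add: ext5_eval[OF m]\<close>)
      qed
    qed
    finally show "(?s \<star> (PH \<star> ?t)) (\<lambda>x. ?f (wmul x ?v)) = ?rhs" .
  qed
  finally show ?thesis using L e by simp
qed

end

section \<open>Changing the record of a module\<close>

text \<open>The relation behind \<open>tens\<close> reads these four fields of a module record.
  Records such as \<open>R_obj V\<close> and \<open>hm_tensor V W\<close>, which carry further
  fields, can therefore be replaced by bare tensor products.\<close>

definition same_module ::
  "('k, 'v, 'm) module_scheme \<Rightarrow> ('k, 'v, 'n) module_scheme \<Rightarrow> bool"
  where "same_module V V' \<longleftrightarrow>
    carrier V = carrier V' \<and> add V = add V' \<and> zero V = zero V' \<and> smult V = smult V'"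

lemma same_module_sym: "same_module V V' \<Longrightarrow> same_module V' V"
  by (simp add: same_module_def)

lemma same_module_refl [simp]: "same_module V V"
  by (simp add: same_module_def)

lemma tensor_rel_same:
  assumes "same_module V V'" "same_module W W'" "tensor_rel K V W xs ys"
  shows "tensor_rel K V' W' xs ys"
  using assms(3)
proof induction
  case (trans xs ys zs) show ?case by (rule tensor_rel.trans[OF trans.IH])
qed (use assms(1,2) in \<open>auto simp: same_module_def intro: tensor_rel.intros\<close>)

lemma tens_same:
  assumes "same_module V V'" "same_module W W'"
  shows "tens K V W xs = tens K V' W' xs"
  using tensor_rel_same[OF assms] tensor_rel_same[OF assms[THEN same_module_sym]]
  by (auto simp: tens_def)

lemma tensor_same:
  assumes "same_module V V'" "same_module W W'"
  shows "same_module (tensor K V W) (tensor K V' W')"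
  using assms by (auto simp: tens_same[OF assms] tensor_def same_module_def)

lemma linear_map_same:
  assumes "same_module V V'" "same_module W W'"
  shows "linear_map K V W f \<longleftrightarrow> linear_map K V' W' f"
  using assms by (simp add: same_module_def linear_map_def)

context quasi_hopf_sig
begin

lemma R_obj_simps:
  "same_module (R_obj V) (tensor K H V)"
  "h \<rhd>\<^bsub>R_obj V\<^esub> t = tens K H V [(h11 \<cdot> a \<cdot> S h2, h12 \<rhd>\<^bsub>V\<^esub> v).
        (h1, h2) \<leftarrow> terms (\<Delta> h), (h11, h12) \<leftarrow> terms (\<Delta> h1), (a, v) \<leftarrow> terms t]"
  "coact2 (R_obj V) t = tens K H (tensor K H V) [(o1 \<cdot> a1 \<cdot> o5, pure K H V (o2 \<cdot> a2 \<cdot> o4) (o3 \<rhd>\<^bsub>V\<^esub> v)).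
        (o1, o2, o3, o4, o5) \<leftarrow> terms5 omega,
        (a, v) \<leftarrow> terms t, (a1, a2) \<leftarrow> terms (\<Delta> a)]"
  by (simp_all add: R_obj_def same_module_def hmodule.defs module.defs ring.defs yd_module.defs)

lemma hm_tensor_simps:
  "same_module (hm_tensor V W) (tensor K V W)"
  "h \<rhd>\<^bsub>hm_tensor V W\<^esub> t =
    tens K V W [(h1 \<rhd>\<^bsub>V\<^esub> v, h2 \<rhd>\<^bsub>W\<^esub> w). (h1, h2) \<leftarrow> terms (\<Delta> h), (v, w) \<leftarrow> terms t]"
  by (simp_all add: hm_tensor_def same_module_def hmodule.defs module.defs ring.defs)

lemma hm_unit_simps:
  "same_module hm_unit (base_field K)"
  "h \<rhd>\<^bsub>hm_unit\<^esub> c = \<epsilon> h \<otimes>\<^bsub>K\<^esub> c"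
  by (simp_all add: hm_unit_def same_module_def hmodule.defs module.defs ring.defs)

lemma yd_of_coact1_simps:
  "same_module (yd_of_coact1 V d) V"
  "coact2 (yd_of_coact1 V d) = coact2_of_coact1 V d"
  by (simp_all add: yd_of_coact1_def same_module_def hmodule.defs module.defs ring.defs yd_module.defs)

end

section \<open>Formal sums given by list comprehensions\<close>

text \<open>Links a list comprehension to an element written with \<open>sw\<close>. The rules below
  follow the generators of a comprehension one by one, so that unfolding a definition into nested
  sums is a structural proof.\<close>

definition represents ::
  "('k, 'r) ring_scheme \<Rightarrow> ('k, 'v, 'm) module_scheme \<Rightarrow> ('k, 'w, 'n) module_scheme \<Rightarrow>
     ('v \<times> 'w) list \<Rightarrow> ('v, 'w) tens \<Rightarrow> bool"
  where "represents K V W xs t \<longleftrightarrow> set xs \<subseteq> carrier V \<times> carrier W \<and> tens K V W xs = t"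

lemma represents_tens: "represents K V W xs t \<Longrightarrow> tens K V W xs = t"
  by (simp add: represents_def)

lemma represents_map:
  assumes m: "module K V" "module K W" "module K V'" "module K W'" and t: "t \<in> carrier (tensor K V' W')"
    and cl: "\<And>a b. a \<in> carrier V' \<Longrightarrow> b \<in> carrier W' \<Longrightarrow> p a b \<in> carrier V"
      "\<And>a b. a \<in> carrier V' \<Longrightarrow> b \<in> carrier W' \<Longrightarrow> q a b \<in> carrier W"
  shows "represents K V W (map (\<lambda>(a, b). (p a b, q a b)) (terms t))
    (sw (tensor K V W) t (\<lambda>a b. pure K V W (p a b) (q a b)))"
proof -
  have "set (map (\<lambda>(a, b). (p a b, q a b)) (terms t)) \<subseteq> carrier V \<times> carrier W"
    using terms_carrier'[OF m(3,4) t] by (auto intro: cl)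
  then show ?thesis
    by (simp add: represents_def tens_sum[OF m(1,2)] lsum_map_terms del: map_map)
qed

lemma represents_concat:
  assumes m: "module K V" "module K W"
    and r: "\<And>x. x \<in> set xs \<Longrightarrow> represents K V W (g x) (f x)"
  shows "represents K V W (concat (map g xs)) (lsum (tensor K V W) (map f xs))"
proof -
  have "tens K V W (concat (map g xs)) = lsum (tensor K V W) (map (\<lambda>x. tens K V W (g x)) xs)"
    using r by (intro tens_concat[OF m]) (auto simp: represents_def)
  also have "map (\<lambda>x. tens K V W (g x)) xs = map f xs"
    using r by (simp add: represents_def)
  finally show ?thesis using r by (fastforce simp: represents_def)
qed

lemma represents_bind:
  assumes m: "module K V" "module K W" "module K V'" "module K W'" and t: "t \<in> carrier (tensor K V' W')"
    and r: "\<And>a b. a \<in> carrier V' \<Longrightarrow> b \<in> carrier W' \<Longrightarrow> represents K V W (L a b) (F a b)"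
  shows "represents K V W (concat (map (\<lambda>(a, b). L a b) (terms t))) (sw (tensor K V W) t F)"
  unfolding sw_def
  using terms_carrier'[OF m(3,4) t] by (intro represents_concat[OF m(1,2)]) (auto intro: r)

context quasi_hopf
begin

lemma represents_bind3:
  assumes m: "module K V" "module K V'" and t: "t \<in> carrier H3"
    and r: "\<And>a b c. \<lbrakk>a \<in> \<H>; b \<in> \<H>; c \<in> \<H>\<rbrakk> \<Longrightarrow> represents K V V' (L a b c) (F a b c)"
  shows "represents K V V' (concat (map (\<lambda>(a, b, c). L a b c) (terms3 t))) (sw3 (tensor K V V') t F)"
  unfolding sw3_def
  using terms3_carrier[OF t] by (intro represents_concat[OF m]) (auto intro: r)

lemma represents_bind5:
  assumes m: "module K V" "module K V'" and t: "t \<in> carrier H5"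
    and r: "\<And>a b c d e. \<lbrakk>a \<in> \<H>; b \<in> \<H>; c \<in> \<H>; d \<in> \<H>; e \<in> \<H>\<rbrakk> \<Longrightarrow> represents K V V' (L a b c d e) (F a b c d e)"
  shows "represents K V V' (concat (map (\<lambda>(a, b, c, d, e). L a b c d e) (terms5 t))) (sw5 (tensor K V V') t F)"
  unfolding sw5_def
  using terms5_carrier[OF t] by (intro represents_concat[OF m]) (fastforce intro: r)

end

section \<open>The right adjoint on objects\<close>

lemma (in quasi_hopf) omega_carrier: "omega \<in> carrier H5"
  by (rule quasi_hopf_val.omega_closed[OF quasi_hopf_val_H])

locale quasi_hopf_bij = quasi_hopf K H for K :: "'k ring" and H :: "('k, 'h) quasi_hopf" +
  assumes bij_S: "bij_betw S (\<H>) (\<H>)"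
begin

lemma S_inv_closed: "h \<in> \<H> \<Longrightarrow> S_inv h \<in> \<H>"
  and S_S_inv: "h \<in> \<H> \<Longrightarrow> S (S_inv h) = h"
  using bij_S inv_into_into[of h S "\<H>"] f_inv_into_f[of h S "\<H>"]
  by (auto simp: bij_betw_def S_inv_def)

lemma qR_closed: "qR \<in> carrier H2"
  unfolding qR_def by (rule tens_closed) (auto dest!: terms3_carrier[OF phi_closed] intro: S_inv_closed alpha_closed)

text \<open>\<open>S\<close> applied to the second leg of \<open>qR\<close> is
  \<open>S b \<cdot> \<alpha> \<cdot> c\<close>, so the inverse antipode disappears wherever that
  leg is used through \<open>S\<close>, as in the coaction of the first kind and in the final
  formula.\<close>

lemma sw_qR:
  assumes Z: "module K Z" and B: "bilin K H H Z B"
  shows "sw Z qR (\<lambda>a b. B a (S b)) = sw3 Z \<phi> (\<lambda>a b c. B a (S b \<cdot> \<alpha> \<cdot> c))"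
proof -
  have s: "set [(f1, S_inv (\<alpha> \<cdot> f3) \<cdot> f2). (f1, f2, f3) \<leftarrow> terms3 \<phi>] \<subseteq> \<H> \<times> \<H>"
    by (auto dest!: terms3_carrier[OF phi_closed] intro: S_inv_closed alpha_closed)
  have B': "bilin K H H Z (\<lambda>a b. B a (S b))"
    by (intro bilinI linear_map_comp[OF S_lin bilin_right[OF B]] bilin_left[OF B] S_closed)
  have "sw Z qR (\<lambda>a b. B a (S b)) = sw3 Z \<phi> (\<lambda>a b c. B a (S (S_inv (\<alpha> \<cdot> c) \<cdot> b)))"
    using s unfolding qR_def by (subst sw_tens[OF mH mH Z B']) (auto simp: lsum_map_terms3 sw3_def comp_def split_def)
  also have "\<dots> = sw3 Z \<phi> (\<lambda>a b c. B a (S b \<cdot> \<alpha> \<cdot> c))"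
    by (rule sw3_cong[OF phi_closed]) (simp add: S_mult S_S_inv S_inv_closed m_assoc alpha_closed)
  finally show ?thesis .
qed

end

locale quasi_hopf_module = quasi_hopf_bij K H + X: hmodule K H X
  for K :: "'k ring" and H :: "('k, 'h) quasi_hopf" and X :: "('k, 'h, 'x, 'm) hmodule_scheme"
begin

lemma mX [simp]: "module K X" by (rule X.module_axioms)

abbreviation "RX \<equiv> tensor K H X"

lemma mRX [simp]: "module K RX" by (rule tensor_module) simp_all

lemma act_closed [simp]: "h \<in> \<H> \<Longrightarrow> x \<in> carrier X \<Longrightarrow> h \<rhd>\<^bsub>X\<^esub> x \<in> carrier X"
  by (rule X.act_closed)

lemma lin_act_left:
  "linear_map K V H f \<Longrightarrow> x \<in> carrier X \<Longrightarrow> linear_map K V X (\<lambda>u. f u \<rhd>\<^bsub>X\<^esub> x)"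
  by (rule linear_mapI) (simp_all add: linear_map_closed linear_map_add linear_map_smult X.act_add_left
      X.act_smult_left)

lemma lin_act_right:
  "linear_map K V X f \<Longrightarrow> h \<in> \<H> \<Longrightarrow> linear_map K V X (\<lambda>u. h \<rhd>\<^bsub>X\<^esub> f u)"
  by (rule linear_mapI) (simp_all add: linear_map_closed linear_map_add linear_map_smult X.act_add_right
      X.act_smult_right)

lemma lin_Delta:
  "module K Z \<Longrightarrow> linear_map K V H f \<Longrightarrow> bilin K H H Z B \<Longrightarrow> linear_map K V Z (\<lambda>u. sw Z (\<Delta> (f u)) B)"
  by (rule lin_sw[OF mH mH _ linear_map_comp[OF _ Delta_lin]])

lemma lin_S: "linear_map K V H f \<Longrightarrow> linear_map K V H (\<lambda>u. S (f u))"
  by (rule linear_map_comp[OF _ S_lin])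

text \<open>\<open>ract\<close>, \<open>rcoact\<close> and \<open>rcoact1\<close> are the action and
  the two coactions of \<open>R_obj X\<close> as nested sums; see \<open>R_obj_act\<close>,
  \<open>R_obj_coact2\<close> and \<open>R_obj_coact1\<close>.\<close>

definition ract :: "'h \<Rightarrow> ('h, 'x) tens \<Rightarrow> ('h, 'x) tens"
  where "ract h t = sw RX (\<Delta> h) (\<lambda>h1 h2. sw RX (\<Delta> h1) (\<lambda>h11 h12. sw RX t (\<lambda>a v.
    pure K H X (h11 \<cdot> a \<cdot> S h2) (h12 \<rhd>\<^bsub>X\<^esub> v))))"

definition rcoact :: "('h, 'x) tens \<Rightarrow> ('h, ('h, 'x) tens) tens"
  where "rcoact t = sw5 (tensor K H RX) omega (\<lambda>o1 o2 o3 o4 o5. sw (tensor K H RX) t (\<lambda>a v.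
    sw (tensor K H RX) (\<Delta> a) (\<lambda>a1 a2. pure K H RX (o1 \<cdot> a1 \<cdot> o5) (pure K H X (o2 \<cdot> a2 \<cdot> o4) (o3 \<rhd>\<^bsub>X\<^esub> v)))))"

definition rcoact1 :: "('h, 'x) tens \<Rightarrow> ('h, ('h, 'x) tens) tens"
  where "rcoact1 t = sw (tensor K H RX) qR (\<lambda>q1 q2. sw (tensor K H RX) (\<Delta> q1) (\<lambda>q11 q12.
    sw (tensor K H RX) (rcoact t) (\<lambda>m v. pure K H RX (q11 \<cdot> m \<cdot> S q2) (ract q12 v))))"

lemmas X_intros = bilinI lin_Delta lin_sw[OF mH mX] linear_map_sw_param[OF mH mH] linear_map_sw_param[OF mH mX]
  lin_mult_left lin_mult_right lin_act_left lin_act_right lin_S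
  lin_pure_left[OF mH mX] lin_pure_right[OF mH mX] lin_pure_left[OF mH mRX] lin_pure_right[OF mH mRX] linear_map_id
  sw_closed[OF mH mH] sw_closed[OF mH mX] sw_closed[OF mH mRX] pure_closed qR_closed
  m_closed S_closed act_closed Delta_closed mH mX mRX tensor_module

lemma ract_closed [simp]: "h \<in> \<H> \<Longrightarrow> t \<in> carrier RX \<Longrightarrow> ract h t \<in> carrier RX"
  unfolding ract_def by (intro X_intros; assumption)

lemma lin_ract_left: "linear_map K V H f \<Longrightarrow> t \<in> carrier RX \<Longrightarrow> linear_map K V RX (\<lambda>u. ract (f u) t)"
  unfolding ract_def by (intro X_intros; assumption)

lemma lin_ract_right: "linear_map K V RX f \<Longrightarrow> h \<in> \<H> \<Longrightarrow> module K V \<Longrightarrow> linear_map K V RX (\<lambda>u. ract h (f u))"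
  unfolding ract_def by (intro X_intros; assumption)

lemmas X_reps = represents_tens represents_map[OF _ _ mH mH] represents_map[OF _ _ mH mX] represents_map[OF _ _
    mH mRX]
  represents_bind[OF _ _ mH mH] represents_bind[OF _ _ mH mX]
  represents_bind3 represents_bind5

lemma R_obj_act: "h \<in> \<H> \<Longrightarrow> t \<in> carrier RX \<Longrightarrow> h \<rhd>\<^bsub>R_obj X\<^esub> t = ract h t"
  unfolding ract_def R_obj_simps by (intro X_reps X_intros; assumption)

lemma R_obj_coact2: "t \<in> carrier RX \<Longrightarrow> coact2 (R_obj X) t = rcoact t"
  unfolding rcoact_def R_obj_simps by (intro X_reps X_intros omega_carrier; assumption)

lemma linear_map_sw5:
  assumes L: "linear_map K V Y L" and V: "module K V" and Y: "module K Y" and t: "t \<in> carrier H5"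
    and F: "\<And>a b c d e. \<lbrakk>a \<in> \<H>; b \<in> \<H>; c \<in> \<H>; d \<in> \<H>; e \<in> \<H>\<rbrakk> \<Longrightarrow> F a b c d e \<in> carrier V"
  shows "L (sw5 V t F) = sw5 Y t (\<lambda>a b c d e. L (F a b c d e))"
proof -
  have "(case p of (a, b, c, d, e) \<Rightarrow> F a b c d e) \<in> carrier V" if "p \<in> set (terms5 t)" for p
    using F terms5_carrier[OF t] that by (cases p) auto
  from linear_map_lsum[OF L V Y, of "terms5 t" "\<lambda>(a, b, c, d, e). F a b c d e", OF this] show ?thesis
    by (simp add: sw5_def split_def)
qed

lemma linear_map_sw5_param:
  assumes V: "module K V" and Y: "module K Y" and t: "t \<in> carrier H5"
    and F: "\<And>a b c d e. \<lbrakk>a \<in> \<H>; b \<in> \<H>; c \<in> \<H>; d \<in> \<H>; e \<in> \<H>\<rbrakk> \<Longrightarrow> linear_map K V Y (\<lambda>u. F u a b c d e)"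
  shows "linear_map K V Y (\<lambda>u. sw5 Y t (F u))"
proof -
  have "linear_map K V Y (\<lambda>u. case p of (a, b, c, d, e) \<Rightarrow> F u a b c d e)" if "p \<in> set (terms5 t)" for p
    using F terms5_carrier[OF t] that by (cases p) auto
  from linear_map_sum[OF V Y, of "terms5 t" "\<lambda>p u. case p of (a, b, c, d, e) \<Rightarrow> F u a b c d e", OF this] show ?thesis
    by (simp add: sw5_def split_def)
qed

lemma lin_rcoact: "linear_map K RX (tensor K H RX) rcoact"
  unfolding rcoact_def[abs_def]
  by (intro linear_map_sw5_param X_intros omega_carrier; assumption)

lemma rcoact_closed [simp]: "t \<in> carrier RX \<Longrightarrow> rcoact t \<in> carrier (tensor K H RX)"
  by (rule linear_map_closed[OF lin_rcoact])

lemma R_obj_coact1: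
  assumes t: "t \<in> carrier RX" shows "coact1 (R_obj X) t = rcoact1 t"
proof -
  let ?T = "tensor K H RX"
  have cl: "h \<rhd>\<^bsub>R_obj X\<^esub> t \<in> carrier RX" if "h \<in> \<H>" "t \<in> carrier RX" for h t
    using that by (simp add: R_obj_act)
  have "coact1 (R_obj X) t = sw ?T qR (\<lambda>q1 q2. sw ?T (\<Delta> q1) (\<lambda>q11 q12.
      sw ?T (rcoact t) (\<lambda>m v. pure K H RX (q11 \<cdot> m \<cdot> S q2) (q12 \<rhd>\<^bsub>R_obj X\<^esub> v))))"
    unfolding coact1_def tens_same[OF same_module_refl R_obj_simps(1)] R_obj_coact2[OF t]
    by (intro X_reps X_intros rcoact_closed t cl; assumption)
  also have "\<dots> = rcoact1 t"
    unfolding rcoact1_def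
    by (intro sw_cong[OF mH mH] sw_cong[OF mH mRX] qR_closed Delta_closed rcoact_closed t) (simp_all add: R_obj_act)
  finally show ?thesis .
qed

lemma lin_rcoact1: "linear_map K RX (tensor K H RX) rcoact1"
  unfolding rcoact1_def[abs_def]
  by (intro lin_sw[OF mH mRX _ lin_rcoact] lin_ract_left lin_ract_right ract_closed X_intros; assumption)

lemma rcoact1_closed [simp]: "t \<in> carrier RX \<Longrightarrow> rcoact1 t \<in> carrier (tensor K H RX)"
  by (rule linear_map_closed[OF lin_rcoact1])

lemma adj_counit_sw: "adj_counit X t = sw X t (\<lambda>a v. \<epsilon> a \<odot>\<^bsub>X\<^esub> v)"
  by (simp add: adj_counit_def sw_def)

lemma lin_adj_counit: "linear_map K RX X (adj_counit X)"
  unfolding adj_counit_sw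
  by (rule linear_map_sw[OF mH mX mX])
    (intro bilinI lin_smult_left[OF mX eps_lin] linear_map_scale[OF mX mX linear_map_id]; simp)

lemma adj_counit_closed [simp]: "t \<in> carrier RX \<Longrightarrow> adj_counit X t \<in> carrier X"
  by (rule linear_map_closed[OF lin_adj_counit])

lemma adj_counit_pure: "a \<in> \<H> \<Longrightarrow> v \<in> carrier X \<Longrightarrow> adj_counit X (pure K H X a v) = \<epsilon> a \<odot>\<^bsub>X\<^esub> v"
  unfolding adj_counit_sw
  by (rule sw_pure[OF mH mX mX])
    (intro bilinI lin_smult_left[OF mX eps_lin] linear_map_scale[OF mX mX linear_map_id]; simp)+

end

section \<open>Linearity of the counit and multiplicativity of the action on R(X)\<close>

context quasi_hopf_module
begin

lemma smult_left_commute: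
  "\<lbrakk>c \<in> carrier K; d \<in> carrier K; x \<in> carrier X\<rbrakk> \<Longrightarrow> c \<odot>\<^bsub>X\<^esub> (d \<odot>\<^bsub>X\<^esub> x) = d \<odot>\<^bsub>X\<^esub> (c \<odot>\<^bsub>X\<^esub> x)"
  by (simp add: X.smult_assoc1[symmetric] m_comm)

text \<open>The counit turns the factors around \<open>a\<close> into the scalars \<epsilon> of
  \<open>h11\<close> and, by \<open>eps_S\<close>, of \<open>h2\<close>; the two counit axioms then
  rebuild \<open>h\<close> from \<open>h12\<close>.\<close>

lemma adj_counit_ract:
  assumes h: "h \<in> \<H>" and t: "t \<in> carrier RX"
  shows "adj_counit X (ract h t) = h \<rhd>\<^bsub>X\<^esub> adj_counit X t"
proof -
  let ?G = "\<lambda>w. sw X t (\<lambda>a v. \<epsilon> a \<odot>\<^bsub>X\<^esub> (w \<rhd>\<^bsub>X\<^esub> v))"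
  have G: "linear_map K H X ?G"
    by (intro linear_map_sw_param[OF mH mX mH mX t] linear_map_scale[OF mH mX] lin_act_left linear_map_id eps_closed)
  have Gv: "?G w = w \<rhd>\<^bsub>X\<^esub> adj_counit X t" if "w \<in> \<H>" for w
    unfolding adj_counit_sw using that
    by (subst linear_map_apply_sw[OF mH mX mX mX lin_act_right[OF linear_map_id that] t])
      (auto intro!: sw_cong[OF mH mX t] simp: X.act_smult_right)
  have "adj_counit X (ract h t) = sw X (\<Delta> h) (\<lambda>h1 h2. sw X (\<Delta> h1) (\<lambda>h11 h12. sw X t (\<lambda>a v.
      \<epsilon> (h11 \<cdot> a \<cdot> S h2) \<odot>\<^bsub>X\<^esub> (h12 \<rhd>\<^bsub>X\<^esub> v))))"
    unfolding ract_def
    by (subst linear_map_apply_sw[OF mH mH mRX mX lin_adj_counit Delta_closed[OF h]], (intro X_intros t; assumption),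
      rule sw_cong[OF mH mH Delta_closed[OF h]],
      subst linear_map_apply_sw[OF mH mH mRX mX lin_adj_counit Delta_closed], assumption, (intro X_intros t;
          assumption),
      rule sw_cong[OF mH mH Delta_closed], assumption,
      subst linear_map_apply_sw[OF mH mX mRX mX lin_adj_counit t], (intro X_intros t; assumption),
      rule sw_cong[OF mH mX t]) (simp add: adj_counit_pure)
  also have "\<dots> = sw X (\<Delta> h) (\<lambda>h1 h2. sw X (\<Delta> h1) (\<lambda>h11 h12. ?G (\<epsilon> h2 \<odot>\<^bsub>H\<^esub> (\<epsilon> h11 \<odot>\<^bsub>H\<^esub> h12))))"
    by (intro sw_cong[OF mH mH] sw_cong[OF mH mX t] Delta_closed h)
      (simp_all add: eps_mult eps_S X.act_smult_left X.smult_assoc1 smult_left_commute)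
  also have "\<dots> = sw X (\<Delta> h) (\<lambda>h1 h2. ?G (\<epsilon> h2 \<odot>\<^bsub>H\<^esub> h1))"
  proof (intro sw_cong[OF mH mH] Delta_closed h)
    fix h1 h2 assume c: "h1 \<in> \<H>" "h2 \<in> \<H>"
    have "sw X (\<Delta> h1) (\<lambda>h11 h12. ?G (\<epsilon> h2 \<odot>\<^bsub>H\<^esub> (\<epsilon> h11 \<odot>\<^bsub>H\<^esub> h12))) =
        ?G (\<epsilon> h2 \<odot>\<^bsub>H\<^esub> sw H (\<Delta> h1) (\<lambda>h11 h12. \<epsilon> h11 \<odot>\<^bsub>H\<^esub> h12))"
      by (rule linear_map_apply_sw[OF mH mH mH mX linear_map_comp[OF linear_map_scale[OF mH mH linear_map_id]
          G], symmetric])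
        (use c in auto)
    then show "sw X (\<Delta> h1) (\<lambda>h11 h12. ?G (\<epsilon> h2 \<odot>\<^bsub>H\<^esub> (\<epsilon> h11 \<odot>\<^bsub>H\<^esub> h12))) = ?G (\<epsilon> h2 \<odot>\<^bsub>H\<^esub> h1)"
      using c by (simp add: counit_left_sw)
  qed
  also have "\<dots> = ?G (sw H (\<Delta> h) (\<lambda>h1 h2. \<epsilon> h2 \<odot>\<^bsub>H\<^esub> h1))"
    by (rule linear_map_apply_sw[OF mH mH mH mX G, symmetric]) (use h in auto)
  also have "\<dots> = h \<rhd>\<^bsub>X\<^esub> adj_counit X t" using h by (simp add: counit_right_sw Gv)
  finally show ?thesis .
qed

lemma ract_pure:
  assumes "h \<in> \<H>" "a \<in> \<H>" "x \<in> carrier X"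
  shows "ract h (pure K H X a x) = sw RX (\<Delta> h) (\<lambda>h1 h2. sw RX (\<Delta> h1) (\<lambda>h11 h12.
    pure K H X (h11 \<cdot> a \<cdot> S h2) (h12 \<rhd>\<^bsub>X\<^esub> x)))"
  unfolding ract_def using assms
  by (intro sw_cong[OF mH mH] Delta_closed sw_pure[OF mH mX mRX]) ((intro X_intros assms)?; assumption?)+

text \<open>In \<open>R2\<close> each factor is acted on twice, once through the leg of
  \<open>pR\<close> split by \<Delta> and once by the tensor coaction; \<open>R2_pure_QX\<close>
  merges the two actions.\<close>

lemma ract_mult:
  assumes g: "g \<in> \<H>" and h: "h \<in> \<H>" and t: "t \<in> carrier RX"
  shows "ract (g \<cdot> h) t = ract g (ract h t)"
proof (rule tensor_ext[OF mH mX mRX _ _ _ t, of "ract (g \<cdot> h)" "\<lambda>t. ract g (ract h t)"])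
  show "linear_map K RX RX (ract (g \<cdot> h))" "linear_map K RX RX (\<lambda>t. ract g (ract h t))"
    by (intro lin_ract_right X_intros g h)+
  fix a x assume a: "a \<in> \<H>" and x: "x \<in> carrier X"
  note dc = Delta_closed[OF g] Delta_closed[OF h]
  have "ract (g \<cdot> h) (pure K H X a x) = sw RX (\<Delta> g) (\<lambda>g1 g2. sw RX (\<Delta> h) (\<lambda>h1 h2. sw RX (\<Delta> (g1 \<cdot> h1)) (\<lambda>k1 k2.
      pure K H X (k1 \<cdot> a \<cdot> S (g2 \<cdot> h2)) (k2 \<rhd>\<^bsub>X\<^esub> x))))"
    unfolding ract_pure[OF m_closed[OF g h] a x] Delta_mult[OF g h]
    by (rule H2.sw_mult[OF mRX _ dc]) (intro X_intros a x; assumption)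
  also have "\<dots> = sw RX (\<Delta> g) (\<lambda>g1 g2. sw RX (\<Delta> h) (\<lambda>h1 h2. sw RX (\<Delta> g1) (\<lambda>g11 g12. sw RX (\<Delta> h1) (\<lambda>h11 h12.
      pure K H X (g11 \<cdot> h11 \<cdot> a \<cdot> S (g2 \<cdot> h2)) ((g12 \<cdot> h12) \<rhd>\<^bsub>X\<^esub> x)))))"
    by (intro sw_cong[OF mH mH] dc, subst Delta_mult, assumption, assumption)
      (rule H2.sw_mult[OF mRX], (intro X_intros a x; assumption)+)
  also have "\<dots> = sw RX (\<Delta> g) (\<lambda>g1 g2. sw RX (\<Delta> g1) (\<lambda>g11 g12. sw RX (\<Delta> h) (\<lambda>h1 h2. sw RX (\<Delta> h1) (\<lambda>h11 h12.
      pure K H X (g11 \<cdot> h11 \<cdot> a \<cdot> S (g2 \<cdot> h2)) ((g12 \<cdot> h12) \<rhd>\<^bsub>X\<^esub> x)))))"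
    by (intro sw_cong[OF mH mH dc(1)] sw_swap[OF mH mH mH mH mRX dc(2)]) (intro X_intros a x; assumption)+
  also have "\<dots> = sw RX (\<Delta> g) (\<lambda>g1 g2. sw RX (\<Delta> g1) (\<lambda>g11 g12. sw RX (ract h (pure K H X a x)) (\<lambda>b v.
      pure K H X (g11 \<cdot> b \<cdot> S g2) (g12 \<rhd>\<^bsub>X\<^esub> v))))"
  proof (intro sw_cong[OF mH mH] dc Delta_closed; assumption?)
    fix g1 g2 g11 g12 assume c: "g1 \<in> \<H>" "g2 \<in> \<H>" "g11 \<in> \<H>" "g12 \<in> \<H>"
    let ?L = "\<lambda>t. sw RX t (\<lambda>b v. pure K H X (g11 \<cdot> b \<cdot> S g2) (g12 \<rhd>\<^bsub>X\<^esub> v))"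
    have B: "bilin K H X RX (\<lambda>b v. pure K H X (g11 \<cdot> b \<cdot> S g2) (g12 \<rhd>\<^bsub>X\<^esub> v))"
      by (intro X_intros c; assumption)
    note L = linear_map_sw[OF mH mX mRX B]
    show "sw RX (\<Delta> h) (\<lambda>h1 h2. sw RX (\<Delta> h1) (\<lambda>h11 h12.
      pure K H X (g11 \<cdot> h11 \<cdot> a \<cdot> S (g2 \<cdot> h2)) ((g12 \<cdot> h12) \<rhd>\<^bsub>X\<^esub> x))) = ?L (ract h (pure K H X a x))"
      unfolding ract_pure[OF h a x]
      by (subst linear_map_apply_sw[OF mH mH mRX mRX L dc(2)], (intro X_intros a x; assumption),
        rule sw_cong[OF mH mH dc(2)], 
        subst linear_map_apply_sw[OF mH mH mRX mRX L Delta_closed], assumption, (intro X_intros a x; assumption),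
        rule sw_cong[OF mH mH Delta_closed], assumption, subst sw_pure[OF mH mX mRX B])
        (use c a x in \<open>auto simp: m_assoc S_mult X.act_mult\<close>)
  qed
  also have "\<dots> = ract g (ract h (pure K H X a x))" unfolding ract_def[of g] ..
  finally show "ract (g \<cdot> h) (pure K H X a x) = ract g (ract h (pure K H X a x))" .
qed

end

context quasi_hopf_val
begin

lemma sw3_sw_swap:
  assumes m: "module K V" "module K V'" and t: "t \<in> carrier H3" and s: "s \<in> carrier (tensor K V V')"
    and B: "\<And>a b c u v. \<lbrakk>a \<in> \<H>; b \<in> \<H>; c \<in> \<H>; u \<in> carrier V\<rbrakk> \<Longrightarrow> v \<in> carrier V' \<Longrightarrow>
      B a b c u v \<in> carrier Z"
  shows "sw3 Z t (\<lambda>a b c. sw Z s (B a b c)) = sw Z s (\<lambda>u v. sw3 Z t (\<lambda>a b c. B a b c u v))"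
proof -
  have "B (fst p) (fst (snd p)) (snd (snd p)) (fst q) (snd q) \<in> carrier Z"
    if "p \<in> set (terms3 t)" "q \<in> set (terms s)" for p q
    using that terms3_carrier[OF t, of "fst p" "fst (snd p)" "snd (snd p)"] terms_carrier'[OF m s, of "fst q" "snd q"]
    by (intro B) simp_all
  then show ?thesis unfolding sw3_def sw_def split_def by (rule Z.lsum_swap)
qed

lemma sw3_sw3_swap:
  assumes t: "t \<in> carrier H3" and s: "s \<in> carrier H3"
    and B: "\<And>a b c u v w. \<lbrakk>a \<in> \<H>; b \<in> \<H>; c \<in> \<H>; u \<in> \<H>; v \<in> \<H>; w \<in> \<H>\<rbrakk> \<Longrightarrow> B a b c u v w \<in> carrier Z"
  shows "sw3 Z t (\<lambda>a b c. sw3 Z s (B a b c)) = sw3 Z s (\<lambda>u v w. sw3 Z t (\<lambda>a b c. B a b c u v w))"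
proof -
  have "B (fst p) (fst (snd p)) (snd (snd p)) (fst q) (fst (snd q)) (snd (snd q)) \<in> carrier Z"
    if "p \<in> set (terms3 t)" "q \<in> set (terms3 s)" for p q
    using that terms3_carrier[OF t, of "fst p" "fst (snd p)" "snd (snd p)"]
      terms3_carrier[OF s, of "fst q" "fst (snd q)" "snd (snd q)"]
    by (intro B) simp_all
  then show ?thesis unfolding sw3_def split_def by (rule Z.lsum_swap)
qed

end

section \<open>The coactions of R(X) followed by the counit\<close>

locale quasi_hopf_module_val = quasi_hopf_module K H X + quasi_hopf_val K H Z
  for K :: "'k ring" and H :: "('k, 'h) quasi_hopf" and X :: "('k, 'h, 'x, 'm) hmodule_scheme"
    and Z :: "('k, 'z, 'n) module_scheme"
begin

context
  fixes B :: "'h \<Rightarrow> 'x \<Rightarrow> 'z" assumes B: "bilin K H X Z B"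
begin

lemma lin_B_left: "linear_map K V H f \<Longrightarrow> x \<in> carrier X \<Longrightarrow> linear_map K V Z (\<lambda>u. B (f u) x)"
  by (rule linear_map_comp[OF _ bilin_left[OF B]])

lemma lin_B_right: "linear_map K V X f \<Longrightarrow> a \<in> \<H> \<Longrightarrow> linear_map K V Z (\<lambda>u. B a (f u))"
  by (rule linear_map_comp[OF _ bilin_right[OF B]])

lemma B_closed: "a \<in> \<H> \<Longrightarrow> x \<in> carrier X \<Longrightarrow> B a x \<in> carrier Z"
  by (rule bilin_closed[OF B])

lemma bilin_B_counit: "bilin K H RX Z (\<lambda>m v. B m (adj_counit X v))"
  by (intro bilinI lin_B_left lin_B_right lin_adj_counit linear_map_id adj_counit_closed)

text \<open>The counit hits the second leg of the coproduct of \<open>a\<close>, which restores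
  \<open>a\<close>, and reduces \<open>o2\<close> and \<open>o4\<close> to scalars.\<close>

lemma B_counit_sum:
  assumes c: "o1 \<in> \<H>" "o2 \<in> \<H>" "o3 \<in> \<H>" "o4 \<in> \<H>" "o5 \<in> \<H>"
    and a: "a \<in> \<H>" and v: "v \<in> carrier X"
  shows "sw Z (\<Delta> a) (\<lambda>a1 a2. B (o1 \<cdot> a1 \<cdot> o5) (adj_counit X (pure K H X (o2 \<cdot> a2 \<cdot> o4) (o3 \<rhd>\<^bsub>X\<^esub> v)))) =
    \<epsilon> (o2 \<cdot> o4) \<odot>\<^bsub>Z\<^esub> B (o1 \<cdot> a \<cdot> o5) (o3 \<rhd>\<^bsub>X\<^esub> v)" (is "?A = _")
proof -
  let ?L = "\<lambda>w. \<epsilon> (o2 \<cdot> o4) \<odot>\<^bsub>Z\<^esub> B (o1 \<cdot> w \<cdot> o5) (o3 \<rhd>\<^bsub>X\<^esub> v)"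
  have L: "linear_map K H Z ?L"
    by (intro linear_map_scale[OF mH mZ] lin_B_left lin_mult_left lin_mult_right linear_map_id act_closed
        eps_closed m_closed c v)
  have "?A =
      sw Z (\<Delta> a) (\<lambda>a1 a2. ?L (\<epsilon> a2 \<odot>\<^bsub>H\<^esub> a1))"
  proof (rule sw_cong[OF mH mH Delta_closed[OF a]])
    fix a1 a2 assume d: "a1 \<in> \<H>" "a2 \<in> \<H>"
    show "B (o1 \<cdot> a1 \<cdot> o5) (adj_counit X (pure K H X (o2 \<cdot> a2 \<cdot> o4) (o3 \<rhd>\<^bsub>X\<^esub> v))) = ?L (\<epsilon> a2 \<odot>\<^bsub>H\<^esub> a1)"
      unfolding linear_map_smult[OF L eps_closed[OF d(2)] d(1)] using c v d
      by (simp add: adj_counit_pure eps_mult linear_map_smult[OF bilin_right[OF B]] Z.smult_assoc1[symmetric] B_closed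
          m_comm m_lcomm)
  qed
  also have "\<dots> = ?L (sw H (\<Delta> a) (\<lambda>a1 a2. \<epsilon> a2 \<odot>\<^bsub>H\<^esub> a1))"
    by (rule linear_map_apply_sw[OF mH mH mH mZ L, symmetric]) (use a in auto)
  finally show ?thesis using a by (simp add: counit_right_sw)
qed

text \<open>A triangle identity of the adjunction; it removes \<^term>\<open>omega\<close> from the computation.\<close>

lemma coact2_counit:
  assumes t: "t \<in> carrier RX"
  shows "sw Z (rcoact t) (\<lambda>m v. B m (adj_counit X v)) = sw Z t B"
proof -
  let ?B = "\<lambda>m v. B m (adj_counit X v)"
  note L = linear_map_sw[OF mH mRX mZ bilin_B_counit]
  let ?p = "\<lambda>o1 o2 o3 o4 o5 v a1 a2. pure K H RX (o1 \<cdot> a1 \<cdot> o5) (pure K H X (o2 \<cdot> a2 \<cdot> o4) (o3 \<rhd>\<^bsub>X\<^esub> v))"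
  let ?F = "\<lambda>x0 x1 x2 x3 x4. sw Z t (\<lambda>a v. \<epsilon> (x1 \<cdot> x3) \<odot>\<^bsub>Z\<^esub> B (x0 \<cdot> a \<cdot> x4) (x2 \<rhd>\<^bsub>X\<^esub> v))"
  let ?C = "\<lambda>x. ?F (x 0) (x (Suc 0)) (x 2) (x 3) (x 4)"
  have m: "mlinn 5 ?C"
    by (rule mlinn5; (intro sw_closed[OF mH mX mZ t] Z.smult_closed B_closed m_closed act_closed eps_closed)?;
      (intro linear_map_sw_param[OF mH mX mH mZ t] linear_map_scale[OF mH mZ] lin_smult_left[OF mZ
          linear_map_comp[OF _ eps_lin]]
        lin_B_left lin_B_right lin_mult_left lin_mult_right lin_act_left
        m_closed act_closed eps_closed B_closed linear_map_id)?; assumption?)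
  have "sw Z (rcoact t) ?B = sw5 Z omega (\<lambda>o1 o2 o3 o4 o5. sw Z t (\<lambda>a v. sw Z (\<Delta> a) (\<lambda>a1 a2.
      B (o1 \<cdot> a1 \<cdot> o5) (adj_counit X (pure K H X (o2 \<cdot> a2 \<cdot> o4) (o3 \<rhd>\<^bsub>X\<^esub> v))))))"
    unfolding rcoact_def
  proof (rule HOL.trans[OF linear_map_sw5[OF L tensor_module[OF mH mRX] mZ omega_carrier]], (intro X_intros t;
      assumption),
      rule sw5_cong[OF omega_carrier])
    fix o1 o2 o3 o4 o5
    assume c: "o1 \<in> \<H>" "o2 \<in> \<H>" "o3 \<in> \<H>" "o4 \<in> \<H>" "o5 \<in> \<H>"
    show "sw Z (sw (tensor K H RX) t (\<lambda>a v. sw (tensor K H RX) (\<Delta> a) (?p o1 o2 o3 o4 o5 v))) ?B =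
      sw Z t (\<lambda>a v. sw Z (\<Delta> a) (\<lambda>a1 a2. B (o1 \<cdot> a1 \<cdot> o5) (adj_counit X (pure K H X (o2 \<cdot> a2 \<cdot> o4) (o3 \<rhd>\<^bsub>X\<^esub> v)))))"
      by (rule HOL.trans[OF linear_map_apply_sw[OF mH mX tensor_module[OF mH mRX] mZ L t]], (intro X_intros c;
          assumption),
        rule sw_cong[OF mH mX t], rule HOL.trans[OF linear_map_apply_sw[OF mH mH tensor_module[OF mH mRX] mZ L
            Delta_closed]], assumption,
        (intro X_intros c; assumption), rule sw_cong[OF mH mH Delta_closed], assumption,
        rule sw_pure[OF mH mRX mZ bilin_B_counit]) ((intro X_intros c)?; assumption?)+
  qed
  \<comment> \<open>The second and fourth legs now occur only under \<epsilon>, so they may be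
    replaced by scalars times 1, the shape of \<open>omega_contract\<close>.\<close>
  also have "\<dots> = sw5 Z omega (\<lambda>o1 o2 o3 o4 o5. ext 5 ?C (o1 ## (\<epsilon> o2 \<odot>\<^bsub>H\<^esub> \<one>\<^sub>H) ## o3 ## (\<epsilon> o4 \<odot>\<^bsub>H\<^esub> \<one>\<^sub>H) ## o5
      ## unit_word))"
    by (rule sw5_cong[OF omega_carrier]) (simp add: ext5_eval[OF m] B_counit_sum eps_mult cong: sw_cong[OF mH mX t])
  also have "\<dots> = ext 5 ?C unit_word" by (rule omega_contract[OF mlin_ext[OF m]])
  also have "\<dots> = ?C unit_word" by (rule ext_unit[OF m]) simp_all
  also have "\<dots> = sw Z t B"
    by (rule sw_cong[OF mH mX t]) (simp add: B_closed X.act_one)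
  finally show ?thesis .
qed

end

context
  fixes B :: "'h \<Rightarrow> 'x \<Rightarrow> 'z" assumes B: "bilin K H X Z B"
begin

lemmas B_rules = lin_B_left[OF B] lin_B_right[OF B] B_closed[OF B]

text \<open>\<open>H\<close>-linearity pulls the counit through the action in the coaction of the
  first kind; \<open>coact2_counit\<close> then removes \<open>omega\<close> and
  \<open>sw_qR\<close> the inverse antipode.\<close>

lemma coact1_counit:
  assumes t: "t \<in> carrier RX"
  shows "sw Z (rcoact1 t) (\<lambda>m v. B m (adj_counit X v)) =
    sw3 Z \<phi> (\<lambda>k1 k2 k3. sw Z (\<Delta> k1) (\<lambda>c d. sw Z t (\<lambda>a v. B (c \<cdot> a \<cdot> (S k2 \<cdot> \<alpha> \<cdot> k3)) (d \<rhd>\<^bsub>X\<^esub> v))))"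
proof -
  let ?B = "\<lambda>m v. B m (adj_counit X v)" and ?T = "tensor K H RX"
  let ?G = "\<lambda>k w. sw Z (\<Delta> k) (\<lambda>c d. sw Z t (\<lambda>a v. B (c \<cdot> a \<cdot> w) (d \<rhd>\<^bsub>X\<^esub> v)))"
  note L = linear_map_sw[OF mH mRX mZ bilin_B_counit[OF B]] and mT = tensor_module[OF mH mRX]
  have G: "bilin K H H Z ?G"
    by (intro bilinI B_rules lin_Delta[OF mZ] linear_map_sw_param[OF mH mH mH mZ]
      linear_map_sw_param[OF mH mX mH mZ] X_intros t; assumption)
  have "sw Z (rcoact1 t) ?B = sw Z qR (\<lambda>q1 q2. ?G q1 (S q2))"
    unfolding rcoact1_def
  proof (rule HOL.trans[OF linear_map_apply_sw[OF mH mH mT mZ L qR_closed]], (intro X_intros ract_closed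
      rcoact_closed t; assumption),
      rule sw_cong[OF mH mH qR_closed], rule HOL.trans[OF linear_map_apply_sw[OF mH mH mT mZ L Delta_closed]],
          assumption,
      (intro X_intros ract_closed rcoact_closed t; assumption), rule sw_cong[OF mH mH Delta_closed], assumption)
    fix q1 q2 q11 q12 assume q: "q1 \<in> \<H>" "q2 \<in> \<H>" "q11 \<in> \<H>" "q12 \<in> \<H>"
    have b: "bilin K H X Z (\<lambda>m v. B (q11 \<cdot> m \<cdot> S q2) (q12 \<rhd>\<^bsub>X\<^esub> v))"
      by (intro B_rules X_intros q; assumption)
    have "sw Z (sw ?T (rcoact t) (\<lambda>m v. pure K H RX (q11 \<cdot> m \<cdot> S q2) (ract q12 v))) ?B =
        sw Z (rcoact t) (\<lambda>m v. B (q11 \<cdot> m \<cdot> S q2) (q12 \<rhd>\<^bsub>X\<^esub> adj_counit X v))" (is "?lhs = _")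
    proof (rule HOL.trans[OF linear_map_apply_sw[OF mH mRX mT mZ L rcoact_closed[OF t]]], (intro X_intros
        ract_closed q; assumption),
        rule sw_cong[OF mH mRX rcoact_closed[OF t]])
      fix m v assume "m \<in> \<H>" "v \<in> carrier RX"
      then show "sw Z (pure K H RX (q11 \<cdot> m \<cdot> S q2) (ract q12 v)) ?B = B (q11 \<cdot> m \<cdot> S q2) (q12 \<rhd>\<^bsub>X\<^esub> adj_counit X v)"
        using q by (simp add: sw_pure[OF mH mRX mZ bilin_B_counit[OF B]] adj_counit_ract)
    qed
    also have "\<dots> = sw Z t (\<lambda>m v. B (q11 \<cdot> m \<cdot> S q2) (q12 \<rhd>\<^bsub>X\<^esub> v))" (is "_ = ?rhs")
      by (rule coact2_counit[OF b t])
    finally show "?lhs = ?rhs" .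
  qed
  also have "\<dots> = sw3 Z \<phi> (\<lambda>k1 k2 k3. ?G k1 (S k2 \<cdot> \<alpha> \<cdot> k3))" by (rule sw_qR[OF mZ G])
  finally show ?thesis .
qed

text \<open>The action of \<open>p\<close> is merged into the sum over \<phi>: its first leg
  multiplies \<open>k1\<close> under the coproduct, its second leg multiplies \<open>k2\<close>
  under the antipode.\<close>

lemma coact1_counit_ract:
  assumes p: "p \<in> \<H>" and a: "a \<in> \<H>" and x: "x \<in> carrier X"
  shows "sw Z (rcoact1 (ract p (pure K H X a x))) (\<lambda>m v. B m (adj_counit X v)) =
    sw Z (\<Delta> p) (\<lambda>p1 p2. sw3 Z \<phi> (\<lambda>k1 k2 k3. sw Z (\<Delta> (k1 \<cdot> p1)) (\<lambda>c d.
      B (c \<cdot> a \<cdot> (S (k2 \<cdot> p2) \<cdot> \<alpha> \<cdot> k3)) (d \<rhd>\<^bsub>X\<^esub> x))))" (is "?A = ?B")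
proof -
  have t: "ract p (pure K H X a x) \<in> carrier RX" using p a x by (simp add: pure_closed)
  note Dp = Delta_closed[OF p]
  have "?A =
    sw3 Z \<phi> (\<lambda>k1 k2 k3. sw Z (\<Delta> k1) (\<lambda>c d. sw Z (\<Delta> p) (\<lambda>p1 p2. sw Z (\<Delta> p1) (\<lambda>p11 p12.
      B (c \<cdot> (p11 \<cdot> a \<cdot> S p2) \<cdot> (S k2 \<cdot> \<alpha> \<cdot> k3)) (d \<rhd>\<^bsub>X\<^esub> p12 \<rhd>\<^bsub>X\<^esub> x)))))"
    unfolding coact1_counit[OF t]
  proof (intro sw3_cong[OF phi_closed] sw_cong[OF mH mH Delta_closed]; assumption?)
    fix k1 k2 k3 c d
    assume q: "k1 \<in> \<H>" "k2 \<in> \<H>" "k3 \<in> \<H>" "c \<in> \<H>" "d \<in> \<H>"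
    have b: "bilin K H X Z (\<lambda>a v. B (c \<cdot> a \<cdot> (S k2 \<cdot> \<alpha> \<cdot> k3)) (d \<rhd>\<^bsub>X\<^esub> v))"
      by (intro B_rules X_intros alpha_closed q; assumption)
    note L = linear_map_sw[OF mH mX mZ b]
    show "sw Z (ract p (pure K H X a x)) (\<lambda>a v. B (c \<cdot> a \<cdot> (S k2 \<cdot> \<alpha> \<cdot> k3)) (d \<rhd>\<^bsub>X\<^esub> v)) =
      sw Z (\<Delta> p) (\<lambda>p1 p2. sw Z (\<Delta> p1) (\<lambda>p11 p12. B (c \<cdot> (p11 \<cdot> a \<cdot> S p2) \<cdot> (S k2 \<cdot> \<alpha> \<cdot> k3)) (d \<rhd>\<^bsub>X\<^esub> p12 \<rhd>\<^bsub>X\<^esub> x)))"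
      unfolding ract_pure[OF p a x]
      by (rule HOL.trans[OF linear_map_apply_sw[OF mH mH mRX mZ L Dp]], (intro X_intros a x; assumption),
        rule sw_cong[OF mH mH Dp], rule HOL.trans[OF linear_map_apply_sw[OF mH mH mRX mZ L Delta_closed]], assumption,
        (intro X_intros a x; assumption), rule sw_cong[OF mH mH Delta_closed], assumption,
        rule sw_pure[OF mH mX mZ b]) ((intro X_intros a x)?; assumption?)+
  qed
  also have "\<dots> = sw3 Z \<phi> (\<lambda>k1 k2 k3. sw Z (\<Delta> p) (\<lambda>p1 p2. sw Z (\<Delta> k1) (\<lambda>c d. sw Z (\<Delta> p1) (\<lambda>p11 p12.
      B (c \<cdot> (p11 \<cdot> a \<cdot> S p2) \<cdot> (S k2 \<cdot> \<alpha> \<cdot> k3)) (d \<rhd>\<^bsub>X\<^esub> p12 \<rhd>\<^bsub>X\<^esub> x)))))"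
    by (intro sw3_cong[OF phi_closed] sw_swap[OF mH mH mH mH mZ _ Dp] Delta_closed;
      (intro B_rules sw_closed[OF mH mH mZ] X_intros alpha_closed a x)?; assumption)
  also have "\<dots> = sw Z (\<Delta> p) (\<lambda>p1 p2. sw3 Z \<phi> (\<lambda>k1 k2 k3. sw Z (\<Delta> k1) (\<lambda>c d. sw Z (\<Delta> p1) (\<lambda>p11 p12.
      B (c \<cdot> (p11 \<cdot> a \<cdot> S p2) \<cdot> (S k2 \<cdot> \<alpha> \<cdot> k3)) (d \<rhd>\<^bsub>X\<^esub> p12 \<rhd>\<^bsub>X\<^esub> x)))))"
    by (rule sw3_sw_swap[OF mH mH phi_closed Dp]) (intro B_rules sw_closed[OF mH mH mZ] X_intros alpha_closed a
        x; assumption)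
  also have "\<dots> = ?B"
  proof (intro sw3_cong[OF phi_closed] sw_cong[OF mH mH Dp])
    fix p1 p2 k1 k2 k3
    assume q: "p1 \<in> \<H>" "p2 \<in> \<H>" "k1 \<in> \<H>" "k2 \<in> \<H>" "k3 \<in> \<H>"
    have "sw Z (\<Delta> (k1 \<cdot> p1)) (\<lambda>c d. B (c \<cdot> a \<cdot> (S (k2 \<cdot> p2) \<cdot> \<alpha> \<cdot> k3)) (d \<rhd>\<^bsub>X\<^esub> x)) =
        sw Z (\<Delta> k1) (\<lambda>c d. sw Z (\<Delta> p1) (\<lambda>p11 p12. B (c \<cdot> p11 \<cdot> a \<cdot> (S (k2 \<cdot> p2) \<cdot> \<alpha> \<cdot> k3)) ((d \<cdot> p12) \<rhd>\<^bsub>X\<^esub> x)))"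
      unfolding Delta_mult[OF q(3,1)]
      by (rule H2.sw_mult[OF mZ _ Delta_closed[OF q(3)] Delta_closed[OF q(1)]])
        (intro B_rules X_intros alpha_closed q a x; assumption)
    then show "sw Z (\<Delta> k1) (\<lambda>c d. sw Z (\<Delta> p1) (\<lambda>p11 p12.
      B (c \<cdot> (p11 \<cdot> a \<cdot> S p2) \<cdot> (S k2 \<cdot> \<alpha> \<cdot> k3)) (d \<rhd>\<^bsub>X\<^esub> p12 \<rhd>\<^bsub>X\<^esub> x))) =
      sw Z (\<Delta> (k1 \<cdot> p1)) (\<lambda>c d. B (c \<cdot> a \<cdot> (S (k2 \<cdot> p2) \<cdot> \<alpha> \<cdot> k3)) (d \<rhd>\<^bsub>X\<^esub> x))"
      using q a x by (simp add: m_assoc S_mult X.act_mult alpha_closed cong: sw_cong[OF mH mH Delta_closed])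
  qed
  finally show ?thesis .
qed

end

end

section \<open>The lax monoidal structure\<close>

lemma same_module_trans: "same_module V V' \<Longrightarrow> same_module V' V'' \<Longrightarrow> same_module V V''"
  by (simp add: same_module_def)

context quasi_hopf
begin

lemma linear_map_sw3_param:
  assumes V: "module K V" and Y: "module K Y" and t: "t \<in> carrier H3"
    and F: "\<And>a b c. \<lbrakk>a \<in> \<H>; b \<in> \<H>; c \<in> \<H>\<rbrakk> \<Longrightarrow> linear_map K V Y (\<lambda>u. F u a b c)"
  shows "linear_map K V Y (\<lambda>u. sw3 Y t (F u))"
proof -
  have "linear_map K V Y (\<lambda>u. case p of (a, b, c) \<Rightarrow> F u a b c)" if "p \<in> set (terms3 t)" for p
    using F terms3_carrier[OF t] that by (cases p) auto
  from linear_map_sum[OF V Y, of "terms3 t" "\<lambda>p u. case p of (a, b, c) \<Rightarrow> F u a b c", OF this] show ?thesis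
    by (simp add: sw3_def split_def)
qed

end

locale quasi_hopf_module_pair = quasi_hopf_bij K H + X: quasi_hopf_module K H X + Y: quasi_hopf_module K H Y
  for K :: "'k ring" and H :: "('k, 'h) quasi_hopf" and X :: "('k, 'h, 'x) hmodule" and Y :: "('k, 'h, 'y) hmodule"
begin

abbreviation "XY \<equiv> tensor K X Y"
abbreviation "RXY \<equiv> tensor K H XY"
abbreviation "RXRY \<equiv> tensor K X.RX Y.RX"
abbreviation "HRXRY \<equiv> tensor K H RXRY"

lemma pair_modules [simp]: "module K XY" "module K RXY" "module K RXRY" "module K HRXRY"
  by (simp_all add: tensor_module)

lemma sw3_closed':
  assumes "module K Z" "t \<in> carrier H3"
    "\<And>a b c. \<lbrakk>a \<in> \<H>; b \<in> \<H>; c \<in> \<H>\<rbrakk> \<Longrightarrow> F a b c \<in> carrier Z"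
  shows "sw3 Z t F \<in> carrier Z"
proof -
  interpret V: quasi_hopf_val K H Z
    by (intro quasi_hopf_val.intro quasi_hopf_axioms assms)
  show ?thesis by (rule V.sw3_closed[OF assms(2,3)])
qed

lemma X_rcoact1_lin: "linear_map K V X.RX f \<Longrightarrow> linear_map K V (tensor K H X.RX) (\<lambda>u. X.rcoact1 (f u))"
  by (rule linear_map_comp[OF _ X.lin_rcoact1])

lemma Y_rcoact1_lin: "linear_map K V Y.RX f \<Longrightarrow> linear_map K V (tensor K H Y.RX) (\<lambda>u. Y.rcoact1 (f u))"
  by (rule linear_map_comp[OF _ Y.lin_rcoact1])

lemmas pair_lin =
  bilinI X.lin_Delta lin_sw[OF mH X.mRX _ X_rcoact1_lin] lin_sw[OF mH Y.mRX _ Y_rcoact1_lin]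
  lin_sw[OF X.mRX Y.mRX] lin_sw[OF mH pair_modules(3)]
  linear_map_sw_param[OF mH mH] linear_map_sw_param[OF mH X.mRX] linear_map_sw_param[OF mH Y.mRX]
  linear_map_sw_param[OF X.mRX Y.mRX] linear_map_sw_param[OF mH pair_modules(3)] linear_map_sw3_param
  lin_mult_left lin_mult_right X.lin_act_left X.lin_act_right Y.lin_act_left Y.lin_act_right X.lin_S
  X.lin_ract_left X.lin_ract_right Y.lin_ract_left Y.lin_ract_right
  lin_pure_left[OF mH pair_modules(3)] lin_pure_right[OF mH pair_modules(3)]
  lin_pure_left[OF X.mRX Y.mRX] lin_pure_right[OF X.mRX Y.mRX]
  lin_pure_left[OF mH pair_modules(1)] lin_pure_right[OF mH pair_modules(1)]
  lin_pure_left[OF X.mX Y.mX] lin_pure_right[OF X.mX Y.mX]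
  linear_map_id

lemmas pair_closed =
  sw_closed[OF mH mH] sw_closed[OF mH X.mRX] sw_closed[OF mH Y.mRX] sw_closed[OF X.mRX Y.mRX]
  sw_closed[OF mH pair_modules(3)] sw3_closed' pure_closed
  X.ract_closed Y.ract_closed X.rcoact1_closed Y.rcoact1_closed X.act_closed Y.act_closed X.adj_counit_closed
      Y.adj_counit_closed
  m_closed S_closed Delta_closed phi_closed phi_inv_closed pR_closed alpha_closed
  mH X.mX Y.mX X.mRX Y.mRX pair_modules

definition tcoact1 :: "(('h, 'x) tens, ('h, 'y) tens) tens \<Rightarrow> ('h, (('h, 'x) tens, ('h, 'y) tens) tens) tens"
  where "tcoact1 t = sw HRXRY t (\<lambda>v w. sw3 HRXRY \<phi> (\<lambda>f1 f2 f3. sw3 HRXRY \<phi>inv (\<lambda>g1 g2 g3. sw3 HRXRY \<phi> (\<lambda>f1' f2' f3'.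
    sw HRXRY (X.rcoact1 (X.ract (g1 \<cdot> f1') v)) (\<lambda>m v0. sw HRXRY (Y.rcoact1 (Y.ract f2' w)) (\<lambda>n w0.
      pure K H RXRY (f1 \<cdot> m \<cdot> g2 \<cdot> n \<cdot> f3') (pure K X.RX Y.RX (X.ract f2 v0) (Y.ract (f3 \<cdot> g3) w0))))))))"

definition tact :: "'h \<Rightarrow> (('h, 'x) tens, ('h, 'y) tens) tens \<Rightarrow> (('h, 'x) tens, ('h, 'y) tens) tens"
  where "tact h t = sw RXRY (\<Delta> h) (\<lambda>h1 h2. sw RXRY t (\<lambda>v w. pure K X.RX Y.RX (X.ract h1 v) (Y.ract h2 w)))"

definition tcoact2 :: "(('h, 'x) tens, ('h, 'y) tens) tens \<Rightarrow> ('h, (('h, 'x) tens, ('h, 'y) tens) tens) tens"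
  where "tcoact2 t = sw HRXRY pR (\<lambda>p1 p2. sw HRXRY (tcoact1 (tact p1 t)) (\<lambda>m u. pure K H RXRY (m \<cdot> p2) u))"

definition ev :: "(('h, 'x) tens, ('h, 'y) tens) tens \<Rightarrow> ('x, 'y) tens"
  where "ev t = sw XY t (\<lambda>v w. pure K X Y (adj_counit X v) (adj_counit Y w))"

lemma lin_tcoact1: "linear_map K RXRY HRXRY tcoact1"
  unfolding tcoact1_def[abs_def] by (intro pair_lin pair_closed; assumption)

lemma lin_tact: "linear_map K V RXRY f \<Longrightarrow> module K V \<Longrightarrow> h \<in> \<H> \<Longrightarrow> linear_map K V RXRY (\<lambda>u. tact h (f u))"
  unfolding tact_def[abs_def] by (intro pair_lin pair_closed; assumption)

lemma tact_closed: "h \<in> \<H> \<Longrightarrow> t \<in> carrier RXRY \<Longrightarrow> tact h t \<in> carrier RXRY"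
  unfolding tact_def by (intro pair_closed; assumption)

lemma tcoact1_closed: "t \<in> carrier RXRY \<Longrightarrow> tcoact1 t \<in> carrier HRXRY"
  by (rule linear_map_closed[OF lin_tcoact1])

lemma lin_tcoact2: "linear_map K RXRY HRXRY tcoact2"
  unfolding tcoact2_def[abs_def]
  by (intro linear_map_comp[OF _ lin_tcoact1] lin_tact pair_lin pair_closed; assumption)

lemma lin_ev: "linear_map K RXRY XY ev"
  unfolding ev_def[abs_def]
  by (intro linear_map_comp[OF _ X.lin_adj_counit] linear_map_comp[OF _ Y.lin_adj_counit] pair_lin pair_closed;
      assumption)

lemma ev_pure: "v \<in> carrier X.RX \<Longrightarrow> w \<in> carrier Y.RX \<Longrightarrow>
    ev (pure K X.RX Y.RX v w) = pure K X Y (adj_counit X v) (adj_counit Y w)"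
  unfolding ev_def
  by (rule sw_pure[OF X.mRX Y.mRX pair_modules(1)])
    (intro linear_map_comp[OF _ X.lin_adj_counit] linear_map_comp[OF _ Y.lin_adj_counit] pair_lin pair_closed;
        assumption)

lemma lin_out: "p \<in> \<H> \<Longrightarrow> linear_map K HRXRY RXY (\<lambda>s. sw RXY s (\<lambda>m u. pure K H XY (m \<cdot> p) (ev u)))"
  by (intro linear_map_comp[OF _ lin_ev] linear_map_closed[OF lin_ev] pair_lin pair_closed; assumption)

lemma same_modules:
  "same_module (tensor K (R_obj X) (R_obj Y)) RXRY"
  "same_module (hm_tensor (R_obj X) (R_obj Y)) RXRY"
  "same_module (hm_tensor X Y) XY"
  "same_module (yd_tensor (R_obj X) (R_obj Y)) RXRY"
  "same_module (R_obj (hm_tensor X Y)) RXY"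
  unfolding yd_tensor_def
  by (intro tensor_same R_obj_simps hm_tensor_simps yd_of_coact1_simps same_module_refl
      same_module_trans[OF hm_tensor_simps(1)] same_module_trans[OF yd_of_coact1_simps(1)] same_module_trans[OF
          R_obj_simps(1)])+

lemmas tens_simps = tens_same[OF R_obj_simps(1) R_obj_simps(1)]
  tens_same[OF same_module_refl same_modules(1)]
  tens_same[OF same_module_refl same_modules(2)] tens_same[OF same_module_refl same_modules(3)]

lemmas pair_reps = represents_tens
  represents_map[OF _ _ mH mH] represents_map[OF _ _ mH X.mRX] represents_map[OF _ _ mH Y.mRX]
  represents_map[OF _ _ X.mRX Y.mRX] represents_map[OF _ _ mH pair_modules(3)]
  represents_bind[OF _ _ mH mH] represents_bind[OF _ _ mH X.mRX] represents_bind[OF _ _ mH Y.mRX]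
  represents_bind[OF _ _ X.mRX Y.mRX] represents_bind[OF _ _ mH pair_modules(3)] represents_bind3

lemma R_act_closed: "h \<in> \<H> \<Longrightarrow> t \<in> carrier X.RX \<Longrightarrow> h \<rhd>\<^bsub>R_obj X\<^esub> t \<in> carrier X.RX"
  "h \<in> \<H> \<Longrightarrow> t' \<in> carrier Y.RX \<Longrightarrow> h \<rhd>\<^bsub>R_obj Y\<^esub> t' \<in> carrier Y.RX"
  by (simp_all add: X.R_obj_act Y.R_obj_act)

lemma R_coact1_closed: "t \<in> carrier X.RX \<Longrightarrow> coact1 (R_obj X) t \<in> carrier (tensor K H X.RX)"
  "t' \<in> carrier Y.RX \<Longrightarrow> coact1 (R_obj Y) t' \<in> carrier (tensor K H Y.RX)"
  by (simp_all add: X.R_obj_coact1 Y.R_obj_coact1)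

lemma tensor_coact1_eq:
  assumes t: "t \<in> carrier RXRY" shows "tensor_coact1 (R_obj X) (R_obj Y) t = tcoact1 t"
proof -
  have "tensor_coact1 (R_obj X) (R_obj Y) t =
    sw HRXRY t (\<lambda>v w. sw3 HRXRY \<phi> (\<lambda>f1 f2 f3. sw3 HRXRY \<phi>inv (\<lambda>g1 g2 g3. sw3 HRXRY \<phi> (\<lambda>f1' f2' f3'.
      sw HRXRY (coact1 (R_obj X) ((g1 \<cdot> f1') \<rhd>\<^bsub>R_obj X\<^esub> v)) (\<lambda>m v0. sw HRXRY (coact1 (R_obj Y) (f2' \<rhd>\<^bsub>R_obj Y\<^esub>
          w)) (\<lambda>n w0.
        pure K H RXRY (f1 \<cdot> m \<cdot> g2 \<cdot> n \<cdot> f3') (pure K X.RX Y.RX (f2 \<rhd>\<^bsub>R_obj X\<^esub> v0) ((f3 \<cdot> g3) \<rhd>\<^bsub>R_obj Y\<^esub> w0))))))))"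
    unfolding tensor_coact1_def tens_simps
    by (intro pair_reps pair_closed R_act_closed R_coact1_closed t; assumption)
  also have "\<dots> = tcoact1 t"
    unfolding tcoact1_def
    by (intro sw_cong[OF X.mRX Y.mRX t] sw3_cong[OF phi_closed] sw3_cong[OF phi_inv_closed])
      (simp add: X.R_obj_act Y.R_obj_act X.R_obj_coact1 Y.R_obj_coact1,
        intro sw_cong[OF mH X.mRX X.rcoact1_closed[OF X.ract_closed]] sw_cong[OF mH Y.mRX Y.rcoact1_closed[OF
            Y.ract_closed]],
        simp_all add: X.R_obj_act Y.R_obj_act)
  finally show ?thesis .
qed

lemma yd_tensor_coact2:
  assumes t: "t \<in> carrier RXRY" shows "coact2 (yd_tensor (R_obj X) (R_obj Y)) t = tcoact2 t"
proof -
  let ?N = "hm_tensor (R_obj X) (R_obj Y)"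
  have a: "h \<rhd>\<^bsub>?N\<^esub> t = tact h t" if h: "h \<in> \<H>" for h
  proof -
    have "h \<rhd>\<^bsub>?N\<^esub> t = sw RXRY (\<Delta> h) (\<lambda>h1 h2. sw RXRY t (\<lambda>v w.
        pure K X.RX Y.RX (h1 \<rhd>\<^bsub>R_obj X\<^esub> v) (h2 \<rhd>\<^bsub>R_obj Y\<^esub> w)))"
      unfolding hm_tensor_simps tens_simps
      by (intro pair_reps pair_closed R_act_closed t h; assumption)
    also have "\<dots> = tact h t"
      unfolding tact_def
      by (intro sw_cong[OF X.mRX Y.mRX t] sw_cong[OF mH mH Delta_closed[OF h]]) (simp add: X.R_obj_act Y.R_obj_act)
    finally show ?thesis .
  qed
  note c = tensor_coact1_eq[OF tact_closed[OF _ t]]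
  have "coact2 (yd_tensor (R_obj X) (R_obj Y)) t = sw HRXRY pR (\<lambda>p1 p2.
      sw HRXRY (tensor_coact1 (R_obj X) (R_obj Y) (p1 \<rhd>\<^bsub>?N\<^esub> t)) (\<lambda>m u. pure K H RXRY (m \<cdot> p2) u))"
    unfolding yd_tensor_def yd_of_coact1_simps coact2_of_coact1_def tens_simps
    by (intro pair_reps pair_closed; (assumption | simp add: a c tcoact1_closed tact_closed t))
  also have "\<dots> = tcoact2 t"
    unfolding tcoact2_def by (intro sw_cong[OF mH mH pR_closed]) (simp add: a c)
  finally show ?thesis .
qed

lemma R2_eq:
  assumes t: "t \<in> carrier RXRY"
  shows "R2 X Y t = sw RXY (tcoact2 t) (\<lambda>m u. pure K H XY m (ev u))"
proof -
  have ev: "tmap K X Y (adj_counit X) (adj_counit Y) u = ev u" if u: "u \<in> carrier RXRY" for u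
    unfolding tmap_def ev_def by (intro pair_reps pair_closed u; assumption)
  have cl: "tcoact2 t \<in> carrier HRXRY" by (rule linear_map_closed[OF lin_tcoact2 t])
  have "R2 X Y t = sw RXY (tcoact2 t) (\<lambda>m u. pure K H XY m (tmap K X Y (adj_counit X) (adj_counit Y) u))"
    unfolding R2_def o_def adj_unit_def yd_tensor_coact2[OF t] R_map_def tmap_def[of K H] tens_simps
    by (intro pair_reps pair_closed; (assumption | simp add: cl ev linear_map_closed[OF lin_ev]))
  also have "\<dots> = sw RXY (tcoact2 t) (\<lambda>m u. pure K H XY m (ev u))"
    by (intro sw_cong[OF mH _ cl]) (simp_all add: ev)
  finally show ?thesis .
qed

lemma R2_linear: "linear_map K (yd_tensor (R_obj X) (R_obj Y)) (R_obj (hm_tensor X Y)) (R2 X Y)"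
  unfolding linear_map_same[OF same_modules(4,5)]
  by (rule linear_map_cong[OF _ pair_modules(3) R2_eq])
    (intro lin_sw[OF mH pair_modules(3) _ lin_tcoact2] linear_map_comp[OF _ lin_ev] linear_map_closed[OF
        lin_ev] pair_lin pair_closed;
      assumption)

end

context quasi_hopf_module_pair
begin

lemma quasi_hopf_val_RXY: "quasi_hopf_val K H RXY"
  by (intro quasi_hopf_val.intro quasi_hopf_axioms pair_modules)

interpretation T: quasi_hopf_val K H RXY by (rule quasi_hopf_val_RXY)

lemmas counit_lin = linear_map_comp[OF _ X.lin_adj_counit] linear_map_comp[OF _ Y.lin_adj_counit]

text \<open>The counits are \<open>H\<close>-linear, so the actions of \<open>f2\<close> and
  \<open>f3 \<cdot> g3\<close> on the coacted factors become actions on \<open>X\<close> and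
  \<open>Y\<close> themselves.\<close>

lemma out_tcoact1_pure:
  assumes v: "v \<in> carrier X.RX" and w: "w \<in> carrier Y.RX" and p: "p \<in> \<H>"
  shows "sw RXY (tcoact1 (pure K X.RX Y.RX v w)) (\<lambda>m u. pure K H XY (m \<cdot> p) (ev u)) =
    sw3 RXY \<phi> (\<lambda>f1 f2 f3. sw3 RXY \<phi>inv (\<lambda>g1 g2 g3. sw3 RXY \<phi> (\<lambda>f1' f2' f3'.
      sw RXY (X.rcoact1 (X.ract (g1 \<cdot> f1') v)) (\<lambda>m v0. sw RXY (Y.rcoact1 (Y.ract f2' w)) (\<lambda>n w0.
        pure K H XY (f1 \<cdot> m \<cdot> g2 \<cdot> n \<cdot> f3' \<cdot> p) (pure K X Y (f2 \<rhd>\<^bsub>X\<^esub> adj_counit X v0) ((f3 \<cdot> g3) \<rhd>\<^bsub>Y\<^esub>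
            adj_counit Y w0)))))))"
    (is "?lhs = ?rhs")
proof -
  have B: "bilin K H RXRY RXY (\<lambda>m u. pure K H XY (m \<cdot> p) (ev u))"
    by (intro linear_map_comp[OF _ lin_ev] linear_map_closed[OF lin_ev] pair_lin pair_closed p; assumption)
  note L = lin_out[OF p]
  have "tcoact1 (pure K X.RX Y.RX v w) = sw3 HRXRY \<phi> (\<lambda>f1 f2 f3. sw3 HRXRY \<phi>inv (\<lambda>g1 g2 g3. sw3 HRXRY \<phi> (\<lambda>f1' f2' f3'.
    sw HRXRY (X.rcoact1 (X.ract (g1 \<cdot> f1') v)) (\<lambda>m v0. sw HRXRY (Y.rcoact1 (Y.ract f2' w)) (\<lambda>n w0.
      pure K H RXRY (f1 \<cdot> m \<cdot> g2 \<cdot> n \<cdot> f3') (pure K X.RX Y.RX (X.ract f2 v0) (Y.ract (f3 \<cdot> g3) w0)))))))"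
    unfolding tcoact1_def
    by (rule sw_pure[OF X.mRX Y.mRX pair_modules(4) _ v w]) (intro pair_lin pair_closed; assumption)
  then show ?thesis
    apply (simp only:)
    apply (rule HOL.trans[OF linear_map_sw3[OF L pair_modules(4,2) phi_closed]], (intro pair_closed v w; assumption))
    apply (rule sw3_cong[OF phi_closed])
    apply (rule HOL.trans[OF linear_map_sw3[OF L pair_modules(4,2) phi_inv_closed]], (intro pair_closed v w;
        assumption))
    apply (rule sw3_cong[OF phi_inv_closed])
    apply (rule HOL.trans[OF linear_map_sw3[OF L pair_modules(4,2) phi_closed]], (intro pair_closed v w; assumption))
    apply (rule sw3_cong[OF phi_closed])
    apply (rule HOL.trans[OF linear_map_apply_sw[OF mH X.mRX pair_modules(4,2) L X.rcoact1_closed]],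
        (intro pair_closed v w; assumption), (intro pair_closed v w; assumption))
    apply (rule sw_cong[OF mH X.mRX X.rcoact1_closed], (intro pair_closed v w; assumption))
    apply (rule HOL.trans[OF linear_map_apply_sw[OF mH Y.mRX pair_modules(4,2) L Y.rcoact1_closed]],
        (intro pair_closed v w; assumption), (intro pair_closed v w; assumption))
    apply (rule sw_cong[OF mH Y.mRX Y.rcoact1_closed], (intro pair_closed v w; assumption))
    apply (subst sw_pure[OF mH pair_modules(3,2) B], (intro pair_closed; assumption)+)
    apply (simp add: ev_pure X.adj_counit_ract Y.adj_counit_ract)
    done
qed

text \<open>The part of the sum that involves the coaction of the first factor, with the output
  \<open>n\<close>, \<open>w0\<close> of the second coaction as parameters. Isolating it allows the
  second coaction to be evaluated first.\<close>

definition QX :: "'h \<Rightarrow> 'h \<Rightarrow> 'h \<Rightarrow> ('h, 'x) tens \<Rightarrow> 'h \<Rightarrow> 'h \<Rightarrow> 'y \<Rightarrow> ('h, ('x, 'y) tens) tens"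
  where "QX f1 f2 f3 v r n w0 = sw3 RXY \<phi>inv (\<lambda>g1 g2 g3. sw RXY (X.rcoact1 (X.ract (g1 \<cdot> r) v)) (\<lambda>m v0.
    pure K H XY (f1 \<cdot> m \<cdot> g2 \<cdot> n) (pure K X Y (f2 \<rhd>\<^bsub>X\<^esub> adj_counit X v0) ((f3 \<cdot> g3) \<rhd>\<^bsub>Y\<^esub> w0))))"

lemma QX_closed: "\<lbrakk>f1 \<in> \<H>; f2 \<in> \<H>; f3 \<in> \<H>\<rbrakk> \<Longrightarrow> v \<in> carrier X.RX \<Longrightarrow> \<lbrakk>r \<in> \<H>; n \<in> \<H>; w0 \<in> carrier Y\<rbrakk> \<Longrightarrow> 
    QX f1 f2 f3 v r n w0 \<in> carrier RXY"
  unfolding QX_def by (intro pair_closed; assumption)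

lemma lin_QX:
  assumes "f1 \<in> \<H>" "f2 \<in> \<H>" "f3 \<in> \<H>" "v \<in> carrier X.RX"
  shows "linear_map K V H f \<Longrightarrow> module K V \<Longrightarrow> n \<in> \<H> \<Longrightarrow> w0 \<in> carrier Y \<Longrightarrow> linear_map K V RXY (\<lambda>u. QX f1 f2 f3 v (f u) n w0)"
    and "linear_map K V H f \<Longrightarrow> module K V \<Longrightarrow> r \<in> \<H> \<Longrightarrow> w0 \<in> carrier Y \<Longrightarrow> linear_map K V RXY (\<lambda>u. QX f1 f2 f3 v r (f u) w0)"
    and "linear_map K V Y k \<Longrightarrow> module K V \<Longrightarrow> r \<in> \<H> \<Longrightarrow> n \<in> \<H> \<Longrightarrow> linear_map K V RXY (\<lambda>u. QX f1 f2 f3 v r n (k u))"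
  unfolding QX_def by (intro counit_lin pair_lin pair_closed assms; assumption)+

text \<open>Independent sums are reordered until everything depending on \<open>g1\<close>,
  \<open>g2\<close>, \<open>g3\<close> and on the first coaction stands inside \<open>QX\<close>.
  The products \<open>f1' \<cdot> h1\<close> and \<open>f2' \<cdot> h2\<close> arise from merging
  two actions by \<open>ract_mult\<close>.\<close>

lemma R2_pure_QX:
  assumes v: "v \<in> carrier X.RX" and w: "w \<in> carrier Y.RX"
  shows "R2 X Y (pure K X.RX Y.RX v w) =
    sw3 RXY \<phi> (\<lambda>f1 f2 f3. sw3 RXY \<phi> (\<lambda>f1' f2' f3'. sw RXY pR (\<lambda>p1 p2. sw RXY (\<Delta> p1) (\<lambda>h1 h2.
      sw RXY (Y.rcoact1 (Y.ract (f2' \<cdot> h2) w)) (\<lambda>n w0. QX f1 f2 f3 v (f1' \<cdot> h1) (n \<cdot> (f3' \<cdot> p2)) (adj_counit Y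
          w0))))))"
proof -
  let ?P = "\<lambda>f1 f2 f3 g2 g3 f3' p2 m v0 n w0. pure K H XY (f1 \<cdot> m \<cdot> g2 \<cdot> (n \<cdot> (f3' \<cdot> p2)))
    (pure K X Y (f2 \<rhd>\<^bsub>X\<^esub> adj_counit X v0) ((f3 \<cdot> g3) \<rhd>\<^bsub>Y\<^esub> adj_counit Y w0))"
  let ?cY = "\<lambda>f2' h2. Y.rcoact1 (Y.ract (f2' \<cdot> h2) w)" and ?cX = "\<lambda>g1 f1' h1. X.rcoact1 (X.ract (g1 \<cdot> (f1' \<cdot> h1)) v)"
  let ?Q = "\<lambda>f1 f2 f3 f1' f2' f3' p2 h1 h2. sw RXY (?cY f2' h2) (\<lambda>n w0.
    QX f1 f2 f3 v (f1' \<cdot> h1) (n \<cdot> (f3' \<cdot> p2)) (adj_counit Y w0))"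
  have cl: "?Q f1 f2 f3 f1' f2' f3' p2 h1 h2 \<in> carrier RXY"
    if "f1 \<in> \<H>" "f2 \<in> \<H>" "f3 \<in> \<H>" "f1' \<in> \<H>" "f2' \<in> \<H>" "f3' \<in> \<H>"
      "p2 \<in> \<H>" "h1 \<in> \<H>" "h2 \<in> \<H>" for f1 f2 f3 f1' f2' f3' p2 h1 h2
    by (intro QX_closed pair_closed that v w; assumption)
  have tc: "pure K X.RX Y.RX v w \<in> carrier RXRY" by (intro pure_closed v w)
  have L0: "linear_map K HRXRY RXY (\<lambda>s. sw RXY s (\<lambda>m u. pure K H XY m (ev u)))"
    and B0: "bilin K H RXRY RXY (\<lambda>m u. pure K H XY m (ev u))"
    by (intro linear_map_sw[OF mH pair_modules(3,2)] linear_map_comp[OF _ lin_ev] linear_map_closed[OF lin_ev]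
        pair_lin pair_closed; assumption)+
  have "R2 X Y (pure K X.RX Y.RX v w) = sw RXY pR (\<lambda>p1 p2.
      sw RXY (tcoact1 (tact p1 (pure K X.RX Y.RX v w))) (\<lambda>m u. pure K H XY (m \<cdot> p2) (ev u)))"
    unfolding R2_eq[OF tc] tcoact2_def
    apply (rule HOL.trans[OF linear_map_apply_sw[OF mH mH pair_modules(4,2) L0 pR_closed]])
     apply (intro tcoact1_closed tact_closed tc pair_closed; assumption)
    apply (rule sw_cong[OF mH mH pR_closed])
    apply (rule HOL.trans[OF linear_map_apply_sw[OF mH pair_modules(3,4,2) L0 tcoact1_closed[OF tact_closed[OF
        _ tc]]]])
      apply assumption
     apply (intro pair_closed; assumption)
    apply (rule sw_cong[OF mH pair_modules(3) tcoact1_closed[OF tact_closed[OF _ tc]]])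
     apply assumption
    apply (rule sw_pure[OF mH pair_modules(3,2) B0])
     apply (((intro pair_closed)?; assumption)+)
    done
  also have "\<dots> = sw RXY pR (\<lambda>p1 p2. sw RXY (\<Delta> p1) (\<lambda>h1 h2.
      sw RXY (tcoact1 (pure K X.RX Y.RX (X.ract h1 v) (Y.ract h2 w))) (\<lambda>m u. pure K H XY (m \<cdot> p2) (ev u))))"
  proof (rule sw_cong[OF mH mH pR_closed])
    fix p1 p2 assume p: "p1 \<in> \<H>" "p2 \<in> \<H>"
    have e: "tact p1 (pure K X.RX Y.RX v w) = sw RXRY (\<Delta> p1) (\<lambda>h1 h2. pure K X.RX Y.RX (X.ract h1 v) (Y.ract h2 w))"
      unfolding tact_def
      by (intro sw_cong[OF mH mH Delta_closed[OF p(1)]] sw_pure[OF X.mRX Y.mRX pair_modules(3) _ v w])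
        (intro pair_lin pair_closed; assumption)
    show "sw RXY (tcoact1 (tact p1 (pure K X.RX Y.RX v w))) (\<lambda>m u. pure K H XY (m \<cdot> p2) (ev u)) =
      sw RXY (\<Delta> p1) (\<lambda>h1 h2. sw RXY (tcoact1 (pure K X.RX Y.RX (X.ract h1 v) (Y.ract h2 w)))
        (\<lambda>m u. pure K H XY (m \<cdot> p2) (ev u)))"
      unfolding e
      by (rule linear_map_apply_sw[OF mH mH pair_modules(3,2) linear_map_comp[OF lin_tcoact1 lin_out[OF p(2)]]
          Delta_closed[OF p(1)]])
        (intro pair_closed v w; assumption)
  qed
  also have "\<dots> = sw RXY pR (\<lambda>p1 p2. sw RXY (\<Delta> p1) (\<lambda>h1 h2. sw3 RXY \<phi> (\<lambda>f1 f2 f3. sw3 RXY \<phi> (\<lambda>f1' f2' f3'.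
      ?Q f1 f2 f3 f1' f2' f3' p2 h1 h2))))"
  proof (intro sw_cong[OF mH mH pR_closed] sw_cong[OF mH mH Delta_closed], assumption)
    fix p1 p2 h1 h2 assume p: "p1 \<in> \<H>" "p2 \<in> \<H>" "h1 \<in> \<H>" "h2 \<in> \<H>"
    have "sw RXY (tcoact1 (pure K X.RX Y.RX (X.ract h1 v) (Y.ract h2 w))) (\<lambda>m u. pure K H XY (m \<cdot> p2) (ev u)) =
      sw3 RXY \<phi> (\<lambda>f1 f2 f3. sw3 RXY \<phi>inv (\<lambda>g1 g2 g3. sw3 RXY \<phi> (\<lambda>f1' f2' f3'.
        sw RXY (?cX g1 f1' h1) (\<lambda>m v0. sw RXY (?cY f2' h2) (\<lambda>n w0. ?P f1 f2 f3 g2 g3 f3' p2 m v0 n w0)))))" (is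
            "?lhs = _")
      unfolding out_tcoact1_pure[OF X.ract_closed[OF p(3) v] Y.ract_closed[OF p(4) w] p(2)]
      apply (rule sw3_cong[OF phi_closed], rule sw3_cong[OF phi_inv_closed], rule sw3_cong[OF phi_closed])
      apply (subst X.ract_mult[symmetric], (intro m_closed p v; assumption)+)
      apply (subst Y.ract_mult[symmetric], (assumption | rule p w)+)
      apply (simp only: m_assoc m_closed p)
      apply (rule sw_cong[OF mH X.mRX X.rcoact1_closed], (intro pair_closed v p; assumption))
      apply (rule sw_cong[OF mH Y.mRX Y.rcoact1_closed], (intro pair_closed w p; assumption))
      apply (simp add: m_assoc p)
      done
    also have "\<dots> = sw3 RXY \<phi> (\<lambda>f1 f2 f3. sw3 RXY \<phi> (\<lambda>f1' f2' f3'. sw3 RXY \<phi>inv (\<lambda>g1 g2 g3.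
        sw RXY (?cX g1 f1' h1) (\<lambda>m v0. sw RXY (?cY f2' h2) (\<lambda>n w0. ?P f1 f2 f3 g2 g3 f3' p2 m v0 n w0)))))"
      by (intro sw3_cong[OF phi_closed] T.sw3_sw3_swap[OF phi_inv_closed phi_closed]) (intro pair_closed p v w;
          assumption)
    also have "\<dots> = sw3 RXY \<phi> (\<lambda>f1 f2 f3. sw3 RXY \<phi> (\<lambda>f1' f2' f3'. sw3 RXY \<phi>inv (\<lambda>g1 g2 g3.
        sw RXY (?cY f2' h2) (\<lambda>n w0. sw RXY (?cX g1 f1' h1) (\<lambda>m v0. ?P f1 f2 f3 g2 g3 f3' p2 m v0 n w0)))))"
      by (intro sw3_cong[OF phi_closed] sw3_cong[OF phi_inv_closed] sw_swap[OF mH X.mRX mH Y.mRX pair_modules(2)])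
        ((intro pair_closed p v w)?; assumption?)+
    also have "\<dots> = sw3 RXY \<phi> (\<lambda>f1 f2 f3. sw3 RXY \<phi> (\<lambda>f1' f2' f3'. ?Q f1 f2 f3 f1' f2' f3' p2 h1 h2))" (is "_ = ?rhs")
      unfolding QX_def
      by (intro sw3_cong[OF phi_closed] T.sw3_sw_swap[OF mH Y.mRX phi_inv_closed]) ((intro pair_closed p v w)?;
          assumption?)+
    finally show "?lhs = ?rhs" .
  qed
  also have "\<dots> = sw RXY pR (\<lambda>p1 p2. sw3 RXY \<phi> (\<lambda>f1 f2 f3. sw3 RXY \<phi> (\<lambda>f1' f2' f3'. sw RXY (\<Delta> p1) (\<lambda>h1 h2.
      ?Q f1 f2 f3 f1' f2' f3' p2 h1 h2))))"
    apply (rule sw_cong[OF mH mH pR_closed])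
    apply (rule HOL.trans[OF T.sw3_sw_swap[OF mH mH phi_closed Delta_closed, symmetric]], assumption, (intro cl
        pair_closed; assumption))
    apply (rule sw3_cong[OF phi_closed])
    apply (rule T.sw3_sw_swap[OF mH mH phi_closed Delta_closed, symmetric], assumption, (intro cl pair_closed;
        assumption))
    done
  also have "\<dots> = sw3 RXY \<phi> (\<lambda>f1 f2 f3. sw3 RXY \<phi> (\<lambda>f1' f2' f3'. sw RXY pR (\<lambda>p1 p2. sw RXY (\<Delta> p1) (\<lambda>h1 h2.
      ?Q f1 f2 f3 f1' f2' f3' p2 h1 h2))))"
    apply (rule HOL.trans[OF T.sw3_sw_swap[OF mH mH phi_closed pR_closed, symmetric]], (intro cl pair_closed;
        assumption))
    apply (rule sw3_cong[OF phi_closed])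
    apply (rule T.sw3_sw_swap[OF mH mH phi_closed pR_closed, symmetric], (intro cl pair_closed; assumption))
    done
  finally show ?thesis .
qed

end

text \<open>Matches the order of the generators in the final list: the sums over \<open>s\<close>
  and over the double split of \<open>u\<close> are independent of those over \<open>t\<close> and
  \<open>g\<close>, while each split of a leg stays inside its parent.\<close>

lemma (in quasi_hopf_val) sw_reorder:
  assumes c: "s \<in> \<H>" "u \<in> \<H>" "t \<in> carrier H2" "g \<in> \<H>"
    and F: "\<And>s1 s2 u2 q2 g1 g2 q11 q12 u11 u12. \<lbrakk>s1 \<in> \<H>; s2 \<in> \<H>; u2 \<in> \<H>; q2 \<in> \<H>; g1 \<in> \<H>; g2 \<in> \<H>; q11 \<in> \<H>; q12 \<in>
        \<H>; u11 \<in> \<H>; u12 \<in> \<H>\<rbrakk> \<Longrightarrow> F s1 s2 u2 q2 g1 g2 q11 q12 u11 u12 \<in> carrier Z"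
  shows "sw Z (\<Delta> s) (\<lambda>s1 s2. sw Z (\<Delta> u) (\<lambda>u1 u2. sw Z t (\<lambda>q1 q2. sw Z (\<Delta> g) (\<lambda>g1 g2. sw Z (\<Delta> q1) (\<lambda>q11 q12.
      sw Z (\<Delta> u1) (F s1 s2 u2 q2 g1 g2 q11 q12)))))) =
    sw Z t (\<lambda>q1 q2. sw Z (\<Delta> g) (\<lambda>g1 g2. sw Z (\<Delta> q1) (\<lambda>q11 q12. sw Z (\<Delta> u) (\<lambda>u1 u2. sw Z (\<Delta> u1) (\<lambda>u11 u12.
      sw Z (\<Delta> s) (\<lambda>s1 s2. F s1 s2 u2 q2 g1 g2 q11 q12 u11 u12))))))" (is "?A = ?B")
proof -
  note swp = HOL.trans[OF sw_swap[OF mH mH mH mH mZ]] and cl = F sw_closed[OF mH mH mZ] Delta_closed c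
    and cg = sw_cong[OF mH mH Delta_closed]
  have "?A =
    sw Z (\<Delta> s) (\<lambda>s1 s2. sw Z t (\<lambda>q1 q2. sw Z (\<Delta> g) (\<lambda>g1 g2. sw Z (\<Delta> q1) (\<lambda>q11 q12. sw Z (\<Delta> u) (\<lambda>u1 u2.
      sw Z (\<Delta> u1) (F s1 s2 u2 q2 g1 g2 q11 q12))))))"
    apply (rule cg[OF c(1)])
    apply (rule swp[OF Delta_closed[OF c(2)] c(3)], (intro cl; assumption), rule sw_cong[OF mH mH c(3)])
    apply (rule swp[OF Delta_closed[OF c(2)] Delta_closed[OF c(4)]], (intro cl; assumption), rule cg[OF c(4)])
    apply (rule sw_swap[OF mH mH mH mH mZ Delta_closed[OF c(2)] Delta_closed], assumption, (intro cl; assumption))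
    done
  also have "\<dots> = ?B"
    apply (rule swp[OF Delta_closed[OF c(1)] c(3)], (intro cl; assumption), rule sw_cong[OF mH mH c(3)])
    apply (rule swp[OF Delta_closed[OF c(1)] Delta_closed[OF c(4)]], (intro cl; assumption), rule cg[OF c(4)])
    apply (rule swp[OF Delta_closed[OF c(1)] Delta_closed], assumption, (intro cl; assumption), rule cg, assumption)
    apply (rule swp[OF Delta_closed[OF c(1)] Delta_closed[OF c(2)]], (intro cl; assumption), rule cg[OF c(2)])
    apply (rule sw_swap[OF mH mH mH mH mZ Delta_closed[OF c(1)] Delta_closed], assumption, (intro cl; assumption))
    done
  finally show ?thesis .
qed

section \<open>Contraction of the associators around the two arguments\<close>

context quasi_hopf_module_pair
begin

interpretation T: quasi_hopf_val K H RXY by (rule quasi_hopf_val_RXY)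

lemma module_val_X: "quasi_hopf_module_val K H X RXY" and module_val_Y: "quasi_hopf_module_val K H Y RXY"
  by (intro quasi_hopf_module_val.intro quasi_hopf_val_RXY X.quasi_hopf_module_axioms Y.quasi_hopf_module_axioms)+

lemmas coact1_counit_X = quasi_hopf_module_val.coact1_counit_ract[OF module_val_X]
lemmas coact1_counit_Y = quasi_hopf_module_val.coact1_counit_ract[OF module_val_Y]

context
  fixes a b :: 'h and x :: 'x and y :: 'y
  assumes a: "a \<in> \<H>" and b: "b \<in> \<H>" and x: "x \<in> carrier X" and y: "y \<in> carrier Y"
begin

text \<open>Summand of the formula with \<open>f1\<close>, \<open>f2\<close>, \<open>f3\<close>
  fixed: \<open>z1\<close> acts on \<open>a\<close> and \<open>x\<close> together, \<open>z2\<close>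
  stands between \<open>a\<close> and \<open>b\<close>, \<open>z3\<close> acts on \<open>y\<close>,
  \<open>z4\<close> closes the product. It is the function \<open>T\<close> of
  \<open>outer_sum\<close>, as \<open>XF\<close> is the function \<open>X\<close> of
  \<open>inner_sum\<close>.\<close>

definition TF :: "'h \<Rightarrow> 'h \<Rightarrow> 'h \<Rightarrow> 'h \<Rightarrow> 'h \<Rightarrow> 'h \<Rightarrow> 'h \<Rightarrow> ('h, ('x, 'y) tens) tens"
  where "TF f1 f2 f3 z1 z2 z3 z4 = sw RXY (\<Delta> z1) (\<lambda>c d.
    pure K H XY (f1 \<cdot> c \<cdot> a \<cdot> z2 \<cdot> b \<cdot> z4) (pure K X Y ((f2 \<cdot> d) \<rhd>\<^bsub>X\<^esub> x) ((f3 \<cdot> z3) \<rhd>\<^bsub>Y\<^esub> y)))"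

definition XF :: "'h \<Rightarrow> 'h \<Rightarrow> 'h \<Rightarrow> 'h \<Rightarrow> 'h \<Rightarrow> 'h \<Rightarrow> ('h, ('x, 'y) tens) tens"
  where "XF f1 f2 f3 r s u = sw RXY (\<Delta> s) (\<lambda>c d. QX f1 f2 f3 (pure K H X a x) r (c \<cdot> b \<cdot> u) (d \<rhd>\<^bsub>Y\<^esub> y))"

lemma pure_RX: "pure K H X a x \<in> carrier X.RX" "pure K H Y b y \<in> carrier Y.RX"
  by (intro pure_closed a b x y)+

lemma lin_TF:
  assumes "f1 \<in> \<H>" "f2 \<in> \<H>" "f3 \<in> \<H>"
  shows "linear_map K V H f \<Longrightarrow> \<lbrakk>z2 \<in> \<H>; z3 \<in> \<H>; z4 \<in> \<H>\<rbrakk> \<Longrightarrow> linear_map K V RXY (\<lambda>v. TF f1 f2 f3 (f v) z2 z3 z4)"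
    and "linear_map K V H f \<Longrightarrow> module K V \<Longrightarrow> \<lbrakk>z1 \<in> \<H>; z3 \<in> \<H>; z4 \<in> \<H>\<rbrakk> \<Longrightarrow>
        linear_map K V RXY (\<lambda>v. TF f1 f2 f3 z1 (f v) z3 z4)"
    and "linear_map K V H f \<Longrightarrow> module K V \<Longrightarrow> \<lbrakk>z1 \<in> \<H>; z2 \<in> \<H>; z4 \<in> \<H>\<rbrakk> \<Longrightarrow>
        linear_map K V RXY (\<lambda>v. TF f1 f2 f3 z1 z2 (f v) z4)"
    and "linear_map K V H f \<Longrightarrow> module K V \<Longrightarrow> \<lbrakk>z1 \<in> \<H>; z2 \<in> \<H>; z3 \<in> \<H>\<rbrakk> \<Longrightarrow>
        linear_map K V RXY (\<lambda>v. TF f1 f2 f3 z1 z2 z3 (f v))"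
  unfolding TF_def by (intro pair_lin pair_closed assms a b x y; assumption)+

lemma lin_XF:
  assumes "f1 \<in> \<H>" "f2 \<in> \<H>" "f3 \<in> \<H>"
  shows "linear_map K V H f \<Longrightarrow> module K V \<Longrightarrow> s \<in> \<H> \<Longrightarrow> u \<in> \<H> \<Longrightarrow> linear_map K V RXY (\<lambda>v. XF f1 f2 f3 (f v) s u)"
    and "linear_map K V H f \<Longrightarrow> r \<in> \<H> \<Longrightarrow> u \<in> \<H> \<Longrightarrow> linear_map K V RXY (\<lambda>v. XF f1 f2 f3 r (f v) u)"
    and "linear_map K V H f \<Longrightarrow> module K V \<Longrightarrow> r \<in> \<H> \<Longrightarrow> s \<in> \<H> \<Longrightarrow> linear_map K V RXY (\<lambda>v. XF f1 f2 f3 r s (f v))"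
  unfolding XF_def by (intro lin_QX QX_closed pair_lin pair_closed assms pure_RX b y; assumption)+

text \<open>Evaluating the first coaction by \<open>coact1_counit_X\<close> inside \<open>XF\<close>
  produces the summand on the left of \<open>outer_sum\<close>.\<close>

lemma XF_eq:
  assumes f: "f1 \<in> \<H>" "f2 \<in> \<H>" "f3 \<in> \<H>"
    and r: "r \<in> \<H>" and s: "s \<in> \<H>" and u: "u \<in> \<H>"
  shows "XF f1 f2 f3 r s u = sw RXY (\<Delta> s) (\<lambda>s1 s2. sw3 RXY \<phi>inv (\<lambda>g1 g2 g3. sw RXY (\<Delta> (g1 \<cdot> r)) (\<lambda>p1 p2.
      sw3 RXY \<phi> (\<lambda>k1 k2 k3. TF f1 f2 f3 (k1 \<cdot> p1) (S (k2 \<cdot> p2) \<cdot> \<alpha> \<cdot> (k3 \<cdot> (g2 \<cdot> s1))) (g3 \<cdot> s2) u))))"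
  unfolding XF_def QX_def
proof (intro sw_cong[OF mH mH Delta_closed[OF s]] sw3_cong[OF phi_inv_closed])
  fix s1 s2 g1 g2 g3
  assume c: "s1 \<in> \<H>" "s2 \<in> \<H>" "g1 \<in> \<H>" "g2 \<in> \<H>" "g3 \<in> \<H>"
  have B: "bilin K H X RXY (\<lambda>m v0. pure K H XY (f1 \<cdot> m \<cdot> g2 \<cdot> (s1 \<cdot> b \<cdot> u))
      (pure K X Y (f2 \<rhd>\<^bsub>X\<^esub> v0) ((f3 \<cdot> g3) \<rhd>\<^bsub>Y\<^esub> (s2 \<rhd>\<^bsub>Y\<^esub> y))))"
    by (intro pair_lin pair_closed f c b y u; assumption)
  note ca = c f r u a b x y alpha_closed
  show "sw RXY (X.rcoact1 (X.ract (g1 \<cdot> r) (pure K H X a x))) (\<lambda>m v0. pure K H XY (f1 \<cdot> m \<cdot> g2 \<cdot> (s1 \<cdot> b \<cdot> u))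
      (pure K X Y (f2 \<rhd>\<^bsub>X\<^esub> adj_counit X v0) ((f3 \<cdot> g3) \<rhd>\<^bsub>Y\<^esub> (s2 \<rhd>\<^bsub>Y\<^esub> y)))) =
    sw RXY (\<Delta> (g1 \<cdot> r)) (\<lambda>p1 p2. sw3 RXY \<phi> (\<lambda>k1 k2 k3.
      TF f1 f2 f3 (k1 \<cdot> p1) (S (k2 \<cdot> p2) \<cdot> \<alpha> \<cdot> (k3 \<cdot> (g2 \<cdot> s1))) (g3 \<cdot> s2) u))"
    unfolding coact1_counit_X[OF B m_closed[OF c(3) r] a x] TF_def
    by (intro sw_cong[OF mH mH Delta_closed] sw3_cong[OF phi_closed] m_closed c r; assumption?)
      (simp add: ca m_assoc X.X.act_mult Y.X.act_mult)
qed

lemma R2_pure_TF: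
  "R2 X Y (pure K X.RX Y.RX (pure K H X a x) (pure K H Y b y)) =
    sw3 RXY \<phi> (\<lambda>f1 f2 f3. sw3 RXY \<phi> (\<lambda>f1' f2' f3'. sw3 RXY \<phi>inv (\<lambda>g1 g2 g3. sw3 RXY \<phi>inv (\<lambda>h1 h2 h3.
      sw RXY (\<Delta> h3) (\<lambda>h31 h32. sw RXY (\<Delta> h1) (\<lambda>h11 h12. sw3 RXY \<phi> (\<lambda>k1 k2 k3.
        TF f1 f2 f3 (g1 \<cdot> (k1 \<cdot> h11)) (S (k2 \<cdot> h12) \<cdot> \<alpha> \<cdot> (k3 \<cdot> h2 \<cdot> f1')) (g2 \<cdot> h31 \<cdot> f2') (S (g3 \<cdot> h32 \<cdot>
            f3')))))))))"
  unfolding R2_pure_QX[OF pure_RX]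
proof (rule sw3_cong[OF phi_closed])
  fix f1 f2 f3 assume f: "f1 \<in> \<H>" "f2 \<in> \<H>" "f3 \<in> \<H>"
  let ?v = "pure K H X a x" and ?w = "pure K H Y b y"
  let ?I = "\<lambda>f1' f2' f3' p1 u. sw RXY (\<Delta> p1) (\<lambda>h1 h2. sw RXY (\<Delta> (f2' \<cdot> h2)) (\<lambda>q1 q2. sw3 RXY \<phi> (\<lambda>k1 k2 k3.
      XF f1 f2 f3 (f1' \<cdot> h1) (k1 \<cdot> q1) (S (k2 \<cdot> q2) \<cdot> \<alpha> \<cdot> k3 \<cdot> (f3' \<cdot> u)))))"
  have "sw3 RXY \<phi> (\<lambda>f1' f2' f3'. sw RXY pR (\<lambda>p1 p2. sw RXY (\<Delta> p1) (\<lambda>h1 h2.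
      sw RXY (Y.rcoact1 (Y.ract (f2' \<cdot> h2) ?w)) (\<lambda>n w0. QX f1 f2 f3 ?v (f1' \<cdot> h1) (n \<cdot> (f3' \<cdot> p2)) (adj_counit
          Y w0))))) =
    sw3 RXY \<phi> (\<lambda>f1' f2' f3'. sw RXY pR (?I f1' f2' f3'))" (is "?lhs = _")
  proof (intro sw3_cong[OF phi_closed] sw_cong[OF mH mH pR_closed] sw_cong[OF mH mH Delta_closed]; assumption?)
    fix f1' f2' f3' p1 p2 h1 h2
    assume c: "f1' \<in> \<H>" "f2' \<in> \<H>" "f3' \<in> \<H>" "p1 \<in> \<H>" "p2 \<in> \<H>"
      "h1 \<in> \<H>" "h2 \<in> \<H>"
    have B: "bilin K H Y RXY (\<lambda>n w0. QX f1 f2 f3 ?v (f1' \<cdot> h1) (n \<cdot> (f3' \<cdot> p2)) w0)"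
      by (intro lin_QX pair_lin pair_closed f c pure_RX; assumption)
    show "sw RXY (Y.rcoact1 (Y.ract (f2' \<cdot> h2) ?w)) (\<lambda>n w0. QX f1 f2 f3 ?v (f1' \<cdot> h1) (n \<cdot> (f3' \<cdot> p2))
        (adj_counit Y w0)) =
      sw RXY (\<Delta> (f2' \<cdot> h2)) (\<lambda>q1 q2. sw3 RXY \<phi> (\<lambda>k1 k2 k3.
        XF f1 f2 f3 (f1' \<cdot> h1) (k1 \<cdot> q1) (S (k2 \<cdot> q2) \<cdot> \<alpha> \<cdot> k3 \<cdot> (f3' \<cdot> p2))))"
      unfolding coact1_counit_Y[OF B m_closed[OF c(2,7)] b y] XF_def
      by (intro sw_cong[OF mH mH Delta_closed] sw3_cong[OF phi_closed] m_closed c; assumption?)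
        (simp add: c b alpha_closed m_assoc)
  qed
  \<comment> \<open>Opening \<open>pR\<close> supplies the factor with \<beta> and
    \<open>S g3\<close> that closes the zigzag of \<open>inner_sum\<close>.\<close>
  also have "\<dots> = sw3 RXY \<phi> (\<lambda>f1' f2' f3'. sw3 RXY \<phi>inv (\<lambda>g1 g2 g3. ?I f1' f2' f3' g1 (g2 \<cdot> \<beta> \<cdot> S g3)))"
    by (intro sw3_cong[OF phi_closed] sw_pR[OF pair_modules(2)])
      (intro lin_XF linear_map_closed[OF lin_XF(1)[OF _ _ _ linear_map_id]] pair_lin pair_closed f; assumption)
  also have "\<dots> = sw3 RXY \<phi> (\<lambda>f1' f2' f3'. sw3 RXY \<phi>inv (\<lambda>g1 g2 g3. sw RXY (\<Delta> g1) (\<lambda>h1 h2. sw RXY (\<Delta> (f2' \<cdot> h2))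
      (\<lambda>q1 q2.
      sw3 RXY \<phi> (\<lambda>k1 k2 k3. XF f1 f2 f3 (f1' \<cdot> h1) (k1 \<cdot> q1) (S (k2 \<cdot> q2) \<cdot> \<alpha> \<cdot> (k3 \<cdot> f3' \<cdot> g2) \<cdot> \<beta> \<cdot> S g3))))))"
    by (intro sw3_cong[OF phi_closed] sw3_cong[OF phi_inv_closed] sw_cong[OF mH mH Delta_closed] m_closed;
        assumption?)
      (simp add: alpha_closed beta_closed m_assoc)
  \<comment> \<open>Three copies shrink to one: \<phi> from the tensor coaction, the inverse from
    \<open>pR\<close> and the \<phi> of the second coaction leave a single inverse.\<close>
  also have "\<dots> = sw3 RXY \<phi>inv (\<lambda>a b c. XF f1 f2 f3 a b (S c))"
    by (rule T.inner_sum) (intro lin_XF linear_map_id f mH; assumption)+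
  also have "\<dots> = sw3 RXY \<phi>inv (\<lambda>a b c. sw RXY (\<Delta> b) (\<lambda>s1 s2. sw3 RXY \<phi>inv (\<lambda>g1 g2 g3. sw RXY (\<Delta> (g1 \<cdot> a)) (\<lambda>p1 p2.
      sw3 RXY \<phi> (\<lambda>k1 k2 k3. TF f1 f2 f3 (k1 \<cdot> p1) (S (k2 \<cdot> p2) \<cdot> \<alpha> \<cdot> (k3 \<cdot> (g2 \<cdot> s1))) (g3 \<cdot> s2) (S c))))))"
    by (intro sw3_cong[OF phi_inv_closed] XF_eq f S_closed)
  \<comment> \<open>Here the number of copies grows from three to four. The indices \<open>g\<close>
    and \<open>h\<close> of the final formula, and its second \<phi>, originate in this step; the
    copy \<open>k\<close> becomes \<open>qR\<close> later.\<close>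
  also have "\<dots> = sw3 RXY \<phi> (\<lambda>f1' f2' f3'. sw3 RXY \<phi>inv (\<lambda>g1 g2 g3. sw3 RXY \<phi>inv (\<lambda>h1 h2 h3.
      sw RXY (\<Delta> h3) (\<lambda>h31 h32. sw RXY (\<Delta> h1) (\<lambda>h11 h12. sw3 RXY \<phi> (\<lambda>k1 k2 k3.
        TF f1 f2 f3 (g1 \<cdot> (k1 \<cdot> h11)) (S (k2 \<cdot> h12) \<cdot> \<alpha> \<cdot> (k3 \<cdot> h2 \<cdot> f1')) (g2 \<cdot> h31 \<cdot> f2') (S (g3 \<cdot> h32 \<cdot>
            f3'))))))))" (is "_ = ?rhs")
    by (rule T.outer_sum) (intro lin_TF linear_map_id f mH; assumption)+
  finally show "?lhs = ?rhs" .
qed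

text \<open>The copy \<open>k1\<close>, \<open>k2\<close>, \<open>k3\<close> is folded into
  \<open>qR\<close> by reading \<open>sw_qR\<close> backwards, and the coproduct of a threefold
  product inside \<open>TF\<close> is opened into three sums.\<close>

lemma R2_pure:
  "R2 X Y (pure K X.RX Y.RX (pure K H X a x) (pure K H Y b y)) =
    sw3 RXY \<phi> (\<lambda>f1 f2 f3. sw3 RXY \<phi> (\<lambda>f1' f2' f3'. sw3 RXY \<phi>inv (\<lambda>g1 g2 g3. sw3 RXY \<phi>inv (\<lambda>h1 h2 h3.
      sw RXY qR (\<lambda>q1 q2. sw RXY (\<Delta> g1) (\<lambda>g11 g12. sw RXY (\<Delta> q1) (\<lambda>q11 q12. sw RXY (\<Delta> h1) (\<lambda>h11 h12.
        sw RXY (\<Delta> h11) (\<lambda>h111 h112. sw RXY (\<Delta> h3) (\<lambda>h31 h32.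
          pure K H XY (f1 \<cdot> g11 \<cdot> q11 \<cdot> h111 \<cdot> a \<cdot> S (q2 \<cdot> h12) \<cdot> h2 \<cdot> f1' \<cdot> b \<cdot> S (g3 \<cdot> h32 \<cdot> f3'))
            (pure K X Y ((f2 \<cdot> g12 \<cdot> q12 \<cdot> h112) \<rhd>\<^bsub>X\<^esub> x) ((f3 \<cdot> g2 \<cdot> h31 \<cdot> f2') \<rhd>\<^bsub>Y\<^esub> y))))))))))))"
  unfolding R2_pure_TF
proof (intro sw3_cong[OF phi_closed] sw3_cong[OF phi_inv_closed])
  fix f1 f2 f3 f1' f2' f3' g1 g2 g3 h1 h2 h3
  assume f: "f1 \<in> \<H>" "f2 \<in> \<H>" "f3 \<in> \<H>" "f1' \<in> \<H>" "f2' \<in> \<H>" "f3' \<in> \<H>"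
    "g1 \<in> \<H>" "g2 \<in> \<H>" "g3 \<in> \<H>" "h1 \<in> \<H>" "h2 \<in> \<H>" "h3 \<in> \<H>"
  let ?N = "\<lambda>h31 h32 h12 q2 g11 g12 q11 q12 h111 h112.
      pure K H XY (f1 \<cdot> g11 \<cdot> q11 \<cdot> h111 \<cdot> a \<cdot> S (q2 \<cdot> h12) \<cdot> h2 \<cdot> f1' \<cdot> b \<cdot> S (g3 \<cdot> h32 \<cdot> f3'))
            (pure K X Y ((f2 \<cdot> g12 \<cdot> q12 \<cdot> h112) \<rhd>\<^bsub>X\<^esub> x) ((f3 \<cdot> g2 \<cdot> h31 \<cdot> f2') \<rhd>\<^bsub>Y\<^esub> y))"
  have "sw RXY (\<Delta> h3) (\<lambda>h31 h32. sw RXY (\<Delta> h1) (\<lambda>h11 h12. sw3 RXY \<phi> (\<lambda>k1 k2 k3.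
      TF f1 f2 f3 (g1 \<cdot> (k1 \<cdot> h11)) (S (k2 \<cdot> h12) \<cdot> \<alpha> \<cdot> (k3 \<cdot> h2 \<cdot> f1')) (g2 \<cdot> h31 \<cdot> f2') (S (g3 \<cdot> h32 \<cdot> f3'))))) =
    sw RXY (\<Delta> h3) (\<lambda>h31 h32. sw RXY (\<Delta> h1) (\<lambda>h11 h12. sw RXY qR (\<lambda>q1 q2. sw RXY (\<Delta> g1) (\<lambda>g11 g12. sw RXY (\<Delta> q1)
        (\<lambda>q11 q12.
      sw RXY (\<Delta> h11) (?N h31 h32 h12 q2 g11 g12 q11 q12))))))" (is "?lhs = _")
  proof (intro sw_cong[OF mH mH Delta_closed] f; assumption?)
    fix h31 h32 h11 h12
    assume c: "h31 \<in> \<H>" "h32 \<in> \<H>" "h11 \<in> \<H>" "h12 \<in> \<H>"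
    let ?T = "\<lambda>k u. TF f1 f2 f3 (g1 \<cdot> (k \<cdot> h11)) (S h12 \<cdot> u \<cdot> (h2 \<cdot> f1')) (g2 \<cdot> h31 \<cdot> f2') (S (g3 \<cdot> h32 \<cdot> f3'))"
    have T: "bilin K H H RXY ?T"
      by (intro lin_TF pair_lin pair_closed f c; assumption)
    have "sw3 RXY \<phi> (\<lambda>k1 k2 k3. TF f1 f2 f3 (g1 \<cdot> (k1 \<cdot> h11)) (S (k2 \<cdot> h12) \<cdot> \<alpha> \<cdot> (k3 \<cdot> h2 \<cdot> f1')) (g2 \<cdot> h31 \<cdot> f2')
        (S (g3 \<cdot> h32 \<cdot> f3'))) = sw3 RXY \<phi> (\<lambda>k1 k2 k3. ?T k1 (S k2 \<cdot> \<alpha> \<cdot> k3))" (is "?lhs = _")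
      by (rule sw3_cong[OF phi_closed]) (simp add: f c alpha_closed S_mult m_assoc)
    also have "\<dots> = sw RXY qR (\<lambda>q1 q2. ?T q1 (S q2))" by (rule sw_qR[OF pair_modules(2) T, symmetric])
    also have "\<dots> = sw RXY qR (\<lambda>q1 q2. sw RXY (\<Delta> g1) (\<lambda>g11 g12. sw RXY (\<Delta> q1) (\<lambda>q11 q12.
      sw RXY (\<Delta> h11) (?N h31 h32 h12 q2 g11 g12 q11 q12))))"
    proof (rule sw_cong[OF mH mH qR_closed])
      fix q1 q2 assume q: "q1 \<in> \<H>" "q2 \<in> \<H>"
      let ?G = "\<lambda>c d. pure K H XY (f1 \<cdot> c \<cdot> a \<cdot> (S h12 \<cdot> S q2 \<cdot> (h2 \<cdot> f1')) \<cdot> b \<cdot> S (g3 \<cdot> h32 \<cdot> f3'))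
          (pure K X Y ((f2 \<cdot> d) \<rhd>\<^bsub>X\<^esub> x) ((f3 \<cdot> (g2 \<cdot> h31 \<cdot> f2')) \<rhd>\<^bsub>Y\<^esub> y))"
      have "?T q1 (S q2) = sw RXY (\<Delta> g1) (\<lambda>g11 g12. sw RXY (\<Delta> (q1 \<cdot> h11)) (\<lambda>c d. ?G (g11 \<cdot> c) (g12 \<cdot> d)))"
        unfolding TF_def Delta_mult[OF f(7) m_closed[OF q(1) c(3)]]
        by (rule H2.sw_mult[OF pair_modules(2) _ Delta_closed Delta_closed]) 
          ((intro pair_lin pair_closed f c q a b x y)?; assumption?)+
      also have "\<dots> = sw RXY (\<Delta> g1) (\<lambda>g11 g12. sw RXY (\<Delta> q1) (\<lambda>q11 q12. sw RXY (\<Delta> h11) (\<lambda>h111 h112.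
          ?G (g11 \<cdot> (q11 \<cdot> h111)) (g12 \<cdot> (q12 \<cdot> h112)))))"
        unfolding Delta_mult[OF q(1) c(3)]
        by (intro sw_cong[OF mH mH Delta_closed[OF f(7)]] H2.sw_mult[OF pair_modules(2) _ Delta_closed Delta_closed])
          ((intro pair_lin pair_closed f c q a b x y)?; assumption?)+
      also have "\<dots> = sw RXY (\<Delta> g1) (\<lambda>g11 g12. sw RXY (\<Delta> q1) (\<lambda>q11 q12.
          sw RXY (\<Delta> h11) (?N h31 h32 h12 q2 g11 g12 q11 q12)))" (is "_ = ?rhs")
        by (intro sw_cong[OF mH mH Delta_closed] f c q) (simp add: f c q a b x y S_mult m_assoc)
      finally show "?T q1 (S q2) = ?rhs" .
    qed
    finally show "?lhs = sw RXY qR (\<lambda>q1 q2. sw RXY (\<Delta> g1) (\<lambda>g11 g12. sw RXY (\<Delta> q1) (\<lambda>q11 q12.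
      sw RXY (\<Delta> h11) (?N h31 h32 h12 q2 g11 g12 q11 q12))))" .
  qed
  also have "\<dots> = sw RXY qR (\<lambda>q1 q2. sw RXY (\<Delta> g1) (\<lambda>g11 g12. sw RXY (\<Delta> q1) (\<lambda>q11 q12. sw RXY (\<Delta> h1) (\<lambda>h11 h12.
        sw RXY (\<Delta> h11) (\<lambda>h111 h112. sw RXY (\<Delta> h3) (\<lambda>h31 h32. ?N h31 h32 h12 q2 g11 g12 q11 q12 h111 h112))))))"
            (is "_ = ?rhs")
    by (rule T.sw_reorder[OF f(12,10) qR_closed f(7)]) (intro pair_closed f a b x y; assumption)
  finally show "?lhs = ?rhs" .
qed

lemma R2_formula:
  "R2 X Y (pure K (R_obj X) (R_obj Y) (pure K H X a x) (pure K H Y b y)) =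
    tens K H (hm_tensor X Y)
      [(f1 \<cdot> g11 \<cdot> q11 \<cdot> h111 \<cdot> a \<cdot> S (q2 \<cdot> h12) \<cdot> h2 \<cdot> f1' \<cdot> b \<cdot> S (g3 \<cdot> h32 \<cdot> f3'),
        pure K X Y ((f2 \<cdot> g12 \<cdot> q12 \<cdot> h112) \<rhd>\<^bsub>X\<^esub> x) ((f3 \<cdot> g2 \<cdot> h31 \<cdot> f2') \<rhd>\<^bsub>Y\<^esub> y)).
        (f1, f2, f3) \<leftarrow> terms3 \<phi>, (f1', f2', f3') \<leftarrow> terms3 \<phi>, (g1, g2, g3) \<leftarrow> terms3 \<phi>inv, (h1, h2, h3) \<leftarrow> terms3 \<phi>inv,
        (q1, q2) \<leftarrow> terms qR, (g11, g12) \<leftarrow> terms (\<Delta> g1), (q11, q12) \<leftarrow> terms (\<Delta> q1), (h11, h12) \<leftarrow> terms (\<Delta> h1),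
        (h111, h112) \<leftarrow> terms (\<Delta> h11), (h31, h32) \<leftarrow> terms (\<Delta> h3)]"
  unfolding tens_simps R2_pure
  by (rule HOL.sym) (intro pair_reps pair_closed qR_closed a b x y; assumption)

end

end

section \<open>The unit constraint of the monoidal structure\<close>

context quasi_hopf
begin

text \<open>The first kind coaction on the unit object is trivial, so only \<open>pR\<close>
  remains, with its first leg turned into a scalar by \<epsilon>. The counit of the inverse
  associator in that leg reduces the sum to \<beta>.\<close>

lemma R0_eq:
  assumes c: "c \<in> carrier K"
  shows "R0 c = pure K H hm_unit \<beta> c"
proof -
  let ?T = "tensor K H (base_field K)"
  interpret T: quasi_hopf_val K H ?T
    by (intro quasi_hopf_val.intro quasi_hopf_axioms tensor_module mH mK)
  note ts = tens_same[OF same_module_refl hm_unit_simps(1)]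
  have pc: "pure K H (base_field K) h d \<in> carrier ?T" if "h \<in> \<H>" "d \<in> carrier K" for h d
    using that by (simp add: pure_closed)
  have lin1: "linear_map K H ?T (\<lambda>u. pure K H (base_field K) (f u) d)" if "linear_map K H H f" "d \<in> carrier K" for f d
    using that by (intro lin_pure_left[OF mH mK]) simp_all
  have lin2: "linear_map K H ?T (\<lambda>u. pure K H (base_field K) h (\<epsilon> u \<otimes>\<^bsub>K\<^esub> c))" if "h \<in> \<H>" for h
  proof (rule lin_pure_right[OF mH mK _ that])
    have "linear_map K H (base_field K) (\<lambda>u. c \<otimes>\<^bsub>K\<^esub> \<epsilon> u)"
      by (rule linear_map_scalar_mult[OF is_cring eps_lin c])
    then show "linear_map K H (base_field K) (\<lambda>u. \<epsilon> u \<otimes>\<^bsub>K\<^esub> c)"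
      by (rule linear_map_cong[OF _ mH]) (simp add: m_comm c)
  qed
  have "R0 c = sw ?T pR (\<lambda>p1 p2. sw ?T (pure K H (base_field K) \<one>\<^sub>H (\<epsilon> p1 \<otimes>\<^bsub>K\<^esub> c)) (\<lambda>m d. pure K H (base_field
      K) (m \<cdot> p2) d))"
    unfolding R0_def adj_unit_def yd_unit_def yd_of_coact1_simps coact2_of_coact1_def hm_unit_simps(2) ts
    by (intro represents_tens represents_bind[OF _ _ mH mH] represents_map[OF _ _ mH mK] pR_closed mH mK
        pure_closed m_closed
        one_closed) (simp_all add: c)
  also have "\<dots> = sw ?T pR (\<lambda>p1 p2. pure K H (base_field K) p2 (\<epsilon> p1 \<otimes>\<^bsub>K\<^esub> c))"
  proof (rule sw_cong[OF mH mH pR_closed])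
    fix p1 p2 assume p: "p1 \<in> \<H>" "p2 \<in> \<H>"
    have "bilin K H (base_field K) ?T (\<lambda>m d. pure K H (base_field K) (m \<cdot> p2) d)"
      by (intro bilinI lin_pure_right[OF mH mK] lin1 lin_mult_left linear_map_id m_closed p) (simp_all add: p
          lin1 lin_mult_left linear_map_id)
    from sw_pure[OF mH mK T.mZ this, of "\<one>\<^sub>H" "\<epsilon> p1 \<otimes>\<^bsub>K\<^esub> c"]
    show "sw ?T (pure K H (base_field K) \<one>\<^sub>H (\<epsilon> p1 \<otimes>\<^bsub>K\<^esub> c)) (\<lambda>m d. pure K H (base_field K) (m \<cdot> p2) d) =
      pure K H (base_field K) p2 (\<epsilon> p1 \<otimes>\<^bsub>K\<^esub> c)" using p c by simp
  qed
  also have "\<dots> = sw3 ?T \<phi>inv (\<lambda>p q r. pure K H (base_field K) (q \<cdot> \<beta> \<cdot> S r) (\<epsilon> p \<otimes>\<^bsub>K\<^esub> c))"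
    by (intro sw_pR[OF T.mZ] bilinI lin2 lin1 linear_map_id) (simp_all add: c)
  also have "\<dots> = pure K H (base_field K) \<beta> c"
  proof -
    let ?C = "\<lambda>x. pure K H (base_field K) (x (Suc 0) \<cdot> \<beta> \<cdot> S (x 2)) (\<epsilon> (x 0) \<otimes>\<^bsub>K\<^esub> c)"
    have "T.mlinn 3 ?C"
      by (rule T.mlinn3; (intro pc lin2 lin1 lin_mult_left lin_mult_right S_lin linear_map_id)?; simp add: c
          beta_closed)
    from T.sw3_counit(2)[OF this] show ?thesis
      using c by (simp add: beta_closed cong: sw3_cong[OF phi_inv_closed])
  qed
  finally show ?thesis unfolding ts .
qed

lemma R0_linear: "linear_map K yd_unit (R_obj hm_unit) R0"
proof -
  have "same_module yd_unit (base_field K)"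
    unfolding yd_unit_def by (rule same_module_trans[OF yd_of_coact1_simps(1) hm_unit_simps(1)])
  moreover have "same_module (R_obj hm_unit) (tensor K H (base_field K))"
    by (rule same_module_trans[OF R_obj_simps(1) tensor_same[OF same_module_refl hm_unit_simps(1)]])
  moreover have "linear_map K (base_field K) (tensor K H (base_field K)) R0"
    by (rule linear_map_cong[OF lin_pure_right[OF mH mK linear_map_id beta_closed] mK])
      (simp add: R0_eq tens_same[OF same_module_refl hm_unit_simps(1)])
  ultimately show ?thesis using linear_map_same by blast
qed

end

theorem lemma5p4:
  fixes K :: "'k ring" and H :: "('k, 'h) quasi_hopf"
    and X :: "('k, 'h, 'x) hmodule" and Y :: "('k, 'h, 'y) hmodule"
  assumes "quasi_hopf K H"
    and "bij_betw (antipode H) (carrier H) (carrier H)"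
    and "hmodule K H X" and "hmodule K H Y"
  shows
    "linear_map K (quasi_hopf_sig.yd_unit K H)
        (quasi_hopf_sig.R_obj K H (quasi_hopf_sig.hm_unit K H)) (quasi_hopf_sig.R0 K H) \<and>
     quasi_hopf_sig.R0 K H \<one>\<^bsub>K\<^esub> = pure K H (quasi_hopf_sig.hm_unit K H) (beta H) \<one>\<^bsub>K\<^esub> \<and>
     linear_map K
        (quasi_hopf_sig.yd_tensor K H (quasi_hopf_sig.R_obj K H X) (quasi_hopf_sig.R_obj K H Y))
        (quasi_hopf_sig.R_obj K H (quasi_hopf_sig.hm_tensor K H X Y))
        (quasi_hopf_sig.R2 K H X Y) \<and>
     (\<forall>a\<in>carrier H. \<forall>b\<in>carrier H. \<forall>x\<in>carrier X. \<forall>y\<in>carrier Y.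
        quasi_hopf_sig.R2 K H X Y
          (pure K (quasi_hopf_sig.R_obj K H X) (quasi_hopf_sig.R_obj K H Y)
            (pure K H X a x) (pure K H Y b y)) =
        tens K H (quasi_hopf_sig.hm_tensor K H X Y)
          [(f1 \<otimes>\<^bsub>H\<^esub> g11 \<otimes>\<^bsub>H\<^esub> q11 \<otimes>\<^bsub>H\<^esub> g1'11 \<otimes>\<^bsub>H\<^esub> a \<otimes>\<^bsub>H\<^esub> antipode H (q2 \<otimes>\<^bsub>H\<^esub> g1'2) \<otimes>\<^bsub>H\<^esub> g2' \<otimes>\<^bsub>H\<^esub> f1' \<otimes>\<^bsub>H\<^esub> b
              \<otimes>\<^bsub>H\<^esub> antipode H (g3 \<otimes>\<^bsub>H\<^esub> g3'2 \<otimes>\<^bsub>H\<^esub> f3'),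
            pure K X Y
              ((f2 \<otimes>\<^bsub>H\<^esub> g12 \<otimes>\<^bsub>H\<^esub> q12 \<otimes>\<^bsub>H\<^esub> g1'12) \<rhd>\<^bsub>X\<^esub> x)
              ((f3 \<otimes>\<^bsub>H\<^esub> g2 \<otimes>\<^bsub>H\<^esub> g3'1 \<otimes>\<^bsub>H\<^esub> f2') \<rhd>\<^bsub>Y\<^esub> y)).
            (f1, f2, f3) \<leftarrow> terms3 (associator H),
            (f1', f2', f3') \<leftarrow> terms3 (associator H),
            (g1, g2, g3) \<leftarrow> terms3 (quasi_hopf_sig.phi_inv K H),
            (g1', g2', g3') \<leftarrow> terms3 (quasi_hopf_sig.phi_inv K H),
            (q1, q2) \<leftarrow> terms (quasi_hopf_sig.qR K H),
            (g11, g12) \<leftarrow> terms (comult H g1),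
            (q11, q12) \<leftarrow> terms (comult H q1),
            (g1'1, g1'2) \<leftarrow> terms (comult H g1'),
            (g1'11, g1'12) \<leftarrow> terms (comult H g1'1),
            (g3'1, g3'2) \<leftarrow> terms (comult H g3')])"
proof -
  interpret quasi_hopf_module_pair K H X Y
    using assms by (intro quasi_hopf_module_pair.intro quasi_hopf_module.intro quasi_hopf_bij.intro
      quasi_hopf_bij_axioms.intro)
  have "\<one>\<^bsub>K\<^esub> \<in> carrier K" using eps_closed[OF one_closed] by simp
  then show ?thesis
    by (intro conjI ballI R0_linear R0_eq R2_linear R2_formula)
qed

end
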